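(* Fix $q\in [0,1)$, $d\geq 1$, $n_1,\ldots,n_d\geq 1$, and consider $d$ sequences $\{f_k^1\}_{k\geq 1}\subset L^2(\mathbb{R}_+^{n_1}),\ldots, \{f_k^d\}_{k\geq 1}\subset L^2(\mathbb{R}_+^{n_d})$ of symmetric functions. Assume that $\lim_{k\to\infty}\langle f^i_k,f^j_k\rangle_q = c(i,j)$ for all $i,j\in\{1,\ldots,d\}$. Then the following four assertions are equivalent as $k\to\infty$: (i) for every $i\in \{1,\ldots,d\}$, $\varphi_q\big( I_{n_i}^{X^{(q)}}(f_k^i)^4 \big) \to (2+q^{n_i^2})\, c(i,i)^2$; (ii) for every $i\in \{1,\ldots,d\}$ and every $p\in \{1,\ldots,n_i-1\}$, $\|f^i_k \frown_p f^i_k\|_{L^2(\mathbb{R}_+^{2n_i-2p})} \to 0$; (iii) for every $i\in \{1,\ldots,d\}$, $I_{n_i}^{X^{(q)}}(f_k^i)$ converges in law to $\mathcal{G}_{q^{n_i^2}}(0,c(i,i))$; (iv) for every $r\geq 1$ and every $i_1,\ldots,i_r \in \{1,\ldots,d\}$, \[ \varphi_q\big( I_{n_{i_1}}^{X^{(q)}}(f_k^{i_1})\cdots I_{n_{i_r}}^{X^{(q)}}(f_k^{i_r}) \big) \to \sum_{\pi \in C_2^{col}(n_{i_1},\ldots,n_{i_r})} \prod_{1\leq i\leq j\leq K} q^{\mathrm{Cr}(\pi_i,\pi_j)N_iN_j} \prod_{\{l,m\}\in \pi} c(i_l,i_m), \] where $N_1<\dots<N_K$ are the distinct values among $n_{i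_1},\ldots,n_{i_r}$.
   Context: Convention $0^0=1$. $\mathrm{inv}(\sigma)=\mathrm{Card}\{i<j:\sigma(i)>\sigma(j)\}$ for $\sigma\in\mathfrak{S}_n$; $\langle f,g\rangle_q=\sum_{\sigma\in\mathfrak{S}_n}q^{\mathrm{inv}(\sigma)}\int_{\mathbb{R}_+^n}f(t_{\sigma(1)},\dots,t_{\sigma(n)})g(t_1,\dots,t_n)\,dt$ for $f,g\in L^2(\mathbb{R}_+^n)$. Contraction: for $f\in L^2(\mathbb{R}_+^n)$, $g\in L^2(\mathbb{R}_+^m)$, $f\frown_p g(t_1,\dots,t_{n+m-2p})=\int_{\mathbb{R}_+^p}f(t_1,\dots,t_{n-p},s_p,\dots,s_1)g(s_1,\dots,s_p,t_{n-p+1},\dots,t_{n+m-2p})\,ds$. Pairings: a crossing in a pairing $\pi$ of $\{1,\dots,r\}$ is a pair of blocks $\{x_1,y_1\},\{x_2,y_2\}$ with $x_1<x_2<y_1<y_2$; $\mathcal{P}_2(\{1,\dots,r\})$ is the set of pairings. $C_2^{col}(n_{i_1},\dots,n_{i_r})$ is the set of $\pi\in\mathcal{P}_2(\{1,\dots,r\})$ such that $n_{i_l}=n_{i_m}$ for every $\{l,m\}\in\pi$; for such $\pi$, $\pi_t:=\{\{l,m\}\in\pi: n_{i_l}=n_{i_m}=N_t\}$, and for subsets $\pi',\pi''\subset\pi$, $\mathrm{Cr}(\pi',\pi'')$ is the number of crossings of $\pi$ formed by a pair of $\pi'$ and a pair of $\pi''$ (for $\pi'=\pi''$, the number of crossings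 between two pairs of $\pi'$). $(\mathcal{A}_q,\varphi_q)$ is a $W^*$-probability space (von Neumann algebra with weakly continuous, positive, faithful, tracial unital linear functional) carrying a $q$-Brownian motion $X^{(q)}$: self-adjoint $X^{(q)}_t$ with $\varphi_q(X^{(q)}_{t_1}\cdots X^{(q)}_{t_r})=\sum_{\pi\in\mathcal{P}_2(\{1,\dots,r\})}q^{\mathrm{Cr}(\pi)}\prod_{\{i,j\}\in\pi}(t_i\wedge t_j)$. Multiple integrals: $I_n^{X^{(q)}}(\mathbf{1}_{(a_1,b_1)}\otimes\cdots\otimes\mathbf{1}_{(a_n,b_n)})=(X^{(q)}_{b_1}-X^{(q)}_{a_1})\cdots(X^{(q)}_{b_n}-X^{(q)}_{a_n})$ for pairwise disjoint intervals, extended linearly and by continuity to $L^2(\mathbb{R}_+^n)$ via the isometry $\varphi_q(I_n^{X^{(q)}}(f)^*I_m^{X^{(q)}}(g))=\delta_{m,n}\langle f,g\rangle_q$. Convergence in law means convergence of all moments; $\mathcal{G}_{q'}(0,t)$, $q'\in(-1,1)$, is the compactly supported probability measure with vanishing odd moments and $2k$-th moment $t^k\sum_{\pi\in\mathcal{P}_2(\{1,\dots,2k\})}q'^{\mathrm{Cr}(\pi)}$. *)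

theory Defs
  imports "HOL-Analysis.Analysis"
begin

text \<open>R_+^n, with coordinates indexed 0..n-1 (the paper's t_1..t_n).\<close>
definition Mn :: "nat \<Rightarrow> (nat \<Rightarrow> real) measure" where
  "Mn n = PiM {..<n} (\<lambda>_. restrict_space lborel {0::real..})"

definition L2 :: "nat \<Rightarrow> ((nat \<Rightarrow> real) \<Rightarrow> real) \<Rightarrow> bool" where
  "L2 n f \<longleftrightarrow> f \<in> borel_measurable (Mn n) \<and> integrable (Mn n) (\<lambda>x. (f x)^2)"

definition L2norm :: "nat \<Rightarrow> ((nat \<Rightarrow> real) \<Rightarrow> real) \<Rightarrow> real" where
  "L2norm n f = sqrt (\<integral>x. (f x)^2 \<partial>Mn n)"

definition permarg :: "nat \<Rightarrow> (nat \<Rightarrow> nat) \<Rightarrow> (nat \<Rightarrow> real) \<Rightarrow> (nat \<Rightarrow> real)" where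
  "permarg n \<sigma> x = restrict (\<lambda>i. x (\<sigma> i)) {..<n}"

definition symmetric_fun :: "nat \<Rightarrow> ((nat \<Rightarrow> real) \<Rightarrow> real) \<Rightarrow> bool" where
  "symmetric_fun n f \<longleftrightarrow>
     (\<forall>\<sigma>. \<sigma> permutes {..<n} \<longrightarrow> (AE x in Mn n. f (permarg n \<sigma> x) = f x))"

definition inversions :: "nat \<Rightarrow> (nat \<Rightarrow> nat) \<Rightarrow> nat" where
  "inversions n \<sigma> = card {(i, j). i < j \<and> j < n \<and> \<sigma> j < \<sigma> i}"

definition qip :: "real \<Rightarrow> nat \<Rightarrow> ((nat \<Rightarrow> real) \<Rightarrow> real) \<Rightarrow> ((nat \<Rightarrow> real) \<Rightarrow> real) \<Rightarrow> real" where
  "qip q n f g = (\<Sum>\<sigma>\<in>{\<sigma>. \<sigma> permutes {..<n}}.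
      q ^ inversions n \<sigma> * (\<integral>x. f (permarg n \<sigma> x) * g x \<partial>Mn n))"

definition contraction :: "nat \<Rightarrow> nat \<Rightarrow> nat \<Rightarrow> ((nat \<Rightarrow> real) \<Rightarrow> real) \<Rightarrow> ((nat \<Rightarrow> real) \<Rightarrow> real)
     \<Rightarrow> ((nat \<Rightarrow> real) \<Rightarrow> real)" where
  "contraction n m p f g = (\<lambda>t. \<integral>s.
      f (restrict (\<lambda>i. if i < n - p then t i else s (n - 1 - i)) {..<n}) *
      g (restrict (\<lambda>i. if i < p then s i else t (n - p + (i - p))) {..<m}) \<partial>Mn p)"

definition pairings :: "nat \<Rightarrow> nat set set set" where
  "pairings r = {P. \<Union>P = {..<r} \<and> (\<forall>B\<in>P. card B = 2) \<and>
                     (\<forall>B\<in>P. \<forall>C\<in>P. B \<noteq> C \<longrightarrow> B \<inter> C = {})}"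

definition crosses :: "nat set \<Rightarrow> nat set \<Rightarrow> bool" where
  "crosses B C \<longleftrightarrow> (\<exists>x1 y1 x2 y2. B = {x1, y1} \<and> C = {x2, y2} \<and> x1 < x2 \<and> x2 < y1 \<and> y1 < y2)"

definition Cr :: "nat set set \<Rightarrow> nat" where
  "Cr P = card {(B, C). B \<in> P \<and> C \<in> P \<and> crosses B C}"

definition Cr2 :: "nat set set \<Rightarrow> nat set set \<Rightarrow> nat" where
  "Cr2 P1 P2 = card {(B, C). crosses B C \<and> ((B \<in> P1 \<and> C \<in> P2) \<or> (B \<in> P2 \<and> C \<in> P1))}"

definition col_pairings :: "nat \<Rightarrow> (nat \<Rightarrow> nat) \<Rightarrow> nat set set set" where
  "col_pairings r col = {P \<in> pairings r. \<forall>B\<in>P. \<forall>l\<in>B. \<forall>m\<in>B. col l = col m}"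

definition qgauss_moment :: "real \<Rightarrow> real \<Rightarrow> nat \<Rightarrow> real" where
  "qgauss_moment q' t m =
     (if odd m then 0 else t ^ (m div 2) * (\<Sum>P\<in>pairings m. q' ^ Cr P))"

text \<open>A (real-scalar view of a complex) Banach *-algebra with C*-identity, a central
  element J acting as the imaginary unit, a unital positive faithful tracial functional phi,
  a q-Brownian motion X, and the multiple integrals I_n characterized by linearity,
  their values on products of indicators of pairwise disjoint intervals, and the isometry.\<close>
definition qBM_setting ::
  "real \<Rightarrow> ('a::{real_normed_algebra_1,banach} \<Rightarrow> 'a) \<Rightarrow> 'a \<Rightarrow> ('a \<Rightarrow> complex) \<Rightarrow> (real \<Rightarrow> 'a)
     \<Rightarrow> (nat \<Rightarrow> ((nat \<Rightarrow> real) \<Rightarrow> real) \<Rightarrow> 'a) \<Rightarrow> bool" where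
  "qBM_setting q star J \<phi> X I \<longleftrightarrow>
    \<comment> \<open>involution and C*-identity\<close>
    (\<forall>x y. star (x + y) = star x + star y) \<and>
    (\<forall>r x. star (r *\<^sub>R x) = r *\<^sub>R star x) \<and>
    (\<forall>x y. star (x * y) = star y * star x) \<and>
    (\<forall>x. star (star x) = x) \<and>
    (\<forall>x. norm (star x * x) = (norm x)^2) \<and>
    \<comment> \<open>complex structure\<close>
    J * J = - 1 \<and> (\<forall>x. J * x = x * J) \<and> star J = - J \<and>
    \<comment> \<open>the state\<close>
    (\<forall>x y. \<phi> (x + y) = \<phi> x + \<phi> y) \<and>
    (\<forall>r x. \<phi> (r *\<^sub>R x) = complex_of_real r * \<phi> x) \<and>
    (\<forall>x. \<phi> (J * x) = \<i> * \<phi> x) \<and>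
    \<phi> 1 = 1 \<and>
    (\<forall>x. \<phi> (star x) = cnj (\<phi> x)) \<and>
    (\<forall>x. Im (\<phi> (star x * x)) = 0 \<and> Re (\<phi> (star x * x)) \<ge> 0) \<and>
    (\<forall>x. \<phi> (star x * x) = 0 \<longrightarrow> x = 0) \<and>
    (\<forall>x y. \<phi> (x * y) = \<phi> (y * x)) \<and>
    \<comment> \<open>q-Brownian motion\<close>
    (\<forall>t\<ge>0. star (X t) = X t) \<and>
    (\<forall>r (t::nat \<Rightarrow> real). (\<forall>i<r. t i \<ge> 0) \<longrightarrow>
        \<phi> (prod_list (map (\<lambda>i. X (t i)) [0..<r])) =
        complex_of_real (\<Sum>P\<in>pairings r. q ^ Cr P * (\<Prod>B\<in>P. min (t (Min B)) (t (Max B))))) \<and>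
    \<comment> \<open>multiple integrals\<close>
    (\<forall>n\<ge>1. \<forall>f g. L2 n f \<longrightarrow> L2 n g \<longrightarrow> I n (\<lambda>x. f x + g x) = I n f + I n g) \<and>
    (\<forall>n\<ge>1. \<forall>f c. L2 n f \<longrightarrow> I n (\<lambda>x. c * f x) = c *\<^sub>R I n f) \<and>
    (\<forall>n\<ge>1. \<forall>a b :: nat \<Rightarrow> real.
        (\<forall>i<n. 0 \<le> a i \<and> a i < b i) \<longrightarrow>
        (\<forall>i<n. \<forall>j<n. i \<noteq> j \<longrightarrow> {a i<..<b i} \<inter> {a j<..<b j} = {}) \<longrightarrow>
        I n (\<lambda>x. \<Prod>i<n. indicator {a i<..<b i} (x i)) =
          prod_list (map (\<lambda>i. X (b i) - X (a i)) [0..<n])) \<and>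
    (\<forall>n\<ge>1. \<forall>m\<ge>1. \<forall>f g. L2 n f \<longrightarrow> L2 m g \<longrightarrow>
        \<phi> (star (I n f) * I m g) = (if n = m then complex_of_real (qip q n f g) else 0))"

end

theory Submission
  imports Defs
begin

text \<open>
  A moment of multiple integrals is a sum of integrals attached to pairings of all the variables, no pair
  lying inside one block (the variables of one factor), with weight $q^{Cr}$. For disjoint boxes this is
  the moment formula for the increments; it extends to $L^2$ by density, because both sides are
  continuous: the pairing integrals are bounded by the product of the $L^2$ norms (Finner's inequality).

  (ii) implies (iv): if a pairing links some block to two different blocks, integrating out the variables
  shared by two linked blocks bounds its integral by a power of a contraction norm, so it vanishes in the
  limit. In the remaining pairings the blocks are paired as wholes, and the sum of $q^{Cr}$ over all ways
  to realise a given pairing of blocks turns the ordinary inner products into $\langle\cdot,\cdot\rangle_q$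
  and produces one factor $q^{nm}$ for each crossing of blocks of sizes $n$ and $m$.

  (i) implies (ii): let $T = I_n(f)^2$, $W = I_{2n}(f \otimes f)$ and $c = \langle f,f\rangle_q$. Positivity
  of $\varphi((T - c - W)^2)$ gives $\varphi(T^2) \ge c^2 + \varphi(W^2)$. The pairings contributing to
  $\varphi(W^2)$ have no pair between the first two blocks; those that pair whole blocks yield
  $(1 + q^{n^2}) c^2$, and all others link the four blocks in a cycle, so that their integral is the square
  of a contraction norm and, as $q \ge 0$, each of them contributes nonnegatively. For $q = 0$ the term for
  a given contraction is found directly among the noncrossing pairings of the diagram formula.
\<close>

subsection \<open>Products of half-lines and Finner's inequality\<close>

text \<open>The kernels are symmetric only almost everywhere, while contractions and pairing
  integrals evaluate them along reordered arguments. The work is done for representatives that are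
  symmetric at every point (\<open>psym\<close>): their value depends only on the set of variables
  fed in (\<open>ev\<close>). Averaging over all permutations supplies such a representative, and
  multiple integrals, inner products and contraction norms do not see the change.

  The sum of \<open>q ^ Cr\<close> over the bijections between two blocks (\<open>Kq\<close>, a
  q-factorial) is never evaluated: the inner product is itself the diagram formula for two blocks,
  so the constant cancels, and only \<open>1 <= Kq q n\<close> is used.

  Behind (i) implies (ii) stands one inequality: the fourth moment is at least (2 + q^(n^2)) c^2
  plus a positive weight times a squared contraction norm, the weight being \<open>q ^ Cr\<close> of
  one explicit pairing. In the argument with W every pair joins the first half of the points to the
  second; without crossings only the fully nested pairing is possible, and it joins whole blocks.
  The pairing that is wanted therefore has crossings and loses its weight at q = 0, which forces a
  separate choice there.\<close>

definition PM :: "'i set \<Rightarrow> ('i \<Rightarrow> real) measure" where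
  "PM V = PiM V (\<lambda>_. restrict_space lborel {0::real..})"

text \<open>\<open>PM\<close> admits arbitrary index sets because the variables of a pairing
  integral are indexed by its pairs, and those of one factor by some of the pairs; the half-line
  power of the setting is the case of an initial segment.\<close>

lemma Mn_eq_PM: "Mn n = PM {..<n}"
  by (simp add: Mn_def PM_def)

lemma sigma_finite_halfline: "sigma_finite_measure (restrict_space lborel {0::real..})"
  by (rule sigma_finite_measure_restrict_space) (auto intro: sigma_finite_lborel)

interpretation HL: product_sigma_finite "\<lambda>_::'i. restrict_space lborel {0::real..}"
  by standard (rule sigma_finite_measure.sigma_finite_countable[OF sigma_finite_halfline])

lemma sigma_finite_PM: "finite V \<Longrightarrow> sigma_finite_measure (PM V)"
  unfolding PM_def by (rule HL.sigma_finite)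

lemma space_PM: "space (PM V) = (\<Pi>\<^sub>E i\<in>V. {0..})"
  by (simp add: PM_def space_PiM space_restrict_space)

lemma measurable_PM_reindex:
  assumes "e \<in> T \<rightarrow> S"
  shows "(\<lambda>y. restrict (\<lambda>i. y (e i)) T) \<in> measurable (PM S) (PM T)"
  unfolding PM_def
  by (rule measurable_restrict) (use assms in \<open>auto intro!: measurable_component_singleton\<close>)

lemma measurable_PM_restrict: "T \<subseteq> S \<Longrightarrow> (\<lambda>y. restrict y T) \<in> measurable (PM S) (PM T)"
  unfolding PM_def by (rule measurable_restrict_subset)

text \<open>All factors of the product are equal, so names of coordinates do not matter. A product
  measure is determined by its rectangles, and the preimage of a rectangle is the rectangle
  relabelled by the inverse of \<open>e\<close>.\<close>

lemma distr_PM_reindex: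
  assumes e: "bij_betw e T S" and fin: "finite T"
  shows "distr (PM S) (PM T) (\<lambda>y. restrict (\<lambda>i. y (e i)) T) = PM T"
proof -
  let ?L = "restrict_space lborel {0::real..}"
  have eTS: "e \<in> T \<rightarrow> S" and inj: "inj_on e T" and S: "S = e ` T"
    using e by (auto simp: bij_betw_def)
  have finS: "finite S" using S fin by simp
  have m: "(\<lambda>y. restrict (\<lambda>i. y (e i)) T) \<in> measurable (PM S) (PM T)"
    by (rule measurable_PM_reindex[OF eTS])
  have "distr (PM S) (PM T) (\<lambda>y. restrict (\<lambda>i. y (e i)) T) = PiM T (\<lambda>_. ?L)"
  proof (rule HL.PiM_eqI[OF fin])
    show "sets (distr (PM S) (PM T) (\<lambda>y. restrict (\<lambda>i. y (e i)) T)) = sets (PiM T (\<lambda>_. ?L))"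
      by (simp add: PM_def)
    fix A assume A: "\<And>i. i \<in> T \<Longrightarrow> A i \<in> sets ?L"
    define g where "g = inv_into T e"
    have ge: "g (e i) = i" if "i \<in> T" for i using inj that by (simp add: g_def)
    have gS: "g j \<in> T" "e (g j) = j" if "j \<in> S" for j
      using that S by (auto simp: ge)
    have sub: "A i \<subseteq> {0..}" if "i \<in> T" for i
      using sets.sets_into_space[OF A[OF that]] by (simp add: space_restrict_space)
    have AP: "(Pi\<^sub>E T A) \<in> sets (PM T)"
      unfolding PM_def using A fin by (intro sets_PiM_I_finite) auto
    have pre: "(\<lambda>y. restrict (\<lambda>i. y (e i)) T) -` (Pi\<^sub>E T A) \<inter> space (PM S)
        = Pi\<^sub>E S (\<lambda>j. A (g j))" (is "?l = ?r")
    proof (intro set_eqI iffI)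
      fix y assume y: "y \<in> ?l"
      then have "y \<in> extensional S" and yA: "\<And>i. i \<in> T \<Longrightarrow> y (e i) \<in> A i"
        by (auto simp: space_PM PiE_def Pi_def)
      moreover have "y j \<in> A (g j)" if "j \<in> S" for j
        using yA[OF gS(1)[OF that]] gS(2)[OF that] by simp
      ultimately show "y \<in> ?r" by (auto simp: PiE_def)
    next
      fix y assume y: "y \<in> ?r"
      then have "y (e i) \<in> A i" if "i \<in> T" for i
        using y that eTS ge[OF that] by (auto simp: PiE_def Pi_def)
      moreover have "y j \<in> {0..}" if "j \<in> S" for j
        using y that sub[OF gS(1)[OF that]] by (auto simp: PiE_def Pi_def)
      ultimately show "y \<in> ?l" using y by (auto simp: space_PM PiE_def Pi_def)
    qed
    have "emeasure (distr (PM S) (PM T) (\<lambda>y. restrict (\<lambda>i. y (e i)) T)) (Pi\<^sub>E T A)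
       = emeasure (PM S) (Pi\<^sub>E S (\<lambda>j. A (g j)))"
      by (subst emeasure_distr[OF m AP]) (simp add: pre)
    also have "\<dots> = (\<Prod>j\<in>S. emeasure ?L (A (g j)))"
      unfolding PM_def using A gS finS by (intro HL.emeasure_PiM) auto
    also have "\<dots> = (\<Prod>i\<in>T. emeasure ?L (A i))"
      using inj ge by (simp add: S prod.reindex)
    finally show "emeasure (distr (PM S) (PM T) (\<lambda>y. restrict (\<lambda>i. y (e i)) T)) (Pi\<^sub>E T A)
      = (\<Prod>i\<in>T. emeasure ?L (A i))" .
  qed
  then show ?thesis by (simp add: PM_def)
qed

lemma nn_integral_PM_reindex:
  assumes "bij_betw e T S" "finite T" and [measurable]: "g \<in> borel_measurable (PM T)"
  shows "(\<integral>\<^sup>+y. g (restrict (\<lambda>i. y (e i)) T) \<partial>PM S) = (\<integral>\<^sup>+x. g x \<partial>PM T)"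
  using assms
  by (subst distr_PM_reindex[OF assms(1,2), symmetric], subst nn_integral_distr)
     (auto intro!: measurable_PM_reindex simp: bij_betw_def)

lemma integral_PM_reindex:
  fixes g :: "_ \<Rightarrow> real"
  assumes "bij_betw e T S" "finite T" and [measurable]: "g \<in> borel_measurable (PM T)"
  shows "(\<integral>y. g (restrict (\<lambda>i. y (e i)) T) \<partial>PM S) = (\<integral>x. g x \<partial>PM T)"
  using assms
  by (subst distr_PM_reindex[OF assms(1,2), symmetric], subst integral_distr)
     (auto intro!: measurable_PM_reindex simp: bij_betw_def)

lemma AE_PM_reindex:
  assumes "bij_betw e T S" "finite T" "AE x in PM T. R x"
  shows "AE y in PM S. R (restrict (\<lambda>i. y (e i)) T)"
proof -
  have "AE x in distr (PM S) (PM T) (\<lambda>y. restrict (\<lambda>i. y (e i)) T). R x"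
    by (subst distr_PM_reindex[OF assms(1,2)]) (rule assms(3))
  then show ?thesis
    using AE_distrD[OF measurable_PM_reindex[OF bij_betw_imp_funcset[OF assms(1)]]] by blast
qed

text \<open>A square root with values in \<open>ennreal\<close>, so that partial norms can be formed
  in Finner's inequality before anything is known to be finite.\<close>

definition esqrt :: "ennreal \<Rightarrow> ennreal" where
  "esqrt x = (if x = \<infinity> then \<infinity> else ennreal (sqrt (enn2real x)))"

lemma esqrt_sq [simp]: "(esqrt x)\<^sup>2 = x"
  by (cases x) (auto simp: esqrt_def ennreal_power)

lemma ennreal_le_of_sq_le:
  assumes "x\<^sup>2 \<le> y\<^sup>2" shows "x \<le> (y::ennreal)"
proof (cases x)
  case (real r)
  show ?thesis
  proof (cases y)
    case (real s)
    then show ?thesis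
      using assms \<open>x = ennreal r\<close> \<open>0 \<le> r\<close> power2_le_imp_le[of r s]
      by (simp add: ennreal_power)
  qed simp
next
  case top
  then show ?thesis using assms by (cases y) (auto simp: ennreal_power top_unique)
qed

lemma esqrt_measurable [measurable]: "esqrt \<in> borel_measurable borel"
  unfolding esqrt_def by measurable

text \<open>One variable is integrated out at a time, by the Cauchy-Schwarz inequality for the two functions in which it occurs.\<close>

lemma Finner_nn_integral:
  fixes G :: "'j \<Rightarrow> ('i \<Rightarrow> real) \<Rightarrow> ennreal"
  assumes "finite V" "finite J"
    and "\<And>j. j \<in> J \<Longrightarrow> S j \<subseteq> V"
    and "\<And>v. v \<in> V \<Longrightarrow> card {j\<in>J. v \<in> S j} = 2"
    and "\<And>j. j \<in> J \<Longrightarrow> G j \<in> borel_measurable (PM (S j))"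
  shows "(\<integral>\<^sup>+y. (\<Prod>j\<in>J. G j (restrict y (S j))) \<partial>PM V)\<^sup>2 \<le> (\<Prod>j\<in>J. \<integral>\<^sup>+y. (G j y)\<^sup>2 \<partial>PM (S j))"
  using assms
proof (induction V arbitrary: S G rule: finite_induct)
  case empty
  then have S: "S j = {}" if "j \<in> J" for j using that by auto
  have "(\<integral>\<^sup>+y. (\<Prod>j\<in>J. G j (restrict y (S j))) \<partial>PM {}) = (\<Prod>j\<in>J. G j (\<lambda>_. undefined))"
    unfolding PM_def by (subst HL.nn_integral_empty) (auto intro!: prod.cong simp: S restrict_def)
  moreover have "(\<Prod>j\<in>J. \<integral>\<^sup>+y. (G j y)\<^sup>2 \<partial>PM (S j)) = (\<Prod>j\<in>J. (G j (\<lambda>_. undefined))\<^sup>2)"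
  proof (rule prod.cong[OF refl])
    fix j assume "j \<in> J"
    show "(\<integral>\<^sup>+y. (G j y)\<^sup>2 \<partial>PM (S j)) = (G j (\<lambda>_. undefined))\<^sup>2"
      unfolding PM_def S[OF \<open>j \<in> J\<close>] by (rule HL.nn_integral_empty) simp
  qed
  ultimately show ?case by (simp only: prod_power_distrib)
next
  case (insert v V)
  note [measurable] = insert.prems(4)
  let ?L = "restrict_space lborel {0::real..}"
  have "card {j\<in>J. v \<in> S j} = 2" using insert.prems by auto
  then obtain a b where ab: "{j\<in>J. v \<in> S j} = {a, b}" "a \<noteq> b" by (auto simp: card_2_iff)
  then have aJ: "a \<in> J" "b \<in> J" "v \<in> S a" "v \<in> S b" by blast+
  have abJ: "v \<in> S j \<longleftrightarrow> j = a \<or> j = b" if "j \<in> J" for j using ab that by blast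
  \<comment> \<open>A factor that contains \<open>v\<close> becomes its norm in \<open>v\<close>, a
    function of its remaining variables. The squared norm of each new factor equals that of the old
    one (\<open>G'sq\<close>), so the right-hand side does not change in the induction step.\<close>
  define S' where "S' j = S j - {v}" for j
  define G' where "G' j = (if v \<in> S j then (\<lambda>y. esqrt (\<integral>\<^sup>+t. (G j (y(v:=t)))\<^sup>2 \<partial>?L)) else G j)" for j
  have upd: "(\<lambda>(y,t). y(v:=t)) \<in> measurable (PM (S' j) \<Otimes>\<^sub>M ?L) (PM (S j))" if "v \<in> S j" for j
  proof -
    have "insert v (S' j) = S j" using that by (auto simp: S'_def)
    then show ?thesis unfolding PM_def
      using measurable_add_dim[of v "S' j" "\<lambda>_. ?L"] by simp
  qed
  have Gm: "(\<lambda>(y,t). G j (y(v:=t))) \<in> borel_measurable (PM (S' j) \<Otimes>\<^sub>M ?L)" if "j \<in> J" "v \<in> S j" for j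
    using measurable_compose[OF upd[OF that(2)] insert.prems(4)[OF that(1)]]
    by (simp add: split_beta' fun_upd_def)
  have sfL: "sigma_finite_measure ?L" by (rule sigma_finite_halfline)
  have Gm1: "(\<lambda>t. G j (y(v:=t))) \<in> borel_measurable ?L" if "j \<in> J" "v \<in> S j" "y \<in> space (PM (S' j))" for j y
    using measurable_compose[OF measurable_Pair1'[OF that(3)] Gm[OF that(1,2)]] by (simp add: comp_def)
  have G'm: "G' j \<in> borel_measurable (PM (S' j))" if "j \<in> J" for j
  proof (cases "v \<in> S j")
    case True
    have "(\<lambda>(y,t). (G j (y(v:=t)))\<^sup>2) \<in> borel_measurable (PM (S' j) \<Otimes>\<^sub>M ?L)"
      using Gm[OF that True] by (auto simp: split_beta' power2_eq_square)
    from sigma_finite_measure.borel_measurable_nn_integral[OF sfL this] show ?thesis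
      using True by (simp add: G'_def)
  next
    case False
    then have "S' j = S j" by (auto simp: S'_def)
    then show ?thesis using False insert.prems(4)[OF that] by (simp add: G'_def)
  qed
  have G'sq: "(\<integral>\<^sup>+y. (G' j y)\<^sup>2 \<partial>PM (S' j)) = (\<integral>\<^sup>+y. (G j y)\<^sup>2 \<partial>PM (S j))" if "j \<in> J" for j
  proof (cases "v \<in> S j")
    case True
    have ins: "insert v (S' j) = S j" and fin: "finite (S' j)"
      using True insert.prems(2)[OF that] insert.hyps(1)
      by (auto simp: S'_def intro: finite_subset)
    have "(\<lambda>y. (G j y)\<^sup>2) \<in> borel_measurable (PM (S j))" using that by measurable
    then have "(\<integral>\<^sup>+y. (G j y)\<^sup>2 \<partial>PM (S j)) = (\<integral>\<^sup>+ y. (\<integral>\<^sup>+ t. (G j (y(v:=t)))\<^sup>2 \<partial>?L) \<partial>PM (S' j))"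
      using HL.product_nn_integral_insert[of "S' j" v "\<lambda>y. (G j y)\<^sup>2", unfolded ins] fin
      by (simp add: PM_def S'_def[of j])
    then show ?thesis using True by (simp add: G'_def)
  next
    case False
    then have "S' j = S j" by (auto simp: S'_def)
    then show ?thesis using False by (simp add: G'_def)
  qed
  have meas: "(\<lambda>y. \<Prod>j\<in>J. G j (restrict y (S j))) \<in> borel_measurable (PM (insert v V))"
    by (intro borel_measurable_prod_ennreal measurable_compose[OF measurable_PM_restrict]
        insert.prems)
  have "(\<integral>\<^sup>+y. (\<Prod>j\<in>J. G j (restrict y (S j))) \<partial>PM (insert v V))
     = (\<integral>\<^sup>+y. (\<integral>\<^sup>+t. (\<Prod>j\<in>J. G j (restrict (y(v:=t)) (S j))) \<partial>?L) \<partial>PM V)"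
    using HL.product_nn_integral_insert[OF insert.hyps meas[unfolded PM_def]] by (simp add: PM_def)
  also have "\<dots> \<le> (\<integral>\<^sup>+y. (\<Prod>j\<in>J. G' j (restrict y (S' j))) \<partial>PM V)"
  proof (rule nn_integral_mono)
    fix y assume y: "y \<in> space (PM V)"
    have yr: "restrict y (S' j) \<in> space (PM (S' j))" if "j \<in> J" for j
      using y insert.prems(2)[OF that] by (fastforce simp: space_PM S'_def)
    let ?R = "J - {a,b}"
    have r1: "restrict (y(v:=t)) (S j) = restrict y (S' j)" if "j \<in> ?R" for j t
      using that abJ[of j] by (auto simp: S'_def restrict_def fun_eq_iff)
    have r2: "restrict (y(v:=t)) (S j) = (restrict y (S' j))(v:=t)" if "v \<in> S j" for j t
      using that by (auto simp: S'_def restrict_def fun_eq_iff)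
    have G'R: "G' j = G j" if "j \<in> ?R" for j using that abJ[of j] by (simp add: G'_def)
    let ?ga = "\<lambda>t. G a ((restrict y (S' a))(v:=t))" and ?gb = "\<lambda>t. G b ((restrict y (S' b))(v:=t))"
    have m: "?ga \<in> borel_measurable ?L" "?gb \<in> borel_measurable ?L"
      using Gm1[OF aJ(1) aJ(3) yr[OF aJ(1)]] Gm1[OF aJ(2) aJ(4) yr[OF aJ(2)]] by auto
    have "(\<integral>\<^sup>+t. ?ga t * ?gb t \<partial>?L)\<^sup>2 \<le> (G' a (restrict y (S' a)) * G' b (restrict y (S' b)))\<^sup>2"
      using Cauchy_Schwarz_nn_integral[OF m] aJ by (simp add: G'_def power_mult_distrib)
    then have cs: "(\<integral>\<^sup>+t. ?ga t * ?gb t \<partial>?L) \<le> G' a (restrict y (S' a)) * G' b (restrict y (S' b))"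
      by (rule ennreal_le_of_sq_le)
    have "(\<integral>\<^sup>+t. (\<Prod>j\<in>J. G j (restrict (y(v:=t)) (S j))) \<partial>?L)
       = (\<integral>\<^sup>+t. (\<Prod>j\<in>?R. G j (restrict y (S' j))) * (?ga t * ?gb t) \<partial>?L)"
    proof (rule nn_integral_cong)
      fix t
      have "(\<Prod>j\<in>J. G j (restrict (y(v:=t)) (S j)))
         = ?ga t * (?gb t * (\<Prod>j\<in>?R. G j (restrict (y(v:=t)) (S j))))"
        using insert.prems(1) ab(2) aJ r2
        by (simp add: prod.remove[of J a] prod.remove[of "J - {a}" b] Diff_insert2[symmetric] insert_commute)
      also have "(\<Prod>j\<in>?R. G j (restrict (y(v:=t)) (S j))) = (\<Prod>j\<in>?R. G j (restrict y (S' j)))"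
        by (rule prod.cong[OF refl]) (simp only: r1)
      finally show "(\<Prod>j\<in>J. G j (restrict (y(v:=t)) (S j)))
        = (\<Prod>j\<in>?R. G j (restrict y (S' j))) * (?ga t * ?gb t)" by (simp only: mult_ac)
    qed
    also have "\<dots> = (\<Prod>j\<in>?R. G j (restrict y (S' j))) * (\<integral>\<^sup>+t. ?ga t * ?gb t \<partial>?L)"
      by (rule nn_integral_cmult) (rule borel_measurable_times_ennreal[OF m])
    also have "\<dots> \<le> (\<Prod>j\<in>?R. G j (restrict y (S' j))) * (G' a (restrict y (S' a)) * G' b (restrict y (S' b)))"
      by (intro mult_left_mono cs) auto
    also have "\<dots> = (\<Prod>j\<in>J. G' j (restrict y (S' j)))"
    proof -
      have "(\<Prod>j\<in>J. G' j (restrict y (S' j)))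
         = G' a (restrict y (S' a)) * (G' b (restrict y (S' b)) * (\<Prod>j\<in>?R. G' j (restrict y (S' j))))"
        using insert.prems(1) ab(2) aJ
        by (simp add: prod.remove[of J a] prod.remove[of "J - {a}" b] Diff_insert2[symmetric] insert_commute)
      also have "(\<Prod>j\<in>?R. G' j (restrict y (S' j))) = (\<Prod>j\<in>?R. G j (restrict y (S' j)))"
        by (rule prod.cong[OF refl]) (simp only: G'R)
      finally show ?thesis by (simp only: mult_ac)
    qed
    finally show "(\<integral>\<^sup>+t. (\<Prod>j\<in>J. G j (restrict (y(v:=t)) (S j))) \<partial>?L) \<le> (\<Prod>j\<in>J. G' j (restrict y (S' j)))" .
  qed
  finally have "(\<integral>\<^sup>+y. (\<Prod>j\<in>J. G j (restrict y (S j))) \<partial>PM (insert v V))\<^sup>2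
     \<le> (\<integral>\<^sup>+y. (\<Prod>j\<in>J. G' j (restrict y (S' j))) \<partial>PM V)\<^sup>2"
    by (intro power_mono) auto
  also have "\<dots> \<le> (\<Prod>j\<in>J. \<integral>\<^sup>+y. (G' j y)\<^sup>2 \<partial>PM (S' j))"
  proof (rule insert.IH)
    show "S' j \<subseteq> V" if "j \<in> J" for j using insert.prems(2)[OF that] by (auto simp: S'_def)
    show "card {j \<in> J. w \<in> S' j} = 2" if "w \<in> V" for w
    proof -
      have "w \<noteq> v" using that insert.hyps by auto
      then have "{j \<in> J. w \<in> S' j} = {j \<in> J. w \<in> S j}" by (auto simp: S'_def)
      then show ?thesis using insert.prems(3) that by auto
    qed
  qed (use insert.prems(1) G'm in auto)
  also have "\<dots> = (\<Prod>j\<in>J. \<integral>\<^sup>+y. (G j y)\<^sup>2 \<partial>PM (S j))"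
    by (intro prod.cong refl G'sq)
  finally show ?case .
qed

subsection \<open>Square-integrable functions\<close>

definition sqint :: "'a measure \<Rightarrow> ('a \<Rightarrow> real) \<Rightarrow> bool" where
  "sqint M f \<longleftrightarrow> f \<in> borel_measurable M \<and> integrable M (\<lambda>x. (f x)^2)"

lemma L2_sqint: "L2 n f \<longleftrightarrow> sqint (PM {..<n}) f"
  by (simp add: L2_def sqint_def Mn_eq_PM)

lemma sqint_measurable: "sqint M f \<Longrightarrow> f \<in> borel_measurable M"
  by (simp add: sqint_def)

lemma sqint_bound:
  assumes "sqint M g" "f \<in> borel_measurable M" "AE x in M. \<bar>f x\<bar> \<le> \<bar>g x\<bar>"
  shows "sqint M f"
  unfolding sqint_def
proof
  note [measurable] = assms(2)
  show "integrable M (\<lambda>x. (f x)^2)"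
  proof (rule Bochner_Integration.integrable_bound)
    show "integrable M (\<lambda>x. (g x)^2)" using assms(1) by (simp add: sqint_def)
    show "AE x in M. norm ((f x)^2) \<le> norm ((g x)^2)"
      using assms(3) by eventually_elim (simp add: abs_le_square_iff)
  qed measurable
qed fact

lemma sqint_mult_integrable:
  assumes "sqint M f" "sqint M g"
  shows "integrable M (\<lambda>x. f x * g x)"
proof (rule Bochner_Integration.integrable_bound)
  note [measurable] = assms[THEN sqint_measurable]
  show "integrable M (\<lambda>x. (f x)^2 + (g x)^2)" using assms by (simp add: sqint_def)
  show "AE x in M. norm (f x * g x) \<le> norm ((f x)^2 + (g x)^2)"
  proof (rule AE_I2)
    fix x
    have "2 * \<bar>f x * g x\<bar> \<le> (f x)^2 + (g x)^2"
      using sum_squares_bound[of "\<bar>f x\<bar>" "\<bar>g x\<bar>"] by (simp add: abs_mult)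
    then show "norm (f x * g x) \<le> norm ((f x)^2 + (g x)^2)" by simp
  qed
  show "(\<lambda>x. f x * g x) \<in> borel_measurable M" by measurable
qed

lemma sqint_cmult: "sqint M f \<Longrightarrow> sqint M (\<lambda>x. c * f x)"
  by (auto simp: sqint_def power_mult_distrib)

lemma sqint_add:
  assumes "sqint M f" "sqint M g" shows "sqint M (\<lambda>x. f x + g x)"
  unfolding sqint_def
proof
  have "integrable M (\<lambda>x. (f x)^2 + (g x)^2 + 2 * (f x * g x))"
    using assms sqint_mult_integrable[OF assms] by (auto simp: sqint_def)
  then show "integrable M (\<lambda>x. (f x + g x)^2)"
    by (simp add: power2_sum mult.assoc)
qed (use assms in \<open>auto simp: sqint_def\<close>)

lemma sqint_diff:
  assumes "sqint M f" "sqint M g" shows "sqint M (\<lambda>x. f x - g x)"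
  using sqint_add[OF assms(1) sqint_cmult[OF assms(2), of "-1"]] by simp

lemma sqint_sum:
  assumes "finite A" "\<And>i. i \<in> A \<Longrightarrow> sqint M (f i)" shows "sqint M (\<lambda>x. \<Sum>i\<in>A. f i x)"
  using assms
proof (induction A rule: finite_induct)
  case empty
  then show ?case by (simp add: sqint_def)
next
  case (insert i A)
  then show ?case by (simp add: sqint_add)
qed

lemma sqint_nn_integral:
  assumes "sqint M f" shows "(\<integral>\<^sup>+x. ennreal ((f x)^2) \<partial>M) = ennreal (\<integral>x. (f x)^2 \<partial>M)"
  using assms by (intro nn_integral_eq_integral) (auto simp: sqint_def)

lemma sqint_iff_nn:
  "sqint M f \<longleftrightarrow> f \<in> borel_measurable M \<and> (\<integral>\<^sup>+x. ennreal ((f x)^2) \<partial>M) < \<infinity>"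
  by (auto simp: sqint_def integrable_iff_bounded)

lemma CS_real:
  assumes "sqint M f" "sqint M g"
  shows "\<bar>\<integral>x. f x * g x \<partial>M\<bar> \<le> sqrt (\<integral>x. (f x)^2 \<partial>M) * sqrt (\<integral>x. (g x)^2 \<partial>M)"
proof -
  note [measurable] = assms[THEN sqint_measurable]
  have "ennreal ((\<integral>x. f x * g x \<partial>M)^2) \<le> (\<integral>\<^sup>+x. ennreal \<bar>f x\<bar> * ennreal \<bar>g x\<bar> \<partial>M)^2"
  proof -
    have "ennreal \<bar>\<integral>x. f x * g x \<partial>M\<bar> \<le> (\<integral>\<^sup>+x. ennreal \<bar>f x\<bar> * ennreal \<bar>g x\<bar> \<partial>M)"
      using integral_norm_bound_ennreal[OF sqint_mult_integrable[OF assms]]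
      by (simp add: abs_mult ennreal_mult)
    then have "(ennreal \<bar>\<integral>x. f x * g x \<partial>M\<bar>)^2 \<le> (\<integral>\<^sup>+x. ennreal \<bar>f x\<bar> * ennreal \<bar>g x\<bar> \<partial>M)^2"
      by (rule power_mono) simp
    then show ?thesis by (simp add: ennreal_power)
  qed
  also have "\<dots> \<le> (\<integral>\<^sup>+x. (ennreal \<bar>f x\<bar>)^2 \<partial>M) * (\<integral>\<^sup>+x. (ennreal \<bar>g x\<bar>)^2 \<partial>M)"
    by (rule Cauchy_Schwarz_nn_integral) measurable
  also have "\<dots> = ennreal ((\<integral>x. (f x)^2 \<partial>M) * (\<integral>x. (g x)^2 \<partial>M))"
    using assms by (simp add: ennreal_power sqint_nn_integral ennreal_mult)
  finally have "(\<integral>x. f x * g x \<partial>M)^2 \<le> (\<integral>x. (f x)^2 \<partial>M) * (\<integral>x. (g x)^2 \<partial>M)"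
    by (simp add: ennreal_le_iff)
  then have "sqrt ((\<integral>x. f x * g x \<partial>M)^2) \<le> sqrt ((\<integral>x. (f x)^2 \<partial>M) * (\<integral>x. (g x)^2 \<partial>M))"
    by (rule real_sqrt_le_mono)
  then show ?thesis by (simp add: real_sqrt_mult)
qed

text \<open>By Cauchy-Schwarz in \<open>b\<close>, the squared overlap of the sections at two points
  is at most a function of the first point times the same function of the second, and the double
  integral of this product is a square.\<close>

lemma overlap_bound:
  fixes v :: "'c \<times> 'b \<Rightarrow> real"
  assumes sf: "sigma_finite_measure MB" "sigma_finite_measure MC"
    and vm[measurable]: "v \<in> borel_measurable (MC \<Otimes>\<^sub>M MB)"
  shows "(\<integral>\<^sup>+cc. ennreal ((\<integral>b. v (fst cc, b) * v (snd cc, b) \<partial>MB)^2) \<partial>(MC \<Otimes>\<^sub>M MC))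
      \<le> (\<integral>\<^sup>+z. ennreal ((v z)^2) \<partial>(MC \<Otimes>\<^sub>M MB))^2"
proof -
  interpret B: sigma_finite_measure MB by fact
  interpret C: sigma_finite_measure MC by fact
  define G where "G cc = (\<integral>b. v (fst cc, b) * v (snd cc, b) \<partial>MB)" for cc
  have "(\<integral>\<^sup>+cc. (ennreal \<bar>G cc\<bar>)^2 \<partial>(MC \<Otimes>\<^sub>M MC))
     \<le> (\<integral>\<^sup>+cc. (\<integral>\<^sup>+b. ennreal ((v (fst cc, b))^2) \<partial>MB) * (\<integral>\<^sup>+b. ennreal ((v (snd cc, b))^2) \<partial>MB) \<partial>(MC \<Otimes>\<^sub>M MC))"
  proof (rule nn_integral_mono)
    fix cc assume "cc \<in> space (MC \<Otimes>\<^sub>M MC)"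
    then have [measurable]: "(\<lambda>b. v (fst cc, b)) \<in> borel_measurable MB" "(\<lambda>b. v (snd cc, b)) \<in> borel_measurable MB"
      by (auto simp: space_pair_measure)
    have "ennreal \<bar>G cc\<bar> \<le> (\<integral>\<^sup>+b. ennreal \<bar>v (fst cc, b)\<bar> * ennreal \<bar>v (snd cc, b)\<bar> \<partial>MB)"
    \<comment> \<open>The Bochner integral of a non-integrable function is 0 by convention, so the
      bound holds there as well.\<close>
    proof (cases "integrable MB (\<lambda>b. v (fst cc, b) * v (snd cc, b))")
      case True
      from integral_norm_bound_ennreal[OF this] show ?thesis
        by (simp add: G_def abs_mult ennreal_mult)
    qed (simp add: G_def not_integrable_integral_eq)
    then have "(ennreal \<bar>G cc\<bar>)^2 \<le> (\<integral>\<^sup>+b. ennreal \<bar>v (fst cc, b)\<bar> * ennreal \<bar>v (snd cc, b)\<bar> \<partial>MB)^2"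
      by (intro power_mono) auto
    also have "\<dots> \<le> (\<integral>\<^sup>+b. (ennreal \<bar>v (fst cc, b)\<bar>)^2 \<partial>MB) * (\<integral>\<^sup>+b. (ennreal \<bar>v (snd cc, b)\<bar>)^2 \<partial>MB)"
      by (rule Cauchy_Schwarz_nn_integral) measurable
    finally show "(ennreal \<bar>G cc\<bar>)^2 \<le> (\<integral>\<^sup>+b. ennreal ((v (fst cc, b))^2) \<partial>MB) * (\<integral>\<^sup>+b. ennreal ((v (snd cc, b))^2) \<partial>MB)"
      by (simp add: ennreal_power)
  qed
  also have "\<dots> = (\<integral>\<^sup>+c. (\<integral>\<^sup>+b. ennreal ((v (c, b))^2) \<partial>MB) \<partial>MC)^2"
    by (subst C.nn_integral_fst[symmetric], measurable) (simp add: nn_integral_cmult nn_integral_multc power2_eq_square)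
  also have "\<dots> = (\<integral>\<^sup>+z. ennreal ((v z)^2) \<partial>(MC \<Otimes>\<^sub>M MB))^2"
    by (subst B.nn_integral_fst, measurable)
  finally show ?thesis by (simp add: G_def ennreal_power)
qed

text \<open>The integral of \<open>u (c,a) * v (c,b) * u (c',a) * v (c',b)\<close> is computed in two orders.\<close>

lemma contraction_Cauchy_Schwarz:
  fixes u :: "'c \<times> 'a \<Rightarrow> real" and v :: "'c \<times> 'b \<Rightarrow> real"
  assumes sf: "sigma_finite_measure MA" "sigma_finite_measure MB" "sigma_finite_measure MC"
    and u: "sqint (MC \<Otimes>\<^sub>M MA) u" and v: "sqint (MC \<Otimes>\<^sub>M MB) v"
  shows "(\<integral>\<^sup>+ab. ennreal ((\<integral>c. u (c, fst ab) * v (c, snd ab) \<partial>MC)^2) \<partial>(MA \<Otimes>\<^sub>M MB))^2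
    \<le> (\<integral>\<^sup>+cc. ennreal ((\<integral>a. u (fst cc, a) * u (snd cc, a) \<partial>MA)^2) \<partial>(MC \<Otimes>\<^sub>M MC))
      * (\<integral>\<^sup>+z. ennreal ((v z)^2) \<partial>(MC \<Otimes>\<^sub>M MB))^2"
proof -
  interpret A: sigma_finite_measure MA by fact
  interpret B: sigma_finite_measure MB by fact
  interpret C: sigma_finite_measure MC by fact
  interpret AB: pair_sigma_finite MA MB ..
  interpret CC: pair_sigma_finite MC MC ..
  interpret CA: pair_sigma_finite MC MA ..
  interpret CB: pair_sigma_finite MC MB ..
  interpret P: pair_sigma_finite "MA \<Otimes>\<^sub>M MB" "MC \<Otimes>\<^sub>M MC" ..
  have um[measurable]: "u \<in> borel_measurable (MC \<Otimes>\<^sub>M MA)" and vm[measurable]: "v \<in> borel_measurable (MC \<Otimes>\<^sub>M MB)"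
    using u v by (auto simp: sqint_def)
  define k where "k ab c = u (c, fst ab) * v (c, snd ab)" for ab c
  define H where "H z = k (fst z) (fst (snd z)) * k (fst z) (snd (snd z))" for z
  define h where "h ab = (\<integral>c. k ab c \<partial>MC)" for ab
  define F where "F cc = (\<integral>a. u (fst cc, a) * u (snd cc, a) \<partial>MA)" for cc
  define G where "G cc = (\<integral>b. v (fst cc, b) * v (snd cc, b) \<partial>MB)" for cc
  have km[measurable]: "case_prod k \<in> borel_measurable ((MA \<Otimes>\<^sub>M MB) \<Otimes>\<^sub>M MC)"
    unfolding k_def by measurable
  have Hm[measurable]: "H \<in> borel_measurable ((MA \<Otimes>\<^sub>M MB) \<Otimes>\<^sub>M (MC \<Otimes>\<^sub>M MC))"
    unfolding H_def k_def by measurable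
  have Fm[measurable]: "F \<in> borel_measurable (MC \<Otimes>\<^sub>M MC)" unfolding F_def by measurable
  have Gm[measurable]: "G \<in> borel_measurable (MC \<Otimes>\<^sub>M MC)" unfolding G_def by measurable
  have hm[measurable]: "h \<in> borel_measurable (MA \<Otimes>\<^sub>M MB)" unfolding h_def by measurable
  \<comment> \<open>Integrability of \<open>H\<close> licenses the exchange of the two orders:
    Cauchy-Schwarz in \<open>c\<close> bounds the integral of its absolute value by the product of
    the squared norms of \<open>u\<close> and \<open>v\<close>.\<close>
  have Hint: "integrable ((MA \<Otimes>\<^sub>M MB) \<Otimes>\<^sub>M (MC \<Otimes>\<^sub>M MC)) H"
  proof (rule integrableI_bounded)
    have "(\<integral>\<^sup>+z. ennreal (norm (H z)) \<partial>((MA \<Otimes>\<^sub>M MB) \<Otimes>\<^sub>M (MC \<Otimes>\<^sub>M MC)))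
       = (\<integral>\<^sup>+ab. \<integral>\<^sup>+c. \<integral>\<^sup>+c'. ennreal \<bar>k ab c\<bar> * ennreal \<bar>k ab c'\<bar> \<partial>MC \<partial>MC \<partial>(MA \<Otimes>\<^sub>M MB))"
    proof (subst CC.P.nn_integral_fst[symmetric], measurable, rule nn_integral_cong)
      fix ab assume ab: "ab \<in> space (MA \<Otimes>\<^sub>M MB)"
      then have [measurable]: "(\<lambda>c. k ab c) \<in> borel_measurable MC"
        by (auto simp: k_def space_pair_measure)
      show "(\<integral>\<^sup>+y. ennreal (norm (H (ab, y))) \<partial>(MC \<Otimes>\<^sub>M MC))
         = (\<integral>\<^sup>+c. \<integral>\<^sup>+c'. ennreal \<bar>k ab c\<bar> * ennreal \<bar>k ab c'\<bar> \<partial>MC \<partial>MC)"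
        unfolding H_def fst_conv snd_conv using ab
        by (subst C.nn_integral_fst[symmetric], measurable) (simp add: abs_mult ennreal_mult)
    qed
    also have "\<dots> = (\<integral>\<^sup>+ab. (\<integral>\<^sup>+c. ennreal \<bar>k ab c\<bar> \<partial>MC)^2 \<partial>(MA \<Otimes>\<^sub>M MB))"
      by (intro nn_integral_cong)
         (simp add: nn_integral_cmult nn_integral_multc power2_eq_square k_def space_pair_measure mem_Times_iff)
    also have "\<dots> \<le> (\<integral>\<^sup>+ab. (\<integral>\<^sup>+c. ennreal ((u (c, fst ab))^2) \<partial>MC) * (\<integral>\<^sup>+c. ennreal ((v (c, snd ab))^2) \<partial>MC) \<partial>(MA \<Otimes>\<^sub>M MB))"
    proof (rule nn_integral_mono)
      fix ab assume "ab \<in> space (MA \<Otimes>\<^sub>M MB)"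
      then have [measurable]: "(\<lambda>c. u (c, fst ab)) \<in> borel_measurable MC" "(\<lambda>c. v (c, snd ab)) \<in> borel_measurable MC"
        by (auto simp: space_pair_measure)
      have "(\<integral>\<^sup>+c. ennreal \<bar>k ab c\<bar> \<partial>MC)^2 = (\<integral>\<^sup>+c. ennreal \<bar>u (c, fst ab)\<bar> * ennreal \<bar>v (c, snd ab)\<bar> \<partial>MC)^2"
        by (simp add: k_def abs_mult ennreal_mult)
      also have "\<dots> \<le> (\<integral>\<^sup>+c. (ennreal \<bar>u (c, fst ab)\<bar>)^2 \<partial>MC) * (\<integral>\<^sup>+c. (ennreal \<bar>v (c, snd ab)\<bar>)^2 \<partial>MC)"
        by (rule Cauchy_Schwarz_nn_integral) measurable
      finally show "(\<integral>\<^sup>+c. ennreal \<bar>k ab c\<bar> \<partial>MC)^2 \<le> (\<integral>\<^sup>+c. ennreal ((u (c, fst ab))^2) \<partial>MC) * (\<integral>\<^sup>+c. ennreal ((v (c, snd ab))^2) \<partial>MC)"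
        by (simp add: ennreal_power)
    qed
    also have "\<dots> = (\<integral>\<^sup>+a. (\<integral>\<^sup>+c. ennreal ((u (c, a))^2) \<partial>MC) \<partial>MA) * (\<integral>\<^sup>+b. (\<integral>\<^sup>+c. ennreal ((v (c, b))^2) \<partial>MC) \<partial>MB)"
      by (subst B.nn_integral_fst[symmetric], measurable) (simp add: nn_integral_cmult nn_integral_multc)
    also have "\<dots> = (\<integral>\<^sup>+z. ennreal ((u z)^2) \<partial>(MC \<Otimes>\<^sub>M MA)) * (\<integral>\<^sup>+z. ennreal ((v z)^2) \<partial>(MC \<Otimes>\<^sub>M MB))"
      by (subst CA.nn_integral_snd[symmetric], measurable, subst CB.nn_integral_snd[symmetric], measurable)
    also have "\<dots> < \<infinity>" using u v by (simp add: sqint_nn_integral ennreal_mult[symmetric])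
    finally show "(\<integral>\<^sup>+z. ennreal (norm (H z)) \<partial>((MA \<Otimes>\<^sub>M MB) \<Otimes>\<^sub>M (MC \<Otimes>\<^sub>M MC))) < \<infinity>" .
  qed measurable
  \<comment> \<open>With \<open>c\<close> and \<open>c'\<close> integrated first, \<open>H\<close>
    splits into two copies of the same inner integral, for almost every section.\<close>
  have s1: "AE ab in MA \<Otimes>\<^sub>M MB. (\<integral>cc. H (ab, cc) \<partial>(MC \<Otimes>\<^sub>M MC)) = (h ab)^2"
    using P.AE_integrable_fst'[OF Hint]
  proof eventually_elim
    case (elim ab)
    have "(\<integral>cc. H (ab, cc) \<partial>(MC \<Otimes>\<^sub>M MC)) = (\<integral>c. \<integral>c'. H (ab, (c, c')) \<partial>MC \<partial>MC)"
      by (rule CC.integral_fst'[OF elim, symmetric])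
    also have "\<dots> = (h ab)^2" by (simp add: H_def h_def power2_eq_square)
    finally show ?case .
  qed
  have Hint': "integrable ((MC \<Otimes>\<^sub>M MC) \<Otimes>\<^sub>M (MA \<Otimes>\<^sub>M MB)) (\<lambda>(y,x). H (x,y))"
    by (rule P.integrable_product_swap[OF Hint])
  interpret P': pair_sigma_finite "MC \<Otimes>\<^sub>M MC" "MA \<Otimes>\<^sub>M MB" ..
  \<comment> \<open>With \<open>a\<close> and \<open>b\<close> integrated first, \<open>H\<close>
    separates into the overlap \<open>F\<close> of the sections of \<open>u\<close> and the overlap
    \<open>G\<close> of the sections of \<open>v\<close>.\<close>
  have s2: "AE cc in MC \<Otimes>\<^sub>M MC. (\<integral>ab. H (ab, cc) \<partial>(MA \<Otimes>\<^sub>M MB)) = F cc * G cc"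
    using P'.AE_integrable_fst'[OF Hint']
  proof eventually_elim
    case (elim cc)
    then have "(\<integral>ab. H (ab, cc) \<partial>(MA \<Otimes>\<^sub>M MB)) = (\<integral>a. \<integral>b. H ((a,b), cc) \<partial>MB \<partial>MA)"
      using AB.integral_fst'[of "\<lambda>ab. H (ab, cc)"] by simp
    also have "\<dots> = (\<integral>a. \<integral>b. (u (fst cc, a) * u (snd cc, a)) * (v (fst cc, b) * v (snd cc, b)) \<partial>MB \<partial>MA)"
      by (simp add: H_def k_def mult_ac)
    also have "\<dots> = F cc * G cc" by (simp add: F_def G_def)
    finally show ?case .
  qed
  have ih: "integrable (MA \<Otimes>\<^sub>M MB) (\<lambda>ab. (h ab)^2)"
    using P.integrable_fst'[OF Hint] s1 by (subst integrable_cong_AE[symmetric]) auto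
  have iFG: "integrable (MC \<Otimes>\<^sub>M MC) (\<lambda>cc. F cc * G cc)"
    using P'.integrable_fst'[OF Hint'] s2 by (subst integrable_cong_AE[symmetric]) auto
  have "(\<integral>ab. (h ab)^2 \<partial>(MA \<Otimes>\<^sub>M MB)) = (\<integral>ab. (\<integral>cc. H (ab, cc) \<partial>(MC \<Otimes>\<^sub>M MC)) \<partial>(MA \<Otimes>\<^sub>M MB))"
    using s1 by (intro integral_cong_AE) auto
  also have "\<dots> = (\<integral>cc. (\<integral>ab. H (ab, cc) \<partial>(MA \<Otimes>\<^sub>M MB)) \<partial>(MC \<Otimes>\<^sub>M MC))"
    using P.Fubini_integral[of "curry H"] Hint by simp
  also have "\<dots> = (\<integral>cc. F cc * G cc \<partial>(MC \<Otimes>\<^sub>M MC))"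
    using s2 by (intro integral_cong_AE) auto
  finally have eq: "(\<integral>ab. (h ab)^2 \<partial>(MA \<Otimes>\<^sub>M MB)) = (\<integral>cc. F cc * G cc \<partial>(MC \<Otimes>\<^sub>M MC))" .
  have "(\<integral>\<^sup>+ab. ennreal ((h ab)^2) \<partial>(MA \<Otimes>\<^sub>M MB)) = ennreal (\<integral>ab. (h ab)^2 \<partial>(MA \<Otimes>\<^sub>M MB))"
    using ih by (intro nn_integral_eq_integral) auto
  also have "\<dots> \<le> ennreal (norm (\<integral>cc. F cc * G cc \<partial>(MC \<Otimes>\<^sub>M MC)))"
    unfolding eq by (intro ennreal_leI) simp
  also have "\<dots> \<le> (\<integral>\<^sup>+cc. ennreal \<bar>F cc\<bar> * ennreal \<bar>G cc\<bar> \<partial>(MC \<Otimes>\<^sub>M MC))"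
    using integral_norm_bound_ennreal[OF iFG] by (simp add: abs_mult ennreal_mult)
  finally have "(\<integral>\<^sup>+ab. ennreal ((h ab)^2) \<partial>(MA \<Otimes>\<^sub>M MB))^2
      \<le> (\<integral>\<^sup>+cc. ennreal \<bar>F cc\<bar> * ennreal \<bar>G cc\<bar> \<partial>(MC \<Otimes>\<^sub>M MC))^2"
    by (intro power_mono) auto
  also have "\<dots> \<le> (\<integral>\<^sup>+cc. (ennreal \<bar>F cc\<bar>)^2 \<partial>(MC \<Otimes>\<^sub>M MC)) * (\<integral>\<^sup>+cc. (ennreal \<bar>G cc\<bar>)^2 \<partial>(MC \<Otimes>\<^sub>M MC))"
    by (rule Cauchy_Schwarz_nn_integral) measurable
  \<comment> \<open>Only \<open>G\<close> is estimated further; the norm of \<open>F\<close> is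
    kept, since for a kernel \<open>u\<close> it is the norm of a contraction of \<open>u\<close>
    with itself.\<close>
  also have "\<dots> \<le> (\<integral>\<^sup>+cc. ennreal ((F cc)^2) \<partial>(MC \<Otimes>\<^sub>M MC)) * (\<integral>\<^sup>+z. ennreal ((v z)^2) \<partial>(MC \<Otimes>\<^sub>M MB))^2"
  proof (intro mult_mono)
    show "(\<integral>\<^sup>+cc. (ennreal \<bar>G cc\<bar>)^2 \<partial>(MC \<Otimes>\<^sub>M MC)) \<le> (\<integral>\<^sup>+z. ennreal ((v z)^2) \<partial>(MC \<Otimes>\<^sub>M MB))^2"
      using overlap_bound[OF sf(2,3) vm] by (simp add: G_def ennreal_power)
  qed (auto simp: ennreal_power)
  finally show ?thesis by (simp add: h_def k_def F_def)
qed

subsection \<open>Density of disjoint boxes\<close>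

text \<open>With the other coordinates fixed, \<open>h\<close> is constant in the coordinate
  \<open>i\<close>, so the section of the exceptional set is at most one point. The lemma is applied
  with \<open>h\<close> equal to 0 and to another coordinate.\<close>

lemma AE_PM_component_neq:
  assumes "finite V" "i \<in> V" and h: "h \<in> borel_measurable (PM V)"
    and h': "\<And>x t. h (x(i:=t)) = (h x :: real)"
  shows "AE x in PM V. x i \<noteq> h x"
proof -
  let ?L = "restrict_space lborel {0::real..}"
  note [measurable] = h[unfolded PM_def]
  obtain W where W: "i \<notin> W" "V = insert i W" using assms by (meson mk_disjoint_insert)
  have finW: "finite W" using W assms by simp
  have [measurable]: "(\<lambda>x. x i) \<in> borel_measurable (PiM V (\<lambda>_. ?L))"
    using measurable_component_singleton[OF assms(2), of "\<lambda>_. ?L"]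
      measurable_restrict_space1[of "\<lambda>x. x" lborel borel "{0..}"]
    by (auto intro: measurable_compose)
  let ?N = "{x \<in> space (PiM V (\<lambda>_. ?L)). x i = h x}"
  have N: "?N \<in> sets (PiM V (\<lambda>_. ?L))" by measurable
  have "emeasure (PiM V (\<lambda>_. ?L)) ?N = (\<integral>\<^sup>+x. indicator ?N x \<partial>PiM V (\<lambda>_. ?L))"
    using N by simp
  also have "\<dots> = (\<integral>\<^sup>+ x. (\<integral>\<^sup>+ t. indicator ?N (x(i:=t)) \<partial>?L) \<partial>PiM W (\<lambda>_. ?L))"
    unfolding W(2)
    by (rule HL.product_nn_integral_insert[OF finW W(1)]) (use N W(2) in simp)
  also have "\<dots> \<le> (\<integral>\<^sup>+ x. (\<integral>\<^sup>+ t. indicator {h x} t \<partial>?L) \<partial>PiM W (\<lambda>_. ?L))"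
    using h' by (intro nn_integral_mono) (auto simp: indicator_def)
  also have "\<dots> = 0"
  proof -
    have "(\<integral>\<^sup>+ t. indicator {h x} t \<partial>?L) = 0" for x
    proof -
      have "(\<integral>\<^sup>+ t. indicator {h x} t \<partial>?L) = (\<integral>\<^sup>+ t. indicator {h x} t * indicator {0..} t \<partial>lborel)"
        by (subst nn_integral_restrict_space) auto
      also have "\<dots> \<le> (\<integral>\<^sup>+ t. indicator {h x} t \<partial>lborel)"
        by (intro nn_integral_mono) (auto simp: indicator_def)
      also have "\<dots> = 0" by simp
      finally show ?thesis by simp
    qed
    then show ?thesis by simp
  qed
  finally have "emeasure (PiM V (\<lambda>_. ?L)) ?N = 0" by simp
  then have "?N \<in> null_sets (PiM V (\<lambda>_. ?L))" using N by auto
  then show ?thesis unfolding PM_def by (rule AE_I') auto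
qed

lemma measurable_PM_component [measurable (raw)]:
  assumes "g \<in> measurable N (PM V)" "i \<in> V"
  shows "(\<lambda>x. g x i) \<in> borel_measurable N"
proof -
  have "(\<lambda>x. x i) \<in> borel_measurable (PM V)"
    unfolding PM_def
    using measurable_component_singleton[OF assms(2), of "\<lambda>_. restrict_space lborel {0::real..}"]
      measurable_restrict_space1[of "\<lambda>x. x" lborel borel "{0::real..}"]
    by (auto intro: measurable_compose)
  then show ?thesis using assms(1) by (rule measurable_compose[rotated])
qed

lemma AE_PM_generic:
  assumes "finite V"
  shows "AE x in PM V. (\<forall>i\<in>V. 0 < x i) \<and> (\<forall>i\<in>V. \<forall>j\<in>V. i \<noteq> j \<longrightarrow> x i \<noteq> x j)"
proof -
  have "AE x in PM V. x i \<noteq> 0" if "i \<in> V" for i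
    by (rule AE_PM_component_neq[OF assms that]) auto
  then have "AE x in PM V. \<forall>i\<in>V. x i \<noteq> 0"
    using assms by (subst AE_ball_countable) (auto intro: countable_finite)
  moreover have "AE x in PM V. x i \<noteq> x j" if "i \<in> V" "j \<in> V - {i}" for i j
    by (rule AE_PM_component_neq[OF assms that(1)]) (use that in auto)
  then have "AE x in PM V. \<forall>i\<in>V. \<forall>j\<in>V - {i}. x i \<noteq> x j"
    using assms by (subst AE_ball_countable; (subst AE_ball_countable)?) (auto intro!: countable_finite)
  moreover have "AE x in PM V. x \<in> space (PM V)" by simp
  ultimately show ?thesis
  proof eventually_elim
    case (elim x)
    then have "\<forall>i\<in>V. 0 \<le> x i" by (auto simp: space_PM)
    then show ?case using elim by (auto simp: less_le)
  qed
qed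

section \<open>Open boxes and the sigma-algebra they generate\<close>

definition obox :: "'i set \<Rightarrow> ('i \<Rightarrow> real) \<Rightarrow> ('i \<Rightarrow> real) \<Rightarrow> ('i \<Rightarrow> real) set" where
  "obox V a b = {x \<in> space (PM V). \<forall>i\<in>V. a i < x i \<and> x i < b i}"

lemma obox_Int: "obox V a b \<inter> obox V c d = obox V (\<lambda>i. max (a i) (c i)) (\<lambda>i. min (b i) (d i))"
  by (auto simp: obox_def)

lemma obox_sets [measurable]: "finite V \<Longrightarrow> obox V a b \<in> sets (PM V)"
  unfolding obox_def by measurable

lemma emeasure_obox_finite:
  assumes "finite V" shows "emeasure (PM V) (obox V a b) < \<infinity>"
proof -
  let ?L = "restrict_space lborel {0::real..}"
  have "obox V a b \<subseteq> (\<Pi>\<^sub>E i\<in>V. {0..} \<inter> {a i..b i})"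
    by (auto simp: obox_def space_PM PiE_def Pi_def less_imp_le)
  moreover have s: "{0..} \<inter> {a i..b i} \<in> sets ?L" for i
    by (subst sets_restrict_space) auto
  ultimately have "emeasure (PM V) (obox V a b) \<le> emeasure (PM V) (\<Pi>\<^sub>E i\<in>V. {0..} \<inter> {a i..b i})"
    unfolding PM_def using assms by (intro emeasure_mono sets_PiM_I_finite) (auto simp: obox_def)
  also have "\<dots> = (\<Prod>i\<in>V. emeasure ?L ({0..} \<inter> {a i..b i}))"
    unfolding PM_def using assms s by (intro HL.emeasure_PiM) auto
  also have "\<dots> < \<infinity>"
  proof -
    have "emeasure ?L ({0..} \<inter> {a i..b i}) \<le> emeasure lborel {a i..b i}" for i
      by (subst emeasure_restrict_space) (auto intro!: emeasure_mono)
    then have "emeasure ?L ({0..} \<inter> {a i..b i}) < \<infinity>" for i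
      by (rule order.strict_trans1) (simp add: emeasure_lborel_Icc_eq)
    then have "\<forall>i\<in>V. emeasure ?L ({0..} \<inter> {a i..b i}) \<noteq> \<infinity>" by (metis less_irrefl)
    then have "(\<Prod>i\<in>V. emeasure ?L ({0..} \<inter> {a i..b i})) \<noteq> \<infinity>" using assms by (simp add: ennreal_prod_eq_top)
    then show ?thesis by (simp add: less_top)
  qed
  finally show ?thesis .
qed

text \<open>The product sigma-algebra is the smallest one that makes the coordinates measurable, and
  a half-space in one coordinate is a countable union of open boxes.\<close>

lemma sets_PM_eq_sigma_obox:
  assumes "finite V"
  shows "sets (PM V) \<subseteq> sigma_sets (space (PM V)) {obox V a b |a b. True}"
proof -
  let ?G = "{obox V a b |a b. True}" and ?\<Omega> = "space (PM V)"
  have G: "?G \<subseteq> Pow ?\<Omega>" by (auto simp: obox_def)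
  have coord: "(\<lambda>x. x i) \<in> borel_measurable (sigma ?\<Omega> ?G)" if "i \<in> V" for i
  proof (subst borel_measurable_iff_less, intro allI)
    fix t :: real
    have "{w \<in> space (sigma ?\<Omega> ?G). w i < t}
       = (\<Union>k::nat. obox V (\<lambda>j. -1) (\<lambda>j. if j = i then t else real k))" (is "?l = ?r")
    proof (intro set_eqI iffI)
      fix w assume w: "w \<in> ?l"
      then have wO: "w \<in> ?\<Omega>" and wt: "w i < t" using G by (auto simp: space_measure_of_conv)
      obtain k :: nat where k: "(\<Sum>j\<in>V. \<bar>w j\<bar>) < real k" using reals_Archimedean2 by blast
      have "w j < real k" if "j \<in> V" for j
      proof -
        have "\<bar>w j\<bar> \<le> (\<Sum>j\<in>V. \<bar>w j\<bar>)" using assms that by (intro member_le_sum) auto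
        then show ?thesis using k by linarith
      qed
      moreover have "0 \<le> w j" if "j \<in> V" for j using wO that by (auto simp: space_PM)
      then have "-1 < w j" if "j \<in> V" for j using that by (meson less_le_trans neg_less_0_iff_less zero_less_one)
      ultimately show "w \<in> ?r" using wO wt by (auto simp: obox_def)
    next
      fix w assume "w \<in> ?r" then show "w \<in> ?l"
        using that G by (auto simp: obox_def space_measure_of_conv)
    qed
    also have "\<dots> \<in> sets (sigma ?\<Omega> ?G)"
      using G by (intro sets.countable_UN) (auto simp: sets_measure_of)
    finally show "{w \<in> space (sigma ?\<Omega> ?G). w i < t} \<in> sets (sigma ?\<Omega> ?G)" .
  qed
  have sp: "space (sigma ?\<Omega> ?G) = ?\<Omega>" and st: "sets (sigma ?\<Omega> ?G) = sigma_sets ?\<Omega> ?G"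
    using G by (simp_all add: space_measure_of_conv sets_measure_of)
  have "(\<lambda>x. x) \<in> measurable (sigma ?\<Omega> ?G) (PiM V (\<lambda>_. restrict_space lborel {0::real..}))"
  proof (rule measurable_PiM_single')
    show "(\<lambda>x. x i) \<in> measurable (sigma ?\<Omega> ?G) (restrict_space lborel {0..})" if "i \<in> V" for i
    proof (rule measurable_restrict_space2)
      show "(\<lambda>x. x i) \<in> space (sigma ?\<Omega> ?G) \<rightarrow> {0..}" unfolding sp using that by (auto simp: space_PM)
      show "(\<lambda>x. x i) \<in> measurable (sigma ?\<Omega> ?G) lborel" using coord[OF that] by simp
    qed
    show "(\<lambda>\<omega> i. \<omega> i) \<in> space (sigma ?\<Omega> ?G) \<rightarrow> (\<Pi>\<^sub>E i\<in>V. space (restrict_space lborel {0::real..}))"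
      unfolding sp by (auto simp: space_PM space_restrict_space)
  qed
  then have m: "(\<lambda>x. x) \<in> measurable (sigma ?\<Omega> ?G) (PM V)" by (simp add: PM_def)
  show ?thesis
  proof
    fix A assume A: "A \<in> sets (PM V)"
    have "(\<lambda>x. x) -` A \<inter> ?\<Omega> \<in> sigma_sets ?\<Omega> ?G" using measurable_sets[OF m A] unfolding sp st .
    moreover have "(\<lambda>x. x) -` A \<inter> ?\<Omega> = A" using sets.sets_into_space[OF A] by auto
    ultimately show "A \<in> sigma_sets ?\<Omega> ?G" by simp
  qed
qed

lemma L2_tendsto_dominated:
  assumes s: "\<And>k. s k \<in> borel_measurable (Mn n)" and f: "f \<in> borel_measurable (Mn n)" and w: "L2 n w"
    and sw: "\<And>k. AE x in Mn n. \<bar>s k x\<bar> \<le> w x"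
    and lim: "AE x in Mn n. (\<lambda>k. s k x) \<longlonglongrightarrow> f x"
  shows "L2 n f" "(\<lambda>k. L2norm n (\<lambda>x. s k x - f x)) \<longlonglongrightarrow> 0"
proof -
  note [measurable] = s f
  have w': "sqint (Mn n) w" using w by (simp add: L2_sqint Mn_eq_PM)
  have "AE x in Mn n. \<forall>k. \<bar>s k x\<bar> \<le> w x" using sw by (simp add: AE_all_countable)
  then have fw: "AE x in Mn n. \<bar>f x\<bar> \<le> w x" using lim
  proof eventually_elim
    case (elim x)
    then have "(\<lambda>k. \<bar>s k x\<bar>) \<longlonglongrightarrow> \<bar>f x\<bar>" by (intro tendsto_rabs)
    then show ?case using elim by (intro LIMSEQ_le_const2[of "\<lambda>k. \<bar>s k x\<bar>"]) auto
  qed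
  then have "AE x in Mn n. \<bar>f x\<bar> \<le> \<bar>w x\<bar>" by (rule AE_mp) (auto intro!: AE_I2)
  then have "sqint (Mn n) f" by (rule sqint_bound[OF w' f])
  then show "L2 n f" by (simp add: L2_sqint Mn_eq_PM)
  have "(\<lambda>k. \<integral>x. (s k x - f x)^2 \<partial>Mn n) \<longlonglongrightarrow> (\<integral>x. 0 \<partial>Mn n)"
  proof (rule integral_dominated_convergence)
    show "integrable (Mn n) (\<lambda>x. 4 * (w x)^2)" using w' by (simp add: sqint_def)
    show "AE x in Mn n. (\<lambda>k. (s k x - f x)^2) \<longlonglongrightarrow> 0" using lim
    proof eventually_elim
      case (elim x)
      then have "(\<lambda>k. (s k x - f x)^2) \<longlonglongrightarrow> (f x - f x)^2" by (intro tendsto_intros)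
      then show ?case by simp
    qed
    show "AE x in Mn n. norm ((s k x - f x)^2) \<le> 4 * (w x)^2" for k
      using sw[of k] fw
    proof eventually_elim
      case (elim x)
      then have "\<bar>s k x - f x\<bar> \<le> \<bar>2 * w x\<bar>" by linarith
      then have "(s k x - f x)^2 \<le> (2 * w x)^2" by (simp add: abs_le_square_iff)
      then show ?case by (simp add: power_mult_distrib)
    qed
  qed measurable
  then have "(\<lambda>k. sqrt (\<integral>x. (s k x - f x)^2 \<partial>Mn n)) \<longlonglongrightarrow> sqrt 0" by (intro tendsto_real_sqrt) simp
  then show "(\<lambda>k. L2norm n (\<lambda>x. s k x - f x)) \<longlonglongrightarrow> 0" by (simp add: L2norm_def)
qed

text \<open>These boxes avoid the diagonals; they are the ones on which \<open>qBM_setting\<close>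
  prescribes the multiple integrals.\<close>

definition disjoint_box :: "nat \<Rightarrow> (nat \<Rightarrow> real) \<Rightarrow> (nat \<Rightarrow> real) \<Rightarrow> bool" where
  "disjoint_box n a b \<longleftrightarrow> (\<forall>i<n. 0 \<le> a i \<and> a i < b i) \<and>
     (\<forall>i<n. \<forall>j<n. i \<noteq> j \<longrightarrow> {a i<..<b i} \<inter> {a j<..<b j} = {})"

definition box_fun :: "nat \<Rightarrow> (nat \<Rightarrow> real) \<Rightarrow> (nat \<Rightarrow> real) \<Rightarrow> (nat \<Rightarrow> real) \<Rightarrow> real" where
  "box_fun n a b = (\<lambda>x. \<Prod>i<n. indicator {a i<..<b i} (x i))"

lemma box_fun_measurable [measurable]: "box_fun n a b \<in> borel_measurable (PM {..<n})"
  unfolding box_fun_def by measurable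

lemma box_fun_eq_indicator: "x \<in> space (PM {..<n}) \<Longrightarrow> box_fun n a b x = indicator (obox {..<n} a b) x"
  unfolding box_fun_def by (auto simp: indicator_def obox_def prod_zero_iff)

lemma L2_indicator:
  assumes "A \<in> sets (PM {..<n})" "emeasure (PM {..<n}) A < \<infinity>"
  shows "L2 n (indicator A)"
proof -
  have "(indicator A x :: real)^2 = indicator A x" for x by (simp add: indicator_def)
  then show ?thesis using assms unfolding L2_def Mn_eq_PM by simp
qed

lemma L2_box_fun: "L2 n (box_fun n a b)"
proof -
  have "integrable (PM {..<n}) (\<lambda>x. (indicator (obox {..<n} a b) x :: real)^2)"
    using L2_indicator[OF obox_sets emeasure_obox_finite] by (simp add: L2_def Mn_eq_PM)
  moreover have "integrable (PM {..<n}) (\<lambda>x. (box_fun n a b x)^2) \<longleftrightarrow>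
      integrable (PM {..<n}) (\<lambda>x. (indicator (obox {..<n} a b) x :: real)^2)"
    by (rule Bochner_Integration.integrable_cong[OF refl]) (simp add: box_fun_eq_indicator)
  ultimately show ?thesis by (simp add: L2_def Mn_eq_PM)
qed

text \<open>Almost every point has positive, pairwise distinct coordinates, and short enough
  intervals around them are disjoint. Rational end points and extensional functions make the family
  of boxes countable.\<close>

lemma AE_disjoint_box_cover:
  "AE x in PM {..<n}. \<exists>c\<in>{..<n} \<rightarrow>\<^sub>E \<rat>. \<exists>d\<in>{..<n} \<rightarrow>\<^sub>E \<rat>. disjoint_box n c d \<and> x \<in> obox {..<n} c d"
  using AE_PM_generic[OF finite_lessThan] AE_space
proof eventually_elim
  case (elim x)
  \<comment> \<open>At most each coordinate, which keeps the left ends nonnegative, and at most half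
    of each gap, which keeps the intervals apart. The element 1 makes the set nonempty for
    \<open>n = 0\<close>.\<close>
  define \<delta> where "\<delta> = Min (insert 1 (x ` {..<n} \<union> (\<lambda>(i,j). \<bar>x i - x j\<bar> / 2) ` {(i,j). i < n \<and> j < n \<and> i \<noteq> j}))"
  have fin: "finite {(i,j). i < n \<and> j < n \<and> i \<noteq> j}"
    by (rule finite_subset[of _ "{..<n} \<times> {..<n}"]) auto
  have \<delta>: "\<delta> > 0" "\<And>i. i < n \<Longrightarrow> \<delta> \<le> x i" "\<And>i j. i < n \<Longrightarrow> j < n \<Longrightarrow> i \<noteq> j \<Longrightarrow> \<delta> \<le> \<bar>x i - x j\<bar> / 2"
    using elim fin unfolding \<delta>_def
    by (force simp: Min_gr_iff, force intro!: Min_le, intro Min_le, force, force)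
  have "\<exists>c\<in>\<rat>. x i - \<delta> < c \<and> c < x i" "\<exists>d\<in>\<rat>. x i < d \<and> d < x i + \<delta>" for i
    using \<delta>(1) Rats_dense_in_real[of "x i - \<delta>" "x i"] Rats_dense_in_real[of "x i" "x i + \<delta>"] by auto
  then obtain c d where cd: "\<And>i. c i \<in> \<rat>" "\<And>i. x i - \<delta> < c i" "\<And>i. c i < x i"
     "\<And>i. d i \<in> \<rat>" "\<And>i. x i < d i" "\<And>i. d i < x i + \<delta>" by metis
  have "disjoint_box n (restrict c {..<n}) (restrict d {..<n})"
    unfolding disjoint_box_def
  proof (intro conjI allI impI)
    fix i assume "i < n"
    then show "0 \<le> restrict c {..<n} i" "restrict c {..<n} i < restrict d {..<n} i"
      using cd(2)[of i] cd(3)[of i] cd(5)[of i] \<delta>(2)[of i] by auto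
  next
    fix i j assume ij: "i < n" "j < n" "i \<noteq> j"
    then have "\<delta> \<le> \<bar>x i - x j\<bar> / 2" by (rule \<delta>(3))
    then have "d i \<le> c j \<or> d j \<le> c i"
      using cd(2)[of i] cd(6)[of i] cd(2)[of j] cd(6)[of j]
      by (cases "x i \<le> x j") (auto simp: abs_if split: if_splits)
    then show "{restrict c {..<n} i<..<restrict d {..<n} i} \<inter> {restrict c {..<n} j<..<restrict d {..<n} j} = {}"
      using ij by auto
  qed
  moreover have "x \<in> obox {..<n} (restrict c {..<n}) (restrict d {..<n})"
    using cd elim by (simp add: obox_def)
  ultimately show ?case using cd by (intro bexI[of _ "restrict c {..<n}"] bexI[of _ "restrict d {..<n}"]) auto
qed

text \<open>A property that is closed under linear combinations and limits passes from a fixed disjoint box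
  to its measurable subsets by a Dynkin argument, whose generator consists of all open boxes:
  the intersection of an open box with a disjoint one is again disjoint.\<close>

lemma L2_induct:
  assumes u: "L2 n u"
    and elem: "\<And>a b. disjoint_box n a b \<Longrightarrow> Q (box_fun n a b)"
    and add: "\<And>f g. L2 n f \<Longrightarrow> L2 n g \<Longrightarrow> Q f \<Longrightarrow> Q g \<Longrightarrow> Q (\<lambda>x. f x + g x)"
    and scale: "\<And>c f. L2 n f \<Longrightarrow> Q f \<Longrightarrow> Q (\<lambda>x. c * f x)"
    and lim: "\<And>s f. (\<And>k. L2 n (s k)) \<Longrightarrow> L2 n f \<Longrightarrow> (\<And>k. Q (s k)) \<Longrightarrow>
        (\<lambda>k. L2norm n (\<lambda>x. s k x - f x)) \<longlonglongrightarrow> 0 \<Longrightarrow> Q f"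
  shows "Q u"
proof -
  let ?M = "PM {..<n}"
  \<comment> \<open>Closure under limits, applied to a constant sequence, shows that
    \<open>Q\<close> respects almost everywhere equality.\<close>
  have cong: "Q g" if "L2 n f" "L2 n g" "Q f" "AE x in ?M. f x = g x" for f g
  proof (rule lim[of "\<lambda>_. f"])
    have "(\<integral>x. (f x - g x)^2 \<partial>Mn n) = (\<integral>x. 0 \<partial>Mn n)"
      unfolding Mn_eq_PM using that by (intro integral_cong_AE) (auto simp: L2_def Mn_eq_PM)
    then show "(\<lambda>k. L2norm n (\<lambda>x. f x - g x)) \<longlonglongrightarrow> 0" by (simp add: L2norm_def)
  qed (use that in auto)
  have dom: "Q f" if "\<And>k. L2 n (s k)" "f \<in> borel_measurable ?M" "L2 n w" "\<And>k. Q (s k)"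
      "\<And>k. AE x in ?M. \<bar>s k x\<bar> \<le> w x" "AE x in ?M. (\<lambda>k. s k x) \<longlonglongrightarrow> f x" for s f w
  proof (rule lim[of s])
    have *: "\<And>k. s k \<in> borel_measurable (Mn n)" using that(1) by (simp add: L2_def)
    note that' = that(2,5,6)[folded Mn_eq_PM]
    show "L2 n f" "(\<lambda>k. L2norm n (\<lambda>x. s k x - f x)) \<longlonglongrightarrow> 0"
      by (fact L2_tendsto_dominated[OF * that'(1) that(3) that'(2,3)])+
  qed (rule that)+
  have "disjoint_box n real (\<lambda>i. real i + 1)"
    unfolding disjoint_box_def
  proof (intro conjI allI impI)
    fix i j :: nat assume "i \<noteq> j"
    then have "real i + 1 \<le> real j \<or> real j + 1 \<le> real i" by linarith
    then show "{real i<..<real i + 1} \<inter> {real j<..<real j + 1} = {}" by auto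
  qed auto
  then have Q0: "Q (\<lambda>x. 0)"
    using scale[OF L2_box_fun elem, of real "\<lambda>i. real i + 1" 0] by simp
  have Qe: "Q (indicator {})"
  proof -
    have "(indicator {} :: (nat \<Rightarrow> real) \<Rightarrow> real) = (\<lambda>x. 0)" by (auto simp: fun_eq_iff)
    then show ?thesis using Q0 by (simp only:)
  qed
  have boxed: "Q (indicator (A \<inter> obox {..<n} c d))" if cd: "disjoint_box n c d" and A: "A \<in> sets ?M" for A c d
  proof -
    let ?R = "obox {..<n} c d"
    have fin: "emeasure ?M B < \<infinity>" if "B \<subseteq> ?R" for B
      by (rule le_less_trans[OF emeasure_mono[OF that obox_sets[OF finite_lessThan]] emeasure_obox_finite[OF finite_lessThan]])
    have L2i: "L2 n (indicator (B \<inter> ?R))" if "B \<in> sets ?M" for B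
      using that by (intro L2_indicator fin) auto
    let ?G = "{obox {..<n} a b |a b. True}"
    have sub: "sigma_sets (space ?M) ?G \<subseteq> sets ?M"
      by (rule sets.sigma_sets_subset) auto
    have "A \<in> sigma_sets (space ?M) ?G" using sets_PM_eq_sigma_obox[of "{..<n}"] A by auto
    then show ?thesis
    proof (induction A rule: sigma_sets_induct_disjoint[rotated 2, consumes 1, case_names basic empty compl union])
      show "Int_stable ?G"
        by (rule Int_stableI) (clarsimp simp only: obox_Int mem_Collect_eq, blast)
      show "?G \<subseteq> Pow (space ?M)" by (auto simp: obox_def)
      show "Q (indicator ({} \<inter> ?R))" using Q0 Qe by simp
    next
      fix A assume "A \<in> ?G"
      then obtain a b where A: "A = obox {..<n} a b" by auto
      let ?a = "\<lambda>i. max (a i) (c i)" and ?b = "\<lambda>i. min (b i) (d i)"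
      have eq: "A \<inter> ?R = obox {..<n} ?a ?b" by (simp add: A obox_Int)
      show "Q (indicator (A \<inter> ?R))"
      proof (cases "\<forall>i<n. ?a i < ?b i")
        case True
        have "{?a i<..<?b i} \<inter> {?a j<..<?b j} \<subseteq> {c i<..<d i} \<inter> {c j<..<d j}" for i j by auto
        then have "{?a i<..<?b i} \<inter> {?a j<..<?b j} = {}" if "i < n" "j < n" "i \<noteq> j" for i j
          using cd that unfolding disjoint_box_def by blast
        moreover have "0 \<le> ?a i" if "i < n" for i
          using cd that by (simp add: disjoint_box_def le_max_iff_disj)
        ultimately have "disjoint_box n ?a ?b"
          using True unfolding disjoint_box_def by blast
        from elem[OF this] show ?thesis
          by (rule cong[rotated 2]) (auto simp: eq box_fun_eq_indicator L2_box_fun intro!: L2_indicator emeasure_obox_finite)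
      next
        case False
        then obtain i where i: "i < n" "\<not> ?a i < ?b i" by blast
        have "A \<inter> ?R = {}"
        proof (rule ccontr)
          assume "A \<inter> ?R \<noteq> {}"
          then obtain x where "x \<in> obox {..<n} ?a ?b" unfolding eq by blast
          then have "?a i < x i" "x i < ?b i" using i(1) by (simp_all add: obox_def)
          then show False using i(2) by (meson less_trans)
        qed
        then show ?thesis using Q0 Qe by simp
      qed
    next
      fix A assume A: "A \<in> sigma_sets (space ?M) ?G" "Q (indicator (A \<inter> ?R))"
      then have As: "A \<in> sets ?M" using sub by auto
      have R: "Q (indicator ?R)"
        by (rule cong[OF L2_box_fun _ elem[OF cd]])
          (auto simp: box_fun_eq_indicator intro!: L2_indicator emeasure_obox_finite)
      have "indicator ((space ?M - A) \<inter> ?R) = (\<lambda>x. indicator ?R x + (-1) * (indicator (A \<inter> ?R) x :: real))"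
        by (auto simp: indicator_def fun_eq_iff obox_def)
      moreover have "L2 n (indicator ?R)" by (intro L2_indicator emeasure_obox_finite) auto
      moreover have "L2 n (\<lambda>x. (-1) * indicator (A \<inter> ?R) x)"
        using L2i[OF As] sqint_cmult by (simp only: L2_sqint)
      ultimately show "Q (indicator ((space ?M - A) \<inter> ?R))"
        using add[OF _ _ R scale[OF L2i[OF As] A(2), of "-1"]] by simp
    next
      \<comment> \<open>Finite unions follow by adding disjoint indicators; the indicator of the
        fixed box \<open>?R\<close> dominates their passage to the limit.\<close>
      fix A :: "nat \<Rightarrow> _" assume A: "disjoint_family A" "range A \<subseteq> sigma_sets (space ?M) ?G" "\<And>i. Q (indicator (A i \<inter> ?R))"
      then have As: "A i \<in> sets ?M" for i using sub by auto
      have part: "Q (indicator ((\<Union>i<k. A i) \<inter> ?R))" for k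
      proof (induction k)
        case 0
        then show ?case using Q0 Qe by simp
      next
        case (Suc k)
        have "A k \<inter> A i = {}" if "i < k" for i
          using disjoint_family_onD[OF A(1), of k i] that by auto
        then have "A k \<inter> (\<Union>i<k. A i) = {}" by blast
        then have "indicator ((\<Union>i<Suc k. A i) \<inter> ?R) = (\<lambda>x. indicator ((\<Union>i<k. A i) \<inter> ?R) x + (indicator (A k \<inter> ?R) x :: real))"
          by (auto simp: indicator_def fun_eq_iff lessThan_Suc)
        then show ?case using add[OF L2i L2i Suc A(3)] As by simp
      qed
      show "Q (indicator ((\<Union>i. A i) \<inter> ?R))"
      proof (rule dom[of "\<lambda>k. indicator ((\<Union>i<k. A i) \<inter> ?R)" _ "indicator ?R"])
        show "AE x in ?M. (\<lambda>k. indicator ((\<Union>i<k. A i) \<inter> ?R) x :: real) \<longlonglongrightarrow> indicator ((\<Union>i. A i) \<inter> ?R) x"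
        proof (rule AE_I2)
          fix x
          have "(\<Union>k. (\<Union>i<k. A i) \<inter> ?R) = (\<Union>i. A i) \<inter> ?R" by auto
          then show "(\<lambda>k. indicator ((\<Union>i<k. A i) \<inter> ?R) x :: real) \<longlonglongrightarrow> indicator ((\<Union>i. A i) \<inter> ?R) x"
            using LIMSEQ_indicator_incseq[of "\<lambda>k. (\<Union>i<k. A i) \<inter> ?R" x]
            by (force simp: incseq_def)
        qed
        show "L2 n (indicator ?R)" by (intro L2_indicator emeasure_obox_finite) auto
      qed (use As part L2i in \<open>auto simp: indicator_def\<close>)
    qed
  qed
  \<comment> \<open>A set of finite measure is covered, up to a null set, by countably many disjoint
    boxes in the sense of \<open>disjoint_box\<close>. They may overlap one another, so each
    contributes only what its predecessors left uncovered.\<close>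
  have fin: "Q (indicator A)" if A: "A \<in> sets ?M" and fA: "emeasure ?M A < \<infinity>" for A
  proof -
    let ?I = "{(c,d). c \<in> {..<n} \<rightarrow>\<^sub>E \<rat> \<and> d \<in> {..<n} \<rightarrow>\<^sub>E \<rat> \<and> disjoint_box n c d}"
    have cI: "countable ?I"
      by (rule countable_subset[of _ "({..<n} \<rightarrow>\<^sub>E \<rat>) \<times> ({..<n} \<rightarrow>\<^sub>E \<rat>)"])
         (auto intro!: countable_SIGMA countable_PiE countable_rat)
    define e where "e k = (if ?I = {} then (real, \<lambda>i. real i + 1) else from_nat_into ?I k)" for k :: nat
    have e: "disjoint_box n (fst (e k)) (snd (e k))" for k
    proof (cases "?I = {}")
      case True
      then show ?thesis using \<open>disjoint_box n real (\<lambda>i. real i + 1)\<close> by (simp add: e_def)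
    next
      case False
      then have "e k = from_nat_into ?I k" unfolding e_def by (rule if_not_P)
      then have "e k \<in> ?I" using from_nat_into[OF False, of k] by (simp only:)
      then show ?thesis by (simp add: case_prod_beta)
    qed
    have cover: "AE x in ?M. \<exists>k. x \<in> obox {..<n} (fst (e k)) (snd (e k))"
      using AE_disjoint_box_cover
    proof eventually_elim
      case (elim x)
      then obtain c d where cd: "(c,d) \<in> ?I" "x \<in> obox {..<n} c d" by blast
      from from_nat_into_surj[OF cI this(1)] obtain k where "from_nat_into ?I k = (c,d)" ..
      moreover have "?I \<noteq> {}" using cd(1) by (rule ex_in_conv[THEN iffD1, OF exI])
      ultimately have "e k = (c,d)" unfolding e_def by (simp only: if_False)
      then show ?case using cd(2) by (metis fst_conv snd_conv)
    qed
    let ?R = "\<lambda>k. obox {..<n} (fst (e k)) (snd (e k))"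
    have L2A: "L2 n (indicator B)" if "B \<subseteq> A" "B \<in> sets ?M" for B
      using that by (intro L2_indicator le_less_trans[OF emeasure_mono[OF that(1) A] fA])
    have part: "Q (indicator (A \<inter> (\<Union>i<k. ?R i)))" for k
    proof (induction k)
      case 0
      then show ?case using Q0 Qe by simp
    next
      case (Suc k)
      let ?B = "A - (\<Union>i<k. ?R i)"
      have "indicator (A \<inter> (\<Union>i<Suc k. ?R i)) = (\<lambda>x. indicator (A \<inter> (\<Union>i<k. ?R i)) x + (indicator (?B \<inter> ?R k) x :: real))"
        by (auto simp: indicator_def fun_eq_iff lessThan_Suc)
      moreover have "Q (\<lambda>x. indicator (A \<inter> (\<Union>i<k. ?R i)) x + (indicator (?B \<inter> ?R k) x :: real))"
        using A by (intro add Suc boxed e L2A) auto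
      ultimately show ?case by simp
    qed
    show ?thesis
    proof (rule dom[of "\<lambda>k. indicator (A \<inter> (\<Union>i<k. ?R i))" _ "indicator A"])
      show "AE x in ?M. (\<lambda>k. indicator (A \<inter> (\<Union>i<k. ?R i)) x :: real) \<longlonglongrightarrow> indicator A x"
        using cover
      proof eventually_elim
        case (elim x)
        then obtain k where k: "x \<in> ?R k" by auto
        have "\<forall>\<^sub>F m in sequentially. indicator (A \<inter> (\<Union>i<m. ?R i)) x = (indicator A x :: real)"
          using k by (auto intro!: eventually_sequentiallyI[of "Suc k"] simp: indicator_def)
        then show ?case by (rule tendsto_eventually)
      qed
    qed (use A part L2A in \<open>auto simp: indicator_def\<close>)
  qed
  have um: "u \<in> borel_measurable ?M" using u by (simp add: L2_def Mn_eq_PM)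
  obtain F where F0: "\<forall>i. simple_function ?M (F i)" "\<forall>x\<in>space ?M. (\<lambda>i. F i x) \<longlonglongrightarrow> u x"
      "\<forall>i. \<forall>x\<in>space ?M. dist (F i x) 0 \<le> 2 * dist (u x) 0"
    using borel_measurable_implies_sequence_metric[OF um, of 0] by blast
  have F: "\<And>i. simple_function ?M (F i)" "\<And>x. x \<in> space ?M \<Longrightarrow> (\<lambda>i. F i x) \<longlonglongrightarrow> u x"
      "\<And>i x. x \<in> space ?M \<Longrightarrow> \<bar>F i x\<bar> \<le> 2 * \<bar>u x\<bar>" using F0 by simp_all
  have w: "L2 n (\<lambda>x. 2 * \<bar>u x\<bar>)"
    using u by (auto simp: L2_def power_mult_distrib)
  have Fm: "F i \<in> borel_measurable ?M" for i using F(1) by (rule borel_measurable_simple_function)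
  have LF: "L2 n (F i)" for i
    using sqint_bound[OF w[unfolded L2_sqint] Fm[of i]] F(3)[of _ i] by (simp add: L2_sqint)
  have QF: "Q (F i)" for i
  proof -
    \<comment> \<open>The value 0 is left out because only the level sets of nonzero values have
      finite measure (Chebyshev's inequality in \<open>meas\<close>).\<close>
    let ?Y = "F i ` space ?M - {0}"
    have finY: "finite ?Y" using F(1)[of i] by (auto simp: simple_function_def)
    have S: "F i -` {y} \<inter> space ?M \<in> sets ?M" for y using simple_functionD(2)[OF F(1)] .
    have meas: "emeasure ?M (F i -` {y} \<inter> space ?M) < \<infinity>" if "y \<noteq> 0" for y
    proof -
      let ?B = "F i -` {y} \<inter> space ?M"
      have "ennreal (y^2) * emeasure ?M ?B = (\<integral>\<^sup>+x. ennreal (y^2) * indicator ?B x \<partial>?M)"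
        using S by (simp add: nn_integral_cmult_indicator)
      also have "\<dots> \<le> (\<integral>\<^sup>+x. ennreal ((F i x)^2) \<partial>?M)"
        by (intro nn_integral_mono) (auto simp: indicator_def)
      also have "\<dots> < \<infinity>" using LF[of i] by (simp add: L2_sqint sqint_iff_nn)
      finally have "ennreal (y^2) * emeasure ?M ?B < \<infinity>" .
      then show ?thesis using that by (auto simp: ennreal_mult_less_top)
    qed
    have LS: "L2 n (\<lambda>x. \<Sum>y\<in>Z. y * indicator (F i -` {y} \<inter> space ?M) x)" if "finite Z" "Z \<subseteq> ?Y" for Z
      unfolding L2_sqint using that S meas
      by (intro sqint_sum sqint_cmult L2_indicator[unfolded L2_sqint]) auto
    have "Q (\<lambda>x. \<Sum>y\<in>Z. y * indicator (F i -` {y} \<inter> space ?M) x)" if "finite Z" "Z \<subseteq> ?Y" for Z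
      using that
    proof (induction Z rule: finite_induct)
      case empty
      then show ?case using Q0 Qe by simp
    next
      case (insert y Z)
      have y: "L2 n (indicator (F i -` {y} \<inter> space ?M))" "Q (indicator (F i -` {y} \<inter> space ?M))"
        using S meas[of y] insert.prems by (auto intro!: L2_indicator fin)
      have "Q (\<lambda>x. y * indicator (F i -` {y} \<inter> space ?M) x + (\<Sum>y\<in>Z. y * indicator (F i -` {y} \<inter> space ?M) x))"
        using insert y by (intro add scale LS) (auto simp: L2_sqint sqint_cmult)
      then show ?case unfolding sum.insert[OF insert.hyps] .
    qed
    from this[OF finY subset_refl] show ?thesis
    proof (rule cong[OF LS[OF finY subset_refl] LF])
      show "AE x in ?M. (\<Sum>y\<in>?Y. y * indicator (F i -` {y} \<inter> space ?M) x) = F i x"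
      proof (rule AE_I2)
        fix x assume x: "x \<in> space ?M"
        have "(\<Sum>y\<in>?Y. y * indicator (F i -` {y} \<inter> space ?M) x) = (\<Sum>y\<in>?Y. if y = F i x then y else 0)"
          using x by (intro sum.cong) (auto simp: indicator_def)
        also have "\<dots> = F i x" using finY x by (auto simp: sum.delta)
        finally show "(\<Sum>y\<in>?Y. y * indicator (F i -` {y} \<inter> space ?M) x) = F i x" .
      qed
    qed
  qed
  show ?thesis
    by (rule dom[of F _ "\<lambda>x. 2 * \<bar>u x\<bar>"]) (use F LF QF w um in \<open>auto intro!: AE_I2\<close>)
qed

subsection \<open>Pairings and crossings\<close>

text \<open>General ground sets are needed because the points of two chosen blocks of a larger
  family form no initial segment.\<close>

definition pairings_on :: "nat set \<Rightarrow> nat set set set" where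
  "pairings_on S = {P. \<Union>P = S \<and> (\<forall>B\<in>P. card B = 2) \<and> (\<forall>B\<in>P. \<forall>C\<in>P. B \<noteq> C \<longrightarrow> B \<inter> C = {})}"

lemma pairings_eq: "pairings r = pairings_on {..<r}"
  by (simp add: pairings_def pairings_on_def)

lemma pairings_on_sub: "P \<in> pairings_on S \<Longrightarrow> B \<in> P \<Longrightarrow> B \<subseteq> S"
  and pairings_on_card: "P \<in> pairings_on S \<Longrightarrow> B \<in> P \<Longrightarrow> card B = 2"
  and pairings_on_disj: "P \<in> pairings_on S \<Longrightarrow> B \<in> P \<Longrightarrow> C \<in> P \<Longrightarrow> x \<in> B \<Longrightarrow> x \<in> C \<Longrightarrow> B = C"
  and pairings_on_cover: "P \<in> pairings_on S \<Longrightarrow> x \<in> S \<Longrightarrow> \<exists>B\<in>P. x \<in> B"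
  by (auto simp: pairings_on_def)

lemma pairings_onI:
  assumes "\<Union>P = S" "\<And>B. B \<in> P \<Longrightarrow> card B = 2"
    "\<And>B C x. B \<in> P \<Longrightarrow> C \<in> P \<Longrightarrow> x \<in> B \<Longrightarrow> x \<in> C \<Longrightarrow> B = C"
  shows "P \<in> pairings_on S"
  unfolding pairings_on_def using assms by (simp add: disjoint_iff) metis

lemma pairings_on_subset_Pow: "pairings_on S \<subseteq> Pow (Pow S)"
  by (auto simp: pairings_on_def)

lemma finite_pairings_on: "finite S \<Longrightarrow> finite (pairings_on S)"
  by (rule finite_subset[OF pairings_on_subset_Pow]) simp

lemma finite_pairing: "finite S \<Longrightarrow> P \<in> pairings_on S \<Longrightarrow> finite P"
  using pairings_on_subset_Pow by (metis PowD finite_Pow_iff finite_subset in_mono)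

lemma card_pairing:
  assumes "finite S" "P \<in> pairings_on S" shows "card S = 2 * card P"
proof -
  have "card S = (\<Sum>B\<in>P. card B)"
    using assms by (subst card_Union_disjoint[symmetric])
      (auto simp: pairings_on_def pairwise_def disjnt_def intro: card_ge_0_finite)
  also have "\<dots> = 2 * card P" using assms by (simp add: pairings_on_card)
  finally show ?thesis .
qed

definition blk :: "nat set set \<Rightarrow> nat \<Rightarrow> nat set" where
  "blk P x = (THE B. B \<in> P \<and> x \<in> B)"

lemma blk_eq: "P \<in> pairings_on S \<Longrightarrow> B \<in> P \<Longrightarrow> x \<in> B \<Longrightarrow> blk P x = B"
  unfolding blk_def by (rule the_equality) (auto dest: pairings_on_disj)

lemma blk_in: "P \<in> pairings_on S \<Longrightarrow> x \<in> S \<Longrightarrow> blk P x \<in> P"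
  and blk_mem: "P \<in> pairings_on S \<Longrightarrow> x \<in> S \<Longrightarrow> x \<in> blk P x"
  using pairings_on_cover blk_eq by metis+

lemma pair_Min_Max:
  fixes B :: "nat set"
  assumes "card B = 2"
  shows "B = {Min B, Max B}" "Min B < Max B"
proof -
  from assms obtain x y where B: "B = {x, y}" "x \<noteq> y" by (auto simp: card_2_iff)
  show "B = {Min B, Max B}" "Min B < Max B"
    using B by (auto simp: min_def max_def)
qed

lemma crosses_iff:
  assumes "card B = 2" "card C = 2"
  shows "crosses B C \<longleftrightarrow> Min B < Min C \<and> Min C < Max B \<and> Max B < Max C"
proof
  assume "crosses B C"
  then obtain x1 y1 x2 y2 where "B = {x1,y1}" "C = {x2,y2}" "x1 < x2" "x2 < y1" "y1 < y2"
    unfolding crosses_def by blast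
  then show "Min B < Min C \<and> Min C < Max B \<and> Max B < Max C" by (auto simp: min_def max_def)
next
  assume "Min B < Min C \<and> Min C < Max B \<and> Max B < Max C"
  then show "crosses B C"
    unfolding crosses_def using pair_Min_Max(1)[OF assms(1)] pair_Min_Max(1)[OF assms(2)] by blast
qed

text \<open>The diagrams of the diagram formula. For two blocks they are the bijections between the
  blocks.\<close>

definition bip :: "nat set \<Rightarrow> (nat \<Rightarrow> nat set) \<Rightarrow> nat set set set" where
  "bip J A = {P \<in> pairings_on (\<Union>j\<in>J. A j). \<forall>B\<in>P. \<forall>j\<in>J. \<not> B \<subseteq> A j}"

lemma bip_pairings: "P \<in> bip J A \<Longrightarrow> P \<in> pairings_on (\<Union>j\<in>J. A j)"
  by (simp add: bip_def)

text \<open>Whether two pairs cross is decided by the relative order of their four points, which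
  \<open>h\<close> preserves.\<close>

lemma Cr_image:
  assumes h: "strict_mono_on S h" and P: "P \<in> pairings_on S"
  shows "Cr ((`) h ` P) = Cr P"
proof -
  have inj: "inj_on h S" using h by (rule strict_mono_on_imp_inj_on)
  have lt: "h x < h y \<longleftrightarrow> x < y" if "x \<in> S" "y \<in> S" for x y
    using strict_mono_on_less[OF h that] .
  have injP: "inj_on ((`) h) P"
    using inj_on_image_Pow[OF inj] pairings_on_sub[OF P] by (auto intro: inj_on_subset)
  have cr: "crosses (h ` B) (h ` C) \<longleftrightarrow> crosses B C" if "B \<in> P" "C \<in> P" for B C
  proof -
    have S: "B \<subseteq> S" "C \<subseteq> S" using P that by (auto dest: pairings_on_sub)
    define x1 y1 x2 y2 where "x1 = Min B" "y1 = Max B" "x2 = Min C" "y2 = Max C"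
    then have BC: "B = {x1,y1}" "x1 < y1" "C = {x2,y2}" "x2 < y2"
      using pair_Min_Max[OF pairings_on_card[OF P that(1)]] pair_Min_Max[OF pairings_on_card[OF P that(2)]]
      by blast+
    have c2: "card (h ` B) = 2" "card (h ` C) = 2"
      using that pairings_on_card[OF P] by (simp_all add: card_image[OF inj_on_subset[OF inj S(1)]] card_image[OF inj_on_subset[OF inj S(2)]])
    have hl: "h x1 < h y1" "h x2 < h y2" using BC S lt by auto
    have "crosses (h ` B) (h ` C) \<longleftrightarrow> h x1 < h x2 \<and> h x2 < h y1 \<and> h y1 < h y2"
      unfolding crosses_iff[OF c2] using hl by (auto simp: BC min_def max_def)
    also have "\<dots> \<longleftrightarrow> x1 < x2 \<and> x2 < y1 \<and> y1 < y2" using S lt by (simp add: BC)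
    also have "\<dots> \<longleftrightarrow> crosses B C"
      using that pairings_on_card[OF P] BC by (subst crosses_iff) (auto simp: min_def max_def)
    finally show ?thesis .
  qed
  have "{(B, C). B \<in> (`) h ` P \<and> C \<in> (`) h ` P \<and> crosses B C}
      = map_prod ((`) h) ((`) h) ` {(B, C). B \<in> P \<and> C \<in> P \<and> crosses B C}"
    using cr by (auto simp: image_iff map_prod_def split: prod.splits)
  moreover have "inj_on (map_prod ((`) h) ((`) h)) {(B, C). B \<in> P \<and> C \<in> P \<and> crosses B C}"
    using injP by (intro inj_on_subset[OF map_prod_inj_on[OF injP injP]]) auto
  ultimately show ?thesis unfolding Cr_def by (simp add: card_image)
qed

lemma pairings_on_image:
  assumes inj: "inj_on h S" and P: "P \<in> pairings_on S"
  shows "(`) h ` P \<in> pairings_on (h ` S)"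
proof -
  have "card (h ` B) = 2" if "B \<in> P" for B
    using inj_on_subset[OF inj pairings_on_sub[OF P that]] pairings_on_card[OF P that] by (simp add: card_image)
  moreover have "h ` B \<inter> h ` C = {}" if "B \<in> P" "C \<in> P" "h ` B \<noteq> h ` C" for B C
  proof -
    have "B \<noteq> C" using that by auto
    then have "B \<inter> C = {}" using P that by (auto simp: pairings_on_def)
    then show ?thesis
      using inj_on_image_Int[OF inj pairings_on_sub[OF P that(1)] pairings_on_sub[OF P that(2)]] by simp
  qed
  moreover have "\<Union>((`) h ` P) = h ` S" using P by (auto simp: pairings_on_def)
  ultimately show ?thesis by (auto simp: pairings_on_def)
qed

lemma bij_betw_pairings_on_image:
  assumes inj: "inj_on h S"
  shows "bij_betw (\<lambda>P. (`) h ` P) (pairings_on S) (pairings_on (h ` S))"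
proof (rule bij_betw_byWitness[where f' = "\<lambda>P. (`) (inv_into S h) ` P"])
  have inj': "inj_on (inv_into S h) (h ` S)" by (simp add: inj_on_inv_into)
  have S': "inv_into S h ` h ` S = S" using inj by simp
  show "\<forall>P\<in>pairings_on S. (`) (inv_into S h) ` (`) h ` P = P"
  proof
    fix P assume P: "P \<in> pairings_on S"
    have "inv_into S h ` h ` B = B" if "B \<in> P" for B
      using inj pairings_on_sub[OF P that] by (rule inv_into_image_cancel)
    then show "(`) (inv_into S h) ` (`) h ` P = P" by (simp add: image_image cong: image_cong)
  qed
  show "\<forall>P\<in>pairings_on (h ` S). (`) h ` (`) (inv_into S h) ` P = P"
  proof
    fix P assume P: "P \<in> pairings_on (h ` S)"
    have "h ` inv_into S h ` B = B" if "B \<in> P" for B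
      using pairings_on_sub[OF P that] by (metis image_inv_into_cancel)
    then show "(`) h ` (`) (inv_into S h) ` P = P" by (simp add: image_image cong: image_cong)
  qed
  show "(\<lambda>P. (`) h ` P) ` pairings_on S \<subseteq> pairings_on (h ` S)"
    using pairings_on_image[OF inj] by auto
  show "(\<lambda>P. (`) (inv_into S h) ` P) ` pairings_on (h ` S) \<subseteq> pairings_on S"
    using pairings_on_image[OF inj'] by (auto simp: S')
qed

lemma bij_betw_bip_image:
  assumes inj: "inj_on h (\<Union>j\<in>J. A j)"
  shows "bij_betw (\<lambda>P. (`) h ` P) (bip J A) (bip J (\<lambda>j. h ` A j))"
proof -
  let ?S = "\<Union>j\<in>J. A j"
  have b: "bij_betw (\<lambda>P. (`) h ` P) (pairings_on ?S) (pairings_on (\<Union>j\<in>J. h ` A j))"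
    using bij_betw_pairings_on_image[OF inj] by (simp add: image_UN)
  have iff: "h ` B \<subseteq> h ` A j \<longleftrightarrow> B \<subseteq> A j" if "B \<subseteq> ?S" "j \<in> J" for B j
    using inj_on_image_subset_iff[OF inj that(1), of "A j"] that(2) by blast
  have eq: "(\<forall>B\<in>(`) h ` P. \<forall>j\<in>J. \<not> B \<subseteq> h ` A j) \<longleftrightarrow> (\<forall>B\<in>P. \<forall>j\<in>J. \<not> B \<subseteq> A j)"
    if "P \<in> pairings_on ?S" for P
    using iff pairings_on_sub[OF that] by simp
  have "(\<lambda>P. (`) h ` P) ` bip J A = bip J (\<lambda>j. h ` A j)"
  proof
    show "(\<lambda>P. (`) h ` P) ` bip J A \<subseteq> bip J (\<lambda>j. h ` A j)"
      using b eq by (auto simp: bip_def bij_betw_def)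
    show "bip J (\<lambda>j. h ` A j) \<subseteq> (\<lambda>P. (`) h ` P) ` bip J A"
    proof
      fix P' assume P': "P' \<in> bip J (\<lambda>j. h ` A j)"
      then obtain P where P: "P \<in> pairings_on ?S" "P' = (`) h ` P"
      proof -
        have "P' \<in> (\<lambda>P. (`) h ` P) ` pairings_on ?S"
          using P' b unfolding bip_def bij_betw_def by simp
        then show ?thesis using that by auto
      qed
      then have "P \<in> bip J A" using P' eq[OF P(1)] by (simp add: bip_def)
      then show "P' \<in> (\<lambda>P. (`) h ` P) ` bip J A" using P by blast
    qed
  qed
  moreover have "inj_on (\<lambda>P. (`) h ` P) (bip J A)"
    using b by (auto simp: bij_betw_def bip_def intro: inj_on_subset)
  ultimately show ?thesis by (simp add: bij_betw_def)
qed

text \<open>The q-factorial of \<open>m\<close>: a diagram between two consecutive blocks is a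
  permutation, and its crossings correspond to inversions. It is the factor between the ordinary
  inner product of symmetric functions and \<open>qip\<close>.\<close>

definition Kq :: "real \<Rightarrow> nat \<Rightarrow> real" where
  "Kq q m = (\<Sum>P\<in>bip {..<2} (\<lambda>j. {j*m..<j*m+m}). q ^ Cr P)"

definition separated :: "nat set \<Rightarrow> (nat \<Rightarrow> nat set) \<Rightarrow> bool" where
  "separated J A \<longleftrightarrow> (\<forall>j\<in>J. finite (A j)) \<and> (\<forall>j\<in>J. \<forall>k\<in>J. j < k \<longrightarrow> (\<forall>x\<in>A j. \<forall>y\<in>A k. x < y))"

lemma separatedD: "separated J A \<Longrightarrow> j \<in> J \<Longrightarrow> k \<in> J \<Longrightarrow> x \<in> A j \<Longrightarrow> y \<in> A k \<Longrightarrow> j < k \<Longrightarrow> x < y"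
  unfolding separated_def by blast

lemma separated_less_iff:
  "separated J A \<Longrightarrow> j \<in> J \<Longrightarrow> k \<in> J \<Longrightarrow> j \<noteq> k \<Longrightarrow> x \<in> A j \<Longrightarrow> y \<in> A k \<Longrightarrow> x < y \<longleftrightarrow> j < k"
  by (meson less_asym linorder_neqE_nat separatedD)

lemma separated_unique: "separated J A \<Longrightarrow> j \<in> J \<Longrightarrow> k \<in> J \<Longrightarrow> x \<in> A j \<Longrightarrow> x \<in> A k \<Longrightarrow> j = k"
  by (meson less_irrefl linorder_neqE_nat separatedD)

lemma separated_subset: "separated J A \<Longrightarrow> J' \<subseteq> J \<Longrightarrow> separated J' A"
  unfolding separated_def by blast

text \<open>The increasing enumerations of the two blocks, put one after the other, form an order
  isomorphism from the standard blocks of \<open>Kq\<close>; it respects blocks and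
  crossings.\<close>

lemma sum_bip_two:
  assumes sep: "separated {l, m} A" and lm: "l < m" and c: "card (A l) = k" "card (A m) = k"
  shows "(\<Sum>P\<in>bip {l, m} A. q ^ Cr P) = Kq q k"
proof -
  have fin: "finite (A l)" "finite (A m)" using sep by (auto simp: separated_def)
  obtain h0 where h0: "bij_betw h0 {..<k} (A l)" "strict_mono_on {..<k} h0"
    using ex_bij_betw_strict_mono_card[OF fin(1)] c by auto
  obtain h1 where h1: "bij_betw h1 {..<k} (A m)" "strict_mono_on {..<k} h1"
    using ex_bij_betw_strict_mono_card[OF fin(2)] c by auto
  define h where "h x = (if x < k then h0 x else h1 (x - k))" for x
  define A' where "A' j = {j*k..<j*k+k}" for j :: nat
  have A'0: "A' 0 = {..<k}" and A'1: "A' 1 = {k..<k+k}" by (auto simp: A'_def)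
  have im0: "h ` A' 0 = A l"
    unfolding A'0 using h0(1) by (auto simp: h_def bij_betw_def)
  have im1: "h ` A' 1 = A m"
  proof -
    have "h ` A' 1 = h1 ` ((\<lambda>x. x - k) ` {k..<k+k})" unfolding A'1 by (auto simp: h_def image_image)
    also have "(\<lambda>x. x - k) ` {k..<k+k} = {..<k}"
    proof -
      have "i \<in> (\<lambda>x. x - k) ` {k..<k+k}" if "i < k" for i
        using that by (intro image_eqI[of _ _ "i + k"]) auto
      then show ?thesis by auto
    qed
    finally show ?thesis using h1(1) by (simp add: bij_betw_def)
  qed
  have U: "(\<Union>j\<in>{..<2}. A' j) = {..<k+k}"
    using A'0 A'1 by (auto simp: numeral_2_eq_2 lessThan_Suc)
  have mono: "strict_mono_on {..<k+k} h"
  proof (rule strict_mono_onI)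
    fix x y assume xy: "x \<in> {..<k+k}" "y \<in> {..<k+k}" "x < y"
    consider "y < k" | "x < k" "k \<le> y" | "k \<le> x" using xy by linarith
    then show "h x < h y"
    proof cases
      case 1
      then show ?thesis using xy strict_mono_onD[OF h0(2)] by (simp add: h_def)
    next
      case 2
      then have "h x \<in> A l" "h y \<in> A m"
        using im0 im1 xy A'0 A'1 by (auto simp: atLeastLessThan_def)
      then show ?thesis using separatedD[OF sep _ _ _ _ lm] by auto
    next
      case 3
      then show ?thesis using xy strict_mono_onD[OF h1(2), of "x - k" "y - k"] by (auto simp: h_def)
    qed
  qed
  then have inj: "inj_on h (\<Union>j\<in>{..<2}. A' j)" unfolding U by (rule strict_mono_on_imp_inj_on)
  have bip_eq: "bip {..<2} (\<lambda>j. h ` A' j) = bip {l, m} A"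
    using im0 im1 by (auto simp: bip_def numeral_2_eq_2 lessThan_Suc Un_commute)
  have "Kq q k = (\<Sum>P\<in>bip {..<2} A'. q ^ Cr ((`) h ` P))"
    unfolding Kq_def A'_def[symmetric]
  proof (rule sum.cong[OF refl])
    fix P assume "P \<in> bip {..<2} A'"
    then have "P \<in> pairings_on {..<k+k}" using U by (auto simp: bip_def)
    from Cr_image[OF mono this] show "q ^ Cr P = q ^ Cr ((`) h ` P)" by simp
  qed
  also have "\<dots> = (\<Sum>P\<in>bip {l, m} A. q ^ Cr P)"
    using sum.reindex_bij_betw[OF bij_betw_bip_image[OF inj], of "\<lambda>P. q ^ Cr P"] by (simp add: bip_eq)
  finally show ?thesis by simp
qed

subsection \<open>Pairings that join whole blocks\<close>

definition oset :: "nat \<Rightarrow> (nat \<Rightarrow> nat set) \<Rightarrow> nat set \<Rightarrow> nat set" where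
  "oset r A B = {j. j < r \<and> B \<inter> A j \<noteq> {}}"

text \<open>The diagrams that project to \<open>Q\<close> when every point is replaced by its block.
  For a pairing \<open>Q\<close> these are the diagrams in which each block is linked to exactly one
  other.\<close>

definition over :: "nat \<Rightarrow> (nat \<Rightarrow> nat set) \<Rightarrow> nat set set \<Rightarrow> nat set set set" where
  "over r A Q = {P \<in> bip {..<r} A. oset r A ` P = Q}"

lemma bip_pairE:
  assumes sep: "separated {..<r} A" and P: "P \<in> bip {..<r} A" and B: "B \<in> P"
  obtains j k x y where "j < k" "k < r" "x \<in> A j" "y \<in> A k" "x < y" "B = {x, y}" "oset r A B = {j, k}"
proof -
  define x y where "x = Min B" "y = Max B"
  then have Bxy: "B = {x,y}" "x < y"
    using pair_Min_Max[OF pairings_on_card[OF bip_pairings[OF P] B]] by auto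
  then obtain j k where jk: "j < r" "x \<in> A j" "k < r" "y \<in> A k"
    using pairings_on_sub[OF bip_pairings[OF P] B] by auto
  have "j \<noteq> k" using P B jk Bxy by (auto simp: bip_def)
  then have "j < k" using separated_less_iff[OF sep, of j k x y] jk Bxy by auto
  moreover have "oset r A B = {j, k}"
  proof (intro subset_antisym subsetI)
    fix i assume "i \<in> oset r A B"
    then have "i < r" "x \<in> A i \<or> y \<in> A i" by (auto simp: oset_def Bxy)
    then show "i \<in> {j, k}"
      using jk separated_unique[OF sep, of i j x] separated_unique[OF sep, of i k y] by auto
  next
    fix i assume "i \<in> {j, k}"
    then show "i \<in> oset r A B" using jk by (auto simp: oset_def Bxy)
  qed
  ultimately show ?thesis using that jk Bxy by blast
qed

lemma over_pairings:
  assumes sep: "separated {..<r} A" and ne: "\<And>j. j < r \<Longrightarrow> A j \<noteq> {}"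
    and P: "P \<in> bip {..<r} A"
    and perf: "\<And>B B' j. B \<in> P \<Longrightarrow> B' \<in> P \<Longrightarrow> j \<in> oset r A B \<Longrightarrow> j \<in> oset r A B' \<Longrightarrow> oset r A B = oset r A B'"
  shows "oset r A ` P \<in> pairings_on {..<r}"
proof -
  have "\<Union>(oset r A ` P) = {..<r}"
  proof
    show "\<Union>(oset r A ` P) \<subseteq> {..<r}" by (auto simp: oset_def)
    show "{..<r} \<subseteq> \<Union>(oset r A ` P)"
    proof
      fix j assume j: "j \<in> {..<r}"
      then obtain x where x: "x \<in> A j" using ne by auto
      then obtain B where "B \<in> P" "x \<in> B" using pairings_on_cover[OF bip_pairings[OF P], of x] j by auto
      then show "j \<in> \<Union>(oset r A ` P)" using x j by (auto simp: oset_def)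
    qed
  qed
  moreover have "card (oset r A B) = 2" if "B \<in> P" for B
    by (rule bip_pairE[OF sep P that]) auto
  moreover have "C = D" if "C \<in> oset r A ` P" "D \<in> oset r A ` P" "j \<in> C" "j \<in> D" for C D j
    using that perf by blast
  ultimately show ?thesis by (intro pairings_onI) auto
qed

lemma finite_bip: "finite J \<Longrightarrow> (\<And>j. j \<in> J \<Longrightarrow> finite (A j)) \<Longrightarrow> finite (bip J A)"
  unfolding bip_def by (rule finite_subset[OF _ finite_pairings_on[of "\<Union>j\<in>J. A j"]]) auto

text \<open>Each pair has exactly one point in either block, so \<open>blk P\<close> is a bijection
  from each of the blocks onto \<open>P\<close>.\<close>

lemma bip_two_card:
  assumes sep: "separated {l, m} A" and lm: "l < m" and P: "P \<in> bip {l, m} A"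
  shows "card P = card (A l)" "card (A l) = card (A m)"
proof -
  have pr: "P \<in> pairings_on (A l \<union> A m)" using P by (auto simp: bip_def)
  have one: "\<exists>x\<in>A l. \<exists>y\<in>A m. B = {x, y}" if "B \<in> P" for B
  proof -
    have "\<not> B \<subseteq> A l" "\<not> B \<subseteq> A m" using P that by (auto simp: bip_def)
    then show ?thesis
      using pair_Min_Max(1)[OF pairings_on_card[OF pr that]] pairings_on_sub[OF pr that]
      by (metis Un_iff empty_subsetI insert_commute insert_subset)
  qed
  have dis: "A l \<inter> A m = {}" using separated_unique[OF sep] lm by blast
  have b: "bij_betw (blk P) (A j) P" if j: "j \<in> {l, m}" for j
  proof (rule bij_betw_imageI)
    show "inj_on (blk P) (A j)"
    proof (rule inj_onI)
      fix x y assume xy: "x \<in> A j" "y \<in> A j" "blk P x = blk P y"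
      then have B: "blk P x \<in> P" "x \<in> blk P x" "y \<in> blk P x"
        using blk_in[OF pr] blk_mem[OF pr] j by auto
      from one[OF B(1)] B(2,3) show "x = y" using xy j dis by auto
    qed
    show "blk P ` A j = P"
    proof
      show "blk P ` A j \<subseteq> P" using blk_in[OF pr] j by auto
      show "P \<subseteq> blk P ` A j"
      proof
        fix B assume B: "B \<in> P"
        then obtain x where "x \<in> A j" "x \<in> B" using one j by blast
        then show "B \<in> blk P ` A j" using blk_eq[OF pr B] by (intro image_eqI[of _ _ x]) auto
      qed
    qed
  qed
  show "card P = card (A l)" "card (A l) = card (A m)"
    using bij_betw_same_card[OF b[of l]] bij_betw_same_card[OF b[of m]] by auto
qed

lemma over_restrict:
  assumes Q: "Q \<in> pairings_on {..<r}" and P: "P \<in> over r A Q" and C: "C \<in> Q"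
  shows "{B\<in>P. oset r A B = C} \<in> bip C A"
proof -
  have Pb: "P \<in> bip {..<r} A" and PQ: "oset r A ` P = Q" using P by (auto simp: over_def)
  note pr = bip_pairings[OF Pb]
  have Cr: "C \<subseteq> {..<r}" using pairings_on_sub[OF Q C] .
  have "\<Union>{B\<in>P. oset r A B = C} = (\<Union>j\<in>C. A j)"
  proof
    show "\<Union>{B\<in>P. oset r A B = C} \<subseteq> (\<Union>j\<in>C. A j)"
    proof
      fix x assume "x \<in> \<Union>{B\<in>P. oset r A B = C}"
      then obtain B where B: "B \<in> P" "oset r A B = C" "x \<in> B" by auto
      then obtain j where "j < r" "x \<in> A j" using pairings_on_sub[OF pr B(1)] by auto
      then have "j \<in> oset r A B" using B(3) by (auto simp: oset_def)
      then show "x \<in> (\<Union>j\<in>C. A j)" using B(2) \<open>x \<in> A j\<close> by auto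
    qed
    show "(\<Union>j\<in>C. A j) \<subseteq> \<Union>{B\<in>P. oset r A B = C}"
    proof
      fix x assume "x \<in> (\<Union>j\<in>C. A j)"
      then obtain j where j: "j \<in> C" "x \<in> A j" by auto
      then obtain B where B: "B \<in> P" "x \<in> B" using pairings_on_cover[OF pr, of x] Cr by auto
      then have "j \<in> oset r A B" using j Cr by (auto simp: oset_def)
      moreover have "oset r A B \<in> Q" using B PQ by auto
      ultimately have "oset r A B = C" using pairings_on_disj[OF Q] C j by blast
      then show "x \<in> \<Union>{B\<in>P. oset r A B = C}" using B by auto
    qed
  qed
  moreover have "\<not> B \<subseteq> A j" if "B \<in> P" "j \<in> C" for B j using Pb that Cr by (auto simp: bip_def)
  moreover have "{B\<in>P. oset r A B = C} \<in> pairings_on (\<Union>j\<in>C. A j)"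
    by (rule pairings_onI) (use calculation(1) pairings_on_card[OF pr] pairings_on_disj[OF pr] in auto)
  ultimately show ?thesis unfolding bip_def by blast
qed

text \<open>The inverse of cutting a diagram over \<open>Q\<close> into its parts over the single
  \<open>C\<close>: arbitrary bijections, one for each pair of blocks, can be combined freely. An
  empty block would leave its \<open>C\<close> without any pair, hence \<open>ne\<close>.\<close>

lemma over_glue:
  assumes sep: "separated {..<r} A" and Q: "Q \<in> pairings_on {..<r}"
    and ne: "\<And>j. j < r \<Longrightarrow> A j \<noteq> {}"
    and f: "\<And>C. C \<in> Q \<Longrightarrow> f C \<in> bip C A"
  shows "(\<Union>C\<in>Q. f C) \<in> over r A Q" "\<And>C B. C \<in> Q \<Longrightarrow> B \<in> f C \<Longrightarrow> oset r A B = C"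
proof -
  have Cr: "C \<subseteq> {..<r}" if "C \<in> Q" for C using pairings_on_sub[OF Q that] .
  have fp: "f C \<in> pairings_on (\<Union>j\<in>C. A j)" if "C \<in> Q" for C using bip_pairings[OF f[OF that]] .
  show os: "oset r A B = C" if CB: "C \<in> Q" "B \<in> f C" for C B
  proof
    show "oset r A B \<subseteq> C"
    proof
      fix j assume "j \<in> oset r A B"
      then obtain x where x: "x \<in> B" "x \<in> A j" "j < r" by (auto simp: oset_def)
      then obtain k where "k \<in> C" "x \<in> A k" using pairings_on_sub[OF fp[OF CB(1)] CB(2)] by auto
      then show "j \<in> C" using separated_unique[OF sep, of j k x] x Cr[OF CB(1)] by auto
    qed
    show "C \<subseteq> oset r A B"
    proof
      fix j assume j: "j \<in> C"
      obtain k where k: "k \<in> C" "C = {j, k}"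
        using pairings_on_card[OF Q CB(1)] j by (auto simp: card_2_iff)
      have "\<not> B \<subseteq> A k" "B \<subseteq> A j \<union> A k"
        using f[OF CB(1)] CB(2) k pairings_on_sub[OF fp[OF CB(1)] CB(2)] by (auto simp: bip_def)
      then show "j \<in> oset r A B" using j Cr[OF CB(1)] by (auto simp: oset_def)
    qed
  qed
  have "\<Union>(f C) = (\<Union>j\<in>C. A j)" if "C \<in> Q" for C using fp[OF that] by (simp add: pairings_on_def)
  then have "(\<Union>C\<in>Q. \<Union>(f C)) = (\<Union>C\<in>Q. \<Union>j\<in>C. A j)" by (rule SUP_cong[OF refl])
  moreover have "\<Union>(\<Union>C\<in>Q. f C) = (\<Union>C\<in>Q. \<Union>(f C))" by blast
  ultimately have "\<Union>(\<Union>C\<in>Q. f C) = (\<Union>C\<in>Q. \<Union>j\<in>C. A j)" by (rule trans[rotated])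
  also have "\<dots> = (\<Union>j\<in>\<Union>Q. A j)" by auto
  finally have "\<Union>(\<Union>C\<in>Q. f C) = (\<Union>j\<in>\<Union>Q. A j)" .
  moreover have UQ: "\<Union>Q = {..<r}" using Q by (simp add: pairings_on_def)
  ultimately have U: "\<Union>(\<Union>C\<in>Q. f C) = (\<Union>j\<in>{..<r}. A j)" by (simp only: UQ)
  have dis: "B \<inter> B' = {}" if h: "C \<in> Q" "B \<in> f C" "C' \<in> Q" "B' \<in> f C'" "B \<noteq> B'" for B B' C C'
  proof (cases "C = C'")
    case True
    then show ?thesis using fp[OF h(1)] h by (auto simp: pairings_on_def)
  next
    case False
    then have "C \<inter> C' = {}" using Q h unfolding pairings_on_def by blast
    show ?thesis
    proof (rule ccontr)
      assume "B \<inter> B' \<noteq> {}"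
      then obtain x where x: "x \<in> B" "x \<in> B'" by auto
      obtain j where j: "j \<in> C" "x \<in> A j" using pairings_on_sub[OF fp[OF h(1)] h(2)] x by auto
      obtain k where k: "k \<in> C'" "x \<in> A k" using pairings_on_sub[OF fp[OF h(3)] h(4)] x by auto
      have "j = k" using j k Cr[OF h(1)] Cr[OF h(3)] separated_unique[OF sep, of j k x] by auto
      then show False using \<open>C \<inter> C' = {}\<close> j k by auto
    qed
  qed
  have c2: "card B = 2" if "C \<in> Q" "B \<in> f C" for B C using fp[OF that(1)] that(2) by (rule pairings_on_card)
  have P: "(\<Union>C\<in>Q. f C) \<in> pairings_on (\<Union>j\<in>{..<r}. A j)"
  proof (rule pairings_onI[OF U])
    fix B assume "B \<in> (\<Union>C\<in>Q. f C)"
    then show "card B = 2" using c2 by auto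
  next
    fix B B' x assume "B \<in> (\<Union>C\<in>Q. f C)" "B' \<in> (\<Union>C\<in>Q. f C)" "x \<in> B" "x \<in> B'"
    then obtain C C' where "C \<in> Q" "B \<in> f C" "C' \<in> Q" "B' \<in> f C'" "B \<inter> B' \<noteq> {}" by auto
    then show "B = B'" using dis by metis
  qed
  have ni: "\<not> B \<subseteq> A j" if h: "C \<in> Q" "B \<in> f C" "j < r" for B C j
  proof
    assume "B \<subseteq> A j"
    moreover obtain k k' where "C = {k,k'}" "k \<noteq> k'" using pairings_on_card[OF Q h(1)] by (auto simp: card_2_iff)
    ultimately show False using os[OF h(1,2)] separated_unique[OF sep, of k j] separated_unique[OF sep, of k' j] h(3)
      by (auto simp: oset_def) blast
  qed
  have "oset r A ` (\<Union>C\<in>Q. f C) = Q"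
  proof
    show "oset r A ` (\<Union>C\<in>Q. f C) \<subseteq> Q" using os by auto
    show "Q \<subseteq> oset r A ` (\<Union>C\<in>Q. f C)"
    proof
      fix C assume C: "C \<in> Q"
      then obtain j where j: "j \<in> C" using pairings_on_card[OF Q C] by fastforce
      then obtain x where "x \<in> A j" using ne Cr[OF C] by blast
      then obtain B where "B \<in> f C" using pairings_on_cover[OF fp[OF C], of x] j by auto
      then show "C \<in> oset r A ` (\<Union>C\<in>Q. f C)" using os[OF C] C by blast
    qed
  qed
  then show "(\<Union>C\<in>Q. f C) \<in> over r A Q" using P ni by (auto simp: over_def bip_def)
qed

text \<open>Crossings inside one \<open>C\<close> are counted separately. Since the blocks follow
  one another, a pair over \<open>C\<close> crosses a pair over another \<open>D\<close> exactly
  when \<open>C\<close> and \<open>D\<close> cross as pairs of blocks; then all pairs over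
  \<open>C\<close> cross all pairs over \<open>D\<close>.\<close>

lemma Cr_over:
  assumes sep: "separated {..<r} A" and Q: "Q \<in> pairings_on {..<r}" and P: "P \<in> over r A Q"
  shows "Cr P = (\<Sum>C\<in>Q. Cr {B\<in>P. oset r A B = C})
      + (\<Sum>(C, D)\<in>{(C, D). C \<in> Q \<and> D \<in> Q \<and> crosses C D}. card (A (Min C)) * card (A (Min D)))"
proof -
  let ?f = "\<lambda>C. {B\<in>P. oset r A B = C}"
  have Pb: "P \<in> bip {..<r} A" and PQ: "oset r A ` P = Q" using P by (auto simp: over_def)
  note pr = bip_pairings[OF Pb]
  have finA: "finite (A j)" if "j < r" for j using sep that by (auto simp: separated_def)
  have finP: "finite P" using finA by (intro finite_pairing[OF _ pr]) auto
  have finQ: "finite Q" using PQ finP by auto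
  let ?X = "{(B, B'). B \<in> P \<and> B' \<in> P \<and> crosses B B'}"
  let ?Y = "\<lambda>CD. {(B, B'). B \<in> ?f (fst CD) \<and> B' \<in> ?f (snd CD) \<and> crosses B B'}"
  have X: "?X = (\<Union>CD\<in>Q \<times> Q. ?Y CD)"
  proof (intro subset_antisym subsetI)
    fix z assume "z \<in> ?X"
    then obtain B B' where z: "z = (B, B')" "B \<in> P" "B' \<in> P" "crosses B B'" by auto
    then have "(oset r A B, oset r A B') \<in> Q \<times> Q" using PQ by auto
    moreover have "z \<in> ?Y (oset r A B, oset r A B')" using z by simp
    ultimately show "z \<in> (\<Union>CD\<in>Q \<times> Q. ?Y CD)" by (rule UN_I)
  next
    fix z assume "z \<in> (\<Union>CD\<in>Q \<times> Q. ?Y CD)"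
    then show "z \<in> ?X" by auto
  qed
  have finX: "finite (?Y CD)" for CD
    by (rule finite_subset[of _ "P \<times> P"]) (use finP in auto)
  have "Cr P = (\<Sum>CD\<in>Q \<times> Q. card (?Y CD))"
    unfolding Cr_def X using finQ finX by (subst card_UN_disjoint) auto
  also have "\<dots> = (\<Sum>CD\<in>Q \<times> Q. (if fst CD = snd CD then Cr (?f (fst CD)) else 0)
       + (if crosses (fst CD) (snd CD) then card (A (Min (fst CD))) * card (A (Min (snd CD))) else 0))"
  proof (rule sum.cong[OF refl])
    fix CD assume CD': "CD \<in> Q \<times> Q"
    obtain C D where CD: "CD = (C, D)" "C \<in> Q" "D \<in> Q" using CD' by auto
    have c2: "card C = 2" "card D = 2" using pairings_on_card[OF Q] CD by auto
    define l m l' m' where "l = Min C" "m = Max C" "l' = Min D" "m' = Max D"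
    then have C: "C = {l, m}" "l < m" and D: "D = {l', m'}" "l' < m'"
      using pair_Min_Max[OF c2(1)] pair_Min_Max[OF c2(2)] by blast+
    have r: "l < r" "m < r" "l' < r" "m' < r" using pairings_on_sub[OF Q CD(2)] pairings_on_sub[OF Q CD(3)] C D by auto
    show "card (?Y CD) = (if fst CD = snd CD then Cr (?f (fst CD)) else 0)
       + (if crosses (fst CD) (snd CD) then card (A (Min (fst CD))) * card (A (Min (snd CD))) else 0)"
    proof (cases "C = D")
      case True
      then have "\<not> crosses C D" using crosses_iff[OF c2] by auto
      then show ?thesis using True by (simp add: CD Cr_def)
    next
      case False
      then have "C \<inter> D = {}" using Q CD unfolding pairings_on_def by blast
      then have ne: "l \<noteq> l'" "l \<noteq> m'" "m \<noteq> l'" "m \<noteq> m'" using C D by auto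
      \<comment> \<open>\<open>C\<close> and \<open>D\<close> are disjoint, so the four points lie
        in four different blocks and are ordered like these blocks.\<close>
      have cc: "crosses B B' \<longleftrightarrow> crosses C D" if B: "B \<in> ?f C" "B' \<in> ?f D" for B B'
      proof -
        have B': "B \<in> P" "oset r A B = C" "B' \<in> P" "oset r A B' = D" using B by auto
        obtain j k x y where jk: "j < k" "x \<in> A j" "y \<in> A k" "x < y" "B = {x, y}" "{j, k} = C"
          by (rule bip_pairE[OF sep Pb B'(1), unfolded B'(2)]) (use that in blast)
        obtain j' k' x' y' where jk': "j' < k'" "x' \<in> A j'" "y' \<in> A k'" "x' < y'" "B' = {x', y'}" "{j', k'} = D"
          by (rule bip_pairE[OF sep Pb B'(3), unfolded B'(4)]) (use that in blast)
        have e: "j = l" "k = m" "j' = l'" "k' = m'" using jk jk' C D by (auto simp: doubleton_eq_iff)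
        have "crosses B B' \<longleftrightarrow> x < x' \<and> x' < y \<and> y < y'"
          using jk jk' by (subst crosses_iff) (auto simp: min_def max_def)
        also have "\<dots> \<longleftrightarrow> l < l' \<and> l' < m \<and> m < m'"
          using jk jk' e ne r separated_less_iff[OF sep] by (metis lessThan_iff)
        also have "\<dots> \<longleftrightarrow> crosses C D"
          using C D by (subst crosses_iff[OF c2]) (auto simp: min_def max_def)
        finally show ?thesis .
      qed
      have cards: "card (?f C) = card (A l)" "card (?f D) = card (A l')"
        using bip_two_card(1)[OF separated_subset[OF sep] C(2), of "?f C"] over_restrict[OF Q P CD(2)]
          bip_two_card(1)[OF separated_subset[OF sep] D(2), of "?f D"] over_restrict[OF Q P CD(3)] C D r by auto
      show ?thesis
      proof (cases "crosses C D")
        case True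
        then have "?Y CD = ?f C \<times> ?f D" using cc by (auto simp: CD)
        then show ?thesis using True False cards \<open>l = Min C\<close> \<open>l' = Min D\<close> by (simp add: CD card_cartesian_product)
      next
        case F: False
        then have "?Y CD = {}" using cc by (auto simp: CD)
        then have "card (?Y CD) = 0" by (simp only: card.empty)
        then show ?thesis using F False by (simp only: CD fst_conv snd_conv if_False)
      qed
    qed
  qed
  also have "\<dots> = (\<Sum>CD\<in>Q \<times> Q. if fst CD = snd CD then Cr (?f (fst CD)) else 0)
       + (\<Sum>CD\<in>Q \<times> Q. if crosses (fst CD) (snd CD) then card (A (Min (fst CD))) * card (A (Min (snd CD))) else 0)"
    by (rule sum.distrib)
  also have "(\<Sum>CD\<in>Q \<times> Q. if fst CD = snd CD then Cr (?f (fst CD)) else 0) = (\<Sum>C\<in>Q. Cr (?f C))"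
    using finQ by (simp add: sum.cartesian_product' sum.delta)
  also have "(\<Sum>CD\<in>Q \<times> Q. if crosses (fst CD) (snd CD) then card (A (Min (fst CD))) * card (A (Min (snd CD))) else 0)
      = (\<Sum>(C, D)\<in>{(C, D). C \<in> Q \<and> D \<in> Q \<and> crosses C D}. card (A (Min C)) * card (A (Min D)))"
    using finQ by (subst sum.inter_filter[symmetric]) (auto simp: case_prod_beta intro!: sum.cong)
  finally show ?thesis .
qed

text \<open>A diagram over \<open>Q\<close> is an independent choice of a bijection for each
  \<open>C\<close>. By \<open>Cr_over\<close> its weight is the product of the weights of these
  choices times a power fixed by \<open>Q\<close>, so the sum factorises.\<close>

lemma sum_over:
  assumes sep: "separated {..<r} A" and Q: "Q \<in> pairings_on {..<r}"
    and ne: "\<And>j. j < r \<Longrightarrow> A j \<noteq> {}"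
    and eq: "\<And>C l m. C \<in> Q \<Longrightarrow> l \<in> C \<Longrightarrow> m \<in> C \<Longrightarrow> card (A l) = card (A m)"
  shows "(\<Sum>P\<in>over r A Q. q ^ Cr P) = (\<Prod>C\<in>Q. Kq q (card (A (Min C))))
     * q ^ (\<Sum>(C, D)\<in>{(C, D). C \<in> Q \<and> D \<in> Q \<and> crosses C D}. card (A (Min C)) * card (A (Min D)))"
proof -
  let ?N = "\<Sum>(C, D)\<in>{(C, D). C \<in> Q \<and> D \<in> Q \<and> crosses C D}. card (A (Min C)) * card (A (Min D))"
  have finQ: "finite Q" by (rule finite_pairing[OF _ Q]) simp
  have finA: "finite (A j)" if "j < r" for j using sep that by (auto simp: separated_def)
  have Crr: "C \<subseteq> {..<r}" if "C \<in> Q" for C using pairings_on_sub[OF Q that] .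
  have finb: "finite (bip C A)" if "C \<in> Q" for C
    using Crr[OF that] finA by (intro finite_bip) (auto intro: finite_subset)
  have b: "bij_betw (\<lambda>f. \<Union>C\<in>Q. f C) (\<Pi>\<^sub>E C\<in>Q. bip C A) (over r A Q)"
  proof (rule bij_betw_byWitness[where f' = "\<lambda>P. \<lambda>C\<in>Q. {B\<in>P. oset r A B = C}"])
    show "\<forall>f\<in>\<Pi>\<^sub>E C\<in>Q. bip C A. (\<lambda>C\<in>Q. {B \<in> \<Union>C\<in>Q. f C. oset r A B = C}) = f"
    proof
      fix f assume f: "f \<in> (\<Pi>\<^sub>E C\<in>Q. bip C A)"
      have "\<And>C B. C \<in> Q \<Longrightarrow> B \<in> f C \<Longrightarrow> oset r A B = C"
        by (rule over_glue(2)[OF sep Q ne, of f]) (use f in auto)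
      then show "(\<lambda>C\<in>Q. {B \<in> \<Union>C\<in>Q. f C. oset r A B = C}) = f"
        using f by (intro extensionalityI[of _ Q]) (auto simp: PiE_def)
    qed
    show "\<forall>P\<in>over r A Q. (\<Union>C\<in>Q. (\<lambda>C\<in>Q. {B \<in> P. oset r A B = C}) C) = P"
      by (auto simp: over_def)
    show "(\<lambda>f. \<Union>C\<in>Q. f C) ` (\<Pi>\<^sub>E C\<in>Q. bip C A) \<subseteq> over r A Q"
      using over_glue(1)[OF sep Q ne] by (auto simp: PiE_def Pi_def)
    show "(\<lambda>P. \<lambda>C\<in>Q. {B \<in> P. oset r A B = C}) ` over r A Q \<subseteq> (\<Pi>\<^sub>E C\<in>Q. bip C A)"
      using over_restrict[OF Q] by auto
  qed
  have "(\<Sum>P\<in>over r A Q. q ^ Cr P) = (\<Sum>f\<in>(\<Pi>\<^sub>E C\<in>Q. bip C A). q ^ Cr (\<Union>C\<in>Q. f C))"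
    by (rule sum.reindex_bij_betw[OF b, symmetric])
  also have "\<dots> = (\<Sum>f\<in>(\<Pi>\<^sub>E C\<in>Q. bip C A). (\<Prod>C\<in>Q. q ^ Cr (f C)) * q ^ ?N)"
  proof (rule sum.cong[OF refl])
    fix f assume f: "f \<in> (\<Pi>\<^sub>E C\<in>Q. bip C A)"
    then have f': "f C \<in> bip C A" if "C \<in> Q" for C using that by auto
    have os: "\<And>C B. C \<in> Q \<Longrightarrow> B \<in> f C \<Longrightarrow> oset r A B = C"
      by (rule over_glue(2)[OF sep Q ne, of f]) (use f in auto)
    have "{B \<in> \<Union>C\<in>Q. f C. oset r A B = C} = f C" if "C \<in> Q" for C using os that by auto
    then have "Cr (\<Union>C\<in>Q. f C) = (\<Sum>C\<in>Q. Cr (f C)) + ?N"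
      using Cr_over[OF sep Q over_glue(1)[OF sep Q ne f']] by simp
    then show "q ^ Cr (\<Union>C\<in>Q. f C) = (\<Prod>C\<in>Q. q ^ Cr (f C)) * q ^ ?N"
      by (simp add: power_add power_sum)
  qed
  also have "\<dots> = (\<Prod>C\<in>Q. \<Sum>P\<in>bip C A. q ^ Cr P) * q ^ ?N"
    using finQ finb by (simp add: sum_distrib_right[symmetric] prod_sum_PiE)
  also have "(\<Prod>C\<in>Q. \<Sum>P\<in>bip C A. q ^ Cr P) = (\<Prod>C\<in>Q. Kq q (card (A (Min C))))"
  proof (rule prod.cong[OF refl])
    fix C assume C: "C \<in> Q"
    note mm = pair_Min_Max[OF pairings_on_card[OF Q C]]
    have mem: "Min C \<in> C" "Max C \<in> C" using mm(1) by (metis insertI1, metis insertI1 insert_commute)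
    have "(\<Sum>P\<in>bip {Min C, Max C} A. q ^ Cr P) = Kq q (card (A (Min C)))"
      using mem Crr[OF C] eq[OF C mem] by (intro sum_bip_two separated_subset[OF sep] mm(2)) auto
    then show "(\<Sum>P\<in>bip C A. q ^ Cr P) = Kq q (card (A (Min C)))" using mm(1) by simp
  qed
  finally show ?thesis .
qed

lemma over_card_eq:
  assumes sep: "separated {..<r} A" and Q: "Q \<in> pairings_on {..<r}" and P: "P \<in> over r A Q"
    and C: "C \<in> Q" "l \<in> C" "m \<in> C"
  shows "card (A l) = card (A m)"
proof -
  note mm = pair_Min_Max[OF pairings_on_card[OF Q C(1)]]
  have "card (A (Min C)) = card (A (Max C))"
    using mm over_restrict[OF Q P C(1)] pairings_on_sub[OF Q C(1)]
    by (intro bip_two_card(2)[OF separated_subset[OF sep] mm(2)]) auto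
  then show ?thesis using C mm(1) by (metis empty_iff insert_iff)
qed

subsection \<open>Moments of Brownian increments\<close>

lemma pair_Min_Max_mem:
  fixes B :: "nat set" assumes "card B = 2" shows "Min B \<in> B" "Max B \<in> B"
proof -
  have "finite B" "B \<noteq> {}" using assms by (auto intro: card_ge_0_finite)
  then show "Min B \<in> B" "Max B \<in> B" by simp_all
qed

lemma pairing_prod_remove:
  assumes "finite S" "P \<in> pairings_on S" "x \<in> S"
  shows "(\<Prod>B\<in>P. F B) = (F (blk P x) :: real) * (\<Prod>B\<in>P - {blk P x}. F B)"
  using assms finite_pairing blk_in by (simp add: prod.remove)

lemma Min_image_pair:
  fixes h :: "nat \<Rightarrow> nat"
  assumes h: "strict_mono_on S h" and B: "B \<subseteq> S" "card B = 2"
  shows "Min (h ` B) = h (Min B)" "Max (h ` B) = h (Max B)"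
proof -
  note mm = pair_Min_Max[OF B(2)]
  have mem: "Min B \<in> S" "Max B \<in> S" using pair_Min_Max_mem[OF B(2)] B(1) by auto
  have "h (Min B) < h (Max B)" using strict_mono_onD[OF h mem mm(2)] .
  moreover have "h ` B = {h (Min B), h (Max B)}" by (subst mm(1)) simp
  ultimately show "Min (h ` B) = h (Min B)" "Max (h ` B) = h (Max B)" by (simp_all add: min_def max_def)
qed

locale qBM =
  fixes q :: real and star :: "'a::{real_normed_algebra_1,banach} \<Rightarrow> 'a" and J :: 'a
    and \<phi> :: "'a \<Rightarrow> complex" and X :: "real \<Rightarrow> 'a"
    and I :: "nat \<Rightarrow> ((nat \<Rightarrow> real) \<Rightarrow> real) \<Rightarrow> 'a"
  assumes setting: "qBM_setting q star J \<phi> X I"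
    and q0: "0 \<le> q" and q1: "q < 1"
begin

lemma
  shows star_add': "\<forall>x y. star (x + y) = star x + star y"
    and star_scaleR': "\<forall>r x. star (r *\<^sub>R x) = r *\<^sub>R star x"
    and star_mult': "\<forall>x y. star (x * y) = star y * star x"
    and star_star': "\<forall>x. star (star x) = x"
    and \<phi>_add': "\<forall>x y. \<phi> (x + y) = \<phi> x + \<phi> y"
    and \<phi>_scaleR': "\<forall>r x. \<phi> (r *\<^sub>R x) = complex_of_real r * \<phi> x"
    and \<phi>_J': "\<forall>x. \<phi> (J * x) = \<i> * \<phi> x"
    and \<phi>_one [simp]: "\<phi> 1 = 1"
    and \<phi>_star': "\<forall>x. \<phi> (star x) = cnj (\<phi> x)"
    and \<phi>_pos': "\<forall>x. Im (\<phi> (star x * x)) = 0 \<and> Re (\<phi> (star x * x)) \<ge> 0"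
    and \<phi>_faithful': "\<forall>x. \<phi> (star x * x) = 0 \<longrightarrow> x = 0"
    and \<phi>_trace': "\<forall>x y. \<phi> (x * y) = \<phi> (y * x)"
    and X_star': "\<forall>t\<ge>0. star (X t) = X t"
    and X_moment': "\<forall>r (t::nat \<Rightarrow> real). (\<forall>i<r. t i \<ge> 0) \<longrightarrow>
        \<phi> (prod_list (map (\<lambda>i. X (t i)) [0..<r])) =
        complex_of_real (\<Sum>P\<in>pairings r. q ^ Cr P * (\<Prod>B\<in>P. min (t (Min B)) (t (Max B))))"
    and I_add': "\<forall>n\<ge>1. \<forall>f g. L2 n f \<longrightarrow> L2 n g \<longrightarrow> I n (\<lambda>x. f x + g x) = I n f + I n g"
    and I_scale': "\<forall>n\<ge>1. \<forall>f c. L2 n f \<longrightarrow> I n (\<lambda>x. c * f x) = c *\<^sub>R I n f"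
    and I_box': "\<forall>n\<ge>1. \<forall>a b :: nat \<Rightarrow> real.
        (\<forall>i<n. 0 \<le> a i \<and> a i < b i) \<longrightarrow>
        (\<forall>i<n. \<forall>j<n. i \<noteq> j \<longrightarrow> {a i<..<b i} \<inter> {a j<..<b j} = {}) \<longrightarrow>
        I n (\<lambda>x. \<Prod>i<n. indicator {a i<..<b i} (x i)) =
          prod_list (map (\<lambda>i. X (b i) - X (a i)) [0..<n])"
    and I_isometry': "\<forall>n\<ge>1. \<forall>m\<ge>1. \<forall>f g. L2 n f \<longrightarrow> L2 m g \<longrightarrow>
        \<phi> (star (I n f) * I m g) = (if n = m then complex_of_real (qip q n f g) else 0)"
  using setting unfolding qBM_setting_def by - (elim conjE, assumption)+

lemmas star_add = star_add'[rule_format] and star_scaleR = star_scaleR'[rule_format]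
  and star_mult = star_mult'[rule_format] and star_star [simp] = star_star'[rule_format]
  and \<phi>_add = \<phi>_add'[rule_format] and \<phi>_scaleR = \<phi>_scaleR'[rule_format]
  and \<phi>_J = \<phi>_J'[rule_format] and \<phi>_star = \<phi>_star'[rule_format]
  and \<phi>_faithful = \<phi>_faithful'[rule_format] and \<phi>_trace = \<phi>_trace'[rule_format]
  and X_star = X_star'[rule_format] and I_add = I_add'[rule_format] and I_scale = I_scale'[rule_format]
  and I_isometry = I_isometry'[rule_format]

lemma \<phi>_pos_Im: "Im (\<phi> (star x * x)) = 0" and \<phi>_pos: "Re (\<phi> (star x * x)) \<ge> 0"
  using \<phi>_pos' by auto

lemma X_moment:
  "(\<And>i. i < r \<Longrightarrow> t i \<ge> 0) \<Longrightarrow> \<phi> (prod_list (map (\<lambda>i. X (t i)) [0..<r])) =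
     complex_of_real (\<Sum>P\<in>pairings r. q ^ Cr P * (\<Prod>B\<in>P. min (t (Min B)) (t (Max B))))"
  by (rule X_moment'[THEN spec, THEN spec, THEN mp]) blast

lemma \<phi>_uminus: "\<phi> (- x) = - \<phi> x"
  using \<phi>_scaleR[of "-1" x] by simp

lemma \<phi>_diff: "\<phi> (x - y) = \<phi> x - \<phi> y"
  using \<phi>_add[of x "- y"] by (simp add: \<phi>_uminus)

lemma star_diff: "star (x - y) = star x - star y"
  using star_add[of x "- y"] star_scaleR[of "-1" y] by simp

lemma star_one [simp]: "star 1 = 1"
  by (metis mult.left_neutral mult.right_neutral star_mult star_star)

lemma star_prod_list: "star (prod_list xs) = prod_list (rev (map star xs))"
  by (induction xs) (simp_all add: star_mult)

text \<open>The moment formula of the setting is numbered from 0; an increasing relabelling changes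
  neither crossings nor the order within a pair.\<close>

lemma X_moment_sorted:
  assumes xs: "sorted xs" "distinct xs" and t: "\<And>x. x \<in> set xs \<Longrightarrow> t x \<ge> 0"
  shows "\<phi> (prod_list (map (\<lambda>x. X (t x)) xs)) =
     complex_of_real (\<Sum>P\<in>pairings_on (set xs). q ^ Cr P * (\<Prod>B\<in>P. min (t (Min B)) (t (Max B))))"
proof -
  let ?r = "length xs" and ?h = "\<lambda>i. xs ! i"
  have mono: "strict_mono_on {..<?r} ?h"
    using xs by (auto intro!: strict_mono_onI sorted_wrt_nth_less simp: strict_sorted_iff)
  have inj: "inj_on ?h {..<?r}" by (rule strict_mono_on_imp_inj_on[OF mono])
  have im: "?h ` {..<?r} = set xs" by (auto simp: set_conv_nth)
  have "map (\<lambda>x. X (t x)) xs = map (\<lambda>i. X (t (xs ! i))) [0..<?r]"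
    by (rule nth_equalityI) auto
  then have "\<phi> (prod_list (map (\<lambda>x. X (t x)) xs)) =
     complex_of_real (\<Sum>P\<in>pairings ?r. q ^ Cr P * (\<Prod>B\<in>P. min (t (xs ! (Min B))) (t (xs ! (Max B)))))"
    using X_moment[of ?r "\<lambda>i. t (xs ! i)"] t by simp
  also have "(\<Sum>P\<in>pairings ?r. q ^ Cr P * (\<Prod>B\<in>P. min (t (xs ! (Min B))) (t (xs ! (Max B)))))
     = (\<Sum>P\<in>pairings_on {..<?r}. q ^ Cr ((`) ?h ` P) * (\<Prod>B\<in>(`) ?h ` P. min (t (Min B)) (t (Max B))))"
    unfolding pairings_eq
  proof (rule sum.cong[OF refl])
    fix P assume P: "P \<in> pairings_on {..<?r}"
    have "inj_on ((`) ?h) P"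
      using inj_on_image_Pow[OF inj] pairings_on_sub[OF P] by (auto intro: inj_on_subset)
    then have "(\<Prod>B\<in>(`) ?h ` P. min (t (Min B)) (t (Max B))) = (\<Prod>B\<in>P. min (t (Min (?h ` B))) (t (Max (?h ` B))))"
      by (simp add: prod.reindex)
    also have "\<dots> = (\<Prod>B\<in>P. min (t (xs ! (Min B))) (t (xs ! (Max B))))"
      using Min_image_pair[OF mono pairings_on_sub[OF P] pairings_on_card[OF P]] by (intro prod.cong) auto
    finally show "q ^ Cr P * (\<Prod>B\<in>P. min (t (xs ! (Min B))) (t (xs ! (Max B))))
      = q ^ Cr ((`) ?h ` P) * (\<Prod>B\<in>(`) ?h ` P. min (t (Min B)) (t (Max B)))"
      by (simp add: Cr_image[OF mono P])
  qed
  also have "\<dots> = (\<Sum>P\<in>pairings_on (set xs). q ^ Cr P * (\<Prod>B\<in>P. min (t (Min B)) (t (Max B))))"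
    using sum.reindex_bij_betw[OF bij_betw_pairings_on_image[OF inj],
        of "\<lambda>P. q ^ Cr P * (\<Prod>B\<in>P. min (t (Min B)) (t (Max B)))"] by (simp only: im)
  finally show ?thesis .
qed

text \<open>The bilinear expansion of the covariance \<open>min\<close> when a slot in
  \<open>D\<close> carries the increment \<open>X (b x) - X (a x)\<close> and any other slot the
  value \<open>X (b x)\<close>.\<close>

definition cov :: "nat set \<Rightarrow> (nat \<Rightarrow> real) \<Rightarrow> (nat \<Rightarrow> real) \<Rightarrow> nat \<Rightarrow> nat \<Rightarrow> real" where
  "cov D a b x y = min (b x) (b y) - (if x \<in> D then min (a x) (b y) else 0)
     - (if y \<in> D then min (b x) (a y) else 0) + (if x \<in> D \<and> y \<in> D then min (a x) (a y) else 0)"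

text \<open>The increments are introduced one slot at a time; both sides are multilinear in the slots.\<close>

lemma increments_moment_aux:
  assumes xs: "sorted xs" "distinct xs" and a: "\<And>x. x \<in> set xs \<Longrightarrow> a x \<ge> 0" and D: "finite D" "D \<subseteq> set xs"
    and b: "\<And>x. x \<in> set xs \<Longrightarrow> b x \<ge> 0"
  shows "\<phi> (prod_list (map (\<lambda>x. if x \<in> D then X (b x) - X (a x) else X (b x)) xs)) =
     complex_of_real (\<Sum>P\<in>pairings_on (set xs). q ^ Cr P * (\<Prod>B\<in>P. cov D a b (Min B) (Max B)))"
  using D b
proof (induction D arbitrary: b rule: finite_induct)
  case empty
  then show ?case using X_moment_sorted[OF xs, of b] by (simp add: cov_def)
next
  case (insert x0 D)
  \<comment> \<open>The increment in the new slot is its value at \<open>b x0\<close> minus its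
    value at \<open>a x0\<close>, so the induction hypothesis is applied to \<open>b\<close> and to
    \<open>?b'\<close>.\<close>
  let ?b' = "b(x0 := a x0)"
  let ?Y = "\<lambda>D b x. if x \<in> D then X (b x) - X (a x) else X (b x)"
  have x0: "x0 \<in> set xs" using insert.prems by auto
  then obtain ys zs where xs_eq: "xs = ys @ x0 # zs" by (meson split_list)
  have nx0: "x0 \<notin> set ys" "x0 \<notin> set zs" using xs(2) xs_eq by auto
  have e1: "map (?Y (insert x0 D) b) l = map (?Y D b) l" "map (?Y (insert x0 D) b) l = map (?Y D ?b') l"
    if "x0 \<notin> set l" for l using that by (auto intro!: map_cong)
  have "prod_list (map (?Y (insert x0 D) b) xs)
     = prod_list (map (?Y D b) xs) - prod_list (map (?Y D ?b') xs)"
    using insert.hyps unfolding xs_eq map_append list.map prod_list.append prod_list.Cons e1(1)[OF nx0(1)] e1(1)[OF nx0(2)]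
      e1(2)[OF nx0(1), symmetric, unfolded e1(1)[OF nx0(1)]] e1(2)[OF nx0(2), symmetric, unfolded e1(1)[OF nx0(2)]]
    by (simp add: algebra_simps)
  then have "\<phi> (prod_list (map (?Y (insert x0 D) b) xs))
     = \<phi> (prod_list (map (?Y D b) xs)) - \<phi> (prod_list (map (?Y D ?b') xs))" by (simp only: \<phi>_diff)
  also have "\<dots> = complex_of_real ((\<Sum>P\<in>pairings_on (set xs). q ^ Cr P * (\<Prod>B\<in>P. cov D a b (Min B) (Max B)))
     - (\<Sum>P\<in>pairings_on (set xs). q ^ Cr P * (\<Prod>B\<in>P. cov D a ?b' (Min B) (Max B))))"
  proof -
    have "D \<subseteq> set xs" "\<And>x. x \<in> set xs \<Longrightarrow> 0 \<le> ?b' x" using insert.prems a by auto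
    then show ?thesis using insert.IH[of b] insert.IH[of ?b'] insert.prems by (simp only: of_real_diff)
  qed
  also have "(\<Sum>P\<in>pairings_on (set xs). q ^ Cr P * (\<Prod>B\<in>P. cov D a b (Min B) (Max B)))
     - (\<Sum>P\<in>pairings_on (set xs). q ^ Cr P * (\<Prod>B\<in>P. cov D a ?b' (Min B) (Max B)))
     = (\<Sum>P\<in>pairings_on (set xs). q ^ Cr P * (\<Prod>B\<in>P. cov (insert x0 D) a b (Min B) (Max B)))"
    unfolding sum_subtractf[symmetric]
  proof (rule sum.cong[OF refl])
    fix P assume P: "P \<in> pairings_on (set xs)"
    let ?B = "blk P x0"
    note rem = pairing_prod_remove[OF finite_set P x0]
    have B: "?B \<in> P" "x0 \<in> ?B" using blk_in[OF P x0] blk_mem[OF P x0] .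
    have mm: "?B = {Min ?B, Max ?B}" "Min ?B < Max ?B" using pair_Min_Max[OF pairings_on_card[OF P B(1)]] .
    \<comment> \<open>Exactly one factor of each product, that of the pair of \<open>x0\<close>,
      depends on this slot, and there the two covariances differ by the new covariance.\<close>
    have c: "cov (insert x0 D) a b (Min ?B) (Max ?B) = cov D a b (Min ?B) (Max ?B) - cov D a ?b' (Min ?B) (Max ?B)"
    proof -
      from B(2) mm(1) have "x0 = Min ?B \<or> x0 = Max ?B" by blast
      then show ?thesis
      proof
        assume x: "x0 = Min ?B"
        then have "Max ?B \<noteq> x0" using mm(2) by simp
        then show ?thesis unfolding x[symmetric] using insert.hyps by (simp add: cov_def)
      next
        assume x: "x0 = Max ?B"
        then have "Min ?B \<noteq> x0" using mm(2) by simp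
        then show ?thesis unfolding x[symmetric] using insert.hyps by (simp add: cov_def)
      qed
    qed
    have o: "cov (insert x0 D) a b (Min C) (Max C) = cov D a b (Min C) (Max C)"
       "cov D a ?b' (Min C) (Max C) = cov D a b (Min C) (Max C)" if C: "C \<in> P - {?B}" for C
    proof -
      have "x0 \<notin> C" using C blk_eq[OF P] by auto
      moreover have "Min C \<in> C" "Max C \<in> C"
        using pair_Min_Max_mem[OF pairings_on_card[OF P]] C by auto
      ultimately have "Min C \<noteq> x0" "Max C \<noteq> x0" by auto
      then show "cov (insert x0 D) a b (Min C) (Max C) = cov D a b (Min C) (Max C)"
        "cov D a ?b' (Min C) (Max C) = cov D a b (Min C) (Max C)" by (simp_all add: cov_def)
    qed
    show "q ^ Cr P * (\<Prod>B\<in>P. cov D a b (Min B) (Max B)) - q ^ Cr P * (\<Prod>B\<in>P. cov D a ?b' (Min B) (Max B))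
       = q ^ Cr P * (\<Prod>B\<in>P. cov (insert x0 D) a b (Min B) (Max B))"
    proof -
      have "(\<Prod>B\<in>P - {?B}. cov (insert x0 D) a b (Min B) (Max B)) = (\<Prod>B\<in>P - {?B}. cov D a b (Min B) (Max B))"
        "(\<Prod>B\<in>P - {?B}. cov D a ?b' (Min B) (Max B)) = (\<Prod>B\<in>P - {?B}. cov D a b (Min B) (Max B))"
        by (rule prod.cong[OF refl], erule o)+
      then show ?thesis unfolding rem c by (simp add: algebra_simps)
    qed
  qed
  finally show ?case .
qed

lemma increments_moment:
  assumes xs: "sorted xs" "distinct xs" and a: "\<And>x. x \<in> set xs \<Longrightarrow> a x \<ge> 0"
    and b: "\<And>x. x \<in> set xs \<Longrightarrow> b x \<ge> 0"
  shows "\<phi> (prod_list (map (\<lambda>x. X (b x) - X (a x)) xs)) =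
     complex_of_real (\<Sum>P\<in>pairings_on (set xs). q ^ Cr P * (\<Prod>B\<in>P. cov (set xs) a b (Min B) (Max B)))"
proof -
  have "map (\<lambda>x. X (b x) - X (a x)) xs = map (\<lambda>x. if x \<in> set xs then X (b x) - X (a x) else X (b x)) xs"
    by (rule map_cong) auto
  then show ?thesis using increments_moment_aux[of xs a "set xs" b] xs a b by (simp only: finite_set subset_refl)
qed

end

subsection \<open>Integrals attached to pairings\<close>

lemma sqint_reindex:
  assumes e: "bij_betw e T S" "finite T" and f: "sqint (PM T) f"
  shows "sqint (PM S) (\<lambda>y. f (restrict (\<lambda>i. y (e i)) T))"
    "(\<integral>y. (f (restrict (\<lambda>i. y (e i)) T))^2 \<partial>PM S) = (\<integral>x. (f x)^2 \<partial>PM T)"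
proof -
  have [measurable]: "f \<in> borel_measurable (PM T)" using f by (rule sqint_measurable)
  have m: "(\<lambda>y. restrict (\<lambda>i. y (e i)) T) \<in> measurable (PM S) (PM T)"
    using e by (intro measurable_PM_reindex bij_betw_imp_funcset)
  have "(\<lambda>y. f (restrict (\<lambda>i. y (e i)) T)) \<in> borel_measurable (PM S)"
    by (rule measurable_compose[OF m sqint_measurable[OF f]])
  moreover have "(\<integral>\<^sup>+y. ennreal ((f (restrict (\<lambda>i. y (e i)) T))^2) \<partial>PM S) < \<infinity>"
    using nn_integral_PM_reindex[OF e, of "\<lambda>x. ennreal ((f x)^2)"] f by (simp add: sqint_iff_nn)
  ultimately show "sqint (PM S) (\<lambda>y. f (restrict (\<lambda>i. y (e i)) T))" by (simp add: sqint_iff_nn)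
  show "(\<integral>y. (f (restrict (\<lambda>i. y (e i)) T))^2 \<partial>PM S) = (\<integral>x. (f x)^2 \<partial>PM T)"
    by (rule integral_PM_reindex[OF e]) measurable
qed

lemma Finner:
  fixes h :: "'j \<Rightarrow> ('i \<Rightarrow> real) \<Rightarrow> real"
  assumes fin: "finite V" "finite J"
    and S: "\<And>j. j \<in> J \<Longrightarrow> S j \<subseteq> V"
    and c: "\<And>v. v \<in> V \<Longrightarrow> card {j\<in>J. v \<in> S j} = 2"
    and h: "\<And>j. j \<in> J \<Longrightarrow> sqint (PM (S j)) (h j)"
  shows "integrable (PM V) (\<lambda>y. \<Prod>j\<in>J. h j (restrict y (S j)))"
    and "\<bar>\<integral>y. (\<Prod>j\<in>J. h j (restrict y (S j))) \<partial>PM V\<bar> \<le> (\<Prod>j\<in>J. sqrt (\<integral>y. (h j y)^2 \<partial>PM (S j)))"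
proof -
  have hm: "h j \<in> borel_measurable (PM (S j))" if "j \<in> J" for j using h[OF that] by (rule sqint_measurable)
  have m: "(\<lambda>y. \<Prod>j\<in>J. h j (restrict y (S j))) \<in> borel_measurable (PM V)"
    by (intro borel_measurable_prod measurable_compose[OF measurable_PM_restrict hm] S)
  let ?N = "\<integral>\<^sup>+y. ennreal (norm (\<Prod>j\<in>J. h j (restrict y (S j)))) \<partial>PM V"
  have "?N = (\<integral>\<^sup>+y. (\<Prod>j\<in>J. (\<lambda>z. ennreal \<bar>h j z\<bar>) (restrict y (S j))) \<partial>PM V)"
    by (simp add: abs_prod prod_ennreal)
  then have "?N^2 \<le> (\<Prod>j\<in>J. \<integral>\<^sup>+y. (ennreal \<bar>h j y\<bar>)^2 \<partial>PM (S j))"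
    using Finner_nn_integral[OF fin, of S "\<lambda>j z. ennreal \<bar>h j z\<bar>"] S c hm by simp
  also have "\<dots> = (\<Prod>j\<in>J. ennreal (\<integral>y. (h j y)^2 \<partial>PM (S j)))"
    using h by (intro prod.cong refl) (simp add: ennreal_power sqint_nn_integral)
  also have "\<dots> = ennreal ((\<Prod>j\<in>J. sqrt (\<integral>y. (h j y)^2 \<partial>PM (S j)))^2)"
    by (simp add: prod_ennreal prod_power_distrib)
  finally have "?N^2 \<le> (ennreal (\<Prod>j\<in>J. sqrt (\<integral>y. (h j y)^2 \<partial>PM (S j))))^2"
    by (simp add: ennreal_power prod_nonneg)
  then have N: "?N \<le> ennreal (\<Prod>j\<in>J. sqrt (\<integral>y. (h j y)^2 \<partial>PM (S j)))" by (rule ennreal_le_of_sq_le)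
  then show i: "integrable (PM V) (\<lambda>y. \<Prod>j\<in>J. h j (restrict y (S j)))"
    using m by (intro integrableI_bounded) (auto simp: le_less_trans)
  show "\<bar>\<integral>y. (\<Prod>j\<in>J. h j (restrict y (S j))) \<partial>PM V\<bar> \<le> (\<Prod>j\<in>J. sqrt (\<integral>y. (h j y)^2 \<partial>PM (S j)))"
    using order_trans[OF integral_norm_bound_ennreal[OF i] N] by (simp add: ennreal_le_iff prod_nonneg)
qed

text \<open>The start points are a parameter, so that the same points can be cut into blocks in
  several ways; the fourth moment uses this with two, three and four blocks.\<close>

definition bl :: "(nat \<Rightarrow> nat) \<Rightarrow> (nat \<Rightarrow> nat) \<Rightarrow> nat \<Rightarrow> nat set" where
  "bl s n j = {s j..<s j + n j}"

definition parg :: "nat set set \<Rightarrow> nat \<Rightarrow> nat \<Rightarrow> (nat set \<Rightarrow> real) \<Rightarrow> nat \<Rightarrow> real" where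
  "parg P a m y = restrict (\<lambda>i. y (blk P (a + i))) {..<m}"

text \<open>One integration variable for each pair of \<open>P\<close>: the argument \<open>i\<close> of \<open>g j\<close> is the
  variable of the pair that contains the point \<open>s j + i\<close>.\<close>

definition PI :: "nat set set \<Rightarrow> nat \<Rightarrow> (nat \<Rightarrow> nat) \<Rightarrow> (nat \<Rightarrow> nat) \<Rightarrow> (nat \<Rightarrow> (nat \<Rightarrow> real) \<Rightarrow> real) \<Rightarrow> real" where
  "PI P r s n g = (\<integral>y. (\<Prod>j<r. g j (parg P (s j) (n j) y)) \<partial>PM P)"

text \<open>For a block \<open>A\<close> these pairs are the integration variables on which the
  function of the block depends.\<close>

definition touch :: "nat set set \<Rightarrow> nat set \<Rightarrow> nat set set" where
  "touch P A = {B\<in>P. B \<inter> A \<noteq> {}}"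

lemma bl_card [simp]: "card (bl s n j) = n j" and bl_finite [simp]: "finite (bl s n j)"
  by (simp_all add: bl_def)

definition blocks :: "nat \<Rightarrow> (nat \<Rightarrow> nat) \<Rightarrow> (nat \<Rightarrow> nat) \<Rightarrow> bool" where
  "blocks r s n \<longleftrightarrow> (\<forall>j. Suc j < r \<longrightarrow> s j + n j \<le> s (Suc j)) \<and> (\<forall>j<r. n j \<ge> 1)"

lemma blocks_le:
  assumes "blocks r s n" "j < k" "k < r" shows "s j + n j \<le> s k"
  using assms(2,3)
proof (induction k)
  case (Suc k)
  have "s k + n k \<le> s (Suc k)" using assms(1) Suc.prems by (simp add: blocks_def)
  moreover have "s j + n j \<le> s k \<or> j = k" using Suc by (cases "j = k") auto
  ultimately show ?case by auto
qed simp

lemma blocks_separated: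
  assumes "blocks r s n" shows "separated {..<r} (bl s n)"
  unfolding separated_def
proof (intro conjI ballI impI)
  fix j k x y assume "j \<in> {..<r}" "k \<in> {..<r}" "j < k" "x \<in> bl s n j" "y \<in> bl s n k"
  then show "x < y" using blocks_le[OF assms, of j k] by (auto simp: bl_def)
qed simp

lemma blocks_nonempty: "blocks r s n \<Longrightarrow> j < r \<Longrightarrow> bl s n j \<noteq> {}"
  by (fastforce simp: blocks_def bl_def)

text \<open>A pair that contained two points of \<open>A\<close> would lie inside \<open>A\<close>;
  hence different points of \<open>A\<close> belong to different pairs.\<close>

lemma bij_betw_touch:
  assumes pr: "P \<in> pairings_on S" and A: "A \<subseteq> S" and ni: "\<And>B. B \<in> P \<Longrightarrow> \<not> B \<subseteq> A"
  shows "bij_betw (blk P) A (touch P A)"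
proof (rule bij_betw_imageI)
  show "inj_on (blk P) A"
  proof (rule inj_onI)
    fix x y assume xy: "x \<in> A" "y \<in> A" "blk P x = blk P y"
    then have B: "blk P x \<in> P" "x \<in> blk P x" "y \<in> blk P x"
      using blk_in[OF pr, of x] blk_mem[OF pr, of x] blk_mem[OF pr, of y] A by auto
    show "x = y"
    proof (rule ccontr)
      assume "x \<noteq> y"
      then have "blk P x = {x, y}" using B(2,3) pairings_on_card[OF pr B(1)] by (auto simp: card_2_iff)
      then show False using ni[OF B(1)] xy by simp
    qed
  qed
  show "blk P ` A = touch P A"
  proof (intro subset_antisym subsetI)
    fix B assume "B \<in> blk P ` A"
    then obtain x where "x \<in> A" "B = blk P x" by auto
    then show "B \<in> touch P A"
      using blk_in[OF pr, of x] blk_mem[OF pr, of x] A by (auto simp: touch_def)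
  next
    fix B assume "B \<in> touch P A"
    then obtain x where "B \<in> P" "x \<in> B" "x \<in> A" by (auto simp: touch_def)
    then show "B \<in> blk P ` A" using blk_eq[OF pr] by (intro image_eqI[of _ _ x]) auto
  qed
qed

lemma bij_betw_touch_bl:
  assumes P: "P \<in> bip {..<r} (bl s n)" and j: "j < r"
  shows "bij_betw (\<lambda>i. blk P (s j + i)) {..<n j} (touch P (bl s n j))"
proof -
  have "bij_betw (blk P) (bl s n j) (touch P (bl s n j))"
    using j P by (intro bij_betw_touch[OF bip_pairings[OF P]]) (auto simp: bip_def)
  moreover have "bij_betw (\<lambda>i. s j + i) {..<n j} (bl s n j)"
    by (rule bij_betwI[where g = "\<lambda>x. x - s j"]) (auto simp: bl_def)
  ultimately show ?thesis using bij_betw_trans by (fastforce simp: comp_def)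
qed

text \<open>Each variable thus occurs in exactly two factors, which is the hypothesis under which
  Finner's inequality involves only $L^2$ norms.\<close>

lemma card_touching:
  assumes sep: "separated {..<r} A" and P: "P \<in> bip {..<r} A" and B: "B \<in> P"
  shows "card {j\<in>{..<r}. B \<in> touch P (A j)} = 2"
proof -
  have "{j\<in>{..<r}. B \<in> touch P (A j)} = oset r A B" using B by (auto simp: touch_def oset_def)
  then show ?thesis using bip_pairE[OF sep P B] by (metis card_2_iff less_irrefl)
qed

lemma finite_bip_pairing:
  assumes "P \<in> bip {..<r} (bl s n)" shows "finite P"
  by (rule finite_pairing[OF _ bip_pairings[OF assms]]) simp

lemma parg_restrict:
  assumes "P \<in> bip {..<r} (bl s n)" "j < r"
  shows "parg P (s j) (n j) (restrict y (touch P (bl s n j))) = parg P (s j) (n j) y"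
  using bij_betw_touch_bl[OF assms] by (auto simp: parg_def bij_betw_def intro!: restrict_ext)

lemma sqint_parg:
  assumes P: "P \<in> bip {..<r} (bl s n)" and j: "j < r" and g: "L2 (n j) g"
  shows "sqint (PM (touch P (bl s n j))) (\<lambda>y. g (parg P (s j) (n j) y))"
    "(\<integral>y. (g (parg P (s j) (n j) y))^2 \<partial>PM (touch P (bl s n j))) = (L2norm (n j) g)^2"
  using sqint_reindex[OF bij_betw_touch_bl[OF P j] finite_lessThan g[unfolded L2_sqint]]
  by (auto simp: parg_def L2norm_def Mn_eq_PM)

text \<open>Finner's inequality with one factor for each block. It gives both the existence of the
  integral and the continuity in each function that the density argument uses.\<close>

lemma PI_bound:
  assumes bs: "blocks r s n" and P: "P \<in> bip {..<r} (bl s n)" and g: "\<And>j. j < r \<Longrightarrow> L2 (n j) (g j)"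
  shows "integrable (PM P) (\<lambda>y. \<Prod>j<r. g j (parg P (s j) (n j) y))"
    and "\<bar>PI P r s n g\<bar> \<le> (\<Prod>j<r. L2norm (n j) (g j))"
proof -
  let ?h = "\<lambda>j y. g j (parg P (s j) (n j) y)"
  have eq: "(\<Prod>j<r. ?h j (restrict y (touch P (bl s n j)))) = (\<Prod>j<r. ?h j y)" for y
    by (rule prod.cong[OF refl]) (simp add: parg_restrict[OF P])
  note F = Finner[OF finite_bip_pairing[OF P] finite_lessThan _ card_touching[OF blocks_separated[OF bs] P] sqint_parg(1)[OF P _ g]]
  show "integrable (PM P) (\<lambda>y. \<Prod>j<r. ?h j y)"
    using F(1) unfolding eq by (auto simp: touch_def)
  have "\<bar>PI P r s n g\<bar> \<le> (\<Prod>j<r. sqrt (\<integral>y. (?h j y)^2 \<partial>PM (touch P (bl s n j))))"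
    using F(2) unfolding eq PI_def by (auto simp: touch_def)
  also have "\<dots> = (\<Prod>j<r. L2norm (n j) (g j))"
  proof (rule prod.cong[OF refl])
    fix j assume "j \<in> {..<r}"
    then have "(\<integral>y. (?h j y)^2 \<partial>PM (touch P (bl s n j))) = (L2norm (n j) (g j))^2"
      by (intro sqint_parg(2)[OF P _ g]) auto
    then show "sqrt (\<integral>y. (?h j y)^2 \<partial>PM (touch P (bl s n j))) = L2norm (n j) (g j)"
      by (simp add: L2norm_def)
  qed
  finally show "\<bar>PI P r s n g\<bar> \<le> (\<Prod>j<r. L2norm (n j) (g j))" .
qed

lemma prod_upd:
  fixes F :: "nat \<Rightarrow> 'b \<Rightarrow> real"
  assumes "j0 < r"
  shows "(\<Prod>j<r. F j ((g(j0 := u)) j)) = F j0 u * (\<Prod>j\<in>{..<r}-{j0}. F j (g j))"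
proof -
  have "(\<Prod>j<r. F j ((g(j0 := u)) j)) = F j0 ((g(j0 := u)) j0) * (\<Prod>j\<in>{..<r}-{j0}. F j ((g(j0 := u)) j))"
    using assms by (intro prod.remove) auto
  also have "(\<Prod>j\<in>{..<r}-{j0}. F j ((g(j0 := u)) j)) = (\<Prod>j\<in>{..<r}-{j0}. F j (g j))"
    by (rule prod.cong) auto
  finally show ?thesis by simp
qed

lemma PI_linear:
  assumes bs: "blocks r s n" and P: "P \<in> bip {..<r} (bl s n)" and g: "\<And>j. j < r \<Longrightarrow> L2 (n j) (g j)"
    and j0: "j0 < r" and u: "L2 (n j0) u" and v: "L2 (n j0) v"
  shows "PI P r s n (g(j0 := (\<lambda>x. u x + v x))) = PI P r s n (g(j0 := u)) + PI P r s n (g(j0 := v))"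
    and "PI P r s n (g(j0 := (\<lambda>x. c * u x))) = c * PI P r s n (g(j0 := u))"
    and "PI P r s n (g(j0 := (\<lambda>x. u x - v x))) = PI P r s n (g(j0 := u)) - PI P r s n (g(j0 := v))"
proof -
  have i: "integrable (PM P) (\<lambda>y. \<Prod>j<r. (g(j0 := w)) j (parg P (s j) (n j) y))" if "L2 (n j0) w" for w
    by (rule PI_bound(1)[OF bs P]) (use g that in auto)
  have p: "(\<Prod>j<r. (g(j0 := w)) j (parg P (s j) (n j) y))
     = w (parg P (s j0) (n j0) y) * (\<Prod>j\<in>{..<r}-{j0}. g j (parg P (s j) (n j) y))" for w y
    by (rule prod_upd[OF j0, of "\<lambda>j f. f (parg P (s j) (n j) y)"])
  note iu = i[OF u, unfolded p] and iv = i[OF v, unfolded p]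
  show "PI P r s n (g(j0 := (\<lambda>x. u x + v x))) = PI P r s n (g(j0 := u)) + PI P r s n (g(j0 := v))"
    unfolding PI_def p using iu iv by (simp add: distrib_right)
  show "PI P r s n (g(j0 := (\<lambda>x. c * u x))) = c * PI P r s n (g(j0 := u))"
    unfolding PI_def p by (simp add: mult.assoc)
  show "PI P r s n (g(j0 := (\<lambda>x. u x - v x))) = PI P r s n (g(j0 := u)) - PI P r s n (g(j0 := v))"
    unfolding PI_def p using iu iv by (simp add: left_diff_distrib)
qed

lemma PI_tendsto:
  assumes bs: "blocks r s n" and P: "P \<in> bip {..<r} (bl s n)" and g: "\<And>j. j < r \<Longrightarrow> L2 (n j) (g j)"
    and j0: "j0 < r" and u: "L2 (n j0) u" and w: "\<And>k. L2 (n j0) (w k)"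
    and lim: "(\<lambda>k. L2norm (n j0) (\<lambda>x. w k x - u x)) \<longlonglongrightarrow> 0"
  shows "(\<lambda>k. PI P r s n (g(j0 := w k))) \<longlonglongrightarrow> PI P r s n (g(j0 := u))"
proof -
  let ?C = "\<Prod>j\<in>{..<r}-{j0}. L2norm (n j) (g j)"
  have "\<bar>PI P r s n (g(j0 := w k)) - PI P r s n (g(j0 := u))\<bar> \<le> L2norm (n j0) (\<lambda>x. w k x - u x) * ?C" for k
  proof -
    have d: "L2 (n j0) (\<lambda>x. w k x - u x)" using u w[of k] by (simp add: L2_sqint sqint_diff)
    have "\<bar>PI P r s n (g(j0 := w k)) - PI P r s n (g(j0 := u))\<bar> = \<bar>PI P r s n (g(j0 := (\<lambda>x. w k x - u x)))\<bar>"
      by (simp only: PI_linear(3)[OF bs P g j0 w u])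
    also have "\<dots> \<le> (\<Prod>j<r. L2norm (n j) ((g(j0 := (\<lambda>x. w k x - u x))) j))"
      by (rule PI_bound(2)[OF bs P]) (use g d in auto)
    also have "\<dots> = L2norm (n j0) (\<lambda>x. w k x - u x) * ?C"
      by (rule prod_upd[OF j0, of "\<lambda>j f. L2norm (n j) f"])
    finally show ?thesis .
  qed
  moreover have "(\<lambda>k. L2norm (n j0) (\<lambda>x. w k x - u x) * ?C) \<longlonglongrightarrow> 0"
    using tendsto_mult_left_zero[OF lim] by simp
  ultimately show ?thesis
  proof -
    assume b: "\<And>k. \<bar>PI P r s n (g(j0 := w k)) - PI P r s n (g(j0 := u))\<bar> \<le> L2norm (n j0) (\<lambda>x. w k x - u x) * ?C"
      and l: "(\<lambda>k. L2norm (n j0) (\<lambda>x. w k x - u x) * ?C) \<longlonglongrightarrow> 0"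
    have "(\<lambda>k. PI P r s n (g(j0 := w k)) - PI P r s n (g(j0 := u))) \<longlonglongrightarrow> 0"
      by (rule Lim_null_comparison[OF _ l]) (simp only: real_norm_def b eventually_True)
    then show ?thesis by (simp only: LIM_zero_iff)
  qed
qed

definition ovl :: "(nat \<Rightarrow> real) \<Rightarrow> (nat \<Rightarrow> real) \<Rightarrow> nat set \<Rightarrow> real" where
  "ovl a b B = (\<integral>t. (\<Prod>x\<in>B. indicator {a x<..<b x} t) \<partial>restrict_space lborel {0::real..})"

lemma ovl_pair:
  assumes "x \<noteq> y" "0 \<le> a x" "a x < b x" "0 \<le> a y" "a y < b y"
  shows "ovl a b {x, y} = max 0 (min (b x) (b y) - max (a x) (a y))"
proof -
  let ?I = "{max (a x) (a y)<..<min (b x) (b y)}"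
  have e: "(\<Prod>z\<in>{x,y}. indicator {a z<..<b z} t) = (indicator ?I t :: real)" for t
    using assms(1) by (auto simp: indicator_def)
  have "ovl a b {x, y} = (\<integral>t. indicator ?I t \<partial>restrict_space lborel {0::real..})"
    unfolding ovl_def e ..
  also have "\<dots> = (\<integral>t. indicator ?I t \<partial>lborel)"
  proof -
    have "indicator {0..} t *\<^sub>R indicator ?I t = (indicator ?I t :: real)" for t
      using assms by (auto simp: indicator_def)
    then show ?thesis by (subst integral_restrict_space, simp) (simp only:)
  qed
  also have "\<dots> = measure lborel ?I" by simp
  also have "\<dots> = max 0 (min (b x) (b y) - max (a x) (a y))"
  proof (cases "max (a x) (a y) \<le> min (b x) (b y)")
    case True
    then show ?thesis by (simp only: measure_lborel_Ioo max_absorb2 diff_ge_0_iff_ge)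
  next
    case False
    then have "?I = {}" by (intro greaterThanLessThan_empty) linarith
    then show ?thesis using False by (simp only: measure_empty)
  qed
  finally show ?thesis .
qed

lemma integrable_indicator_pair:
  assumes "x \<noteq> y"
  shows "integrable (restrict_space lborel {0::real..}) (\<lambda>t. \<Prod>z\<in>{x, y}. indicator {a z<..<b z} t :: real)"
proof -
  let ?I = "{max (a x) (a y)<..<min (b x) (b y)}"
  have e: "(\<Prod>z\<in>{x,y}. indicator {a z<..<b z} t) = (indicator ?I t :: real)" for t
    using assms(1) by (auto simp: indicator_def)
  have ioo: "emeasure lborel {l<..<u} < \<infinity>" for l u :: real
    by (cases "l \<le> u") (auto simp: emeasure_lborel_Ioo)
  have "integrable lborel (\<lambda>t. indicator {0..} t *\<^sub>R (indicator ?I t :: real))"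
    by (rule integrable_mult_indicator) (auto intro!: integrable_real_indicator ioo)
  then show ?thesis unfolding e by (subst integrable_restrict_space) (auto simp: set_integrable_def)
qed

text \<open>A box function is a product over points, and the points can be regrouped by pairs. Each
  variable then meets only the two indicators of its own pair, and the integral is a product of
  lengths of overlaps.\<close>

lemma PI_box:
  assumes bs: "blocks r s n" and P: "P \<in> bip {..<r} (bl s n)"
  shows "PI P r s n (\<lambda>j. box_fun (n j) (\<lambda>i. a (s j + i)) (\<lambda>i. b (s j + i))) = (\<Prod>B\<in>P. ovl a b B)"
proof -
  let ?L = "restrict_space lborel {0::real..}"
  let ?S = "\<Union>j\<in>{..<r}. bl s n j"
  note pr = bip_pairings[OF P]
  have finP: "finite P" by (rule finite_bip_pairing[OF P])
  have dis: "\<forall>i\<in>{..<r}. \<forall>j\<in>{..<r}. i \<noteq> j \<longrightarrow> bl s n i \<inter> bl s n j = {}"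
    using separated_unique[OF blocks_separated[OF bs]] by blast
  have "(\<Prod>j<r. box_fun (n j) (\<lambda>i. a (s j + i)) (\<lambda>i. b (s j + i)) (parg P (s j) (n j) y))
     = (\<Prod>B\<in>P. \<Prod>x\<in>B. indicator {a x<..<b x} (y B))" for y
  proof -
    let ?F = "\<lambda>x. indicator {a x<..<b x} (y (blk P x)) :: real"
    have "(\<Prod>j<r. box_fun (n j) (\<lambda>i. a (s j + i)) (\<lambda>i. b (s j + i)) (parg P (s j) (n j) y))
       = (\<Prod>j<r. \<Prod>x\<in>bl s n j. ?F x)"
    proof (rule prod.cong[OF refl])
      fix j
      have b: "bij_betw (\<lambda>i. s j + i) {..<n j} (bl s n j)"
        by (rule bij_betwI[where g = "\<lambda>x. x - s j"]) (auto simp: bl_def)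
      show "box_fun (n j) (\<lambda>i. a (s j + i)) (\<lambda>i. b (s j + i)) (parg P (s j) (n j) y) = (\<Prod>x\<in>bl s n j. ?F x)"
        using prod.reindex_bij_betw[OF b, of ?F] by (simp add: box_fun_def parg_def)
    qed
    also have "\<dots> = (\<Prod>x\<in>?S. ?F x)" using dis by (intro prod.UNION_disjoint[symmetric]) auto
    also have "?S = \<Union>P" using pr by (simp add: pairings_on_def)
    also have "(\<Prod>x\<in>\<Union>P. ?F x) = (\<Prod>B\<in>P. \<Prod>x\<in>B. ?F x)"
      using pr by (subst prod.Union_disjoint) (auto simp: pairings_on_def intro: card_ge_0_finite)
    also have "\<dots> = (\<Prod>B\<in>P. \<Prod>x\<in>B. indicator {a x<..<b x} (y B))"
      by (intro prod.cong refl) (simp add: blk_eq[OF pr])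
    finally show ?thesis .
  qed
  then have "PI P r s n (\<lambda>j. box_fun (n j) (\<lambda>i. a (s j + i)) (\<lambda>i. b (s j + i)))
     = (\<integral>y. (\<Prod>B\<in>P. (\<lambda>t. \<Prod>x\<in>B. indicator {a x<..<b x} t) (y B)) \<partial>PiM P (\<lambda>_. ?L))"
    by (simp add: PI_def PM_def)
  also have "\<dots> = (\<Prod>B\<in>P. (\<integral>t. (\<Prod>x\<in>B. indicator {a x<..<b x} t) \<partial>?L))"
  proof (rule HL.product_integral_prod[OF finP])
    fix B assume "B \<in> P"
    then obtain x y where "B = {x, y}" "x \<noteq> y" using pairings_on_card[OF pr] unfolding card_2_iff by blast
    then show "integrable ?L (\<lambda>t. \<Prod>x\<in>B. indicator {a x<..<b x} t :: real)"
      unfolding \<open>B = {x, y}\<close> by (intro integrable_indicator_pair)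
  qed
  finally show ?thesis by (simp add: ovl_def)
qed

subsection \<open>The diagram formula\<close>

lemma L2_permarg:
  assumes "\<sigma> permutes {..<n}" "L2 n f"
  shows "L2 n (\<lambda>x. f (permarg n \<sigma> x))" "L2norm n (\<lambda>x. f (permarg n \<sigma> x)) = L2norm n f"
  using sqint_reindex[OF permutes_imp_bij[OF assms(1)] finite_lessThan assms(2)[unfolded L2_sqint]]
  by (auto simp: permarg_def L2_sqint L2norm_def Mn_eq_PM)

lemma L2norm_nonneg: "0 \<le> L2norm n f"
  by (simp add: L2norm_def)

lemma L2norm_sq: "(L2norm n f)^2 = (\<integral>x. (f x)^2 \<partial>Mn n)"
  by (simp add: L2norm_def)

lemma L2_inner_bound:
  assumes "L2 n f" "L2 n g" shows "\<bar>\<integral>x. f x * g x \<partial>Mn n\<bar> \<le> L2norm n f * L2norm n g"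
  using CS_real[of "Mn n" f g] assms by (simp add: L2_sqint Mn_eq_PM L2norm_def)

text \<open>Each of the \<open>fact n\<close> terms is at most the squared norm, by Cauchy-Schwarz
  and because the weight is at most 1. Together with the isometry this makes \<open>I n\<close>
  continuous.\<close>

lemma qip_self_bound:
  assumes q: "0 \<le> q" "q \<le> 1" and f: "L2 n f"
  shows "qip q n f f \<le> fact n * (L2norm n f)^2"
proof -
  have "qip q n f f \<le> (\<Sum>\<sigma>\<in>{\<sigma>. \<sigma> permutes {..<n}}. (L2norm n f)^2)"
    unfolding qip_def
  proof (rule sum_mono)
    fix \<sigma> assume "\<sigma> \<in> {\<sigma>. \<sigma> permutes {..<n}}"
    then have \<sigma>: "\<sigma> permutes {..<n}" by simp
    have b: "\<bar>\<integral>x. f (permarg n \<sigma> x) * f x \<partial>Mn n\<bar> \<le> (L2norm n f)^2"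
      using L2_inner_bound[OF L2_permarg(1)[OF \<sigma> f] f] by (simp add: L2_permarg(2)[OF \<sigma> f] power2_eq_square)
    have "q ^ inversions n \<sigma> * (\<integral>x. f (permarg n \<sigma> x) * f x \<partial>Mn n)
      \<le> q ^ inversions n \<sigma> * (L2norm n f)^2"
      using b q by (intro mult_left_mono) auto
    also have "\<dots> \<le> 1 * (L2norm n f)^2"
      using q by (intro mult_right_mono power_le_one) auto
    finally show "q ^ inversions n \<sigma> * (\<integral>x. f (permarg n \<sigma> x) * f x \<partial>Mn n) \<le> (L2norm n f)^2" by simp
  qed
  also have "\<dots> = fact n * (L2norm n f)^2" by (simp add: card_permutations)
  finally show ?thesis .
qed

lemma sorted_concat_blocks:
  assumes "blocks r s n" "k \<le> r"
  shows "sorted_wrt (<) (concat (map (\<lambda>j. [s j..<s j + n j]) [0..<k]))"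
  using assms(2)
proof (induction k)
  case (Suc k)
  have "x < y" if h: "x \<in> set (concat (map (\<lambda>j. [s j..<s j + n j]) [0..<k]))" "y \<in> set [s k..<s k + n k]" for x y
  proof -
    obtain j where "j < k" "x < s j + n j" using h(1) by auto
    then show ?thesis using blocks_le[OF assms(1), of j k] h(2) Suc.prems by simp
  qed
  moreover have "sorted_wrt (<) (concat (map (\<lambda>j. [s j..<s j + n j]) [0..<k]))"
    using Suc by simp
  moreover have "concat (map (\<lambda>j. [s j..<s j + n j]) [0..<Suc k])
      = concat (map (\<lambda>j. [s j..<s j + n j]) [0..<k]) @ [s k..<s k + n k]" by simp
  ultimately show ?case
    using sorted_wrt_upt[of "s k" "s k + n k"] by (simp only: sorted_wrt_append) blast
qed simp

lemma prod_list_concat: "prod_list (concat xss) = prod_list (map prod_list xss)"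
  by (induction xss) auto

section \<open>Positivity of the state and the diagram formula\<close>

context qBM
begin

definition nrm2 :: "'a \<Rightarrow> real" where "nrm2 x = Re (\<phi> (star x * x))"

lemma nrm2_nonneg: "0 \<le> nrm2 x"
  unfolding nrm2_def by (rule \<phi>_pos)

lemma nrm2_complex: "\<phi> (star x * x) = complex_of_real (nrm2 x)"
  using \<phi>_pos_Im[of x] by (simp add: nrm2_def complex_eq_iff)

text \<open>The quadratic polynomial \<open>nrm2 (t *\<^sub>R x + y)\<close> in the real variable
  \<open>t\<close> is nonnegative, so its discriminant is not positive. If its leading coefficient
  vanishes, it is linear and its slope must be 0.\<close>

lemma Re_\<phi>_CS: "(Re (\<phi> (star x * y)))^2 \<le> nrm2 x * nrm2 y"
proof -
  have e: "nrm2 (t *\<^sub>R x + y) = t^2 * nrm2 x + 2 * t * Re (\<phi> (star x * y)) + nrm2 y" for t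
  proof -
    have "star (t *\<^sub>R x + y) * (t *\<^sub>R x + y) = t^2 *\<^sub>R (star x * x) + t *\<^sub>R (star x * y) + t *\<^sub>R (star y * x) + star y * y"
      by (simp add: star_add star_scaleR algebra_simps power2_eq_square)
    moreover have "Re (\<phi> (star y * x)) = Re (\<phi> (star x * y))"
      using \<phi>_star[of "star x * y"] by (simp add: star_mult)
    ultimately show ?thesis by (simp add: nrm2_def \<phi>_add \<phi>_scaleR)
  qed
  have p: "0 \<le> t^2 * nrm2 x + 2 * t * Re (\<phi> (star x * y)) + nrm2 y" for t
    using nrm2_nonneg[of "t *\<^sub>R x + y"] e by simp
  show ?thesis
  proof (cases "nrm2 x = 0")
    case True
    have "Re (\<phi> (star x * y)) = 0"
    proof (rule ccontr)
      assume n: "Re (\<phi> (star x * y)) \<noteq> 0"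
      \<comment> \<open>For this value of \<open>t\<close> the linear function equals -1.\<close>
      have "0 \<le> 2 * (- (nrm2 y + 1) / (2 * Re (\<phi> (star x * y)))) * Re (\<phi> (star x * y)) + nrm2 y"
        using p[of "- (nrm2 y + 1) / (2 * Re (\<phi> (star x * y)))"] True by simp
      then show False using n by (simp add: field_simps)
    qed
    then show ?thesis using True by simp
  next
    case False
    then have pos: "nrm2 x > 0" using nrm2_nonneg[of x] by simp
    have "0 \<le> nrm2 x * ((- Re (\<phi> (star x * y)) / nrm2 x)^2 * nrm2 x
        + 2 * (- Re (\<phi> (star x * y)) / nrm2 x) * Re (\<phi> (star x * y)) + nrm2 y)"
      using p[of "- Re (\<phi> (star x * y)) / nrm2 x"] pos by simp
    also have "\<dots> = nrm2 x * nrm2 y - (Re (\<phi> (star x * y)))^2"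
      using pos by (simp add: field_simps power2_eq_square)
    finally show ?thesis by simp
  qed
qed

lemma \<phi>_tendsto_zero:
  assumes "(\<lambda>k. nrm2 (w k)) \<longlonglongrightarrow> 0"
  shows "(\<lambda>k. \<phi> (z * w k)) \<longlonglongrightarrow> 0"
proof -
  have R: "(\<lambda>k. Re (\<phi> (z * w k))) \<longlonglongrightarrow> 0" for z
  proof (rule Lim_null_comparison)
    have "\<bar>Re (\<phi> (z * w k))\<bar> \<le> sqrt (nrm2 (star z) * nrm2 (w k))" for k
      using Re_\<phi>_CS[of "star z" "w k"] by (simp add: real_le_rsqrt)
    then show "\<forall>\<^sub>F k in sequentially. norm (Re (\<phi> (z * w k))) \<le> sqrt (nrm2 (star z) * nrm2 (w k))" by simp
    have "(\<lambda>k. sqrt (nrm2 (star z) * nrm2 (w k))) \<longlonglongrightarrow> sqrt (nrm2 (star z) * 0)"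
      by (intro tendsto_intros assms)
    then show "(\<lambda>k. sqrt (nrm2 (star z) * nrm2 (w k))) \<longlonglongrightarrow> 0" by simp
  qed
  \<comment> \<open>The central element \<open>J\<close> turns the imaginary part into a real part,
    for which the bound is already available.\<close>
  have "Im (\<phi> (z * w k)) = - Re (\<phi> ((J * z) * w k))" for k
    using \<phi>_J[of "z * w k"] by (simp add: mult.assoc)
  then have "(\<lambda>k. Im (\<phi> (z * w k))) \<longlonglongrightarrow> 0" using tendsto_minus[OF R[of "J * z"]] by simp
  then show ?thesis using R[of z] by (simp add: tendsto_complex_iff)
qed

lemma I_diff: "n \<ge> 1 \<Longrightarrow> L2 n f \<Longrightarrow> L2 n g \<Longrightarrow> I n (\<lambda>x. f x - g x) = I n f - I n g"
  using I_add[of n f "\<lambda>x. (-1) * g x"] I_scale[of n g "-1"] sqint_cmult[of "PM {..<n}" g "-1"]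
  by (simp add: L2_sqint)

lemma nrm2_I: "n \<ge> 1 \<Longrightarrow> L2 n f \<Longrightarrow> nrm2 (I n f) = qip q n f f"
  using I_isometry[of n n f f] by (simp add: nrm2_def)

lemma nrm2_I_tendsto:
  assumes n: "n \<ge> 1" and s: "\<And>k. L2 n (s k)" and f: "L2 n f"
    and lim: "(\<lambda>k. L2norm n (\<lambda>x. s k x - f x)) \<longlonglongrightarrow> 0"
  shows "(\<lambda>k. nrm2 (I n (s k) - I n f)) \<longlonglongrightarrow> 0"
proof (rule Lim_null_comparison)
  have "nrm2 (I n (s k) - I n f) \<le> fact n * (L2norm n (\<lambda>x. s k x - f x))^2" for k
    using n s[of k] f nrm2_I[of n "\<lambda>x. s k x - f x"] qip_self_bound[of q n "\<lambda>x. s k x - f x"] q0 q1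
    by (simp add: I_diff L2_sqint sqint_diff)
  then show "\<forall>\<^sub>F k in sequentially. norm (nrm2 (I n (s k) - I n f)) \<le> fact n * (L2norm n (\<lambda>x. s k x - f x))^2"
    using nrm2_nonneg by simp
  have "(\<lambda>k. fact n * (L2norm n (\<lambda>x. s k x - f x))^2) \<longlonglongrightarrow> fact n * 0^2"
    by (intro tendsto_intros lim)
  then show "(\<lambda>k. fact n * (L2norm n (\<lambda>x. s k x - f x))^2) \<longlonglongrightarrow> 0" by simp
qed

text \<open>Traciality moves \<open>z'\<close> to the front. The varying factor then stands last,
  next to a fixed element, and its 2-norm alone controls the error.\<close>

lemma \<phi>_I_tendsto:
  assumes "n \<ge> 1" "\<And>k. L2 n (s k)" "L2 n f" "(\<lambda>k. L2norm n (\<lambda>x. s k x - f x)) \<longlonglongrightarrow> 0"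
  shows "(\<lambda>k. \<phi> (z * I n (s k) * z')) \<longlonglongrightarrow> \<phi> (z * I n f * z')"
proof -
  have "(\<lambda>k. \<phi> ((z' * z) * (I n (s k) - I n f))) \<longlonglongrightarrow> 0"
    by (rule \<phi>_tendsto_zero[OF nrm2_I_tendsto[OF assms]])
  moreover have "\<phi> ((z' * z) * (I n (s k) - I n f)) = \<phi> (z * I n (s k) * z') - \<phi> (z * I n f * z')" for k
    using \<phi>_trace[of z' "z * I n (s k)"] \<phi>_trace[of z' "z * I n f"]
    by (simp add: right_diff_distrib \<phi>_diff mult.assoc)
  ultimately show ?thesis by (simp add: LIM_zero_iff)
qed

lemma cov_eq_ovl:
  assumes "x \<in> D" "y \<in> D" "x \<noteq> y" "0 \<le> a x" "a x < b x" "0 \<le> a y" "a y < b y"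
  shows "cov D a b x y = ovl a b {x, y}"
  unfolding ovl_pair[OF assms(3-7)] using assms by (auto simp: cov_def min_def max_def)

definition DS :: "nat \<Rightarrow> (nat \<Rightarrow> nat) \<Rightarrow> (nat \<Rightarrow> nat) \<Rightarrow> (nat \<Rightarrow> (nat \<Rightarrow> real) \<Rightarrow> real) \<Rightarrow> real" where
  "DS r s n g = (\<Sum>P\<in>bip {..<r} (bl s n). q ^ Cr P * PI P r s n g)"

definition Iprod :: "nat \<Rightarrow> (nat \<Rightarrow> nat) \<Rightarrow> (nat \<Rightarrow> (nat \<Rightarrow> real) \<Rightarrow> real) \<Rightarrow> 'a" where
  "Iprod r n g = prod_list (map (\<lambda>j. I (n j) (g j)) [0..<r])"

lemma diagram_box:
  assumes bs: "blocks r s n" and ab: "\<And>j. j < r \<Longrightarrow> disjoint_box (n j) (a j) (b j)"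
    and g: "\<And>j. j < r \<Longrightarrow> g j = box_fun (n j) (a j) (b j)"
  shows "\<phi> (Iprod r n g) = complex_of_real (DS r s n g)"
proof -
  \<comment> \<open>The block of a point; through it the end points given block by block become
    functions \<open>a'\<close>, \<open>b'\<close> of the points.\<close>
  define own where "own x = (THE j. j < r \<and> x \<in> bl s n j)" for x
  have own: "own x = j" if "j < r" "x \<in> bl s n j" for x j
    unfolding own_def
    by (rule the_equality) (use that separated_unique[OF blocks_separated[OF bs]] in auto)
  define a' where "a' x = a (own x) (x - s (own x))" for x
  define b' where "b' x = b (own x) (x - s (own x))" for x
  have a'b': "a' (s j + i) = a j i" "b' (s j + i) = b j i" if "j < r" "i < n j" for i j
    using own[of j "s j + i"] that by (auto simp: a'_def b'_def bl_def)
  let ?xs = "concat (map (\<lambda>j. [s j..<s j + n j]) [0..<r])"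
  let ?S = "\<Union>j\<in>{..<r}. bl s n j"
  have xs: "sorted ?xs" "distinct ?xs"
    using sorted_concat_blocks[OF bs order_refl] by (auto simp: strict_sorted_iff)
  have set: "set ?xs = ?S" by (auto simp: bl_def)
  have pos: "0 \<le> a' x" "a' x < b' x" if x: "x \<in> ?S" for x
  proof -
    obtain j where j: "j < r" "x \<in> bl s n j" using x by auto
    then have "x = s j + (x - s j)" "x - s j < n j" by (auto simp: bl_def)
    then show "0 \<le> a' x" "a' x < b' x"
      using a'b'[OF j(1), of "x - s j"] ab[OF j(1)] by (auto simp: disjoint_box_def)
  qed
  have pos': "0 \<le> b' x" if "x \<in> ?S" for x using pos[OF that] by linarith
  have "Iprod r n g = prod_list (map (\<lambda>x. X (b' x) - X (a' x)) ?xs)"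
  proof -
    have I_eq: "I (n j) (g j) = prod_list (map (\<lambda>x. X (b' x) - X (a' x)) [s j..<s j + n j])" if j: "j < r" for j
    proof -
    have "I (n j) (g j) = prod_list (map (\<lambda>i. X (b j i) - X (a j i)) [0..<n j])"
      unfolding g[OF j] box_fun_def
      using ab[OF j] bs j by (intro I_box'[rule_format]) (auto simp: disjoint_box_def blocks_def)
    also have "map (\<lambda>i. X (b j i) - X (a j i)) [0..<n j] = map (\<lambda>i. X (b' (i + s j)) - X (a' (i + s j))) [0..<n j]"
      using a'b'[OF j] by (intro map_cong) (auto simp: add.commute)
    also have "\<dots> = map (\<lambda>x. X (b' x) - X (a' x)) [s j..<s j + n j]"
    proof -
      have u: "[s j..<s j + n j] = map (\<lambda>i. i + s j) [0..<n j]" by (simp add: map_add_upt add.commute)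
      show ?thesis unfolding u by simp
    qed
    finally show ?thesis .
    qed
    have "map (\<lambda>j. I (n j) (g j)) [0..<r] = map (\<lambda>j. prod_list (map (\<lambda>x. X (b' x) - X (a' x)) [s j..<s j + n j])) [0..<r]"
      by (rule map_cong[OF refl]) (simp add: I_eq)
    then have "Iprod r n g = prod_list (map (\<lambda>j. prod_list (map (\<lambda>x. X (b' x) - X (a' x)) [s j..<s j + n j])) [0..<r])"
      by (simp only: Iprod_def)
    then show ?thesis by (simp add: map_concat prod_list_concat comp_def)
  qed
  then have "\<phi> (Iprod r n g) = complex_of_real (\<Sum>P\<in>pairings_on ?S. q ^ Cr P * (\<Prod>B\<in>P. cov ?S a' b' (Min B) (Max B)))"
    using increments_moment[OF xs, of a' b'] pos(1) pos' unfolding set by (simp only:)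
  also have "(\<Sum>P\<in>pairings_on ?S. q ^ Cr P * (\<Prod>B\<in>P. cov ?S a' b' (Min B) (Max B)))
     = (\<Sum>P\<in>pairings_on ?S. q ^ Cr P * (\<Prod>B\<in>P. ovl a' b' B))"
  proof (intro sum.cong refl arg_cong[where f = "(*) _"] prod.cong)
    fix P B assume P: "P \<in> pairings_on ?S" and B: "B \<in> P"
    note mm = pair_Min_Max[OF pairings_on_card[OF P B]]
    have mem: "Min B \<in> ?S" "Max B \<in> ?S"
      using pair_Min_Max_mem[OF pairings_on_card[OF P B]] pairings_on_sub[OF P B] by blast+
    have "cov ?S a' b' (Min B) (Max B) = ovl a' b' {Min B, Max B}"
      by (rule cov_eq_ovl[OF mem less_imp_neq[OF mm(2)] pos[OF mem(1)] pos[OF mem(2)]])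
    then show "cov ?S a' b' (Min B) (Max B) = ovl a' b' B" using mm(1) by simp
  qed
  also have "\<dots> = (\<Sum>P\<in>bip {..<r} (bl s n). q ^ Cr P * (\<Prod>B\<in>P. ovl a' b' B))"
  proof (rule sum.mono_neutral_right)
    show "finite (pairings_on ?S)" by (rule finite_pairings_on) simp
    show "bip {..<r} (bl s n) \<subseteq> pairings_on ?S" by (auto simp: bip_def)
    \<comment> \<open>A pair inside a block joins two disjoint intervals, so its overlap has length
      0. This is how the condition that no pair lies inside a block arises.\<close>
    show "\<forall>P\<in>pairings_on ?S - bip {..<r} (bl s n). q ^ Cr P * (\<Prod>B\<in>P. ovl a' b' B) = 0"
    proof
      fix P assume P: "P \<in> pairings_on ?S - bip {..<r} (bl s n)"
      then obtain B j where B: "B \<in> P" "j < r" "B \<subseteq> bl s n j" by (auto simp: bip_def)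
      have pr: "P \<in> pairings_on ?S" using P by simp
      obtain x y where xy: "B = {x, y}" "x \<noteq> y" using pairings_on_card[OF pr B(1)] unfolding card_2_iff by blast
      have x: "x = s j + (x - s j)" "x - s j < n j" and y: "y = s j + (y - s j)" "y - s j < n j"
        using B xy by (auto simp: bl_def)
      have xS: "x \<in> ?S" "y \<in> ?S" using B xy by auto
      have ne: "x - s j \<noteq> y - s j" using xy(2) x y by linarith
      have e: "{a' x<..<b' x} \<inter> {a' y<..<b' y} = {}"
        using ab[OF B(2)] ne x(2) y(2) a'b'[OF B(2) x(2)] a'b'[OF B(2) y(2)] x(1) y(1)
        unfolding disjoint_box_def by metis
      have "\<not> max (a' x) (a' y) < min (b' x) (b' y)"
      proof
        assume "max (a' x) (a' y) < min (b' x) (b' y)"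
        then obtain t where "max (a' x) (a' y) < t" "t < min (b' x) (b' y)" using dense by blast
        then have "t \<in> {a' x<..<b' x} \<inter> {a' y<..<b' y}" by simp
        then show False using e by blast
      qed
      then have "min (b' x) (b' y) - max (a' x) (a' y) \<le> 0" by (simp only: not_less diff_le_0_iff_le)
      then have "ovl a' b' B = 0"
        using ovl_pair[OF xy(2) pos[OF xS(1)] pos[OF xS(2)]] by (simp only: xy(1) max_absorb1)
      then show "q ^ Cr P * (\<Prod>B\<in>P. ovl a' b' B) = 0"
        using B(1) finite_pairing[OF _ pr] by (auto intro!: prod_zero)
    qed
  qed
  also have "\<dots> = DS r s n g"
    unfolding DS_def
  proof (rule sum.cong[OF refl])
    fix P assume P: "P \<in> bip {..<r} (bl s n)"
    have "g j (parg P (s j) (n j) y) = box_fun (n j) (\<lambda>i. a' (s j + i)) (\<lambda>i. b' (s j + i)) (parg P (s j) (n j) y)"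
      if "j < r" for j y
      unfolding g[OF that] box_fun_def using a'b'[OF that] by (intro prod.cong) auto
    then have "PI P r s n g = PI P r s n (\<lambda>j. box_fun (n j) (\<lambda>i. a' (s j + i)) (\<lambda>i. b' (s j + i)))"
      unfolding PI_def by (intro Bochner_Integration.integral_cong prod.cong) auto
    then show "q ^ Cr P * (\<Prod>B\<in>P. ovl a' b' B) = q ^ Cr P * PI P r s n g"
      using PI_box[OF bs P, of a' b'] by simp
  qed
  finally show ?thesis .
qed

lemma Iprod_upd:
  assumes "m < r"
  shows "Iprod r n (g(m := u)) = prod_list (map (\<lambda>j. I (n j) (g j)) [0..<m]) * I (n m) u
     * prod_list (map (\<lambda>j. I (n j) (g j)) [Suc m..<r])"
proof -
  have "[0..<r] = [0..<m] @ m # [Suc m..<r]"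
    using assms by (metis less_imp_add_positive upt_add_eq_append upt_conv_Cons le0 less_imp_le_nat)
  moreover have "map (\<lambda>j. I (n j) ((g(m := u)) j)) [0..<m] = map (\<lambda>j. I (n j) (g j)) [0..<m]"
    "map (\<lambda>j. I (n j) ((g(m := u)) j)) [Suc m..<r] = map (\<lambda>j. I (n j) (g j)) [Suc m..<r]"
    by (auto intro!: map_cong)
  ultimately show ?thesis
    by (simp only: Iprod_def map_append list.map prod_list.append prod_list.Cons fun_upd_same mult.assoc)
qed

text \<open>Induction on the number \<open>m\<close> of leading slots that may hold arbitrary
  square-integrable functions while the later ones hold disjoint boxes. Each step frees one slot by
  \<open>L2_induct\<close>, both sides being linear and continuous in that slot.\<close>

lemma diagram_formula:
  assumes bs: "blocks r s n" and g: "\<And>j. j < r \<Longrightarrow> L2 (n j) (g j)"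
  shows "\<phi> (Iprod r n g) = complex_of_real (DS r s n g)"
proof -
  have "\<phi> (Iprod r n g) = complex_of_real (DS r s n g)"
    if "m \<le> r" "\<And>j. j < m \<Longrightarrow> L2 (n j) (g j)"
      "\<And>j. m \<le> j \<Longrightarrow> j < r \<Longrightarrow> \<exists>a b. disjoint_box (n j) a b \<and> g j = box_fun (n j) a b" for m g
    using that
  proof (induction m arbitrary: g)
    case 0
    then have "\<forall>j. \<exists>a b. j < r \<longrightarrow> disjoint_box (n j) a b \<and> g j = box_fun (n j) a b" by blast
    then obtain a b where "\<And>j. j < r \<Longrightarrow> disjoint_box (n j) (a j) (b j) \<and> g j = box_fun (n j) (a j) (b j)" by metis
    then show ?case by (intro diagram_box[OF bs]) auto
  next
    case (Suc m)
    have m: "m < r" using Suc.prems by simp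
    have nm: "n m \<ge> 1" using bs m by (simp add: blocks_def)
    have L2g: "L2 (n j) (g j)" if "j < r" for j
    proof (cases "j < Suc m")
      case False
      then show ?thesis using Suc.prems(3)[of j] that L2_box_fun by auto
    qed (rule Suc.prems)
    let ?Q = "\<lambda>u. \<phi> (Iprod r n (g(m := u))) = complex_of_real (DS r s n (g(m := u)))"
    have "?Q (g m)"
    proof (rule L2_induct[where n = "n m" and Q = ?Q])
      show "L2 (n m) (g m)" using L2g m by simp
      show "?Q (box_fun (n m) a b)" if ab: "disjoint_box (n m) a b" for a b
      proof (rule Suc.IH)
        show "\<exists>a' b'. disjoint_box (n j) a' b' \<and> (g(m := box_fun (n m) a b)) j = box_fun (n j) a' b'"
          if "m \<le> j" "j < r" for j
        proof (cases "j = m")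
          case True
          then show ?thesis using ab by auto
        next
          case False
          then show ?thesis using Suc.prems(3)[of j] that by auto
        qed
      qed (use Suc.prems in auto)
      show "?Q (\<lambda>x. u x + v x)" if uv: "L2 (n m) u" "L2 (n m) v" "?Q u" "?Q v" for u v
      proof -
        have "\<phi> (Iprod r n (g(m := (\<lambda>x. u x + v x)))) = \<phi> (Iprod r n (g(m := u))) + \<phi> (Iprod r n (g(m := v)))"
          unfolding Iprod_upd[OF m] I_add[OF nm uv(1,2)] by (simp add: distrib_left distrib_right \<phi>_add)
        moreover have "DS r s n (g(m := (\<lambda>x. u x + v x))) = DS r s n (g(m := u)) + DS r s n (g(m := v))"
          unfolding DS_def sum.distrib[symmetric]
          by (intro sum.cong refl) (simp only: PI_linear(1)[OF bs _ L2g m uv(1,2)] distrib_left)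
        ultimately show ?thesis using uv by simp
      qed
      show "?Q (\<lambda>x. c * u x)" if u: "L2 (n m) u" "?Q u" for c u
      proof -
        have "\<phi> (Iprod r n (g(m := (\<lambda>x. c * u x)))) = complex_of_real c * \<phi> (Iprod r n (g(m := u)))"
          unfolding Iprod_upd[OF m] I_scale[OF nm u(1)] by (simp add: \<phi>_scaleR)
        moreover have "DS r s n (g(m := (\<lambda>x. c * u x))) = c * DS r s n (g(m := u))"
          unfolding DS_def sum_distrib_left
          by (intro sum.cong refl) (simp only: PI_linear(2)[OF bs _ L2g m u(1) u(1)] mult.left_commute)
        ultimately show ?thesis using u by simp
      qed
      show "?Q u" if su: "\<And>k. L2 (n m) (w k)" "L2 (n m) u" "\<And>k. ?Q (w k)"
        "(\<lambda>k. L2norm (n m) (\<lambda>x. w k x - u x)) \<longlonglongrightarrow> 0" for w u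
      proof (rule LIMSEQ_unique)
        show "(\<lambda>k. \<phi> (Iprod r n (g(m := w k)))) \<longlonglongrightarrow> \<phi> (Iprod r n (g(m := u)))"
          unfolding Iprod_upd[OF m] by (rule \<phi>_I_tendsto[OF nm su(1,2,4)])
        have "(\<lambda>k. DS r s n (g(m := w k))) \<longlonglongrightarrow> DS r s n (g(m := u))"
          unfolding DS_def by (intro tendsto_sum tendsto_mult_left PI_tendsto[OF bs _ L2g m su(2,1,4)])
        then show "(\<lambda>k. \<phi> (Iprod r n (g(m := w k)))) \<longlonglongrightarrow> complex_of_real (DS r s n (g(m := u)))"
          unfolding su(3) by (rule tendsto_of_real)
      qed
    qed
    then show ?case by simp
  qed
  from this[of r g] g show ?thesis by simp
qed

end

subsection \<open>Symmetric functions\<close>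

text \<open>Symmetry at every point, in contrast to \<open>symmetric_fun\<close>. No null set has to
  be carried along when arguments are reordered inside an integral.\<close>

definition psym :: "nat \<Rightarrow> ((nat \<Rightarrow> real) \<Rightarrow> real) \<Rightarrow> bool" where
  "psym n f \<longleftrightarrow> (\<forall>\<sigma> x. \<sigma> permutes {..<n} \<longrightarrow> f (permarg n \<sigma> x) = f x)"

text \<open>Two enumerations of the same set differ by a permutation of the positions.\<close>

lemma psym_enumeration:
  assumes f: "psym n f" and e1: "bij_betw e1 {..<n} S" and e2: "bij_betw e2 {..<n} S"
  shows "f (restrict (\<lambda>i. y (e1 i)) {..<n}) = f (restrict (\<lambda>i. y (e2 i)) {..<n})"
proof -
  define \<sigma> where "\<sigma> i = (if i \<in> {..<n} then (inv_into {..<n} e2 \<circ> e1) i else i)" for i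
  have b: "bij_betw (inv_into {..<n} e2 \<circ> e1) {..<n} {..<n}"
    by (rule bij_betw_trans[OF e1 bij_betw_inv_into[OF e2]])
  then have "bij_betw \<sigma> {..<n} {..<n}"
    by (subst bij_betw_cong[where g = "inv_into {..<n} e2 \<circ> e1"]) (simp_all add: \<sigma>_def)
  then have \<sigma>: "\<sigma> permutes {..<n}" by (rule bij_imp_permutes) (simp add: \<sigma>_def)
  have "e2 (\<sigma> i) = e1 i" "\<sigma> i < n" if "i < n" for i
  proof -
    have "e1 i \<in> S" using e1 that by (auto simp: bij_betw_def)
    then show "e2 (\<sigma> i) = e1 i" using e2 that by (simp add: \<sigma>_def bij_betw_def f_inv_into_f)
    show "\<sigma> i < n" using permutes_in_image[OF \<sigma>, of i] that by simp
  qed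
  then have "permarg n \<sigma> (restrict (\<lambda>i. y (e2 i)) {..<n}) = restrict (\<lambda>i. y (e1 i)) {..<n}"
    by (auto simp: permarg_def fun_eq_iff)
  then show ?thesis using f \<sigma> unfolding psym_def by metis
qed

text \<open>The choice of the enumeration is irrelevant for \<open>psym\<close> functions, see \<open>ev_eq\<close>.\<close>

definition ev :: "nat \<Rightarrow> ((nat \<Rightarrow> real) \<Rightarrow> real) \<Rightarrow> 'i set \<Rightarrow> ('i \<Rightarrow> real) \<Rightarrow> real" where
  "ev n f S y = f (restrict (\<lambda>i. y ((SOME e. bij_betw e {..<n} S) i)) {..<n})"

lemma ev_eq:
  assumes "psym n f" "bij_betw e {..<n} S"
  shows "f (restrict (\<lambda>i. y (e i)) {..<n}) = ev n f S y"
  unfolding ev_def by (rule psym_enumeration[OF assms someI[of "\<lambda>e. bij_betw e {..<n} S", OF assms(2)]])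

lemma ex_enum: "finite S \<Longrightarrow> card S = n \<Longrightarrow> \<exists>e. bij_betw e {..<n} S"
  using ex_bij_betw_nat_finite[of S] by (auto simp: atLeast0LessThan)

lemma enum_some: "finite S \<Longrightarrow> card S = n \<Longrightarrow> bij_betw (SOME e. bij_betw e {..<n} S) {..<n} S"
  by (rule someI_ex[OF ex_enum])

lemma ev_cong:
  assumes "finite S" "card S = n" "\<And>i. i \<in> S \<Longrightarrow> y i = z i"
  shows "ev n f S y = ev n f S z"
  unfolding ev_def using enum_some[OF assms(1,2)] assms(3)
  by (intro arg_cong[where f = f] restrict_ext) (auto simp: bij_betw_def)

lemma ev_restrict [simp]: "finite S \<Longrightarrow> card S = n \<Longrightarrow> S \<subseteq> T \<Longrightarrow> ev n f S (restrict y T) = ev n f S y"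
  by (rule ev_cong) auto

lemma sqint_ev:
  assumes "L2 n f" "finite S" "card S = n"
  shows "sqint (PM S) (ev n f S)" "(\<integral>y. (ev n f S y)^2 \<partial>PM S) = (L2norm n f)^2"
  unfolding ev_def using sqint_reindex[OF enum_some[OF assms(2,3)] finite_lessThan assms(1)[unfolded L2_sqint]]
  by (auto simp: L2norm_def Mn_eq_PM)

lemma finite_touch: "finite P \<Longrightarrow> finite (touch P A)" and touch_sub: "touch P A \<subseteq> P"
  by (auto simp: touch_def)

lemma card_touch: "P \<in> bip {..<r} (bl s n) \<Longrightarrow> j < r \<Longrightarrow> card (touch P (bl s n j)) = n j"
  using bij_betw_same_card[OF bij_betw_touch_bl] by force

lemma parg_ev:
  assumes "P \<in> bip {..<r} (bl s n)" "j < r" "psym (n j) f"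
  shows "f (parg P (s j) (n j) y) = ev (n j) f (touch P (bl s n j)) y"
  unfolding parg_def by (rule ev_eq[OF assms(3) bij_betw_touch_bl[OF assms(1,2)]])

lemma PI_ev:
  assumes P: "P \<in> bip {..<r} (bl s n)" and g: "\<And>j. j < r \<Longrightarrow> psym (n j) (g j)"
  shows "PI P r s n g = (\<integral>y. (\<Prod>j<r. ev (n j) (g j) (touch P (bl s n j)) y) \<partial>PM P)"
  unfolding PI_def
  by (intro Bochner_Integration.integral_cong prod.cong refl) (simp add: parg_ev[OF P _ g])

lemma merge_PM_distr:
  assumes "I \<inter> J = {}" "finite I" "finite J"
  shows "distr (PM I \<Otimes>\<^sub>M PM J) (PM (I \<union> J)) (merge I J) = PM (I \<union> J)"
  using HL.distr_merge[OF assms] by (simp add: PM_def)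

lemma measurable_merge_PM [measurable]: "merge I J \<in> measurable (PM I \<Otimes>\<^sub>M PM J) (PM (I \<union> J))"
  unfolding PM_def by (rule measurable_merge)

lemma PM_nn_integral_pair:
  assumes IJ: "I \<inter> J = {}" "finite I" "finite J" and f: "f \<in> borel_measurable (PM (I \<union> J))"
  shows "(\<integral>\<^sup>+y. f y \<partial>PM (I \<union> J)) = (\<integral>\<^sup>+z. f (merge I J z) \<partial>(PM I \<Otimes>\<^sub>M PM J))"
  using f by (subst merge_PM_distr[OF IJ, symmetric], subst nn_integral_distr) simp_all

lemma sqint_merge:
  assumes IJ: "I \<inter> J = {}" "finite I" "finite J" and f: "sqint (PM (I \<union> J)) f"
  shows "sqint (PM I \<Otimes>\<^sub>M PM J) (\<lambda>z. f (merge I J z))"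
    "(\<integral>\<^sup>+z. ennreal ((f (merge I J z))^2) \<partial>(PM I \<Otimes>\<^sub>M PM J)) = (\<integral>\<^sup>+y. ennreal ((f y)^2) \<partial>PM (I \<union> J))"
proof -
  have fm[measurable]: "f \<in> borel_measurable (PM (I \<union> J))" using f by (rule sqint_measurable)
  show e: "(\<integral>\<^sup>+z. ennreal ((f (merge I J z))^2) \<partial>(PM I \<Otimes>\<^sub>M PM J)) = (\<integral>\<^sup>+y. ennreal ((f y)^2) \<partial>PM (I \<union> J))"
    by (rule PM_nn_integral_pair[OF IJ, symmetric]) measurable
  show "sqint (PM I \<Otimes>\<^sub>M PM J) (\<lambda>z. f (merge I J z))"
    unfolding sqint_iff_nn e using f by (auto simp: sqint_iff_nn intro: measurable_compose[OF measurable_merge_PM])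
qed

lemma PM_integral_fold:
  fixes f :: "_ \<Rightarrow> real"
  assumes "I \<inter> J = {}" "finite I" "finite J" "integrable (PM (I \<union> J)) f"
  shows "(\<integral>y. f y \<partial>PM (I \<union> J)) = (\<integral>x. (\<integral>z. f (merge I J (x, z)) \<partial>PM J) \<partial>PM I)"
  using HL.product_integral_fold[of I J f] assms by (simp add: PM_def)

lemma integral_indep:
  fixes h1 h2 :: "('i \<Rightarrow> real) \<Rightarrow> real"
  assumes IJ: "I \<inter> J = {}" "finite I" "finite J" and h1: "integrable (PM I) h1" and h2: "integrable (PM J) h2"
  shows "integrable (PM (I \<union> J)) (\<lambda>y. h1 (restrict y I) * h2 (restrict y J))"
    "(\<integral>y. h1 (restrict y I) * h2 (restrict y J) \<partial>PM (I \<union> J)) = (\<integral>y. h1 y \<partial>PM I) * (\<integral>y. h2 y \<partial>PM J)"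
proof -
  have [measurable]: "h1 \<in> borel_measurable (PM I)" "h2 \<in> borel_measurable (PM J)" using h1 h2 by auto
  have [measurable]: "(\<lambda>y. restrict y I) \<in> measurable (PM (I \<union> J)) (PM I)" "(\<lambda>y. restrict y J) \<in> measurable (PM (I \<union> J)) (PM J)"
    by (auto intro!: measurable_PM_restrict)
  have r: "restrict (merge I J (x, z)) I = x" "restrict (merge I J (x, z)) J = z"
    if "x \<in> space (PM I)" "z \<in> space (PM J)" for x z
    using that IJ(1) by (auto simp: merge_def space_PM fun_eq_iff PiE_def extensional_def)
  show i: "integrable (PM (I \<union> J)) (\<lambda>y. h1 (restrict y I) * h2 (restrict y J))"
  proof (rule integrableI_bounded)
    have "(\<integral>\<^sup>+y. ennreal (norm (h1 (restrict y I) * h2 (restrict y J))) \<partial>PM (I \<union> J))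
        = (\<integral>\<^sup>+x. (\<integral>\<^sup>+z. ennreal (norm (h1 (restrict (merge I J (x, z)) I) * h2 (restrict (merge I J (x, z)) J))) \<partial>PM J) \<partial>PM I)"
      unfolding PM_def by (rule HL.product_nn_integral_fold[OF IJ]) (unfold PM_def[symmetric], measurable)
    also have "\<dots> = (\<integral>\<^sup>+x. (\<integral>\<^sup>+z. ennreal (norm (h1 x)) * ennreal (norm (h2 z)) \<partial>PM J) \<partial>PM I)"
      by (intro nn_integral_cong) (simp add: r abs_mult ennreal_mult)
    also have "\<dots> = (\<integral>\<^sup>+x. ennreal (norm (h1 x)) \<partial>PM I) * (\<integral>\<^sup>+z. ennreal (norm (h2 z)) \<partial>PM J)"
      by (simp add: nn_integral_cmult nn_integral_multc)
    also have "\<dots> < \<infinity>" using h1 h2 by (simp add: integrable_iff_bounded ennreal_mult_less_top)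
    finally show "(\<integral>\<^sup>+y. ennreal (norm (h1 (restrict y I) * h2 (restrict y J))) \<partial>PM (I \<union> J)) < \<infinity>" .
  qed measurable
  have "(\<integral>y. h1 (restrict y I) * h2 (restrict y J) \<partial>PM (I \<union> J)) = (\<integral>x. (\<integral>z. h1 x * h2 z \<partial>PM J) \<partial>PM I)"
    unfolding PM_integral_fold[OF IJ i] by (intro Bochner_Integration.integral_cong refl) (simp add: r)
  also have "\<dots> = (\<integral>y. h1 y \<partial>PM I) * (\<integral>y. h2 y \<partial>PM J)" by simp
  finally show "(\<integral>y. h1 (restrict y I) * h2 (restrict y J) \<partial>PM (I \<union> J)) = (\<integral>y. h1 y \<partial>PM I) * (\<integral>y. h2 y \<partial>PM J)" .
qed

lemma integral_indep_prod:
  fixes h :: "'c \<Rightarrow> ('i \<Rightarrow> real) \<Rightarrow> real"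
  assumes "finite Q" "\<And>C. C \<in> Q \<Longrightarrow> finite (V C)" "\<And>C D. C \<in> Q \<Longrightarrow> D \<in> Q \<Longrightarrow> C \<noteq> D \<Longrightarrow> V C \<inter> V D = {}"
    "\<And>C. C \<in> Q \<Longrightarrow> integrable (PM (V C)) (h C)"
  shows "integrable (PM (\<Union>C\<in>Q. V C)) (\<lambda>y. \<Prod>C\<in>Q. h C (restrict y (V C))) \<and>
    (\<integral>y. (\<Prod>C\<in>Q. h C (restrict y (V C))) \<partial>PM (\<Union>C\<in>Q. V C)) = (\<Prod>C\<in>Q. \<integral>y. h C y \<partial>PM (V C))"
  using assms
proof (induction Q rule: finite_induct)
  case empty
  then show ?case by (simp add: PM_def PiM_empty integrable_count_space lebesgue_integral_count_space_finite)
next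
  case (insert C Q)
  let ?U = "\<Union>C\<in>Q. V C"
  have "integrable (PM ?U) (\<lambda>y. \<Prod>C\<in>Q. h C (restrict y (V C))) \<and>
    (\<integral>y. (\<Prod>C\<in>Q. h C (restrict y (V C))) \<partial>PM ?U) = (\<Prod>C\<in>Q. \<integral>y. h C y \<partial>PM (V C))"
    by (rule insert.IH) (use insert.prems in blast)+
  note IH = conjunct1[OF this] conjunct2[OF this]
  have d: "V C \<inter> ?U = {}" "finite (V C)" "finite ?U" using insert.prems(1,2) insert.hyps by fastforce+
  have "(\<Prod>D\<in>Q. h D (restrict (restrict y ?U) (V D))) = (\<Prod>D\<in>Q. h D (restrict y (V D)))" for y
  proof (rule prod.cong[OF refl])
    fix D assume "D \<in> Q"
    then have "?U \<inter> V D = V D" by auto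
    then show "h D (restrict (restrict y ?U) (V D)) = h D (restrict y (V D))" by (simp add: restrict_restrict)
  qed
  note e = this
  have "integrable (PM (V C)) (h C)" using insert.prems(3) by blast
  note ind = integral_indep[OF d this IH(1)]
  show ?case
    unfolding UN_insert prod.insert[OF insert.hyps] using ind unfolding e IH(2) by (rule conjI)
qed

text \<open>The two blocks of \<open>C\<close> depend on the same variables, and different
  \<open>C\<close> on disjoint sets of variables, so the integral splits. By symmetry the bijection
  between the two blocks is irrelevant: the value depends on \<open>Q\<close> and not on
  \<open>P\<close>.\<close>

lemma PI_over:
  assumes bs: "blocks r s n" and Q: "Q \<in> pairings_on {..<r}" and P: "P \<in> over r (bl s n) Q"
    and g: "\<And>j. j < r \<Longrightarrow> L2 (n j) (g j)" and sym: "\<And>j. j < r \<Longrightarrow> psym (n j) (g j)"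
  shows "PI P r s n g = (\<Prod>C\<in>Q. \<integral>x. g (Min C) x * g (Max C) x \<partial>Mn (n (Min C)))"
proof -
  let ?T = "\<lambda>j. touch P (bl s n j)"
  note sep = blocks_separated[OF bs]
  have Pb: "P \<in> bip {..<r} (bl s n)" and os: "oset r (bl s n) ` P = Q" using P by (auto simp: over_def)
  have finP: "finite P" by (rule finite_bip_pairing[OF Pb])
  have finQ: "finite Q" using finP os by auto
  have mm: "Min C \<in> C" "Max C \<in> C" "Min C < Max C" "C = {Min C, Max C}" if "C \<in> Q" for C
    using pair_Min_Max_mem[OF pairings_on_card[OF Q that]] pair_Min_Max[OF pairings_on_card[OF Q that]] by auto
  have Cr: "C \<subseteq> {..<r}" if "C \<in> Q" for C using pairings_on_sub[OF Q that] .
  define V where "V C = {B\<in>P. oset r (bl s n) B = C}" for C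
  have T: "?T j = V C" if "C \<in> Q" "j \<in> C" for C j
  proof (intro subset_antisym subsetI)
    fix B assume B: "B \<in> ?T j"
    then have "j \<in> oset r (bl s n) B" "oset r (bl s n) B \<in> Q" using that Cr os by (auto simp: touch_def oset_def)
    then have "oset r (bl s n) B = C" using pairings_on_disj[OF Q] that by blast
    then show "B \<in> V C" using B by (auto simp: V_def touch_def)
  next
    fix B assume "B \<in> V C"
    then show "B \<in> ?T j" using that by (auto simp: V_def touch_def oset_def)
  qed
  have fV: "finite (V C)" for C using finP by (simp add: V_def)
  have cV: "card (V C) = n j" if "C \<in> Q" "j \<in> C" for C j
    using card_touch[OF Pb, of j] T[OF that] Cr[OF that(1)] that(2) by auto
  have U: "(\<Union>C\<in>Q. V C) = P" using os by (auto simp: V_def)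
  have dis: "V C \<inter> V D = {}" if "C \<noteq> D" for C D using that by (auto simp: V_def)
  define h where "h C y = ev (n (Min C)) (g (Min C)) (V C) y * ev (n (Max C)) (g (Max C)) (V C) y" for C y
  have L: "L2 (n (Min C)) (g (Min C))" "L2 (n (Max C)) (g (Max C))" "psym (n (Min C)) (g (Min C))"
    "psym (n (Max C)) (g (Max C))" "n (Max C) = n (Min C)" if "C \<in> Q" for C
  proof -
    have "Min C < r" "Max C < r" using mm(1,2)[OF that] Cr[OF that] by auto
    then show "L2 (n (Min C)) (g (Min C))" "L2 (n (Max C)) (g (Max C))" "psym (n (Min C)) (g (Min C))"
      "psym (n (Max C)) (g (Max C))" by (auto intro: g sym)
    show "n (Max C) = n (Min C)" using cV[OF that mm(1)[OF that]] cV[OF that mm(2)[OF that]] by simp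
  qed
  have hi: "integrable (PM (V C)) (h C)" if "C \<in> Q" for C
    unfolding h_def
    by (intro sqint_mult_integrable sqint_ev L[OF that] fV cV[OF that] mm(1,2)[OF that])
  have "(\<Prod>j<r. ev (n j) (g j) (?T j) y) = (\<Prod>C\<in>Q. h C (restrict y (V C)))" for y
  proof -
    have "(\<Prod>j<r. ev (n j) (g j) (?T j) y) = (\<Prod>j\<in>\<Union>Q. ev (n j) (g j) (?T j) y)"
      using Q by (simp add: pairings_on_def)
    also have "\<dots> = (\<Prod>C\<in>Q. \<Prod>j\<in>C. ev (n j) (g j) (?T j) y)"
      using Q by (subst prod.Union_disjoint) (auto simp: pairings_on_def intro: card_ge_0_finite)
    also have "\<dots> = (\<Prod>C\<in>Q. h C (restrict y (V C)))"
    proof (rule prod.cong[OF refl])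
      fix C assume C: "C \<in> Q"
      have "(\<Prod>j\<in>C. ev (n j) (g j) (?T j) y) = (\<Prod>j\<in>C. ev (n j) (g j) (V C) y)"
        by (intro prod.cong refl) (simp add: T[OF C])
      also have "\<dots> = (\<Prod>j\<in>{Min C, Max C}. ev (n j) (g j) (V C) y)" using mm(4)[OF C] by simp
      also have "\<dots> = h C y" using mm(3)[OF C] by (simp add: h_def)
      also have "\<dots> = h C (restrict y (V C))"
        unfolding h_def using cV[OF C mm(1)[OF C]] cV[OF C mm(2)[OF C]] fV by simp
      finally show "(\<Prod>j\<in>C. ev (n j) (g j) (?T j) y) = h C (restrict y (V C))" .
    qed
    finally show ?thesis .
  qed
  note eq = this
  have "PI P r s n g = (\<integral>y. (\<Prod>j<r. ev (n j) (g j) (?T j) y) \<partial>PM P)"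
    by (rule PI_ev[OF Pb]) (rule sym)
  then have "PI P r s n g = (\<integral>y. (\<Prod>C\<in>Q. h C (restrict y (V C))) \<partial>PM (\<Union>C\<in>Q. V C))"
    unfolding U eq .
  also have "\<dots> = (\<Prod>C\<in>Q. \<integral>y. h C y \<partial>PM (V C))"
    by (rule conjunct2[OF integral_indep_prod[OF finQ]]) (simp_all add: fV dis hi)
  also have "\<dots> = (\<Prod>C\<in>Q. \<integral>x. g (Min C) x * g (Max C) x \<partial>Mn (n (Min C)))"
  proof (rule prod.cong[OF refl])
    fix C assume C: "C \<in> Q"
    obtain e where e: "bij_betw e {..<n (Min C)} (V C)" using ex_enum[OF fV cV[OF C mm(1)[OF C]]] by blast
    have [measurable]: "g (Min C) \<in> borel_measurable (PM {..<n (Min C)})" "g (Max C) \<in> borel_measurable (PM {..<n (Min C)})"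
      using L[OF C] by (auto simp: L2_sqint sqint_def)
    have "(\<integral>y. h C y \<partial>PM (V C)) = (\<integral>y. (\<lambda>x. g (Min C) x * g (Max C) x) (restrict (\<lambda>i. y (e i)) {..<n (Min C)}) \<partial>PM (V C))"
      using ev_eq[OF L(3)[OF C] e] ev_eq[OF L(4)[OF C], of e "V C"] e L(5)[OF C] by (simp add: h_def)
    also have "\<dots> = (\<integral>x. g (Min C) x * g (Max C) x \<partial>PM {..<n (Min C)})"
      by (rule integral_PM_reindex[OF e]) auto
    finally show "(\<integral>y. h C y \<partial>PM (V C)) = (\<integral>x. g (Min C) x * g (Max C) x \<partial>Mn (n (Min C)))"
      by (simp add: Mn_eq_PM)
  qed
  finally show ?thesis .
qed

subsection \<open>Contractions\<close>

text \<open>Transports a contraction to variables with arbitrary names: \<open>A\<close> holds the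
  contracted variables, \<open>C1\<close> and \<open>C2\<close> the free ones of the two factors.
  The index \<open>n - 1 - i\<close> is the reversed order of the contracted variables in the first
  factor. The families \<open>y\<close> and \<open>y'\<close> are separate, so that
  \<open>C1\<close> and \<open>C2\<close> may coincide, as in
  \<open>contraction_norm\<close>.\<close>

lemma contraction_reindex:
  assumes fm: "f \<in> borel_measurable (PM {..<n})" and p: "p \<le> n" and eA: "bij_betw eA {..<p} A"
    and e1: "bij_betw e1 {..<n-p} C1" "C1 \<inter> A = {}" and e2: "bij_betw e2 {n-p..<2*n-2*p} C2" "C2 \<inter> A = {}"
    and t1: "\<And>i. i < n - p \<Longrightarrow> t i = y (e1 i)" and t2: "\<And>i. n - p \<le> i \<Longrightarrow> i < 2*n-2*p \<Longrightarrow> t i = y' (e2 i)"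
    and yt: "\<And>i. i \<in> C1 \<Longrightarrow> 0 \<le> y i" "\<And>i. i \<in> C2 \<Longrightarrow> 0 \<le> y' i"
  shows "contraction n n p f f t =
    (\<integral>a. f (restrict (\<lambda>i. merge C1 A (y, a) (if i < n - p then e1 i else eA (n - 1 - i))) {..<n}) *
         f (restrict (\<lambda>i. merge C2 A (y', a) (if i < p then eA i else e2 (n - p + (i - p)))) {..<n}) \<partial>PM A)"
proof -
  have e1': "e1 i \<in> C1" if "i < n - p" for i using e1(1) that by (auto simp: bij_betw_def)
  have e2': "e2 i \<in> C2" if "n - p \<le> i" "i < 2*n-2*p" for i using e2(1) that by (auto simp: bij_betw_def)
  have eA': "eA i \<in> A" if "i < p" for i using eA that by (auto simp: bij_betw_def)
  let ?G = "\<lambda>s. f (restrict (\<lambda>i. if i < n - p then t i else s (n - 1 - i)) {..<n}) *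
      f (restrict (\<lambda>i. if i < p then s i else t (n - p + (i - p))) {..<n})"
  have tpos: "0 \<le> t i" if "i < 2*n-2*p" for i
  proof (cases "i < n - p")
    case True
    then show ?thesis using t1[OF True] yt(1)[OF e1'[OF True]] by simp
  next
    case False
    then show ?thesis using t2[of i] yt(2)[OF e2'[of i]] that by simp
  qed
  have m1: "(\<lambda>s. restrict (\<lambda>i. if i < n - p then t i else s (n - 1 - i)) {..<n}) \<in> measurable (PM {..<p}) (PM {..<n})"
    unfolding PM_def
  proof (rule measurable_restrict)
    fix i assume i: "i \<in> {..<n}"
    show "(\<lambda>s. if i < n - p then t i else s (n - 1 - i)) \<in> measurable (PiM {..<p} (\<lambda>_. restrict_space lborel {0..})) (restrict_space lborel {0..})"
      using tpos i p by (cases "i < n - p") (auto simp: space_restrict_space intro!: measurable_component_singleton)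
  qed
  have m2: "(\<lambda>s. restrict (\<lambda>i. if i < p then s i else t (n - p + (i - p))) {..<n}) \<in> measurable (PM {..<p}) (PM {..<n})"
    unfolding PM_def
  proof (rule measurable_restrict)
    fix i assume i: "i \<in> {..<n}"
    show "(\<lambda>s. if i < p then s i else t (n - p + (i - p))) \<in> measurable (PiM {..<p} (\<lambda>_. restrict_space lborel {0..})) (restrict_space lborel {0..})"
      using tpos i p by (cases "i < p") (auto simp: space_restrict_space intro!: measurable_component_singleton)
  qed
  have "contraction n n p f f t = (\<integral>s. ?G s \<partial>PM {..<p})" by (simp add: contraction_def Mn_eq_PM)
  also have "\<dots> = (\<integral>a. ?G (restrict (\<lambda>i. a (eA i)) {..<p}) \<partial>PM A)"
    by (rule integral_PM_reindex[OF eA finite_lessThan, symmetric])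
       (intro borel_measurable_times measurable_compose[OF m1 fm] measurable_compose[OF m2 fm])
  also have "\<dots> = (\<integral>a. f (restrict (\<lambda>i. merge C1 A (y, a) (if i < n - p then e1 i else eA (n - 1 - i))) {..<n}) *
         f (restrict (\<lambda>i. merge C2 A (y', a) (if i < p then eA i else e2 (n - p + (i - p)))) {..<n}) \<partial>PM A)"
  proof (intro Bochner_Integration.integral_cong refl arg_cong2[where f = "(*)"] arg_cong[where f = f])
    fix a
    show "restrict (\<lambda>i. if i < n - p then t i else restrict (\<lambda>i. a (eA i)) {..<p} (n - 1 - i)) {..<n}
        = restrict (\<lambda>i. merge C1 A (y, a) (if i < n - p then e1 i else eA (n - 1 - i))) {..<n}"
    proof (rule restrict_ext)
      fix i assume i: "i \<in> {..<n}"
      show "(if i < n - p then t i else restrict (\<lambda>i. a (eA i)) {..<p} (n - 1 - i)) = merge C1 A (y, a) (if i < n - p then e1 i else eA (n - 1 - i))"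
      proof (cases "i < n - p")
        case True
        then show ?thesis using t1 e1'[OF True] by (simp add: merge_def)
      next
        case False
        then have "n - 1 - i < p" using i p by auto
        then show ?thesis using False eA'[of "n - 1 - i"] e1(2) by (auto simp: merge_def)
      qed
    qed
    show "restrict (\<lambda>i. if i < p then restrict (\<lambda>i. a (eA i)) {..<p} i else t (n - p + (i - p))) {..<n}
        = restrict (\<lambda>i. merge C2 A (y', a) (if i < p then eA i else e2 (n - p + (i - p)))) {..<n}"
    proof (rule restrict_ext)
      fix i assume i: "i \<in> {..<n}"
      show "(if i < p then restrict (\<lambda>i. a (eA i)) {..<p} i else t (n - p + (i - p))) = merge C2 A (y', a) (if i < p then eA i else e2 (n - p + (i - p)))"
      proof (cases "i < p")
        case True
        then show ?thesis using eA'[OF True] e2(2) by (auto simp: merge_def)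
      next
        case False
        then have "n - p \<le> n - p + (i - p)" "n - p + (i - p) < 2*n-2*p" using i p by auto
        then show ?thesis using False t2 e2' by (simp add: merge_def)
      qed
    qed
  qed
  finally show ?thesis .
qed

text \<open>For a symmetric \<open>f\<close> the order of the arguments disappears, including the
  reversal, and only the sets of contracted and of free variables remain.\<close>

lemma contraction_ev:
  assumes f: "psym n f" "L2 n f" and p: "p \<le> n"
    and A: "finite A" "card A = p"
    and e1: "bij_betw e1 {..<n-p} C1" "C1 \<inter> A = {}" and e2: "bij_betw e2 {n-p..<2*n-2*p} C2" "C2 \<inter> A = {}"
    and t: "\<And>i. i < n - p \<Longrightarrow> t i = y (e1 i)" "\<And>i. n - p \<le> i \<Longrightarrow> i < 2*n-2*p \<Longrightarrow> t i = y' (e2 i)"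
    and yt: "\<And>i. i \<in> C1 \<Longrightarrow> 0 \<le> y i" "\<And>i. i \<in> C2 \<Longrightarrow> 0 \<le> y' i"
  shows "contraction n n p f f t = (\<integral>a. ev n f (C1 \<union> A) (merge C1 A (y, a)) * ev n f (C2 \<union> A) (merge C2 A (y', a)) \<partial>PM A)"
proof -
  obtain eA where eA: "bij_betw eA {..<p} A" using ex_enum[OF A] by blast
  define b1 where "b1 i = (if i < n - p then e1 i else eA (n - 1 - i))" for i
  define b2 where "b2 i = (if i < p then eA i else e2 (n - p + (i - p)))" for i
  have b1: "bij_betw b1 {..<n} (C1 \<union> A)"
  proof -
    have "bij_betw (\<lambda>i. n - 1 - i) {n-p..<n} {..<p}"
      by (rule bij_betwI[where g = "\<lambda>i. n - 1 - i"]) (use p in auto)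
    from bij_betw_trans[OF this eA] have "bij_betw b1 {n-p..<n} A"
      by (rule bij_betw_cong[THEN iffD1, rotated]) (auto simp: b1_def)
    moreover have "bij_betw b1 {..<n-p} C1"
      by (rule bij_betw_cong[THEN iffD1, OF _ e1(1)]) (auto simp: b1_def)
    ultimately have "bij_betw b1 ({..<n-p} \<union> {n-p..<n}) (C1 \<union> A)" by (intro bij_betw_combine e1(2))
    moreover have "{..<n-p} \<union> {n-p..<n} = {..<n}" using p by auto
    ultimately show ?thesis by simp
  qed
  have b2: "bij_betw b2 {..<n} (C2 \<union> A)"
  proof -
    have "bij_betw (\<lambda>i. n - p + (i - p)) {p..<n} {n-p..<2*n-2*p}"
      by (rule bij_betwI[where g = "\<lambda>i. i - (n - p) + p"]) (use p in auto)
    from bij_betw_trans[OF this e2(1)] have "bij_betw b2 {p..<n} C2"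
      by (rule bij_betw_cong[THEN iffD1, rotated]) (auto simp: b2_def)
    moreover have "bij_betw b2 {..<p} A"
      by (rule bij_betw_cong[THEN iffD1, OF _ eA]) (auto simp: b2_def)
    ultimately have "bij_betw b2 ({p..<n} \<union> {..<p}) (C2 \<union> A)" by (intro bij_betw_combine e2(2))
    moreover have "{p..<n} \<union> {..<p} = {..<n}" using p by auto
    ultimately show ?thesis by simp
  qed
  have fm: "f \<in> borel_measurable (PM {..<n})" using f(2) by (simp add: L2_def Mn_eq_PM)
  have "contraction n n p f f t =
    (\<integral>a. f (restrict (\<lambda>i. merge C1 A (y, a) (b1 i)) {..<n}) * f (restrict (\<lambda>i. merge C2 A (y', a) (b2 i)) {..<n}) \<partial>PM A)"
    unfolding b1_def b2_def
    by (rule contraction_reindex[OF fm p eA e1 e2, where y = y and y' = y']) (use t yt in simp_all)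
  then show ?thesis by (simp only: ev_eq[OF f(1) b1] ev_eq[OF f(1) b2])
qed

lemma contraction_measurable:
  assumes f: "f \<in> borel_measurable (PM {..<n})" and p: "p \<le> n"
  shows "contraction n n p f f \<in> borel_measurable (PM {..<2*n-2*p})"
proof -
  let ?L = "restrict_space lborel {0::real..}"
  interpret S: sigma_finite_measure "PM {..<p} :: (nat \<Rightarrow> real) measure" by (rule sigma_finite_PM) simp
  have t: "(\<lambda>z. fst z k) \<in> measurable (PM {..<2*n-2*p} \<Otimes>\<^sub>M PM {..<p}) ?L" if "k < 2*n-2*p" for k
    unfolding PM_def using that by (intro measurable_compose[OF measurable_fst] measurable_component_singleton) auto
  have s: "(\<lambda>z. snd z k) \<in> measurable (PM {..<2*n-2*p} \<Otimes>\<^sub>M PM {..<p}) ?L" if "k < p" for k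
    unfolding PM_def using that by (intro measurable_compose[OF measurable_snd] measurable_component_singleton) auto
  have m1: "(\<lambda>z. restrict (\<lambda>i. if i < n - p then fst z i else snd z (n - 1 - i)) {..<n})
      \<in> measurable (PM {..<2*n-2*p} \<Otimes>\<^sub>M PM {..<p}) (PM {..<n})"
    unfolding PM_def[of "{..<n}"]
  proof (rule measurable_restrict)
    fix i assume "i \<in> {..<n}"
    then show "(\<lambda>z. if i < n - p then fst z i else snd z (n - 1 - i)) \<in> measurable (PM {..<2*n-2*p} \<Otimes>\<^sub>M PM {..<p}) ?L"
      using t[of i] s[of "n - 1 - i"] p by (cases "i < n - p") auto
  qed
  have m2: "(\<lambda>z. restrict (\<lambda>i. if i < p then snd z i else fst z (n - p + (i - p))) {..<n})
      \<in> measurable (PM {..<2*n-2*p} \<Otimes>\<^sub>M PM {..<p}) (PM {..<n})"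
    unfolding PM_def[of "{..<n}"]
  proof (rule measurable_restrict)
    fix i assume "i \<in> {..<n}"
    then show "(\<lambda>z. if i < p then snd z i else fst z (n - p + (i - p))) \<in> measurable (PM {..<2*n-2*p} \<Otimes>\<^sub>M PM {..<p}) ?L"
      using t[of "n - p + (i - p)"] s[of i] p by (cases "i < p") auto
  qed
  have "(\<lambda>(t, s). f (restrict (\<lambda>i. if i < n - p then t i else s (n - 1 - i)) {..<n}) *
      f (restrict (\<lambda>i. if i < p then s i else t (n - p + (i - p))) {..<n}))
      \<in> borel_measurable (PM {..<2*n-2*p} \<Otimes>\<^sub>M PM {..<p})"
    unfolding split_beta' using measurable_compose[OF m1 f] measurable_compose[OF m2 f] by (rule borel_measurable_times)
  then show ?thesis
    unfolding contraction_def Mn_eq_PM by (rule S.borel_measurable_lebesgue_integral)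
qed

text \<open>The kernel that arises on pairs of points over \<open>C\<close> when \<open>A\<close> is
  integrated out is the contraction with its two halves of arguments named by two copies of
  \<open>C\<close>. The left-hand side is the factor that survives in
  \<open>contraction_Cauchy_Schwarz\<close>; its finiteness comes from
  \<open>overlap_bound\<close>.\<close>

lemma contraction_norm:
  fixes A C :: "'i set"
  assumes f: "psym n f" "L2 n f" and p: "p \<le> n"
    and A: "finite A" "card A = p" and C: "finite C" "card C = n - p" "C \<inter> A = {}"
  shows "(\<integral>\<^sup>+cc. ennreal ((\<integral>a. ev n f (C \<union> A) (merge C A (fst cc, a)) * ev n f (C \<union> A) (merge C A (snd cc, a)) \<partial>PM A)^2)
      \<partial>(PM C \<Otimes>\<^sub>M PM C)) = (\<integral>\<^sup>+t. ennreal ((contraction n n p f f t)^2) \<partial>Mn (2*n-2*p))" (is "?N = ?R")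
    and "L2 (2*n-2*p) (contraction n n p f f)"
proof -
  let ?m = "n - p" and ?M = "2*n-2*p"
  let ?I1 = "{..<n-p}" and ?I2 = "{n-p..<2*n-2*p}"
  have I: "?I1 \<inter> ?I2 = {}" "finite ?I1" "finite ?I2" "?I1 \<union> ?I2 = {..<?M}" by auto
  interpret IA: sigma_finite_measure "PM A" by (rule sigma_finite_PM[OF A(1)])
  interpret IC: sigma_finite_measure "PM C" by (rule sigma_finite_PM[OF C(1)])
  interpret J2: sigma_finite_measure "PM ?I2 :: (nat \<Rightarrow> real) measure" by (rule sigma_finite_PM) simp
  have fin: "finite (C \<union> A)" "card (C \<union> A) = n" using A C p by (auto simp: card_Un_disjoint)
  have evs: "sqint (PM (C \<union> A)) (ev n f (C \<union> A))" by (rule sqint_ev(1)[OF f(2) fin])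
  have [measurable]: "ev n f (C \<union> A) \<in> borel_measurable (PM (C \<union> A))" using evs by (rule sqint_measurable)
  note vm = sqint_merge[OF C(3,1) A(1) evs]
  obtain e where e: "bij_betw e ?I1 C" using ex_enum[OF C(1,2)] by blast
  define e2 where "e2 = e \<circ> (\<lambda>i. i - (n - p))"
  have "bij_betw (\<lambda>i. i - (n - p)) ?I2 ?I1"
    by (rule bij_betwI[where g = "\<lambda>i. i + (n - p)"]) auto
  from bij_betw_trans[OF this e] have e2: "bij_betw e2 ?I2 C" by (simp add: e2_def)
  have eC: "e i \<in> C" if "i < n - p" for i using e that by (auto simp: bij_betw_def)
  have fm: "f \<in> borel_measurable (PM {..<n})" using f(2) by (simp add: L2_def Mn_eq_PM)
  have cm[measurable]: "contraction n n p f f \<in> borel_measurable (PM (?I1 \<union> ?I2))"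
    using contraction_measurable[OF fm p] by (simp add: I(4))
  define G where "G t = ennreal ((contraction n n p f f t)^2)" for t
  have Gm[measurable]: "G \<in> borel_measurable (PM (?I1 \<union> ?I2))" unfolding G_def by measurable
  let ?H = "\<lambda>c c'. \<integral>a. ev n f (C \<union> A) (merge C A (c, a)) * ev n f (C \<union> A) (merge C A (c', a)) \<partial>PM A"
  have Hm: "(\<lambda>z. ennreal ((?H (fst z) (snd z))^2)) \<in> borel_measurable (PM C \<Otimes>\<^sub>M PM C)" by measurable
  have "?R = (\<integral>\<^sup>+t. G t \<partial>PM (?I1 \<union> ?I2))" by (simp only: G_def I(4) Mn_eq_PM)
  also have "\<dots> = (\<integral>\<^sup>+z. G (merge ?I1 ?I2 z) \<partial>(PM ?I1 \<Otimes>\<^sub>M PM ?I2))"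
    by (rule PM_nn_integral_pair[OF I(1-3) Gm])
  also have "\<dots> = (\<integral>\<^sup>+x. \<integral>\<^sup>+x'. G (merge ?I1 ?I2 (x, x')) \<partial>PM ?I2 \<partial>PM ?I1)"
    by (rule J2.nn_integral_fst[symmetric]) measurable
  also have "\<dots> = (\<integral>\<^sup>+c. \<integral>\<^sup>+x'. G (merge ?I1 ?I2 (restrict (\<lambda>i. c (e i)) ?I1, x')) \<partial>PM ?I2 \<partial>PM C)"
    by (rule nn_integral_PM_reindex[OF e I(2), symmetric]) measurable
  also have "\<dots> = (\<integral>\<^sup>+c. \<integral>\<^sup>+c'. G (merge ?I1 ?I2 (restrict (\<lambda>i. c (e i)) ?I1, restrict (\<lambda>i. c' (e2 i)) ?I2)) \<partial>PM C \<partial>PM C)"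
  proof (rule nn_integral_cong)
    fix c :: "'i \<Rightarrow> real" assume c: "c \<in> space (PM C)"
    then have "restrict (\<lambda>i. c (e i)) ?I1 \<in> space (PM ?I1)"
      using eC by (auto simp: space_PM)
    then have "(\<lambda>x'. G (merge ?I1 ?I2 (restrict (\<lambda>i. c (e i)) ?I1, x'))) \<in> borel_measurable (PM ?I2)"
      by (intro measurable_compose[OF _ Gm] measurable_compose[OF _ measurable_merge_PM] measurable_Pair1')
    then show "(\<integral>\<^sup>+x'. G (merge ?I1 ?I2 (restrict (\<lambda>i. c (e i)) ?I1, x')) \<partial>PM ?I2)
      = (\<integral>\<^sup>+c'. G (merge ?I1 ?I2 (restrict (\<lambda>i. c (e i)) ?I1, restrict (\<lambda>i. c' (e2 i)) ?I2)) \<partial>PM C)"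
      by (rule nn_integral_PM_reindex[OF e2 I(3), symmetric])
  qed
  also have "\<dots> = (\<integral>\<^sup>+c. \<integral>\<^sup>+c'. ennreal ((?H c c')^2) \<partial>PM C \<partial>PM C)"
  proof (intro nn_integral_cong)
    fix c c' :: "'i \<Rightarrow> real" assume c: "c \<in> space (PM C)" "c' \<in> space (PM C)"
    have "contraction n n p f f (merge ?I1 ?I2 (restrict (\<lambda>i. c (e i)) ?I1, restrict (\<lambda>i. c' (e2 i)) ?I2)) = ?H c c'"
      by (rule contraction_ev[OF f p A e C(3) e2 C(3)]) (use c in \<open>auto simp: merge_def space_PM\<close>)
    then show "G (merge ?I1 ?I2 (restrict (\<lambda>i. c (e i)) ?I1, restrict (\<lambda>i. c' (e2 i)) ?I2)) = ennreal ((?H c c')^2)"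
      by (simp only: G_def)
  qed
  also have "\<dots> = ?N"
    using IC.nn_integral_fst[OF Hm] by simp
  finally show eq: "?N = ?R" ..
  have "?N \<le> (\<integral>\<^sup>+z. ennreal ((ev n f (C \<union> A) (merge C A z))^2) \<partial>(PM C \<Otimes>\<^sub>M PM A))^2"
    using overlap_bound[OF sigma_finite_PM[OF A(1)] sigma_finite_PM[OF C(1)] sqint_measurable[OF vm(1)]] by simp
  also have "\<dots> < \<infinity>" using vm(1) by (auto simp: sqint_iff_nn power2_eq_square ennreal_mult_less_top)
  finally show "L2 ?M (contraction n n p f f)"
    unfolding eq using cm by (simp add: L2_sqint sqint_iff_nn I(4) Mn_eq_PM)
qed

lemma contraction_L2:
  assumes "psym n f" "L2 n f" "p \<le> n" shows "L2 (2*n-2*p) (contraction n n p f f)"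
  by (rule contraction_norm(2)[OF assms, of "{..<p}" "{p..<n}"]) (use assms in auto)

subsection \<open>Bounds by contractions\<close>

lemma ev_merge_measurable:
  assumes f: "L2 n f" and T: "finite T" "card T = n" "T \<subseteq> I \<union> J"
  shows "(\<lambda>z. ev n f T (merge I J z)) \<in> borel_measurable (PM I \<Otimes>\<^sub>M PM J)"
proof -
  have "(\<lambda>z. ev n f T (restrict (merge I J z) T)) \<in> borel_measurable (PM I \<Otimes>\<^sub>M PM J)"
    by (rule measurable_compose[OF measurable_compose[OF measurable_merge_PM measurable_PM_restrict[OF T(3)]]
          sqint_measurable[OF sqint_ev(1)[OF f T(1,2)]]])
  then show ?thesis using T by simp
qed

lemma sqint_one_empty: "sqint (PM {}) (\<lambda>_. 1)" "(\<integral>y. 1 \<partial>PM {}) = (1::real)"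
  by (simp_all add: sqint_def PM_def PiM_empty integrable_count_space lebesgue_integral_count_space_finite)

text \<open>If the blocks \<open>j\<close> and \<open>k\<close> share some but not all of the variables of \<open>j\<close>, the shared variables are
  integrated out first; the resulting kernel replaces the block \<open>j\<close> (and the block \<open>k\<close> becomes
  trivial) in Finner's inequality.\<close>

lemma PI_partial_bound:
  assumes bs: "blocks r s n" and P: "P \<in> bip {..<r} (bl s n)"
    and g: "\<And>l. l < r \<Longrightarrow> L2 (n l) (g l)" and sym: "\<And>l. l < r \<Longrightarrow> psym (n l) (g l)"
    and jk: "j < r" "k < r" "j \<noteq> k"
    and ne: "touch P (bl s n j) \<inter> touch P (bl s n k) \<noteq> {}" "\<not> touch P (bl s n j) \<subseteq> touch P (bl s n k)"
  defines "p \<equiv> card (touch P (bl s n j) - touch P (bl s n k))"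
  shows "1 \<le> p" "p \<le> n j - 1"
    "\<bar>PI P r s n g\<bar> \<le> sqrt (L2norm (2 * n j - 2 * p) (contraction (n j) (n j) p (g j) (g j)))
        * L2norm (n k) (g k) * (\<Prod>l\<in>{..<r} - {j, k}. L2norm (n l) (g l))"
proof -
  let ?T = "\<lambda>l. touch P (bl s n l)"
  let ?E = "\<lambda>l. ev (n l) (g l) (?T l)"
  note sep = blocks_separated[OF bs]
  have finP: "finite P" by (rule finite_bip_pairing[OF P])
  have finT: "finite (?T l)" for l by (rule finite_touch[OF finP])
  have cT: "card (?T l) = n l" if "l < r" for l by (rule card_touch[OF P that])
  \<comment> \<open>\<open>C\<close> are the shared variables, \<open>A\<close> and \<open>B\<close>
    those of \<open>j\<close> and of \<open>k\<close> alone. Integrating out \<open>C\<close> is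
    controlled by the overlap of the function of block \<open>j\<close> with itself over
    \<open>A\<close>, which is why the contraction index \<open>p\<close> counts \<open>A\<close>
    and not \<open>C\<close>.\<close>
  define C where "C = ?T j \<inter> ?T k"
  define A where "A = ?T j - ?T k"
  define B where "B = ?T k - ?T j"
  have fin: "finite C" "finite A" "finite B" by (auto simp: C_def A_def B_def finT)
  have TjU: "?T j = C \<union> A" and TkU: "?T k = C \<union> B" and dis: "C \<inter> A = {}" "C \<inter> B = {}" "A \<inter> B = {}"
    by (auto simp: C_def A_def B_def)
  have cA: "card A = p" by (simp add: A_def p_def)
  have nj: "n j = card C + p" using cT[OF jk(1)] dis fin by (simp add: TjU card_Un_disjoint cA)
  have "A \<noteq> {}" "C \<noteq> {}" using ne by (auto simp: A_def C_def)
  then have "card A > 0" "card C > 0" using fin by (auto simp: card_gt_0_iff)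
  then show p1: "1 \<le> p" and p2: "p \<le> n j - 1" using cA nj by auto
  have cC: "card C = n j - p" using nj by simp
  let ?W = "P - C"
  have PW: "?W \<inter> C = {}" "finite ?W" "?W \<union> C = P" using finP by (auto simp: C_def touch_def)
  have AB: "A \<union> B \<subseteq> ?W" by (auto simp: A_def B_def C_def touch_def)
  have other: "?T l \<subseteq> ?W" if "l < r" "l \<noteq> j" "l \<noteq> k" for l
  proof
    fix D assume D: "D \<in> ?T l"
    then have DP: "D \<in> P" by (simp add: touch_def)
    \<comment> \<open>A shared variable already occurs in the blocks \<open>j\<close> and
      \<open>k\<close>; a third block would contradict \<open>card_touching\<close>.\<close>
    have "D \<notin> C"
    proof
      assume "D \<in> C"
      then have "{j, k, l} \<subseteq> {i\<in>{..<r}. D \<in> ?T i}" using jk that D by (auto simp: C_def)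
      then have "card {j, k, l} \<le> 2" using card_mono[of "{i\<in>{..<r}. D \<in> ?T i}"] card_touching[OF sep P DP] by fastforce
      then show False using jk that by simp
    qed
    then show "D \<in> ?W" using DP by simp
  qed
  have E_cong: "?E l y = ?E l z" if "l < r" "\<And>i. i \<in> ?T l \<Longrightarrow> y i = z i" for l y z
    by (rule ev_cong[OF finT cT[OF that(1)] that(2)])
  define H where "H z = (\<integral>c. ?E j (merge (A \<union> B) C (z, c)) * ?E k (merge (A \<union> B) C (z, c)) \<partial>PM C)" for z
  interpret IC: sigma_finite_measure "PM C" by (rule sigma_finite_PM[OF fin(1)])
  have Hm: "H \<in> borel_measurable (PM (A \<union> B))"
    unfolding H_def
    by (intro IC.borel_measurable_lebesgue_integral)
       (auto simp: split_beta' TjU TkU intro!: borel_measurable_times ev_merge_measurable g jk fin cT[OF jk(1), unfolded TjU] cT[OF jk(2), unfolded TkU])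
  define S where "S l = (if l = j then A \<union> B else if l = k then {} else ?T l)" for l
  define h where "h l = (if l = j then H else if l = k then (\<lambda>_. 1) else ?E l)" for l
  have PI_eq: "PI P r s n g = (\<integral>x. (\<Prod>l<r. h l (restrict x (S l))) \<partial>PM ?W)"
  proof -
    have e: "(\<lambda>y. \<Prod>l<r. g l (parg P (s l) (n l) y)) = (\<lambda>y. \<Prod>l<r. ?E l y)"
      by (intro ext prod.cong refl) (simp add: parg_ev[OF P _ sym])
    have i: "integrable (PM (?W \<union> C)) (\<lambda>y. \<Prod>l<r. ?E l y)"
      using PI_bound(1)[OF bs P g] unfolding e PW(3) by simp
    have "PI P r s n g = (\<integral>y. (\<Prod>l<r. ?E l y) \<partial>PM (?W \<union> C))" unfolding PI_def e PW(3) ..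
    also have "\<dots> = (\<integral>x. (\<integral>c. (\<Prod>l<r. ?E l (merge ?W C (x, c))) \<partial>PM C) \<partial>PM ?W)"
      by (rule PM_integral_fold[OF PW(1,2) fin(1) i])
    also have "\<dots> = (\<integral>x. (\<Prod>l<r. h l (restrict x (S l))) \<partial>PM ?W)"
    proof (intro Bochner_Integration.integral_cong refl)
      fix x :: "nat set \<Rightarrow> real"
      let ?R = "{..<r} - {j} - {k}"
      have spl: "(\<Prod>l<r. F l) = F j * (F k * (\<Prod>l\<in>?R. F l))" for F :: "nat \<Rightarrow> real"
        using jk by (simp add: prod.remove[of "{..<r}" j] prod.remove[of "{..<r} - {j}" k])
      have "(\<integral>c. (\<Prod>l<r. ?E l (merge ?W C (x, c))) \<partial>PM C)
         = (\<integral>c. (?E j (merge (A \<union> B) C (restrict x (A \<union> B), c)) * ?E k (merge (A \<union> B) C (restrict x (A \<union> B), c)))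
              * (\<Prod>l\<in>?R. ?E l (restrict x (?T l))) \<partial>PM C)"
      proof (intro Bochner_Integration.integral_cong refl)
        fix c
        have "?E j (merge ?W C (x, c)) = ?E j (merge (A \<union> B) C (restrict x (A \<union> B), c))"
          by (rule E_cong[OF jk(1)]) (use AB dis in \<open>auto simp: merge_def TjU\<close>)
        moreover have "?E k (merge ?W C (x, c)) = ?E k (merge (A \<union> B) C (restrict x (A \<union> B), c))"
          by (rule E_cong[OF jk(2)]) (use AB dis in \<open>auto simp: merge_def TkU\<close>)
        moreover have "(\<Prod>l\<in>?R. ?E l (merge ?W C (x, c))) = (\<Prod>l\<in>?R. ?E l (restrict x (?T l)))"
        proof (rule prod.cong[OF refl])
          fix l assume "l \<in> ?R"
          then have l: "l < r" "l \<noteq> j" "l \<noteq> k" by auto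
          show "?E l (merge ?W C (x, c)) = ?E l (restrict x (?T l))"
            by (rule E_cong[OF l(1)]) (use other[OF l] in \<open>auto simp: merge_def\<close>)
        qed
        ultimately show "(\<Prod>l<r. ?E l (merge ?W C (x, c)))
           = (?E j (merge (A \<union> B) C (restrict x (A \<union> B), c)) * ?E k (merge (A \<union> B) C (restrict x (A \<union> B), c)))
              * (\<Prod>l\<in>?R. ?E l (restrict x (?T l)))"
          unfolding spl by (simp only: mult.assoc)
      qed
      also have "\<dots> = H (restrict x (A \<union> B)) * (\<Prod>l\<in>?R. ?E l (restrict x (?T l)))"
        unfolding H_def by (rule integral_mult_left_zero)
      also have "\<dots> = (\<Prod>l<r. h l (restrict x (S l)))"
      proof -
        have "(\<Prod>l\<in>?R. ?E l (restrict x (?T l))) = (\<Prod>l\<in>?R. h l (restrict x (S l)))"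
          by (rule prod.cong) (auto simp: h_def S_def)
        then show ?thesis unfolding spl using jk by (simp add: h_def S_def)
      qed
      finally show "(\<integral>c. (\<Prod>l<r. ?E l (merge ?W C (x, c))) \<partial>PM C) = (\<Prod>l<r. h l (restrict x (S l)))" .
    qed
    finally show ?thesis .
  qed
  let ?cn = "L2norm (2 * n j - 2 * p) (contraction (n j) (n j) p (g j) (g j))"
  \<comment> \<open>The squared norm of the kernel is at most the contraction norm of
    \<open>g j\<close> times the squared norm of \<open>g k\<close>; hence the square root of the
    contraction norm in the final bound.\<close>
  have Hb: "(\<integral>\<^sup>+z. ennreal ((H z)^2) \<partial>PM (A \<union> B)) \<le> ennreal (?cn * (L2norm (n k) (g k))^2)"
  proof -
    let ?u = "\<lambda>z. ?E j (merge C A z)" and ?v = "\<lambda>z. ?E k (merge C B z)"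
    have su: "sqint (PM C \<Otimes>\<^sub>M PM A) ?u"
      by (rule sqint_merge(1)[OF dis(1) fin(1,2)]) (use sqint_ev(1)[OF g[OF jk(1)] finT cT[OF jk(1)]] TjU in simp)
    have sqv: "sqint (PM (C \<union> B)) (?E k)"
      using sqint_ev(1)[OF g[OF jk(2)] finT cT[OF jk(2)]] TkU by simp
    have sv: "sqint (PM C \<Otimes>\<^sub>M PM B) ?v" by (rule sqint_merge(1)[OF dis(2) fin(1,3) sqv])
    have nv: "(\<integral>\<^sup>+z. ennreal ((?v z)^2) \<partial>(PM C \<Otimes>\<^sub>M PM B)) = ennreal ((L2norm (n k) (g k))^2)"
      unfolding sqint_merge(2)[OF dis(2) fin(1,3) sqv] sqint_nn_integral[OF sqv]
      using sqint_ev(2)[OF g[OF jk(2)] finT cT[OF jk(2)]] TkU by simp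
    have "(\<integral>\<^sup>+z. ennreal ((H z)^2) \<partial>PM (A \<union> B)) = (\<integral>\<^sup>+z. ennreal ((H (merge A B z))^2) \<partial>(PM A \<Otimes>\<^sub>M PM B))"
      by (rule PM_nn_integral_pair[OF dis(3) fin(2,3)]) (use Hm in measurable)
    also have "\<dots> = (\<integral>\<^sup>+ab. ennreal ((\<integral>c. ?u (c, fst ab) * ?v (c, snd ab) \<partial>PM C)^2) \<partial>(PM A \<Otimes>\<^sub>M PM B))"
    proof (intro nn_integral_cong arg_cong[where f = "\<lambda>x. ennreal (x^2)"])
      fix ab :: "(nat set \<Rightarrow> real) \<times> (nat set \<Rightarrow> real)"
      obtain a b where ab: "ab = (a, b)" by (cases ab)
      show "H (merge A B ab) = (\<integral>c. ?u (c, fst ab) * ?v (c, snd ab) \<partial>PM C)"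
        unfolding H_def ab fst_conv snd_conv
      proof (intro Bochner_Integration.integral_cong refl arg_cong2[where f = "(*)"])
        fix c :: "nat set \<Rightarrow> real"
        show "?E j (merge (A \<union> B) C (merge A B (a, b), c)) = ?E j (merge C A (c, a))"
          by (rule E_cong[OF jk(1)]) (use dis in \<open>auto simp: merge_def TjU\<close>)
        show "?E k (merge (A \<union> B) C (merge A B (a, b), c)) = ?E k (merge C B (c, b))"
          by (rule E_cong[OF jk(2)]) (use dis in \<open>auto simp: merge_def TkU\<close>)
      qed
    qed
    finally have e1: "(\<integral>\<^sup>+z. ennreal ((H z)^2) \<partial>PM (A \<union> B))
       = (\<integral>\<^sup>+ab. ennreal ((\<integral>c. ?u (c, fst ab) * ?v (c, snd ab) \<partial>PM C)^2) \<partial>(PM A \<Otimes>\<^sub>M PM B))" .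
    have pn: "p \<le> n j" using nj by simp
    have "(\<integral>\<^sup>+z. ennreal ((H z)^2) \<partial>PM (A \<union> B))^2
      \<le> (\<integral>\<^sup>+cc. ennreal ((\<integral>a. ?u (fst cc, a) * ?u (snd cc, a) \<partial>PM A)^2) \<partial>(PM C \<Otimes>\<^sub>M PM C))
        * (ennreal ((L2norm (n k) (g k))^2))^2"
      unfolding e1 using contraction_Cauchy_Schwarz[OF sigma_finite_PM[OF fin(2)] sigma_finite_PM[OF fin(3)] sigma_finite_PM[OF fin(1)] su sv]
      unfolding nv .
    also have "(\<integral>\<^sup>+cc. ennreal ((\<integral>a. ?u (fst cc, a) * ?u (snd cc, a) \<partial>PM A)^2) \<partial>(PM C \<Otimes>\<^sub>M PM C))
       = (\<integral>\<^sup>+t. ennreal ((contraction (n j) (n j) p (g j) (g j) t)^2) \<partial>Mn (2 * n j - 2 * p))"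
      using contraction_norm(1)[OF sym[OF jk(1)] g[OF jk(1)] pn fin(2) cA fin(1) cC dis(1)] unfolding TjU .
    also have "\<dots> = ennreal (?cn^2)"
      using contraction_L2[OF sym[OF jk(1)] g[OF jk(1)] pn]
      by (simp add: L2norm_sq Mn_eq_PM L2_sqint sqint_nn_integral)
    also have "ennreal (?cn^2) * (ennreal ((L2norm (n k) (g k))^2))^2 = (ennreal (?cn * (L2norm (n k) (g k))^2))^2"
      by (simp add: ennreal_power ennreal_mult[symmetric] power_mult_distrib L2norm_nonneg)
    finally show ?thesis by (rule ennreal_le_of_sq_le)
  qed
  have sH: "sqint (PM (A \<union> B)) H"
    unfolding sqint_iff_nn using Hm Hb by (auto intro: le_less_trans)
  have nH: "sqrt (\<integral>z. (H z)^2 \<partial>PM (A \<union> B)) \<le> sqrt ?cn * L2norm (n k) (g k)"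
  proof -
    have "(\<integral>z. (H z)^2 \<partial>PM (A \<union> B)) \<le> ?cn * (L2norm (n k) (g k))^2"
      using Hb sqint_nn_integral[OF sH] by (simp add: ennreal_le_iff L2norm_nonneg)
    then have "sqrt (\<integral>z. (H z)^2 \<partial>PM (A \<union> B)) \<le> sqrt (?cn * (L2norm (n k) (g k))^2)" by (rule real_sqrt_le_mono)
    then show ?thesis by (simp add: real_sqrt_mult L2norm_nonneg)
  qed
  have sS: "sqint (PM (S l)) (h l)" if "l \<in> {..<r}" for l
    using that sH sqint_one_empty(1) sqint_ev(1)[OF g finT cT] by (auto simp: S_def h_def)
  have SW: "S l \<subseteq> ?W" if "l \<in> {..<r}" for l
    using that AB other[of l] by (auto simp: S_def)
  \<comment> \<open>The variables of \<open>B\<close> pass from the block \<open>k\<close> to the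
    kernel at \<open>j\<close>, so each remaining variable still occurs twice.\<close>
  have card2: "card {l\<in>{..<r}. D \<in> S l} = 2" if D: "D \<in> ?W" for D
  proof -
    have DP: "D \<in> P" using D by simp
    have c: "card {l\<in>{..<r}. D \<in> ?T l} = 2" by (rule card_touching[OF sep P DP])
    have DC: "\<not> (D \<in> ?T j \<and> D \<in> ?T k)" using D by (auto simp: C_def)
    show ?thesis
    proof (cases "D \<in> ?T k")
      case False
      then have "{l\<in>{..<r}. D \<in> S l} = {l\<in>{..<r}. D \<in> ?T l}"
        using jk DC by (auto simp: S_def A_def B_def split: if_splits)
      then show ?thesis using c by simp
    next
      case True
      then have "{l\<in>{..<r}. D \<in> S l} = insert j ({l\<in>{..<r}. D \<in> ?T l} - {k})"
        using jk DC by (auto simp: S_def A_def B_def split: if_splits)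
      moreover have "j \<notin> {l\<in>{..<r}. D \<in> ?T l} - {k}" using DC True by auto
      moreover have "k \<in> {l\<in>{..<r}. D \<in> ?T l}" using True jk by auto
      ultimately show ?thesis using c by (simp add: card_Diff_singleton)
    qed
  qed
  have "\<bar>PI P r s n g\<bar> \<le> (\<Prod>l<r. sqrt (\<integral>y. (h l y)^2 \<partial>PM (S l)))"
    unfolding PI_eq by (rule Finner(2)[OF PW(2) finite_lessThan SW card2 sS])
  also have "\<dots> = sqrt (\<integral>z. (H z)^2 \<partial>PM (A \<union> B)) * (1 * (\<Prod>l\<in>{..<r} - {j} - {k}. L2norm (n l) (g l)))"
  proof -
    have "(\<Prod>l\<in>{..<r} - {j} - {k}. sqrt (\<integral>y. (h l y)^2 \<partial>PM (S l))) = (\<Prod>l\<in>{..<r} - {j} - {k}. L2norm (n l) (g l))"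
      by (rule prod.cong) (auto simp: h_def S_def sqint_ev(2)[OF g finT cT] L2norm_nonneg)
    moreover have "h k = (\<lambda>_. 1)" "S k = {}" "h j = H" "S j = A \<union> B" using jk by (auto simp: h_def S_def)
    moreover have "(\<integral>y. 1 \<partial>PM ({} :: nat set set)) = (1::real)" by (rule sqint_one_empty(2))
    ultimately show ?thesis
      using jk by (simp add: prod.remove[of "{..<r}" j] prod.remove[of "{..<r} - {j}" k])
  qed
  also have "\<dots> \<le> (sqrt ?cn * L2norm (n k) (g k)) * (1 * (\<Prod>l\<in>{..<r} - {j} - {k}. L2norm (n l) (g l)))"
    by (intro mult_right_mono nH) (simp add: prod_nonneg L2norm_nonneg)
  finally show "\<bar>PI P r s n g\<bar> \<le> sqrt ?cn * L2norm (n k) (g k) * (\<Prod>l\<in>{..<r} - {j, k}. L2norm (n l) (g l))"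
    by (simp add: Diff_insert2[of "{..<r}" j "{k}", symmetric] insert_commute)
qed

text \<open>A pairing of four blocks without pairs between the opposite blocks \<open>\<alpha>\<close>, \<open>\<gamma>\<close> links the blocks in a cycle;
  fixing the variables shared by \<open>\<alpha>\<close>, \<open>\<delta>\<close> and by \<open>\<beta>\<close>, \<open>\<gamma>\<close>, the remaining integral is the square of a contraction.\<close>

lemma PI_four_cycle:
  assumes bs: "blocks 4 s (\<lambda>_. n)" and P: "P \<in> bip {..<4} (bl s (\<lambda>_. n))" and f: "L2 n f" "psym n f"
    and idx: "{..<4} = {\<alpha>, \<beta>, \<gamma>, \<delta>}" "distinct [\<alpha>, \<beta>, \<gamma>, \<delta>]"
    and opp: "touch P (bl s (\<lambda>_. n) \<alpha>) \<inter> touch P (bl s (\<lambda>_. n) \<gamma>) = {}"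
  defines "p \<equiv> card (touch P (bl s (\<lambda>_. n) \<alpha>) \<inter> touch P (bl s (\<lambda>_. n) \<beta>))"
  shows "PI P 4 s (\<lambda>_. n) (\<lambda>_. f) = (L2norm (2*n-2*p) (contraction n n p f f))^2"
proof -
  let ?T = "\<lambda>l. touch P (bl s (\<lambda>_. n) l)"
  let ?E = "\<lambda>l. ev n f (?T l)"
  note sep = blocks_separated[OF bs]
  have finP: "finite P" by (rule finite_bip_pairing[OF P])
  have finT: "finite (?T l)" for l by (rule finite_touch[OF finP])
  have lt: "\<alpha> < 4" "\<beta> < 4" "\<gamma> < 4" "\<delta> < 4" using idx(1) by auto
  have cT: "card (?T l) = n" if "l < 4" for l using card_touch[OF P that] .
  have cP: "card P = 2 * n"
  proof -
    have "card (\<Union>j\<in>{..<4::nat}. bl s (\<lambda>_. n) j) = (\<Sum>j\<in>{..<4::nat}. card (bl s (\<lambda>_. n) j))"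
      using separated_unique[OF sep] by (intro card_UN_disjoint) auto
    then show ?thesis using card_pairing[OF _ bip_pairings[OF P]] by simp
  qed
  have TP: "?T l \<subseteq> P" for l by (rule touch_sub)
  \<comment> \<open>Two opposite blocks without a common variable have together \<open>2 * n\<close>
    variables, and this is the number of all pairs.\<close>
  have ag: "?T \<alpha> \<union> ?T \<gamma> = P"
    using cT[OF lt(1)] cT[OF lt(3)] opp finT cP
    by (intro card_subset_eq[OF finP]) (auto simp: card_Un_disjoint touch_def)
  have two: "card {l\<in>{..<4}. D \<in> ?T l} = 2" if "D \<in> P" for D by (rule card_touching[OF sep P that])
  \<comment> \<open>Each variable occurs in exactly two blocks, one of which is \<alpha> or \<gamma>
    but not both; the other is then exactly one of \<beta> and \<delta>.\<close>
  have bd: "(D \<in> ?T \<beta>) \<noteq> (D \<in> ?T \<delta>)" if "D \<in> P" for D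
  proof -
    have "{l\<in>{..<4}. D \<in> ?T l} = {l\<in>{\<alpha>,\<beta>,\<gamma>,\<delta>}. D \<in> ?T l}" using idx(1) by simp
    also have "\<dots> = (if D \<in> ?T \<alpha> then {\<alpha>} else {}) \<union> (if D \<in> ?T \<beta> then {\<beta>} else {})
       \<union> (if D \<in> ?T \<gamma> then {\<gamma>} else {}) \<union> (if D \<in> ?T \<delta> then {\<delta>} else {})" by auto
    finally have "card ((if D \<in> ?T \<alpha> then {\<alpha>} else {}) \<union> (if D \<in> ?T \<beta> then {\<beta>} else {})
       \<union> (if D \<in> ?T \<gamma> then {\<gamma>} else {}) \<union> (if D \<in> ?T \<delta> then {\<delta>} else {})) = 2"
      using two[OF that] by simp
    moreover have "(D \<in> ?T \<alpha>) \<noteq> (D \<in> ?T \<gamma>)" using ag opp that by auto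
    ultimately show ?thesis using idx(2) by (auto split: if_splits)
  qed
  define A1 where "A1 = ?T \<alpha> \<inter> ?T \<beta>"
  define A2 where "A2 = ?T \<gamma> \<inter> ?T \<delta>"
  define C1 where "C1 = ?T \<alpha> \<inter> ?T \<delta>"
  define C2 where "C2 = ?T \<beta> \<inter> ?T \<gamma>"
  have fin: "finite A1" "finite A2" "finite C1" "finite C2" by (auto simp: A1_def A2_def C1_def C2_def finT)
  have ex: "(D \<in> ?T \<alpha>) \<noteq> (D \<in> ?T \<gamma>)" if "D \<in> P" for D using ag opp that by auto
  have U: "?T \<alpha> = C1 \<union> A1" "?T \<beta> = C2 \<union> A1" "?T \<gamma> = C2 \<union> A2" "?T \<delta> = C1 \<union> A2"
    using bd ex TP unfolding A1_def A2_def C1_def C2_def by blast+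
  have D: "C1 \<inter> A1 = {}" "C2 \<inter> A1 = {}" "C2 \<inter> A2 = {}" "C1 \<inter> A2 = {}" "C1 \<inter> C2 = {}" "A1 \<inter> A2 = {}"
    using bd ex TP unfolding A1_def A2_def C1_def C2_def by blast+
  have UP: "(C1 \<union> C2) \<union> (A1 \<union> A2) = P" using ag U by blast
  have cA1: "card A1 = p" by (simp add: A1_def p_def)
  have s1: "card C1 + card A1 = n" using cT[OF lt(1)] fin D by (simp add: U(1) card_Un_disjoint)
  have s2: "card C2 + card A1 = n" using cT[OF lt(2)] fin D by (simp add: U(2) card_Un_disjoint)
  have s3: "card C2 + card A2 = n" using cT[OF lt(3)] fin D by (simp add: U(3) card_Un_disjoint)
  have pn: "p \<le> n" and cC1: "card C1 = n - p" and cC2: "card C2 = n - p" and cA2: "card A2 = p"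
    using s1 s2 s3 cA1 by auto
  obtain e1 where e1: "bij_betw e1 {..<n-p} C1" using ex_enum[OF fin(3) cC1] by blast
  obtain e2' where e2': "bij_betw e2' {..<n-p} C2" using ex_enum[OF fin(4) cC2] by blast
  have "bij_betw (\<lambda>i. i - (n - p)) {n-p..<2*n-2*p} {..<n-p}"
    by (rule bij_betwI[where g = "\<lambda>i. i + (n - p)"]) auto
  from bij_betw_trans[OF this e2'] obtain e2 where e2: "bij_betw e2 {n-p..<2*n-2*p} C2" by blast
  define e where "e i = (if i < n - p then e1 i else e2 i)" for i
  have eb: "bij_betw e {..<2*n-2*p} (C1 \<union> C2)"
  proof -
    have "bij_betw e {..<n-p} C1" by (rule bij_betw_cong[THEN iffD1, OF _ e1]) (auto simp: e_def)
    moreover have "bij_betw e {n-p..<2*n-2*p} C2" by (rule bij_betw_cong[THEN iffD1, OF _ e2]) (auto simp: e_def)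
    ultimately have "bij_betw e ({..<n-p} \<union> {n-p..<2*n-2*p}) (C1 \<union> C2)" by (rule bij_betw_combine[OF _ _ D(5)])
    moreover have "{..<n-p} \<union> {n-p..<2*n-2*p} = {..<2*n-2*p}" by auto
    ultimately show ?thesis by simp
  qed
  let ?t = "\<lambda>x. restrict (\<lambda>i. x (e i)) {..<2*n-2*p}"
  let ?I = "C1 \<union> C2" and ?J = "A1 \<union> A2"
  have IJ: "?I \<inter> ?J = {}" "finite ?I" "finite ?J" using D fin by auto
  let ?F = "\<lambda>y. ?E \<alpha> y * ?E \<beta> y * (?E \<gamma> y * ?E \<delta> y)"
  have pe: "(\<lambda>y. \<Prod>l<4. f (parg P (s l) n y)) = ?F"
  proof
    fix y
    have "(\<Prod>l<4. f (parg P (s l) n y)) = (\<Prod>l<4. ?E l y)"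
      using parg_ev[OF P _ f(2)] by (intro prod.cong refl) simp
    also have "\<dots> = (\<Prod>l\<in>{\<alpha>, \<beta>, \<gamma>, \<delta>}. ?E l y)" by (simp only: idx(1))
    also have "\<dots> = ?F y" using idx(2) by simp
    finally show "(\<Prod>l<4. f (parg P (s l) n y)) = ?F y" .
  qed
  have i: "integrable (PM (?I \<union> ?J)) ?F"
    using PI_bound(1)[OF bs P, of "\<lambda>_. f"] f(1) unfolding pe UP by simp
  interpret SI: sigma_finite_measure "PM ?I" by (rule sigma_finite_PM[OF IJ(2)])
  interpret SJ: sigma_finite_measure "PM ?J" by (rule sigma_finite_PM[OF IJ(3)])
  interpret SP: pair_sigma_finite "PM ?I" "PM ?J" ..
  have i': "integrable (PM ?I \<Otimes>\<^sub>M PM ?J) (\<lambda>z. ?F (merge ?I ?J z))"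
    by (rule integrable_distr[OF measurable_merge_PM]) (simp only: merge_PM_distr[OF IJ] i)
  \<comment> \<open>With the variables of \<open>C1\<close> and \<open>C2\<close> fixed, the
    integrand is a function of \<open>A1\<close> times a function of \<open>A2\<close>. By symmetry
    both integrals are the contraction at the same argument.\<close>
  have key: "(\<integral>z. ?F (merge ?I ?J (x, z)) \<partial>PM ?J) = (contraction n n p f f (?t x))^2"
    if x: "x \<in> space (PM ?I)" and int: "integrable (PM ?J) (\<lambda>z. ?F (merge ?I ?J (x, z)))" for x
  proof -
    let ?h1 = "\<lambda>a. ev n f (C1 \<union> A1) (merge C1 A1 (x, a)) * ev n f (C2 \<union> A1) (merge C2 A1 (x, a))"
    let ?h2 = "\<lambda>a. ev n f (C1 \<union> A2) (merge C1 A2 (x, a)) * ev n f (C2 \<union> A2) (merge C2 A2 (x, a))"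
    have c: "contraction n n p f f (?t x) = (\<integral>a. ?h1 a \<partial>PM A1)" "contraction n n p f f (?t x) = (\<integral>a. ?h2 a \<partial>PM A2)"
      by (rule contraction_ev[OF f(2,1) pn fin(1) cA1 e1 D(1) e2 D(2)] contraction_ev[OF f(2,1) pn fin(2) cA2 e1 D(4) e2 D(3)];
          use x in \<open>auto simp: e_def space_PM\<close>)+
    have F: "?F (merge ?I ?J (x, merge A1 A2 (a, b))) = ?h1 a * ?h2 b" for a b
    proof -
      have "?E \<alpha> (merge ?I ?J (x, merge A1 A2 (a, b))) = ev n f (C1 \<union> A1) (merge C1 A1 (x, a))"
        unfolding U(1)[symmetric]
        by (rule ev_cong[OF finT cT[OF lt(1)]]) (use D in \<open>auto simp: merge_def U(1)\<close>)
      moreover have "?E \<beta> (merge ?I ?J (x, merge A1 A2 (a, b))) = ev n f (C2 \<union> A1) (merge C2 A1 (x, a))"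
        unfolding U(2)[symmetric]
        by (rule ev_cong[OF finT cT[OF lt(2)]]) (use D in \<open>auto simp: merge_def U(2)\<close>)
      moreover have "?E \<gamma> (merge ?I ?J (x, merge A1 A2 (a, b))) = ev n f (C2 \<union> A2) (merge C2 A2 (x, b))"
        unfolding U(3)[symmetric]
        by (rule ev_cong[OF finT cT[OF lt(3)]]) (use D in \<open>auto simp: merge_def U(3)\<close>)
      moreover have "?E \<delta> (merge ?I ?J (x, merge A1 A2 (a, b))) = ev n f (C1 \<union> A2) (merge C1 A2 (x, b))"
        unfolding U(4)[symmetric]
        by (rule ev_cong[OF finT cT[OF lt(4)]]) (use D in \<open>auto simp: merge_def U(4)\<close>)
      ultimately show ?thesis by (simp only: mult_ac)
    qed
    have "(\<integral>z. ?F (merge ?I ?J (x, z)) \<partial>PM ?J) = (\<integral>a. (\<integral>b. ?h1 a * ?h2 b \<partial>PM A2) \<partial>PM A1)"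
      using PM_integral_fold[OF D(6) fin(1,2) int] unfolding F .
    also have "\<dots> = (\<integral>a. ?h1 a \<partial>PM A1) * (\<integral>b. ?h2 b \<partial>PM A2)" by (simp only: integral_mult_right_zero integral_mult_left_zero)
    also have "\<dots> = (contraction n n p f f (?t x))^2" by (simp only: c[symmetric] power2_eq_square)
    finally show ?thesis .
  qed
  have fm: "f \<in> borel_measurable (PM {..<n})" using f(1) by (simp add: L2_def Mn_eq_PM)
  note cm[measurable] = contraction_measurable[OF fm pn]
  have tm: "?t \<in> measurable (PM ?I) (PM {..<2*n-2*p})"
    by (rule measurable_PM_reindex[OF bij_betw_imp_funcset[OF eb]])
  have "PI P 4 s (\<lambda>_. n) (\<lambda>_. f) = (\<integral>y. ?F y \<partial>PM (?I \<union> ?J))" unfolding PI_def pe UP ..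
  also have "\<dots> = (\<integral>x. (\<integral>z. ?F (merge ?I ?J (x, z)) \<partial>PM ?J) \<partial>PM ?I)"
    by (rule PM_integral_fold[OF IJ i])
  also have "\<dots> = (\<integral>x. (contraction n n p f f (?t x))^2 \<partial>PM ?I)"
  proof (rule integral_cong_AE)
    show "(\<lambda>x. \<integral>z. ?F (merge ?I ?J (x, z)) \<partial>PM ?J) \<in> borel_measurable (PM ?I)"
      using SP.integrable_fst'[OF i'] by auto
    show "(\<lambda>x. (contraction n n p f f (?t x))^2) \<in> borel_measurable (PM ?I)"
      using measurable_compose[OF tm cm] by measurable
    show "AE x in PM ?I. (\<integral>z. ?F (merge ?I ?J (x, z)) \<partial>PM ?J) = (contraction n n p f f (?t x))^2"
      using SP.AE_integrable_fst'[OF i'] AE_space by eventually_elim (rule key)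
  qed
  also have "\<dots> = (\<integral>t. (contraction n n p f f t)^2 \<partial>PM {..<2*n-2*p})"
    by (rule integral_PM_reindex[OF eb finite_lessThan]) measurable
  finally show ?thesis by (simp add: L2norm_sq Mn_eq_PM)
qed

subsection \<open>The inner product as a pairing sum\<close>

definition rv :: "nat \<Rightarrow> nat \<Rightarrow> nat" where "rv n i = (if i < n then n - 1 - i else i)"

lemma rv_permutes: "rv n permutes {..<n}"
proof (rule bij_imp_permutes)
  show "bij_betw (rv n) {..<n} {..<n}"
    by (rule bij_betwI[where g = "rv n"]) (auto simp: rv_def)
qed (simp add: rv_def)

lemma box_fun_rv: "box_fun n a b (permarg n (rv n) x) = box_fun n (\<lambda>i. a (rv n i)) (\<lambda>i. b (rv n i)) x"
proof -
  have bij: "bij_betw (rv n) {..<n} {..<n}" by (rule permutes_imp_bij[OF rv_permutes])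
  have "box_fun n a b (permarg n (rv n) x) = (\<Prod>i<n. indicator {a i<..<b i} (x (rv n i)))"
    by (simp add: box_fun_def permarg_def)
  also have "\<dots> = (\<Prod>i<n. indicator {a (rv n i)<..<b (rv n i)} (x (rv n (rv n i))))"
    by (rule prod.reindex_bij_betw[OF bij, symmetric])
  also have "\<dots> = box_fun n (\<lambda>i. a (rv n i)) (\<lambda>i. b (rv n i)) x"
    unfolding box_fun_def by (intro prod.cong refl) (auto simp: rv_def)
  finally show ?thesis .
qed

lemma disjoint_box_rv:
  assumes "disjoint_box n a b" shows "disjoint_box n (\<lambda>i. a (rv n i)) (\<lambda>i. b (rv n i))"
proof -
  have r: "rv n i < n" if "i < n" for i using that by (auto simp: rv_def)
  have ne: "rv n i \<noteq> rv n j" if "i < n" "j < n" "i \<noteq> j" for i j using that by (auto simp: rv_def)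
  show ?thesis using assms r ne unfolding disjoint_box_def by blast
qed

lemma L2norm_permarg_diff:
  assumes "\<sigma> permutes {..<n}" "L2 n f" "L2 n g"
  shows "L2norm n (\<lambda>x. f (permarg n \<sigma> x) - g (permarg n \<sigma> x)) = L2norm n (\<lambda>x. f x - g x)"
proof -
  have "L2 n (\<lambda>x. f x - g x)" using assms by (simp add: L2_sqint sqint_diff)
  from L2_permarg(2)[OF assms(1) this] show ?thesis .
qed

lemma L2norm_sq': "(L2norm n f)^2 = (\<integral>x. f x * f x \<partial>Mn n)"
  unfolding L2norm_sq by (simp add: power2_eq_square)

lemma qip_psym:
  assumes "psym n f" shows "qip q n f f = (\<Sum>\<sigma>\<in>{\<sigma>. \<sigma> permutes {..<n}}. q ^ inversions n \<sigma>) * (L2norm n f)^2"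
proof -
  have "qip q n f f = (\<Sum>\<sigma>\<in>{\<sigma>. \<sigma> permutes {..<n}}. q ^ inversions n \<sigma> * (L2norm n f)^2)"
    unfolding qip_def
  proof (intro sum.cong refl)
    fix \<sigma> assume "\<sigma> \<in> {\<sigma>. \<sigma> permutes {..<n}}"
    then have "f (permarg n \<sigma> x) = f x" for x using assms by (simp add: psym_def)
    then show "q ^ inversions n \<sigma> * (\<integral>x. f (permarg n \<sigma> x) * f x \<partial>Mn n) = q ^ inversions n \<sigma> * (L2norm n f)^2"
      by (simp add: L2norm_sq')
  qed
  then show ?thesis by (simp add: sum_distrib_right)
qed

lemma inversion_sum_ge_one:
  assumes "0 \<le> (q::real)" shows "1 \<le> (\<Sum>\<sigma>\<in>{\<sigma>. \<sigma> permutes {..<n}}. q ^ inversions n \<sigma>)"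
proof -
  have "inversions n id = 0"
  proof -
    have "{(i, j). i < j \<and> j < n \<and> id j < id i} = {}" by auto
    then show ?thesis unfolding inversions_def by (simp only: card.empty)
  qed
  then have "1 = (\<Sum>\<sigma>\<in>{id}. q ^ inversions n \<sigma>)" by simp
  also have "\<dots> \<le> (\<Sum>\<sigma>\<in>{\<sigma>. \<sigma> permutes {..<n}}. q ^ inversions n \<sigma>)"
    using assms by (intro sum_mono2 finite_permutations) (auto simp: permutes_id)
  finally show ?thesis .
qed

lemma psym_unit_box: "psym n (box_fun n (\<lambda>_. 0) (\<lambda>_. 1))"
  unfolding psym_def
proof (intro allI impI)
  fix \<sigma> :: "nat \<Rightarrow> nat" and x assume \<sigma>: "\<sigma> permutes {..<n}"
  have "box_fun n (\<lambda>_. 0) (\<lambda>_. 1) (permarg n \<sigma> x) = (\<Prod>i<n. indicator {0<..<1} (x (\<sigma> i)))"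
    by (simp add: box_fun_def permarg_def)
  also have "\<dots> = box_fun n (\<lambda>_. 0) (\<lambda>_. 1) x"
    unfolding box_fun_def by (rule prod.reindex_bij_betw[OF permutes_imp_bij[OF \<sigma>]])
  finally show "box_fun n (\<lambda>_. 0) (\<lambda>_. 1) (permarg n \<sigma> x) = box_fun n (\<lambda>_. 0) (\<lambda>_. 1) x" .
qed

lemma L2norm_unit_box: "(L2norm n (box_fun n (\<lambda>_. 0) (\<lambda>_. 1)))^2 = 1"
proof -
  let ?L = "restrict_space lborel {0::real..}"
  have i: "integrable ?L (indicator {0<..<1::real} :: real \<Rightarrow> real)" and v: "(\<integral>t. indicator {0<..<1::real} t \<partial>?L) = (1::real)"
    using integrable_indicator_pair[of "0::nat" 1 "\<lambda>_. 0" "\<lambda>_. 1"] ovl_pair[of "0::nat" 1 "\<lambda>_. 0" "\<lambda>_. 1"]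
    by (simp_all add: ovl_def indicator_inter_arith[symmetric])
  have "(L2norm n (box_fun n (\<lambda>_. 0) (\<lambda>_. 1)))^2 = (\<integral>x. (\<Prod>i<n. indicator {0<..<1::real} (x i)) \<partial>PiM {..<n} (\<lambda>_. ?L))"
    unfolding L2norm_sq Mn_def box_fun_def prod_power_distrib[symmetric]
    by (simp add: power2_eq_square indicator_inter_arith[symmetric] prod.distrib[symmetric])
  also have "\<dots> = (\<Prod>i<n. (\<integral>t. indicator {0<..<1::real} t \<partial>?L))"
    by (rule HL.product_integral_prod) (simp_all add: i)
  also have "\<dots> = 1" by (simp only: v prod.neutral_const)
  finally show ?thesis .
qed

text \<open>The pairs are the orbits of an involution \<open>h\<close> without fixed points;
  explicit pairings are easier to state and check in this form.\<close>

definition inv_pairing :: "nat set \<Rightarrow> (nat \<Rightarrow> nat) \<Rightarrow> nat set set" where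
  "inv_pairing S h = (\<lambda>x. {x, h x}) ` S"

lemma inv_pairing:
  assumes "\<And>x. x \<in> S \<Longrightarrow> h x \<in> S" "\<And>x. x \<in> S \<Longrightarrow> h (h x) = x" "\<And>x. x \<in> S \<Longrightarrow> h x \<noteq> x"
  shows "inv_pairing S h \<in> pairings_on S"
proof (rule pairings_onI)
  show "\<Union>(inv_pairing S h) = S" using assms by (auto simp: inv_pairing_def)
  show "card B = 2" if B: "B \<in> inv_pairing S h" for B
  proof -
    obtain x where "x \<in> S" "B = {x, h x}" using B by (auto simp: inv_pairing_def)
    then show ?thesis using assms(3)[of x] by (metis card_2_iff)
  qed
  show "B = C" if BC: "B \<in> inv_pairing S h" "C \<in> inv_pairing S h" "z \<in> B" "z \<in> C" for B C z
  proof -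
    have "B = {z, h z}" if "B \<in> inv_pairing S h" "z \<in> B" for B
      using that assms(2) by (auto simp: inv_pairing_def)
    then show ?thesis using BC by metis
  qed
qed

lemma card_touch_inv_pairing:
  assumes h: "\<And>x. x \<in> S \<Longrightarrow> h (h x) = x" and A: "A \<subseteq> S" and B: "B \<inter> A = {}" and ni: "\<And>x. x \<in> A \<Longrightarrow> h x \<notin> A" "\<And>x. x \<in> S \<Longrightarrow> h x \<in> S"
  shows "card (touch (inv_pairing S h) A \<inter> touch (inv_pairing S h) B) = card {x\<in>A. h x \<in> B}"
proof -
  have "touch (inv_pairing S h) A \<inter> touch (inv_pairing S h) B = (\<lambda>x. {x, h x}) ` {x\<in>A. h x \<in> B}"
  proof (intro subset_antisym subsetI)
    fix D assume "D \<in> touch (inv_pairing S h) A \<inter> touch (inv_pairing S h) B"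
    then obtain x where x: "x \<in> S" "D = {x, h x}" "{x, h x} \<inter> A \<noteq> {}" "{x, h x} \<inter> B \<noteq> {}"
      by (auto simp: touch_def inv_pairing_def)
    show "D \<in> (\<lambda>x. {x, h x}) ` {x\<in>A. h x \<in> B}"
    proof (cases "x \<in> A")
      case True
      then show ?thesis using x B ni(1)[OF True] by auto
    next
      case False
      then have "h x \<in> A" "x \<in> B" using x B by auto
      then show ?thesis using x h[OF x(1)] by (intro image_eqI[of _ _ "h x"]) auto
    qed
  next
    fix D assume "D \<in> (\<lambda>x. {x, h x}) ` {x\<in>A. h x \<in> B}"
    then show "D \<in> touch (inv_pairing S h) A \<inter> touch (inv_pairing S h) B"
      using A by (auto simp: touch_def inv_pairing_def)
  qed
  moreover have "inj_on (\<lambda>x. {x, h x}) {x\<in>A. h x \<in> B}"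
    using B by (auto simp: inj_on_def doubleton_eq_iff)
  ultimately show ?thesis by (simp add: card_image)
qed

context qBM
begin

lemma nrm2_star: "nrm2 (star x) = nrm2 x"
  by (simp add: nrm2_def \<phi>_trace)

text \<open>The parallelogram identity, with one nonnegative term dropped.\<close>

lemma nrm2_add_le: "nrm2 (x + y) \<le> 2 * nrm2 x + 2 * nrm2 y"
proof -
  have "nrm2 (x + y) + nrm2 (x - y) = 2 * nrm2 x + 2 * nrm2 y"
    by (simp add: nrm2_def star_add star_diff algebra_simps \<phi>_add \<phi>_diff)
  then show ?thesis using nrm2_nonneg[of "x - y"] by linarith
qed

lemma nrm2_zeroD: "nrm2 x = 0 \<Longrightarrow> x = 0"
  using nrm2_complex[of x] \<phi>_faithful by simp

lemma I_box_fun: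
  assumes "n \<ge> 1" "disjoint_box n a b"
  shows "I n (box_fun n a b) = prod_list (map (\<lambda>i. X (b i) - X (a i)) [0..<n])"
  unfolding box_fun_def using assms by (intro I_box'[rule_format]) (auto simp: disjoint_box_def)

text \<open>The involution reverses a product of self-adjoint increments, which reverses the sides
  of a box. The general case follows by density; for symmetric kernels the integral becomes
  self-adjoint.\<close>

lemma star_I:
  assumes n: "n \<ge> 1" and g: "L2 n g"
  shows "star (I n g) = I n (\<lambda>x. g (permarg n (rv n) x))"
proof (rule L2_induct[where n = n and Q = "\<lambda>u. star (I n u) = I n (\<lambda>x. u (permarg n (rv n) x))"])
  note L2rv = L2_permarg[OF rv_permutes]
  show "L2 n g" by fact
  show "star (I n (box_fun n a b)) = I n (\<lambda>x. box_fun n a b (permarg n (rv n) x))" if ab: "disjoint_box n a b" for a b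
  proof -
    have st: "star (X (b i) - X (a i)) = X (b i) - X (a i)" if "i < n" for i
      using ab that unfolding disjoint_box_def by (simp add: star_diff X_star less_imp_le order_trans[of 0 "a i" "b i"])
    have "star (I n (box_fun n a b)) = prod_list (rev (map star (map (\<lambda>i. X (b i) - X (a i)) [0..<n])))"
      unfolding I_box_fun[OF n ab] by (rule star_prod_list)
    also have "map star (map (\<lambda>i. X (b i) - X (a i)) [0..<n]) = map (\<lambda>i. X (b i) - X (a i)) [0..<n]"
      unfolding map_map by (rule map_cong) (simp_all add: st)
    also have "rev (map (\<lambda>i. X (b i) - X (a i)) [0..<n]) = map (\<lambda>i. X (b (rv n i)) - X (a (rv n i))) [0..<n]"
      by (rule nth_equalityI) (auto simp: rev_nth rv_def)
    also have "prod_list \<dots> = I n (\<lambda>x. box_fun n a b (permarg n (rv n) x))"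
      unfolding box_fun_rv using I_box_fun[OF n disjoint_box_rv[OF ab]] by simp
    finally show ?thesis .
  qed
  show "star (I n (\<lambda>x. u x + v x)) = I n (\<lambda>x. u (permarg n (rv n) x) + v (permarg n (rv n) x))"
    if "L2 n u" "L2 n v" "star (I n u) = I n (\<lambda>x. u (permarg n (rv n) x))" "star (I n v) = I n (\<lambda>x. v (permarg n (rv n) x))" for u v
    using that by (simp add: I_add[OF n] L2rv star_add)
  show "star (I n (\<lambda>x. c * u x)) = I n (\<lambda>x. c * u (permarg n (rv n) x))"
    if "L2 n u" "star (I n u) = I n (\<lambda>x. u (permarg n (rv n) x))" for c u
    using that by (simp add: I_scale[OF n] L2rv star_scaleR)
  show "star (I n u) = I n (\<lambda>x. u (permarg n (rv n) x))"
    if w: "\<And>k. L2 n (w k)" "L2 n u" "\<And>k. star (I n (w k)) = I n (\<lambda>x. w k (permarg n (rv n) x))"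
      and lim: "(\<lambda>k. L2norm n (\<lambda>x. w k x - u x)) \<longlonglongrightarrow> 0" for w u
  proof -
    let ?u' = "\<lambda>x. u (permarg n (rv n) x)" and ?w' = "\<lambda>k x. w k (permarg n (rv n) x)"
    have l1: "(\<lambda>k. nrm2 (I n (w k) - I n u)) \<longlonglongrightarrow> 0" by (rule nrm2_I_tendsto[OF n w(1,2) lim])
    have l2: "(\<lambda>k. nrm2 (I n (?w' k) - I n ?u')) \<longlonglongrightarrow> 0"
      by (rule nrm2_I_tendsto[OF n L2rv(1)[OF w(1)] L2rv(1)[OF w(2)]])
         (use lim in \<open>simp only: L2norm_permarg_diff[OF rv_permutes w(1,2)]\<close>)
    \<comment> \<open>The involution preserves \<open>nrm2\<close> because the state is tracial, so
      both differences in the splitting tend to 0.\<close>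
    have b: "nrm2 (star (I n u) - I n ?u') \<le> 2 * nrm2 (I n (w k) - I n u) + 2 * nrm2 (I n (?w' k) - I n ?u')" for k
    proof -
      have "star (I n u) - I n ?u' = star (I n u - I n (w k)) + (I n (?w' k) - I n ?u')"
        by (simp add: star_diff w(3))
      then have "nrm2 (star (I n u) - I n ?u') \<le> 2 * nrm2 (I n u - I n (w k)) + 2 * nrm2 (I n (?w' k) - I n ?u')"
        using nrm2_add_le nrm2_star by metis
      moreover have "nrm2 (I n u - I n (w k)) = nrm2 (I n (w k) - I n u)"
        by (simp add: nrm2_def star_diff algebra_simps)
      ultimately show ?thesis by simp
    qed
    have "(\<lambda>k. 2 * nrm2 (I n (w k) - I n u) + 2 * nrm2 (I n (?w' k) - I n ?u')) \<longlonglongrightarrow> 2 * 0 + 2 * 0"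
      by (intro tendsto_intros l1 l2)
    then have "nrm2 (star (I n u) - I n ?u') \<le> 2 * 0 + 2 * 0"
      by (rule LIMSEQ_le_const) (use b in blast)
    then have "nrm2 (star (I n u) - I n ?u') = 0" using nrm2_nonneg[of "star (I n u) - I n ?u'"] by simp
    from nrm2_zeroD[OF this] show ?thesis by simp
  qed
qed

lemma star_I_psym:
  assumes "n \<ge> 1" "L2 n f" "psym n f" shows "star (I n f) = I n f"
  using star_I[OF assms(1,2)] assms(3) rv_permutes by (simp add: psym_def)

lemma sum_over_PI:
  assumes bs: "blocks r s n" and Q: "Q \<in> pairings_on {..<r}"
    and eq: "\<And>C l m. C \<in> Q \<Longrightarrow> l \<in> C \<Longrightarrow> m \<in> C \<Longrightarrow> n l = n m"
    and g: "\<And>j. j < r \<Longrightarrow> L2 (n j) (g j)" "\<And>j. j < r \<Longrightarrow> psym (n j) (g j)"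
  shows "(\<Sum>P\<in>over r (bl s n) Q. q ^ Cr P * PI P r s n g)
    = q ^ (\<Sum>(C, D)\<in>{(C, D). C \<in> Q \<and> D \<in> Q \<and> crosses C D}. n (Min C) * n (Min D))
      * (\<Prod>C\<in>Q. Kq q (n (Min C)) * (\<integral>x. g (Min C) x * g (Max C) x \<partial>Mn (n (Min C))))"
proof -
  have "(\<Sum>P\<in>over r (bl s n) Q. q ^ Cr P * PI P r s n g)
      = (\<Sum>P\<in>over r (bl s n) Q. q ^ Cr P) * (\<Prod>C\<in>Q. \<integral>x. g (Min C) x * g (Max C) x \<partial>Mn (n (Min C)))"
    unfolding sum_distrib_right by (intro sum.cong refl) (simp add: PI_over[OF bs Q _ g])
  also have "(\<Sum>P\<in>over r (bl s n) Q. q ^ Cr P) = (\<Prod>C\<in>Q. Kq q (card (bl s n (Min C))))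
     * q ^ (\<Sum>(C, D)\<in>{(C, D). C \<in> Q \<and> D \<in> Q \<and> crosses C D}. card (bl s n (Min C)) * card (bl s n (Min D)))"
    by (rule sum_over[OF blocks_separated[OF bs] Q blocks_nonempty[OF bs]]) (assumption, unfold bl_card, rule eq)
  finally show ?thesis by (simp only: bl_card prod.distrib mult_ac)
qed

text \<open>Since \<open>I n f\<close> is self-adjoint, the isometry is a moment of two integrals.
  Its diagrams all lie over the only pairing of two blocks, so the diagram formula gives
  \<open>Kq\<close> times one ordinary inner product.\<close>

lemma qip_eq_Kq:
  assumes n: "n \<ge> 1" and f: "L2 n f" "psym n f" and g: "L2 n g" "psym n g"
  shows "qip q n f g = Kq q n * (\<integral>x. f x * g x \<partial>Mn n)"
proof -
  let ?s = "\<lambda>j. j * n" and ?n = "\<lambda>_. n" and ?g = "\<lambda>j. if j = (0::nat) then f else g"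
  have bs: "blocks 2 ?s ?n" using n by (simp add: blocks_def)
  have two: "{..<2::nat} = {0, 1}" by auto
  have Q: "{{0, 1}} \<in> pairings_on {..<2}" unfolding two by (rule pairings_onI) auto
  have ov: "over 2 (bl ?s ?n) {{0, 1}} = bip {..<2} (bl ?s ?n)"
  proof (intro subset_antisym subsetI)
    fix P assume P: "P \<in> bip {..<2} (bl ?s ?n)"
    have "oset 2 (bl ?s ?n) B = {0, 1}" if "B \<in> P" for B
    proof -
      obtain j k where jk: "j < k" "k < 2" "oset 2 (bl ?s ?n) B = {j, k}"
        by (rule bip_pairE[OF blocks_separated[OF bs] P \<open>B \<in> P\<close>])
      have "j = 0" "k = 1" using jk(1,2) by auto
      then show ?thesis unfolding jk(3) by (simp only:)
    qed
    moreover have "P \<noteq> {}"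
    proof
      assume "P = {}"
      then have "{} \<in> pairings_on (\<Union>j\<in>{..<2}. bl ?s ?n j)" using bip_pairings[OF P] by (simp only:)
      then have "\<Union>{} = (\<Union>j\<in>{..<2}. bl ?s ?n j)" unfolding pairings_on_def by blast
      moreover have "bl ?s ?n 0 \<subseteq> (\<Union>j\<in>{..<2}. bl ?s ?n j)" by (rule UN_upper) simp
      ultimately have "bl ?s ?n 0 = {}" by blast
      then show False using blocks_nonempty[OF bs, of 0] by simp
    qed
    ultimately have "oset 2 (bl ?s ?n) ` P = {{0, 1}}" by auto
    then show "P \<in> over 2 (bl ?s ?n) {{0, 1}}" using P by (simp add: over_def)
  qed (auto simp: over_def)
  have "complex_of_real (qip q n f g) = \<phi> (star (I n f) * I n g)" using I_isometry[OF n n f(1) g(1)] by simp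
  also have "\<dots> = \<phi> (Iprod 2 ?n ?g)"
    by (simp add: star_I_psym[OF n f] Iprod_def numeral_2_eq_2)
  also have "\<dots> = complex_of_real (DS 2 ?s ?n ?g)"
    using f g by (intro diagram_formula[OF bs]) auto
  also have "DS 2 ?s ?n ?g = (\<Sum>P\<in>over 2 (bl ?s ?n) {{0, 1}}. q ^ Cr P * PI P 2 ?s ?n ?g)"
    by (simp only: DS_def ov)
  also have "\<dots> = q ^ (\<Sum>(C, D)\<in>{(C, D). C \<in> {{0::nat, 1}} \<and> D \<in> {{0, 1}} \<and> crosses C D}. n * n)
      * (\<Prod>C\<in>{{0::nat, 1}}. Kq q n * (\<integral>x. ?g (Min C) x * ?g (Max C) x \<partial>Mn n))"
    using f g by (intro sum_over_PI[OF bs Q]) auto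
  also have "{(C, D). C \<in> {{0::nat, 1}} \<and> D \<in> {{0, 1}} \<and> crosses C D} = {}"
    by (auto simp: crosses_iff)
  finally show ?thesis by (simp only: of_real_eq_iff) simp
qed

text \<open>Tested on the indicator of the unit cube, a symmetric function of norm 1,
  \<open>qip\<close> is the sum of \<open>q ^ inversions\<close> by definition and \<open>Kq\<close>
  by the diagram formula. The identity contributes 1 to the sum and the other terms are
  nonnegative.\<close>

lemma Kq_ge_one:
  assumes "n \<ge> 1" shows "1 \<le> Kq q n"
proof -
  let ?f = "box_fun n (\<lambda>_. 0) (\<lambda>_. 1)"
  have "qip q n ?f ?f = Kq q n * (L2norm n ?f)^2"
    using qip_eq_Kq[OF assms L2_box_fun psym_unit_box L2_box_fun psym_unit_box]
    by (simp add: L2norm_sq')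
  then show ?thesis
    using qip_psym[OF psym_unit_box, of q n] inversion_sum_ge_one[OF q0, of n] by (simp add: L2norm_unit_box)
qed

lemma L2norm_le_qip:
  assumes "n \<ge> 1" "L2 n f" "psym n f" shows "(L2norm n f)^2 \<le> qip q n f f"
  using qip_eq_Kq[OF assms assms(2,3)] mult_right_mono[OF Kq_ge_one[OF assms(1)], of "(L2norm n f)^2"]
  by (simp add: L2norm_sq')

end

subsection \<open>Convergence of mixed moments\<close>

text \<open>Either each block is linked to a single other block, and the diagram lies over a pairing
  of the blocks, or some block \<open>j\<close> is linked to two different ones and shares only a
  proper part of its variables with one of them.\<close>

lemma perfect_or_partial:
  assumes sep: "separated {..<r} A" and ne: "\<And>j. j < r \<Longrightarrow> A j \<noteq> {}" and P: "P \<in> bip {..<r} A"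
  obtains (perfect) Q where "Q \<in> pairings_on {..<r}" "P \<in> over r A Q"
  | (partial) j k where "j < r" "k < r" "j \<noteq> k" "touch P (A j) \<inter> touch P (A k) \<noteq> {}" "\<not> touch P (A j) \<subseteq> touch P (A k)"
proof (cases "\<forall>B\<in>P. \<forall>B'\<in>P. \<forall>j. j \<in> oset r A B \<longrightarrow> j \<in> oset r A B' \<longrightarrow> oset r A B = oset r A B'")
  case True
  then have "oset r A ` P \<in> pairings_on {..<r}" by (intro over_pairings[OF sep ne P]) blast+
  moreover have "P \<in> over r A (oset r A ` P)" using P by (simp add: over_def)
  ultimately show ?thesis by (rule perfect)
next
  case False
  then obtain B B' j where B: "B \<in> P" "B' \<in> P" "j \<in> oset r A B" "j \<in> oset r A B'" "oset r A B \<noteq> oset r A B'" by blast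
  have two: "\<exists>k. k \<noteq> j \<and> oset r A D = {j, k}" if D: "D \<in> P" "j \<in> oset r A D" for D
  proof -
    obtain a b where "a < b" "oset r A D = {a, b}" by (rule bip_pairE[OF sep P D(1)])
    then show ?thesis using D(2) by auto
  qed
  obtain k where k: "k \<noteq> j" "oset r A B = {j, k}" using two[OF B(1,3)] by blast
  have kB': "k \<notin> oset r A B'" using two[OF B(2,4)] B(5) k by auto
  have "k \<in> oset r A B" using k by simp
  then have "j < r" "k < r" "B \<in> touch P (A j) \<inter> touch P (A k)" using B by (auto simp: oset_def touch_def)
  moreover have "B' \<in> touch P (A j)" "B' \<notin> touch P (A k)" using B kB' \<open>k < r\<close> by (auto simp: oset_def touch_def)
  ultimately show ?thesis using k(1) by (intro partial[of j k]) auto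
qed

lemma over_disjoint: "Q \<noteq> Q' \<Longrightarrow> over r A Q \<inter> over r A Q' = {}"
  by (auto simp: over_def)

lemma over_touch:
  assumes Q: "Q \<in> pairings_on {..<r}" and P: "P \<in> over r A Q"
    and jk: "j < r" "k < r" and ne: "touch P (A j) \<inter> touch P (A k) \<noteq> {}"
  shows "touch P (A j) \<subseteq> touch P (A k)"
proof
  fix B' assume B': "B' \<in> touch P (A j)"
  obtain B where B: "B \<in> touch P (A j)" "B \<in> touch P (A k)" using ne by auto
  have "oset r A B \<in> Q" "oset r A B' \<in> Q" using P B B' by (auto simp: over_def touch_def)
  moreover have "j \<in> oset r A B" "j \<in> oset r A B'" "k \<in> oset r A B" using B B' jk by (auto simp: oset_def touch_def)
  ultimately have "k \<in> oset r A B'" using pairings_on_disj[OF Q] by metis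
  then show "B' \<in> touch P (A k)" using B' by (auto simp: oset_def touch_def)
qed

text \<open>The crossings are regrouped by the colours of the two pairs. The map \<kappa> sorts the
  two colours, matching \<open>Cr2\<close>, which counts a crossing regardless of which of the two
  pairs opens first.\<close>

lemma cross_weight:
  fixes col :: "nat \<Rightarrow> nat" and q :: real
  assumes Q: "Q \<in> col_pairings r col"
  shows "(\<Prod>(a, b)\<in>{(a, b). a \<in> col ` {..<r} \<and> b \<in> col ` {..<r} \<and> a \<le> b}.
       q ^ (Cr2 {B\<in>Q. \<forall>l\<in>B. col l = a} {B\<in>Q. \<forall>l\<in>B. col l = b} * a * b))
    = q ^ (\<Sum>(C, D)\<in>{(C, D). C \<in> Q \<and> D \<in> Q \<and> crosses C D}. col (Min C) * col (Min D))"
proof -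
  have Qp: "Q \<in> pairings_on {..<r}" using Q by (simp add: col_pairings_def pairings_eq)
  have c: "col l = col m" if "B \<in> Q" "l \<in> B" "m \<in> B" for B l m
    using Q that unfolding col_pairings_def by blast
  have finQ: "finite Q" by (rule finite_pairing[OF _ Qp]) simp
  let ?X = "{(C, D). C \<in> Q \<and> D \<in> Q \<and> crosses C D}"
  let ?T = "{(a, b). a \<in> col ` {..<r} \<and> b \<in> col ` {..<r} \<and> a \<le> b}"
  define \<kappa> where "\<kappa> = (\<lambda>(C, D). (min (col (Min C)) (col (Min D)), max (col (Min C)) (col (Min D))))"
  have finX: "finite ?X" by (rule finite_subset[of _ "Q \<times> Q"]) (use finQ in auto)
  have finT: "finite ?T" by (rule finite_subset[of _ "(col ` {..<r}) \<times> (col ` {..<r})"]) auto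
  have mem: "Min B \<in> B" if "B \<in> Q" for B using pair_Min_Max_mem(1)[OF pairings_on_card[OF Qp that]] .
  have colB: "col (Min B) \<in> col ` {..<r}" if "B \<in> Q" for B using mem[OF that] pairings_on_sub[OF Qp that] by auto
  have ab: "{B\<in>Q. \<forall>l\<in>B. col l = a} = {B\<in>Q. col (Min B) = a}" for a
    by (intro Collect_cong conj_cong refl) (metis mem c)
  have \<kappa>T: "\<kappa> ` ?X \<subseteq> ?T" using colB by (auto simp: \<kappa>_def min_def max_def)
  have "(\<Sum>(C, D)\<in>?X. col (Min C) * col (Min D)) = (\<Sum>y\<in>?T. \<Sum>x\<in>{x\<in>?X. \<kappa> x = y}. case x of (C, D) \<Rightarrow> col (Min C) * col (Min D))"
    by (rule sum.group[OF finX finT \<kappa>T, symmetric])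
  also have "\<dots> = (\<Sum>(a, b)\<in>?T. Cr2 {B\<in>Q. \<forall>l\<in>B. col l = a} {B\<in>Q. \<forall>l\<in>B. col l = b} * a * b)"
  proof (rule sum.cong[OF refl])
    fix y assume y: "y \<in> ?T"
    then obtain a b where y: "y = (a, b)" "a \<le> b" by auto
    have "(\<Sum>x\<in>{x\<in>?X. \<kappa> x = y}. case x of (C, D) \<Rightarrow> col (Min C) * col (Min D)) = (\<Sum>x\<in>{x\<in>?X. \<kappa> x = y}. a * b)"
      by (rule sum.cong) (auto simp: \<kappa>_def y min_def max_def split: if_splits)
    also have "\<dots> = card {x\<in>?X. \<kappa> x = y} * a * b" by simp
    also have "card {x\<in>?X. \<kappa> x = y} = Cr2 {B\<in>Q. col (Min B) = a} {B\<in>Q. col (Min B) = b}"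
      unfolding Cr2_def using y(2)
      by (intro arg_cong[where f = card]) (auto simp: \<kappa>_def y(1) min_def max_def split: if_splits)
    finally show "(\<Sum>x\<in>{x\<in>?X. \<kappa> x = y}. case x of (C, D) \<Rightarrow> col (Min C) * col (Min D))
      = (case y of (a, b) \<Rightarrow> Cr2 {B\<in>Q. \<forall>l\<in>B. col l = a} {B\<in>Q. \<forall>l\<in>B. col l = b} * a * b)"
      unfolding ab y(1) prod.case .
  qed
  finally have "q ^ (\<Sum>(C, D)\<in>?X. col (Min C) * col (Min D))
     = q ^ (\<Sum>(a, b)\<in>?T. Cr2 {B\<in>Q. \<forall>l\<in>B. col l = a} {B\<in>Q. \<forall>l\<in>B. col l = b} * a * b)" by (simp only:)
  then show ?thesis by (simp add: power_sum split_beta')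
qed

definition starts :: "(nat \<Rightarrow> nat) \<Rightarrow> nat \<Rightarrow> nat" where "starts n j = (\<Sum>l<j. n l)"

lemma blocks_starts: "(\<And>j. j < r \<Longrightarrow> n j \<ge> 1) \<Longrightarrow> blocks r (starts n) n"
  by (simp add: blocks_def starts_def)

lemma bounded_of_tendsto_sq:
  fixes a :: "nat \<Rightarrow> real"
  assumes "\<And>k. (a k)^2 \<le> b k" "b \<longlonglongrightarrow> l"
  shows "\<exists>M. \<forall>k. a k \<le> M"
proof -
  have "Bseq b" using assms(2) by (intro convergent_imp_Bseq) (auto simp: convergent_def)
  then obtain K where K: "\<And>k. \<bar>b k\<bar> \<le> K" by (auto simp: Bseq_def)
  have "a k \<le> sqrt K" for k
    using assms(1)[of k] K[of k] by (intro real_le_rsqrt) linarith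
  then show ?thesis by blast
qed

context qBM
begin

lemma mixed_moment_tendsto:
  assumes n: "\<And>l. l < r \<Longrightarrow> n l \<ge> 1"
    and f: "\<And>l k. l < r \<Longrightarrow> L2 (n l) (f l k)" "\<And>l k. l < r \<Longrightarrow> psym (n l) (f l k)"
    and lim: "\<And>l m. l < r \<Longrightarrow> m < r \<Longrightarrow> n l = n m \<Longrightarrow> (\<lambda>k. qip q (n l) (f l k) (f m k)) \<longlonglongrightarrow> c l m"
    and ctr: "\<And>l p. l < r \<Longrightarrow> 1 \<le> p \<Longrightarrow> p \<le> n l - 1 \<Longrightarrow>
        (\<lambda>k. L2norm (2 * n l - 2 * p) (contraction (n l) (n l) p (f l k) (f l k))) \<longlonglongrightarrow> 0"
  shows "(\<lambda>k. \<phi> (Iprod r n (\<lambda>l. f l k))) \<longlonglongrightarrow> complex_of_real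
     (\<Sum>Q\<in>col_pairings r n. (\<Prod>(a, b)\<in>{(a, b). a \<in> n ` {..<r} \<and> b \<in> n ` {..<r} \<and> a \<le> b}.
       q ^ (Cr2 {B\<in>Q. \<forall>l\<in>B. n l = a} {B\<in>Q. \<forall>l\<in>B. n l = b} * a * b)) * (\<Prod>C\<in>Q. c (Min C) (Max C)))"
proof -
  let ?s = "starts n" and ?A = "bl (starts n) n"
  let ?N = "\<lambda>Q. \<Sum>(C, D)\<in>{(C, D). C \<in> Q \<and> D \<in> Q \<and> crosses C D}. n (Min C) * n (Min D)"
  have bs: "blocks r ?s n" by (rule blocks_starts) (rule n)
  note sep = blocks_separated[OF bs]
  have "\<exists>M. \<forall>k. L2norm (n l) (f l k) \<le> M" if "l < r" for l
    by (rule bounded_of_tendsto_sq[OF L2norm_le_qip[OF n[OF that] f[OF that]] lim[OF that that refl]])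
  then obtain M where M: "\<And>l k. l < r \<Longrightarrow> L2norm (n l) (f l k) \<le> M l" by metis
  \<comment> \<open>One contraction norm tends to 0 and the other norms stay bounded, being
    dominated by the convergent values of \<open>qip\<close>.\<close>
  have vanish: "(\<lambda>k. PI P r ?s n (\<lambda>l. f l k)) \<longlonglongrightarrow> 0"
    if P: "P \<in> bip {..<r} ?A" and jk: "j < r" "k0 < r" "j \<noteq> k0" and ne: "touch P (?A j) \<inter> touch P (?A k0) \<noteq> {}"
      "\<not> touch P (?A j) \<subseteq> touch P (?A k0)" for P j k0
  proof -
    define p where "p = card (touch P (?A j) - touch P (?A k0))"
    let ?K = "M k0 * (\<Prod>l\<in>{..<r} - {j, k0}. M l)"
    let ?x = "\<lambda>k. L2norm (2 * n j - 2 * p) (contraction (n j) (n j) p (f j k) (f j k))"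
    have PB: "1 \<le> p" "p \<le> n j - 1"
      "\<bar>PI P r ?s n (\<lambda>l. f l k)\<bar> \<le> sqrt (?x k) * L2norm (n k0) (f k0 k) * (\<Prod>l\<in>{..<r} - {j, k0}. L2norm (n l) (f l k))" for k
      unfolding p_def by (rule PI_partial_bound[OF bs P _ _ jk ne, where g = "\<lambda>l. f l k"]; rule f; assumption)+
    have b: "\<bar>PI P r ?s n (\<lambda>l. f l k)\<bar> \<le> sqrt (?x k) * ?K" for k
    proof -
      have "L2norm (n k0) (f k0 k) * (\<Prod>l\<in>{..<r} - {j, k0}. L2norm (n l) (f l k)) \<le> ?K"
        using M jk L2norm_nonneg
        by (intro mult_mono prod_mono) (auto intro!: prod_nonneg order_trans[OF L2norm_nonneg M])
      then have "sqrt (?x k) * (L2norm (n k0) (f k0 k) * (\<Prod>l\<in>{..<r} - {j, k0}. L2norm (n l) (f l k))) \<le> sqrt (?x k) * ?K"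
        by (rule mult_left_mono) (simp add: L2norm_nonneg)
      then show ?thesis using PB(3)[of k] by (simp add: mult.assoc)
    qed
    have "(\<lambda>k. sqrt (?x k) * ?K) \<longlonglongrightarrow> sqrt 0 * ?K"
      by (intro tendsto_intros ctr[OF jk(1) PB(1,2)])
    then have l: "(\<lambda>k. sqrt (?x k) * ?K) \<longlonglongrightarrow> 0" by simp
    show ?thesis by (rule Lim_null_comparison[OF _ l]) (simp only: real_norm_def b eventually_True)
  qed
  \<comment> \<open>The limit of a single pairing integral. The division by \<open>Kq\<close> turns
    \<open>qip\<close> back into an ordinary inner product; summing over all diagrams above the same
    \<open>Q\<close> restores these factors.\<close>
  define L where "L P = (if \<exists>Q\<in>pairings_on {..<r}. P \<in> over r ?A Q then
      (\<Prod>C\<in>oset r ?A ` P. c (Min C) (Max C) / Kq q (n (Min C))) else 0)" for P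
  have mm: "Min C < r" "Max C < r" "Min C \<in> C" "Max C \<in> C" if "Q \<in> pairings_on {..<r}" "C \<in> Q" for Q C
    using pair_Min_Max_mem[OF pairings_on_card[OF that]] pairings_on_sub[OF that] by auto
  have over_n: "n l = n m" if "Q \<in> pairings_on {..<r}" "P \<in> over r ?A Q" "C \<in> Q" "l \<in> C" "m \<in> C" for Q P C l m
    using over_card_eq[OF sep that] by simp
  have PIlim: "(\<lambda>k. PI P r ?s n (\<lambda>l. f l k)) \<longlonglongrightarrow> L P" if P: "P \<in> bip {..<r} ?A" for P
  proof (rule perfect_or_partial[OF sep blocks_nonempty[OF bs] P])
    fix Q assume Q: "Q \<in> pairings_on {..<r}" "P \<in> over r ?A Q"
    have LP: "L P = (\<Prod>C\<in>Q. c (Min C) (Max C) / Kq q (n (Min C)))"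
      using Q by (auto simp: L_def over_def)
    have "(\<lambda>k. \<Prod>C\<in>Q. (\<integral>x. f (Min C) k x * f (Max C) k x \<partial>Mn (n (Min C)))) \<longlonglongrightarrow> L P"
      unfolding LP
    proof (rule tendsto_prod)
      fix C assume C: "C \<in> Q"
      note mC = mm[OF Q(1) C]
      have nn: "n (Min C) = n (Max C)" by (rule over_n[OF Q C mC(3,4)])
      have K: "Kq q (n (Min C)) \<noteq> 0" using Kq_ge_one[OF n[OF mC(1)]] by simp
      have "(\<integral>x. f (Min C) k x * f (Max C) k x \<partial>Mn (n (Min C))) = qip q (n (Min C)) (f (Min C) k) (f (Max C) k) / Kq q (n (Min C))" for k
      proof -
        have g: "L2 (n (Min C)) (f (Max C) k)" "psym (n (Min C)) (f (Max C) k)"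
          using f(1)[OF mC(2), of k] f(2)[OF mC(2), of k] by (simp_all only: nn)
        show ?thesis using qip_eq_Kq[OF n[OF mC(1)] f(1)[OF mC(1)] f(2)[OF mC(1)] g] K by simp
      qed
      then show "(\<lambda>k. \<integral>x. f (Min C) k x * f (Max C) k x \<partial>Mn (n (Min C))) \<longlonglongrightarrow> c (Min C) (Max C) / Kq q (n (Min C))"
        using lim[OF mC(1,2) nn] K by (simp add: tendsto_divide)
    qed
    moreover have "PI P r ?s n (\<lambda>l. f l k) = (\<Prod>C\<in>Q. (\<integral>x. f (Min C) k x * f (Max C) k x \<partial>Mn (n (Min C))))" for k
      by (rule PI_over[OF bs Q f])
    ultimately show ?thesis by simp
  next
    fix j k0 assume jk: "j < r" "k0 < r" "j \<noteq> k0" "touch P (?A j) \<inter> touch P (?A k0) \<noteq> {}" "\<not> touch P (?A j) \<subseteq> touch P (?A k0)"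
    have "\<not> (\<exists>Q\<in>pairings_on {..<r}. P \<in> over r ?A Q)" using over_touch[OF _ _ jk(1,2,4)] jk(5) by blast
    then have "L P = 0" unfolding L_def by (rule if_not_P)
    then show ?thesis using vanish[OF P jk] by simp
  qed
  have finb: "finite (bip {..<r} ?A)" by (rule finite_bip) auto
  have finp: "finite (pairings_on {..<r})" by (rule finite_pairings_on) simp
  have "(\<Sum>P\<in>bip {..<r} ?A. q ^ Cr P * L P) = (\<Sum>P\<in>(\<Union>Q\<in>pairings_on {..<r}. over r ?A Q). q ^ Cr P * L P)"
    using finb by (intro sum.mono_neutral_right) (auto simp: over_def L_def)
  also have "\<dots> = (\<Sum>Q\<in>pairings_on {..<r}. \<Sum>P\<in>over r ?A Q. q ^ Cr P * L P)"
    using finp finb over_disjoint by (intro sum.UNION_disjoint) (auto simp: over_def)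
  also have "\<dots> = (\<Sum>Q\<in>col_pairings r n. \<Sum>P\<in>over r ?A Q. q ^ Cr P * L P)"
  proof (rule sum.mono_neutral_right[OF finp])
    show "col_pairings r n \<subseteq> pairings_on {..<r}" by (auto simp: col_pairings_def pairings_eq)
    \<comment> \<open>Blocks of different sizes admit no bijection, so nothing lies over a pairing
      that joins them. This is where the colour condition comes from.\<close>
    show "\<forall>Q\<in>pairings_on {..<r} - col_pairings r n. (\<Sum>P\<in>over r ?A Q. q ^ Cr P * L P) = 0"
    proof
      fix Q assume Q: "Q \<in> pairings_on {..<r} - col_pairings r n"
      have "P \<notin> over r ?A Q" for P
      proof
        assume P: "P \<in> over r ?A Q"
        have "Q \<in> col_pairings r n"
          using Q over_n[OF _ P] unfolding col_pairings_def pairings_eq by blast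
        then show False using Q by blast
      qed
      then have "over r ?A Q = {}" by blast
      then show "(\<Sum>P\<in>over r ?A Q. q ^ Cr P * L P) = 0" by simp
    qed
  qed
  also have "\<dots> = (\<Sum>Q\<in>col_pairings r n. (\<Prod>(a, b)\<in>{(a, b). a \<in> n ` {..<r} \<and> b \<in> n ` {..<r} \<and> a \<le> b}.
       q ^ (Cr2 {B\<in>Q. \<forall>l\<in>B. n l = a} {B\<in>Q. \<forall>l\<in>B. n l = b} * a * b)) * (\<Prod>C\<in>Q. c (Min C) (Max C)))"
  proof (rule sum.cong[OF refl])
    fix Q assume Qc: "Q \<in> col_pairings r n"
    then have Q: "Q \<in> pairings_on {..<r}" by (simp add: col_pairings_def pairings_eq)
    have ceq: "n l = n m" if "C \<in> Q" "l \<in> C" "m \<in> C" for C l m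
      using Qc that unfolding col_pairings_def by blast
    have "(\<Sum>P\<in>over r ?A Q. q ^ Cr P * L P) = (\<Sum>P\<in>over r ?A Q. q ^ Cr P) * (\<Prod>C\<in>Q. c (Min C) (Max C) / Kq q (n (Min C)))"
      unfolding sum_distrib_right using Q by (intro sum.cong refl) (auto simp: L_def over_def)
    also have "(\<Sum>P\<in>over r ?A Q. q ^ Cr P) = (\<Prod>C\<in>Q. Kq q (card (?A (Min C))))
      * q ^ (\<Sum>(C, D)\<in>{(C, D). C \<in> Q \<and> D \<in> Q \<and> crosses C D}. card (?A (Min C)) * card (?A (Min D)))"
      by (rule sum_over[OF sep Q blocks_nonempty[OF bs]]) (assumption, unfold bl_card, rule ceq)
    also have "\<dots> * (\<Prod>C\<in>Q. c (Min C) (Max C) / Kq q (n (Min C)))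
      = q ^ ?N Q * (\<Prod>C\<in>Q. Kq q (n (Min C)) * (c (Min C) (Max C) / Kq q (n (Min C))))"
      by (simp only: bl_card prod.distrib mult_ac)
    also have "(\<Prod>C\<in>Q. Kq q (n (Min C)) * (c (Min C) (Max C) / Kq q (n (Min C)))) = (\<Prod>C\<in>Q. c (Min C) (Max C))"
    proof (rule prod.cong[OF refl])
      fix C assume "C \<in> Q"
      then have "Kq q (n (Min C)) \<noteq> 0" using Kq_ge_one[OF n[OF mm(1)[OF Q]]] by force
      then show "Kq q (n (Min C)) * (c (Min C) (Max C) / Kq q (n (Min C))) = c (Min C) (Max C)" by simp
    qed
    finally show "(\<Sum>P\<in>over r ?A Q. q ^ Cr P * L P) = (\<Prod>(a, b)\<in>{(a, b). a \<in> n ` {..<r} \<and> b \<in> n ` {..<r} \<and> a \<le> b}.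
       q ^ (Cr2 {B\<in>Q. \<forall>l\<in>B. n l = a} {B\<in>Q. \<forall>l\<in>B. n l = b} * a * b)) * (\<Prod>C\<in>Q. c (Min C) (Max C))"
      by (simp only: cross_weight[OF Qc])
  qed
  finally have val: "(\<Sum>P\<in>bip {..<r} ?A. q ^ Cr P * L P) = \<dots>" .
  have "(\<lambda>k. DS r ?s n (\<lambda>l. f l k)) \<longlonglongrightarrow> (\<Sum>P\<in>bip {..<r} ?A. q ^ Cr P * L P)"
    unfolding DS_def by (intro tendsto_sum tendsto_mult_left PIlim)
  then have "(\<lambda>k. complex_of_real (DS r ?s n (\<lambda>l. f l k))) \<longlonglongrightarrow> complex_of_real (\<Sum>P\<in>bip {..<r} ?A. q ^ Cr P * L P)"
    by (rule tendsto_of_real)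
  moreover have "\<phi> (Iprod r n (\<lambda>l. f l k)) = complex_of_real (DS r ?s n (\<lambda>l. f l k))" for k
    by (rule diagram_formula[OF bs f(1)])
  ultimately show ?thesis by (simp only: val)
qed

end

subsection \<open>The fourth moment\<close>

lemma less_four: "j < (4::nat) \<longleftrightarrow> j = 0 \<or> j = 1 \<or> j = 2 \<or> j = 3"
  by auto

lemma Cr_inv_pairing_zero:
  assumes nc: "\<And>x y. x \<in> S \<Longrightarrow> y \<in> S \<Longrightarrow> x < y \<Longrightarrow> y < h x \<Longrightarrow> h x < h y \<Longrightarrow> False"
    and h: "\<And>x. x \<in> S \<Longrightarrow> h (h x) = x" "\<And>x. x \<in> S \<Longrightarrow> h x \<in> S"
  shows "Cr (inv_pairing S h) = 0"
proof -
  have no: "\<not> crosses B C" if BC: "B \<in> inv_pairing S h" "C \<in> inv_pairing S h" for B C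
  proof
    assume "crosses B C"
    then obtain x1 y1 x2 y2 where xy: "B = {x1, y1}" "C = {x2, y2}" "x1 < x2" "x2 < y1" "y1 < y2"
      unfolding crosses_def by blast
    have m: "x \<in> S \<and> y = h x" if "{x, y} \<in> inv_pairing S h" "x < y" for x y
    proof -
      obtain z where "z \<in> S" "{x, y} = {z, h z}" using \<open>{x, y} \<in> inv_pairing S h\<close> by (auto simp: inv_pairing_def)
      then show ?thesis using h \<open>x < y\<close> by (auto simp: doubleton_eq_iff)
    qed
    have "x1 \<in> S" "y1 = h x1" "x2 \<in> S" "y2 = h x2" using m[of x1 y1] m[of x2 y2] BC xy by auto
    then show False using nc[of x1 x2] xy by auto
  qed
  then have "{(B, C). B \<in> inv_pairing S h \<and> C \<in> inv_pairing S h \<and> crosses B C} = {}" by auto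
  then show ?thesis unfolding Cr_def by (simp only: card.empty)
qed

abbreviation (input) s4 :: "nat \<Rightarrow> nat \<Rightarrow> nat" where "s4 n \<equiv> (\<lambda>j. j * n)"
abbreviation (input) b4 :: "nat \<Rightarrow> nat \<Rightarrow> nat set" where "b4 n \<equiv> bl (\<lambda>j. j * n) (\<lambda>_. n)"

lemma b4_simps: "b4 n 0 = {0..<n}" "b4 n 1 = {n..<2*n}" "b4 n 2 = {2*n..<3*n}" "b4 n 3 = {3*n..<4*n}"
  by (auto simp: bl_def)

lemma lessThan_four: "{..<4::nat} = {0, 1, 2, 3}"
  by auto

lemma b4_union: "(\<Union>j\<in>{..<4}. b4 n j) = {..<4*n}"
  unfolding lessThan_four by (auto simp: b4_simps[simplified])

lemma inv_pairing_bip4: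
  assumes h: "\<And>x. x < 4*n \<Longrightarrow> h x < 4*n" "\<And>x. x < 4*n \<Longrightarrow> h (h x) = x"
    and ni: "\<And>x j. j < 4 \<Longrightarrow> x \<in> b4 n j \<Longrightarrow> h x \<notin> b4 n j"
  shows "inv_pairing {..<4*n} h \<in> bip {..<4} (b4 n)"
proof -
  have nfix: "h x \<noteq> x" if "x < 4*n" for x
  proof -
    have "x \<in> (\<Union>j\<in>{..<4}. b4 n j)" using that by (simp add: b4_union)
    then obtain j where "j < 4" "x \<in> b4 n j" by auto
    then show ?thesis using ni[of j x] by metis
  qed
  have "inv_pairing {..<4*n} h \<in> pairings_on {..<4*n}"
    by (rule inv_pairing) (use h nfix in auto)
  moreover have "\<not> B \<subseteq> b4 n j" if "B \<in> inv_pairing {..<4*n} h" "j < 4" for B j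
    using that ni[of j] by (auto simp: inv_pairing_def)
  ultimately show ?thesis unfolding bip_def b4_union by auto
qed

text \<open>The blocks \<open>0, 1\<close> and \<open>2, 3\<close> are linked by \<open>p\<close> nested pairs, the blocks \<open>0, 3\<close> and \<open>1, 2\<close>
  by \<open>n - p\<close> nested pairs; nothing crosses.\<close>

definition h_nc :: "nat \<Rightarrow> nat \<Rightarrow> nat \<Rightarrow> nat" where
  "h_nc n p x = (if n - p \<le> x \<and> x < n + p then 2*n - 1 - x
     else if 3*n - p \<le> x \<and> x < 3*n + p then 6*n - 1 - x else 4*n - 1 - x)"

text \<open>The blocks \<open>0, 3\<close> and \<open>1, 2\<close> are linked by \<open>p\<close> pairs, the blocks \<open>0, 2\<close> and \<open>1, 3\<close> by
  \<open>n - p\<close> pairs; there are crossings, but no pair inside the first half.\<close>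

definition h_cr :: "nat \<Rightarrow> nat \<Rightarrow> nat \<Rightarrow> nat" where
  "h_cr n p x = (if x < p then x + 3*n else if x < n then x + 2*n else if x < n + p then x + n
     else if x < 2*n then x + 2*n else if x < 2*n + p then x - n else if x < 3*n then x - 2*n
     else if x < 3*n + p then x - 3*n else x - 2*n)"

lemma h_nc_bip:
  assumes "1 \<le> p" "p < n"
  shows "inv_pairing {..<4*n} (h_nc n p) \<in> bip {..<4} (b4 n)"
    "Cr (inv_pairing {..<4*n} (h_nc n p)) = 0"
    "card (touch (inv_pairing {..<4*n} (h_nc n p)) (b4 n 0) \<inter> touch (inv_pairing {..<4*n} (h_nc n p)) (b4 n 1)) = p"
proof -
  have h: "h_nc n p x < 4*n" "h_nc n p (h_nc n p x) = x" if "x < 4*n" for x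
    using assms that by (auto simp: h_nc_def)
  have ni: "h_nc n p x \<notin> b4 n j" if "j < 4" "x \<in> b4 n j" for x j
    using assms that unfolding less_four by (elim disjE) (auto simp: b4_simps b4_simps[simplified] h_nc_def)
  show "inv_pairing {..<4*n} (h_nc n p) \<in> bip {..<4} (b4 n)"
    by (rule inv_pairing_bip4) (use h ni in auto)
  show "Cr (inv_pairing {..<4*n} (h_nc n p)) = 0"
  proof (rule Cr_inv_pairing_zero)
    show False if "x \<in> {..<4*n}" "y \<in> {..<4*n}" "x < y" "y < h_nc n p x" "h_nc n p x < h_nc n p y" for x y
      using that assms by (auto simp: h_nc_def split: if_splits)
  qed (use h in auto)
  have "card (touch (inv_pairing {..<4*n} (h_nc n p)) (b4 n 0) \<inter> touch (inv_pairing {..<4*n} (h_nc n p)) (b4 n 1))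
     = card {x\<in>b4 n 0. h_nc n p x \<in> b4 n 1}"
    by (rule card_touch_inv_pairing) (use h ni[of 0] in \<open>auto simp: b4_simps b4_simps[simplified]\<close>)
  also have "{x\<in>b4 n 0. h_nc n p x \<in> b4 n 1} = {n-p..<n}"
    using assms by (auto simp: b4_simps b4_simps[simplified] h_nc_def split: if_splits)
  finally show "card (touch (inv_pairing {..<4*n} (h_nc n p)) (b4 n 0) \<inter> touch (inv_pairing {..<4*n} (h_nc n p)) (b4 n 1)) = p"
    using assms by simp
qed

lemma h_cr_bip:
  assumes "1 \<le> p" "p < n"
  shows "inv_pairing {..<4*n} (h_cr n p) \<in> bip {..<4} (b4 n)"
    "touch (inv_pairing {..<4*n} (h_cr n p)) (b4 n 0) \<inter> touch (inv_pairing {..<4*n} (h_cr n p)) (b4 n 1) = {}"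
    "card (touch (inv_pairing {..<4*n} (h_cr n p)) (b4 n 0) \<inter> touch (inv_pairing {..<4*n} (h_cr n p)) (b4 n 3)) = p"
proof -
  let ?P = "inv_pairing {..<4*n} (h_cr n p)"
  have h: "h_cr n p x < 4*n" "h_cr n p (h_cr n p x) = x" if "x < 4*n" for x
    using assms that by (auto simp: h_cr_def)
  have ni: "h_cr n p x \<notin> b4 n j" if "j < 4" "x \<in> b4 n j" for x j
    using assms that unfolding less_four by (elim disjE) (auto simp: b4_simps b4_simps[simplified] h_cr_def)
  show P: "?P \<in> bip {..<4} (b4 n)"
    by (rule inv_pairing_bip4) (use h ni in auto)
  have "card (touch ?P (b4 n 0) \<inter> touch ?P (b4 n 1)) = card {x\<in>b4 n 0. h_cr n p x \<in> b4 n 1}"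
    by (rule card_touch_inv_pairing) (use h ni[of 0] in \<open>auto simp: b4_simps b4_simps[simplified]\<close>)
  also have "{x\<in>b4 n 0. h_cr n p x \<in> b4 n 1} = {}"
    using assms by (auto simp: b4_simps b4_simps[simplified] h_cr_def split: if_splits)
  finally show "touch ?P (b4 n 0) \<inter> touch ?P (b4 n 1) = {}"
    using finite_touch[OF finite_bip_pairing[OF P]] by simp
  have "card (touch ?P (b4 n 0) \<inter> touch ?P (b4 n 3)) = card {x\<in>b4 n 0. h_cr n p x \<in> b4 n 3}"
    by (rule card_touch_inv_pairing) (use h ni[of 0] in \<open>auto simp: b4_simps b4_simps[simplified]\<close>)
  also have "{x\<in>b4 n 0. h_cr n p x \<in> b4 n 3} = {0..<p}"
    using assms by (auto simp: b4_simps b4_simps[simplified] h_cr_def split: if_splits)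
  finally show "card (touch ?P (b4 n 0) \<inter> touch ?P (b4 n 3)) = p" by simp
qed

definition "Q01 = {{0, 1}, {2, 3::nat}}"
definition "Q02 = {{0, 2}, {1, 3::nat}}"
definition "Q03 = {{0, 3}, {1, 2::nat}}"

lemma Q_pairings: "Q01 \<in> pairings_on {..<4}" "Q02 \<in> pairings_on {..<4}" "Q03 \<in> pairings_on {..<4}"
  unfolding lessThan_four by (rule pairings_onI; auto simp: Q01_def Q02_def Q03_def)+

lemma pairings_four: "pairings_on {..<4} = {Q01, Q02, Q03}"
proof (intro subset_antisym subsetI)
  fix P assume P: "P \<in> pairings_on {..<4}"
  have c2: "card P = 2" using card_pairing[OF _ P] by simp
  obtain B where B0: "B \<in> P" "0 \<in> B" using blk_in[OF P, of 0] blk_mem[OF P, of 0] by auto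
  obtain B1 B2 where "P = {B1, B2}" "B1 \<noteq> B2" using c2 unfolding card_2_iff by blast
  then obtain C where C: "P = {B, C}" "C \<noteq> B" using B0(1) by blast
  have CP: "C \<in> P" using C(1) by blast
  have dis: "B \<inter> C = {}" using P B0(1) CP C(2) unfolding pairings_on_def by blast
  have "\<Union>P = {..<4}" using P by (simp add: pairings_on_def)
  moreover have "\<Union>P = B \<union> C" unfolding C(1) by blast
  ultimately have U: "B \<union> C = {0, 1, 2, 3}" by (simp only: lessThan_four)
  obtain y z where yz: "B = {y, z}" "y \<noteq> z" using pairings_on_card[OF P B0(1)] unfolding card_2_iff by blast
  then obtain x where x: "B = {0, x}" "x \<noteq> 0" using B0(2) by blast
  have "x \<in> B \<union> C" using x(1) by simp
  then have "x \<in> {1, 2, 3}" unfolding U using x(2) by simp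
  then consider "x = 1" | "x = 2" | "x = 3" by blast
  moreover have "C = (B \<union> C) - B" using dis by blast
  then have C2: "C = {0, 1, 2, 3} - {0, x}" unfolding U unfolding x(1) .
  ultimately show "P \<in> {Q01, Q02, Q03}"
  proof cases
    case 1
    have "C = {2, 3}" unfolding C2 1 by auto
    then have "P = Q01" unfolding C(1) x(1) 1 by (simp only: Q01_def)
    then show ?thesis by simp
  next
    case 2
    have "C = {1, 3}" unfolding C2 2 by auto
    then have "P = Q02" unfolding C(1) x(1) 2 by (simp only: Q02_def)
    then show ?thesis by simp
  next
    case 3
    have "C = {1, 2}" unfolding C2 3 by auto
    then have "P = Q03" unfolding C(1) x(1) 3 by (simp only: Q03_def)
    then show ?thesis by simp
  qed
qed (use Q_pairings in auto)

lemma Cr_four: "Cr Q01 = 0" "Cr Q02 = 1" "Cr Q03 = 0"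
proof -
  have "{(C, D). C \<in> Q01 \<and> D \<in> Q01 \<and> crosses C D} = {}"
    "{(C, D). C \<in> Q02 \<and> D \<in> Q02 \<and> crosses C D} = {({0, 2}, {1, 3})}"
    "{(C, D). C \<in> Q03 \<and> D \<in> Q03 \<and> crosses C D} = {}"
    by (auto simp: crosses_iff Q01_def Q02_def Q03_def)
  then show "Cr Q01 = 0" "Cr Q02 = 1" "Cr Q03 = 0" unfolding Cr_def by (simp_all only: card.empty card_1_singleton_iff) auto
qed

lemma Q_distinct: "Q01 \<noteq> Q02" "Q01 \<noteq> Q03" "Q02 \<noteq> Q03"
  by (auto simp: Q01_def Q02_def Q03_def doubleton_eq_iff)

text \<open>If no pair joins the blocks 1 and 3, each of the \<open>2 * n\<close> pairs meets block
  0 or block 2. These blocks meet \<open>n\<close> pairs each, so no pair can meet both.\<close>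

lemma opposite_touch:
  assumes bs: "blocks 4 s (\<lambda>_. n)" and P: "P \<in> bip {..<4} (bl s (\<lambda>_. n))"
    and e: "touch P (bl s (\<lambda>_. n) 1) \<inter> touch P (bl s (\<lambda>_. n) 3) = {}"
  shows "touch P (bl s (\<lambda>_. n) 0) \<inter> touch P (bl s (\<lambda>_. n) 2) = {}"
proof -
  let ?T = "\<lambda>l. touch P (bl s (\<lambda>_. n) l)"
  note sep = blocks_separated[OF bs]
  have finP: "finite P" by (rule finite_bip_pairing[OF P])
  have finT: "finite (?T l)" for l by (rule finite_touch[OF finP])
  have cP: "card P = 2 * n"
  proof -
    have "card (\<Union>j\<in>{..<4::nat}. bl s (\<lambda>_. n) j) = (\<Sum>j\<in>{..<4::nat}. card (bl s (\<lambda>_. n) j))"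
      using separated_unique[OF sep] by (intro card_UN_disjoint) auto
    then show ?thesis using card_pairing[OF _ bip_pairings[OF P]] by simp
  qed
  have "P \<subseteq> ?T 0 \<union> ?T 2"
  proof
    fix B assume B: "B \<in> P"
    obtain j k where jk: "j < k" "k < 4" "oset 4 (bl s (\<lambda>_. n)) B = {j, k}" by (rule bip_pairE[OF sep P B])
    have "B \<in> ?T j" "B \<in> ?T k"
    proof -
      have "j \<in> oset 4 (bl s (\<lambda>_. n)) B" "k \<in> oset 4 (bl s (\<lambda>_. n)) B" using jk(3) by auto
      then show "B \<in> ?T j" "B \<in> ?T k" using B by (auto simp: oset_def touch_def)
    qed
    then have "\<not> (j = 1 \<and> k = 3)" using e by auto
    then have "j = 0 \<or> j = 2 \<or> k = 0 \<or> k = 2" using jk(1,2) by auto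
    then show "B \<in> ?T 0 \<union> ?T 2" using \<open>B \<in> ?T j\<close> \<open>B \<in> ?T k\<close> by auto
  qed
  then have "card (?T 0 \<union> ?T 2) = 2 * n"
    using cP touch_sub by (metis Un_least subset_antisym)
  moreover have "card (?T 0) = n" "card (?T 2) = n" using card_touch[OF P, of 0] card_touch[OF P, of 2] by auto
  ultimately have "card (?T 0 \<inter> ?T 2) = 0" using card_Un_Int[OF finT finT, of 0 2] by simp
  then show ?thesis using finT by simp
qed

section \<open>The tensor square of a symmetric function\<close>

definition tens :: "nat \<Rightarrow> ((nat \<Rightarrow> real) \<Rightarrow> real) \<Rightarrow> (nat \<Rightarrow> real) \<Rightarrow> real" where
  "tens n f x = f (restrict x {..<n}) * f (restrict (\<lambda>i. x (n + i)) {..<n})"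

lemma tens_parg: "tens n f (parg P a (2*n) y) = f (parg P a n y) * f (parg P (a + n) n y)"
proof -
  have "restrict (parg P a (2*n) y) {..<n} = parg P a n y"
    by (auto simp: parg_def fun_eq_iff)
  moreover have "restrict (\<lambda>i. parg P a (2*n) y (n + i)) {..<n} = parg P (a + n) n y"
    by (auto simp: parg_def fun_eq_iff add.assoc)
  ultimately show ?thesis by (simp add: tens_def)
qed

lemma L2_tens:
  assumes f: "L2 n f" shows "L2 (2*n) (tens n f)"
proof -
  let ?I = "{..<n}" and ?J = "{n..<2*n}"
  have IJ: "?I \<inter> ?J = {}" "finite ?I" "finite ?J" and U: "?I \<union> ?J = {..<2*n}" by auto
  have e: "bij_betw (\<lambda>i. n + i) ?I ?J" by (rule bij_betwI[where g = "\<lambda>i. i - n"]) auto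
  let ?f2 = "\<lambda>z. f (restrict (\<lambda>i. z (n + i)) ?I)"
  have f1: "sqint (PM ?I) f" using f by (simp add: L2_sqint)
  have f2: "sqint (PM ?J) ?f2" by (rule sqint_reindex(1)[OF e IJ(2) f1])
  have r: "tens n f x = f (restrict x ?I) * ?f2 (restrict x ?J)" for x
    unfolding tens_def by (intro arg_cong2[where f = "(*)"] refl arg_cong[where f = f]) auto
  have "integrable (PM (?I \<union> ?J)) (\<lambda>x. (f (restrict x ?I))^2 * (?f2 (restrict x ?J))^2)"
    by (rule integral_indep(1)[OF IJ, of "\<lambda>x. (f x)^2" "\<lambda>x. (?f2 x)^2"]) (use f1 f2 in \<open>auto simp: sqint_def\<close>)
  moreover have "(\<lambda>x. f (restrict x ?I) * ?f2 (restrict x ?J)) \<in> borel_measurable (PM (?I \<union> ?J))"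
    by (intro borel_measurable_times measurable_compose[OF measurable_PM_restrict sqint_measurable[OF f1]]
          measurable_compose[OF measurable_PM_restrict sqint_measurable[OF f2]]) auto
  ultimately show ?thesis unfolding L2_sqint sqint_def r U by (simp add: power_mult_distrib)
qed

text \<open>Reversal exchanges the two halves and reverses each of them, and the symmetry of
  \<open>f\<close> undoes the latter. The double integral of the tensor square is therefore
  self-adjoint.\<close>

lemma tens_rv:
  assumes f: "psym n f" shows "tens n f (permarg (2*n) (rv (2*n)) x) = tens n f x"
proof -
  have "f (restrict (permarg (2*n) (rv (2*n)) x) {..<n}) = f (restrict (\<lambda>i. x (2*n - 1 - i)) {..<n})"
    by (intro arg_cong[where f = f]) (auto simp: permarg_def rv_def fun_eq_iff)
  also have "\<dots> = f (restrict (\<lambda>i. x (n + i)) {..<n})"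
  proof -
    have "bij_betw (\<lambda>i. 2*n - 1 - i) {..<n} {n..<2*n}" by (rule bij_betwI[where g = "\<lambda>i. 2*n - 1 - i"]) auto
    moreover have "bij_betw (\<lambda>i. n + i) {..<n} {n..<2*n}" by (rule bij_betwI[where g = "\<lambda>i. i - n"]) auto
    ultimately show ?thesis by (rule psym_enumeration[OF f])
  qed
  finally have 1: "f (restrict (permarg (2*n) (rv (2*n)) x) {..<n}) = f (restrict (\<lambda>i. x (n + i)) {..<n})" .
  have "f (restrict (\<lambda>i. permarg (2*n) (rv (2*n)) x (n + i)) {..<n}) = f (restrict (\<lambda>i. x (n - 1 - i)) {..<n})"
    by (intro arg_cong[where f = f]) (auto simp: permarg_def rv_def fun_eq_iff)
  also have "\<dots> = f (restrict (\<lambda>i. x (id i)) {..<n})"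
  proof -
    have "bij_betw (\<lambda>i. n - 1 - i) {..<n} {..<n}" by (rule bij_betwI[where g = "\<lambda>i. n - 1 - i"]) auto
    then show ?thesis by (rule psym_enumeration[OF f _ bij_betw_id])
  qed
  finally have 2: "f (restrict (\<lambda>i. permarg (2*n) (rv (2*n)) x (n + i)) {..<n}) = f (restrict x {..<n})" by simp
  show ?thesis unfolding tens_def 1 2 by (rule mult.commute)
qed

context qBM
begin

lemma power_Iprod: "I n f ^ m = Iprod m (\<lambda>_. n) (\<lambda>_. f)"
  by (simp add: Iprod_def map_replicate_const)

text \<open>A single block has no diagram, since each pair would lie inside it.\<close>

lemma I_mean:
  assumes "n \<ge> 1" "L2 n f" shows "\<phi> (I n f) = 0"
proof -
  have bs: "blocks 1 (\<lambda>_. 0) (\<lambda>_. n)" using assms by (simp add: blocks_def)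
  have "bip {..<1} (bl (\<lambda>_. 0) (\<lambda>_. n)) = {}"
  proof (rule ccontr)
    assume "bip {..<1} (bl (\<lambda>_. 0) (\<lambda>_. n)) \<noteq> {}"
    then obtain P where P: "P \<in> bip {..<1} (bl (\<lambda>_. 0) (\<lambda>_. n))" by blast
    have "0 \<in> (\<Union>j\<in>{..<1::nat}. bl (\<lambda>_. 0) (\<lambda>_. n) j)" using assms by (simp add: bl_def)
    then obtain B where B: "B \<in> P" using pairings_on_cover[OF bip_pairings[OF P]] by blast
    obtain j k :: nat where "j < k" "k < 1" by (rule bip_pairE[OF blocks_separated[OF bs] P B])
    then show False by simp
  qed
  then show ?thesis using diagram_formula[OF bs, of "\<lambda>_. f"] assms by (simp add: Iprod_def DS_def)
qed

text \<open>The mixed moment of T and W equals the second moment of W, because the blocks n, n, 2n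
  and the blocks 2n, 2n admit the same diagrams with the same integrals. These are the diagrams of
  four blocks without a link between the blocks 0 and 1.\<close>

lemma fourth_moment_tensor_bound:
  assumes n: "n \<ge> 1" and f: "L2 n f" "psym n f"
  shows "(qip q n f f)^2 + (\<Sum>P\<in>{P\<in>bip {..<4} (b4 n). touch P (b4 n 0) \<inter> touch P (b4 n 1) = {}}.
      q ^ Cr P * PI P 4 (s4 n) (\<lambda>_. n) (\<lambda>_. f)) \<le> Re (\<phi> (I n f ^ 4))" (is "_ + ?D \<le> _")
proof -
  let ?D4 = "{P\<in>bip {..<4} (b4 n). touch P (b4 n 0) \<inter> touch P (b4 n 1) = {}}"
  let ?T = "I n f * I n f" and ?W = "I (2*n) (tens n f)" and ?c = "qip q n f f"
  have n2: "2*n \<ge> 1" using n by simp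
  note Lt = L2_tens[OF f(1)]
  have starT: "star ?T = ?T" by (simp add: star_mult star_I_psym[OF n f])
  have starW: "star ?W = ?W" using star_I[OF n2 Lt] by (simp add: tens_rv[OF f(2)])
  let ?s2 = "\<lambda>j. j * (2*n)" and ?n2 = "\<lambda>_::nat. 2*n"
  let ?s3 = "\<lambda>j. j * n" and ?n3 = "\<lambda>j::nat. if j = 2 then 2*n else n"
  have bs2: "blocks 2 ?s2 ?n2" using n by (simp add: blocks_def)
  have bs3: "blocks 3 ?s3 ?n3" using n by (auto simp: blocks_def)
  have two: "{..<2::nat} = {0, 1}" and three: "{..<3::nat} = {0, 1, 2}" by auto
  have U2: "(\<Union>j\<in>{..<2}. bl ?s2 ?n2 j) = {..<4*n}" unfolding two by (auto simp: bl_def)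
  have U3: "(\<Union>j\<in>{..<3}. bl ?s3 ?n3 j) = {..<4*n}" unfolding three by (auto simp: bl_def)
  have c2: "P \<in> bip {..<2} (bl ?s2 ?n2) \<longleftrightarrow> P \<in> pairings_on {..<4*n} \<and> (\<forall>B\<in>P. \<not> B \<subseteq> {..<2*n} \<and> \<not> B \<subseteq> {2*n..<4*n})" for P
  proof -
    have I2: "bl ?s2 ?n2 0 = {..<2*n}" "bl ?s2 ?n2 1 = {2*n..<4*n}" by (auto simp: bl_def)
    have "P \<in> bip {..<2} (bl ?s2 ?n2) \<longleftrightarrow> P \<in> pairings_on {..<4*n} \<and> (\<forall>B\<in>P. \<forall>j\<in>{..<2::nat}. \<not> B \<subseteq> bl ?s2 ?n2 j)"
      by (simp only: bip_def mem_Collect_eq U2)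
    then show ?thesis by (simp only: two ball_simps(5,7) I2 simp_thms)
  qed
  \<comment> \<open>If no pair lies in the second half, its \<open>2 * n\<close> points belong to
    \<open>2 * n\<close> different pairs, which are all pairs; so none lies in the first half
    either.\<close>
  have cov: "touch P {2*n..<4*n} = P" if P: "P \<in> pairings_on {..<4*n}" and ni: "\<And>B. B \<in> P \<Longrightarrow> \<not> B \<subseteq> {2*n..<4*n}" for P
  proof -
    have b: "bij_betw (blk P) {2*n..<4*n} (touch P {2*n..<4*n})" by (rule bij_betw_touch[OF P _ ni]) auto
    have "finite P" by (rule finite_pairing[OF _ P]) simp
    moreover have "card (touch P {2*n..<4*n}) = card P"
      using bij_betw_same_card[OF b] card_pairing[OF _ P] by simp
    ultimately show ?thesis by (intro card_subset_eq touch_sub)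
  qed
  have e3: "bip {..<3} (bl ?s3 ?n3) = bip {..<2} (bl ?s2 ?n2)"
  proof (intro subset_antisym subsetI)
    fix P assume P: "P \<in> bip {..<3} (bl ?s3 ?n3)"
    then have pr: "P \<in> pairings_on {..<4*n}" using bip_pairings[OF P] U3 by simp
    have ni: "\<not> B \<subseteq> {2*n..<4*n}" if "B \<in> P" for B using P that by (auto simp: bip_def three bl_def)
    have "\<not> B \<subseteq> {..<2*n}" if "B \<in> P" for B
    proof -
      have "B \<in> touch P {2*n..<4*n}" using cov[OF pr ni] that by simp
      then show ?thesis by (fastforce simp: touch_def)
    qed
    then show "P \<in> bip {..<2} (bl ?s2 ?n2)" using c2 pr ni by blast
  next
    fix P assume "P \<in> bip {..<2} (bl ?s2 ?n2)"
    then have P: "P \<in> pairings_on {..<4*n}" "\<forall>B\<in>P. \<not> B \<subseteq> {..<2*n} \<and> \<not> B \<subseteq> {2*n..<4*n}" using c2 by blast+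
    have "\<not> B \<subseteq> bl ?s3 ?n3 j" if "B \<in> P" "j < 3" for B j
    proof -
      have "bl ?s3 ?n3 j \<subseteq> {..<2*n} \<or> bl ?s3 ?n3 j \<subseteq> {2*n..<4*n}"
      proof -
        have "j = 0 \<or> j = 1 \<or> j = 2" using that(2) by linarith
        then show ?thesis by (elim disjE) (auto simp: bl_def)
      qed
      then show ?thesis using P(2) that(1) by blast
    qed
    then show "P \<in> bip {..<3} (bl ?s3 ?n3)" unfolding bip_def U3 using P(1) by blast
  qed
  have e4: "bip {..<2} (bl ?s2 ?n2) = ?D4"
  proof (intro subset_antisym subsetI)
    fix P assume "P \<in> bip {..<2} (bl ?s2 ?n2)"
    then have P: "P \<in> pairings_on {..<4*n}" "\<forall>B\<in>P. \<not> B \<subseteq> {..<2*n} \<and> \<not> B \<subseteq> {2*n..<4*n}" using c2 by blast+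
    have "b4 n j \<subseteq> {..<2*n} \<or> b4 n j \<subseteq> {2*n..<4*n}" if "j < 4" for j
      using that unfolding less_four by (elim disjE) (auto simp: bl_def)
    then have "P \<in> bip {..<4} (b4 n)" unfolding bip_def b4_union using P by blast
    moreover have "touch P (b4 n 0) \<inter> touch P (b4 n 1) = {}"
    proof (rule ccontr)
      assume "touch P (b4 n 0) \<inter> touch P (b4 n 1) \<noteq> {}"
      then obtain B x y where B: "B \<in> P" "x \<in> B" "x \<in> b4 n 0" "y \<in> B" "y \<in> b4 n 1" by (auto simp: touch_def)
      then have "x \<noteq> y" "x < 2*n" "y < 2*n" by (auto simp: bl_def)
      moreover have "card B = 2" by (rule pairings_on_card[OF P(1) B(1)])
      ultimately have "B \<subseteq> {..<2*n}" using B by (auto simp: card_2_iff)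
      then show False using P(2) B(1) by blast
    qed
    ultimately show "P \<in> ?D4" by simp
  next
    fix P assume P: "P \<in> ?D4"
    then have Pb: "P \<in> bip {..<4} (b4 n)" and e: "touch P (b4 n 0) \<inter> touch P (b4 n 1) = {}" by auto
    have pr: "P \<in> pairings_on {..<4*n}" using bip_pairings[OF Pb] by (simp only: b4_union)
    have finT: "finite (touch P A)" for A by (rule finite_touch[OF finite_bip_pairing[OF Pb]])
    have tP: "touch P (b4 n 0) \<union> touch P (b4 n 1) = P"
    proof (rule card_subset_eq[OF finite_bip_pairing[OF Pb]])
      show "card (touch P (b4 n 0) \<union> touch P (b4 n 1)) = card P"
        unfolding card_Un_disjoint[OF finT finT e]
        using card_touch[OF Pb, of 0] card_touch[OF Pb, of 1] card_pairing[OF _ pr] by simp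
    qed (auto simp: touch_def)
    have sub: "b4 n 0 \<union> b4 n 1 = {..<2*n}" by (auto simp: bl_def)
    have n0: "\<not> B \<subseteq> {..<2*n}" if B: "B \<in> P" for B
    proof
      assume B2: "B \<subseteq> {..<2*n}"
      have "\<not> B \<subseteq> b4 n 0" "\<not> B \<subseteq> b4 n 1" using Pb B by (auto simp: bip_def)
      then have "B \<in> touch P (b4 n 0) \<inter> touch P (b4 n 1)" using B B2 unfolding sub[symmetric] touch_def by blast
      then show False using e by blast
    qed
    have n1: "\<not> B \<subseteq> {2*n..<4*n}" if B: "B \<in> P" for B
    proof
      assume B2: "B \<subseteq> {2*n..<4*n}"
      have "B \<in> touch P (b4 n 0) \<union> touch P (b4 n 1)" using B tP by simp
      then have "B \<inter> {..<2*n} \<noteq> {}" unfolding touch_def sub[symmetric] by blast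
      moreover have "{2*n..<4*n} \<inter> {..<2*n} = {}" by auto
      ultimately show False using B2 by blast
    qed
    show "P \<in> bip {..<2} (bl ?s2 ?n2)" using c2 pr n0 n1 by blast
  qed
  have PI2: "PI P 2 ?s2 ?n2 (\<lambda>_. tens n f) = PI P 4 (s4 n) (\<lambda>_. n) (\<lambda>_. f)" for P
    unfolding PI_def by (intro Bochner_Integration.integral_cong refl)
      (simp add: numeral_eq_Suc lessThan_Suc tens_parg[unfolded mult_2] mult_ac add_ac)
  have PI3: "PI P 3 ?s3 ?n3 (\<lambda>j. if j = 2 then tens n f else f) = PI P 4 (s4 n) (\<lambda>_. n) (\<lambda>_. f)" for P
    unfolding PI_def by (intro Bochner_Integration.integral_cong refl)
      (simp add: numeral_eq_Suc lessThan_Suc tens_parg[unfolded mult_2] mult_ac add_ac)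
  have WW: "\<phi> (?W * ?W) = complex_of_real ?D"
  proof -
    have "\<phi> (Iprod 2 ?n2 (\<lambda>_. tens n f)) = complex_of_real (DS 2 ?s2 ?n2 (\<lambda>_. tens n f))"
      by (rule diagram_formula[OF bs2 Lt])
    then show ?thesis unfolding DS_def e4 PI2 by (simp add: Iprod_def numeral_2_eq_2)
  qed
  have TW: "\<phi> (?T * ?W) = complex_of_real ?D"
  proof -
    have "\<phi> (Iprod 3 ?n3 (\<lambda>j. if j = 2 then tens n f else f)) = complex_of_real (DS 3 ?s3 ?n3 (\<lambda>j. if j = 2 then tens n f else f))"
      by (rule diagram_formula[OF bs3]) (use Lt f in auto)
    moreover have "Iprod 3 ?n3 (\<lambda>j. if j = 2 then tens n f else f) = ?T * ?W"
      by (simp add: Iprod_def numeral_3_eq_3 mult.assoc)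
    ultimately show ?thesis unfolding DS_def e3 e4 PI3 by simp
  qed
  have W0: "\<phi> ?W = 0" by (rule I_mean[OF n2 Lt])
  have T0: "\<phi> ?T = complex_of_real ?c"
    using I_isometry[OF n n f(1) f(1)] by (simp add: star_I_psym[OF n f])
  \<comment> \<open>Subtracting both the mean and W leaves an element whose squared norm is the
    fourth moment minus \<open>?c * ?c\<close> minus the diagram sum.\<close>
  let ?Y = "?T - ?W - ?c *\<^sub>R 1"
  have "star ?Y * ?Y = ?T * ?T + ?W * ?W + (?c * ?c) *\<^sub>R 1 - ?T * ?W - ?W * ?T - (2 * ?c) *\<^sub>R ?T + (2 * ?c) *\<^sub>R ?W"
    unfolding star_diff starT starW star_scaleR star_one
    by (simp add: algebra_simps scaleR_2[symmetric])
  then have "nrm2 ?Y = Re (\<phi> (?T * ?T)) + ?D + ?c * ?c - ?D - ?D - 2 * ?c * ?c"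
    using \<phi>_trace[of ?W ?T]
    by (simp only: nrm2_def \<phi>_add \<phi>_diff \<phi>_scaleR \<phi>_one WW TW W0 T0) (simp add: algebra_simps)
  then have "?c * ?c + ?D \<le> Re (\<phi> (?T * ?T))" using nrm2_nonneg[of ?Y] by simp
  moreover have "?T * ?T = I n f ^ 4" by (simp add: power4_eq_xxxx mult.assoc)
  ultimately show ?thesis by (simp add: power2_eq_square)
qed

lemma over_four_sum:
  assumes n: "n \<ge> 1" and f: "L2 n f" "psym n f" and Q: "Q \<in> {Q01, Q02, Q03}"
  shows "(\<Sum>P\<in>over 4 (b4 n) Q. q ^ Cr P * PI P 4 (s4 n) (\<lambda>_. n) (\<lambda>_. f)) = q ^ (n^2 * Cr Q) * (qip q n f f)^2"
proof -
  have bs: "blocks 4 (s4 n) (\<lambda>_. n)" using n by (simp add: blocks_def)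
  have Qp: "Q \<in> pairings_on {..<4}" using Q Q_pairings by auto
  have cQ: "card Q = 2" using card_pairing[OF _ Qp] by simp
  have "(\<Sum>P\<in>over 4 (b4 n) Q. q ^ Cr P * PI P 4 (s4 n) (\<lambda>_. n) (\<lambda>_. f))
    = q ^ (\<Sum>(C, D)\<in>{(C, D). C \<in> Q \<and> D \<in> Q \<and> crosses C D}. n * n) * (\<Prod>C\<in>Q. Kq q n * (\<integral>x. f x * f x \<partial>Mn n))"
    by (rule sum_over_PI[OF bs Qp]) (auto simp: f)
  also have "(\<Sum>(C, D)\<in>{(C, D). C \<in> Q \<and> D \<in> Q \<and> crosses C D}. n * n) = n^2 * Cr Q"
    by (simp add: Cr_def case_prod_beta power2_eq_square mult.commute)
  also have "(\<Prod>C\<in>Q. Kq q n * (\<integral>x. f x * f x \<partial>Mn n)) = (qip q n f f)^2"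
    by (simp add: cQ qip_eq_Kq[OF n f f])
  finally show ?thesis .
qed

text \<open>All diagrams that remain in the sum contribute squares with nonnegative weights, so all
  may be dropped except those over two pairings of whole blocks and one further diagram. The
  integral of the latter is the wanted contraction norm squared and its weight serves as
  \<open>w\<close>.\<close>

lemma fourth_moment_lower_bound:
  assumes n: "n \<ge> 1" and p: "1 \<le> p" "p \<le> n - 1"
  shows "\<exists>w>0. \<forall>f. L2 n f \<longrightarrow> psym n f \<longrightarrow>
     (2 + q ^ (n^2)) * (qip q n f f)^2 + w * (L2norm (2*n-2*p) (contraction n n p f f))^2 \<le> Re (\<phi> (I n f ^ 4))"
proof -
  have pn: "p < n" using p by simp
  have bs: "blocks 4 (s4 n) (\<lambda>_. n)" using n by (simp add: blocks_def)
  note sep = blocks_separated[OF bs]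
  have finb: "finite (bip {..<4} (b4 n))" by (rule finite_bip) auto
  have key: "q ^ (n^2 * Cr Qa) * (qip q n f f)^2 + q ^ (n^2 * Cr Qb) * (qip q n f f)^2 + q ^ Cr P0 * PI P0 4 (s4 n) (\<lambda>_. n) (\<lambda>_. f)
       \<le> (\<Sum>P\<in>S. q ^ Cr P * PI P 4 (s4 n) (\<lambda>_. n) (\<lambda>_. f))"
    if f: "L2 n f" "psym n f" and Qs: "Qa \<in> {Q01, Q02, Q03}" "Qb \<in> {Q01, Q02, Q03}" "Qa \<noteq> Qb"
      and S: "S \<subseteq> bip {..<4} (b4 n)" "over 4 (b4 n) Qa \<subseteq> S" "over 4 (b4 n) Qb \<subseteq> S" "P0 \<in> S"
      and nn: "\<And>P. P \<in> S \<Longrightarrow> 0 \<le> q ^ Cr P * PI P 4 (s4 n) (\<lambda>_. n) (\<lambda>_. f)"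
      and P0: "j < 4" "k < 4" "card (touch P0 (b4 n j) \<inter> touch P0 (b4 n k)) = p"
    for f Qa Qb S P0 j k
  proof -
    have finS: "finite S" by (rule finite_subset[OF S(1) finb])
    let ?F = "\<lambda>P. q ^ Cr P * PI P 4 (s4 n) (\<lambda>_. n) (\<lambda>_. f)"
    \<comment> \<open>The two blocks share \<open>p\<close> variables with 0 < p < n, whereas in a
      diagram over a pairing of blocks they share all or none. So \<open>P0\<close> is not counted
      twice.\<close>
    have nP0: "P0 \<notin> over 4 (b4 n) Q" if "Q \<in> {Q01, Q02, Q03}" for Q
    proof
      assume P: "P0 \<in> over 4 (b4 n) Q"
      have Qp: "Q \<in> pairings_on {..<4}" using that Q_pairings by auto
      have "touch P0 (b4 n j) \<inter> touch P0 (b4 n k) \<noteq> {}" using P0(3) p by auto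
      then have "touch P0 (b4 n j) \<subseteq> touch P0 (b4 n k)" by (rule over_touch[OF Qp P P0(1,2)])
      then have "touch P0 (b4 n j) \<inter> touch P0 (b4 n k) = touch P0 (b4 n j)" by blast
      moreover have "card (touch P0 (b4 n j)) = n" using P by (intro card_touch[OF _ P0(1)]) (auto simp: over_def)
      ultimately show False using P0(3) pn by simp
    qed
    have d: "over 4 (b4 n) Qa \<inter> over 4 (b4 n) Qb = {}" by (rule over_disjoint[OF Qs(3)])
    have fo: "finite (over 4 (b4 n) Q)" if "over 4 (b4 n) Q \<subseteq> S" for Q by (rule finite_subset[OF that finS])
    have "sum ?F (over 4 (b4 n) Qa) + sum ?F (over 4 (b4 n) Qb) + ?F P0 = sum ?F (insert P0 (over 4 (b4 n) Qa \<union> over 4 (b4 n) Qb))"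
      using nP0[OF Qs(1)] nP0[OF Qs(2)] fo[OF S(2)] fo[OF S(3)] d by (simp add: sum.union_disjoint)
    also have "\<dots> \<le> sum ?F S"
      using S nn finS by (intro sum_mono2) auto
    finally show ?thesis by (simp only: over_four_sum[OF n f Qs(1)] over_four_sum[OF n f Qs(2)])
  qed
  show ?thesis
  proof (cases "q = 0")
    case True
    \<comment> \<open>At \<open>q = 0\<close> only diagrams without crossings have a nonzero weight.
      Those over \<open>Q01\<close> and \<open>Q03\<close> give the constant 2, the term for
      \<open>Q02\<close> having the factor 0.\<close>
    let ?P0 = "inv_pairing {..<4*n} (h_nc n p)"
    note P0 = h_nc_bip[OF p(1) pn]
    have cyc: "PI P 4 (s4 n) (\<lambda>_. n) (\<lambda>_. f) = (L2norm (2*n-2*card (touch P (b4 n 0) \<inter> touch P (b4 n 1)))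
        (contraction n n (card (touch P (b4 n 0) \<inter> touch P (b4 n 1))) f f))^2"
      if P: "P \<in> bip {..<4} (b4 n)" "Cr P = 0" and f: "L2 n f" "psym n f" for P f
    proof (rule PI_four_cycle[OF bs P(1) f, where \<gamma> = 2 and \<delta> = 3])
      have finP: "finite P" by (rule finite_bip_pairing[OF P(1)])
      note pr = bip_pairings[OF P(1)]
      have nc: "\<not> crosses B C" if "B \<in> P" "C \<in> P" for B C
      proof
        assume "crosses B C"
        then have "(B, C) \<in> {(B, C). B \<in> P \<and> C \<in> P \<and> crosses B C}" using that by simp
        moreover have "finite {(B, C). B \<in> P \<and> C \<in> P \<and> crosses B C}"
          by (rule finite_subset[of _ "P \<times> P"]) (use finP in auto)
        ultimately show False using P(2) unfolding Cr_def by (simp only: card_0_eq empty_iff)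
      qed
      \<comment> \<open>A link between 0 and 2 forces one between 1 and 3, and these two pairs would
        cross.\<close>
      show "touch P (b4 n 0) \<inter> touch P (b4 n 2) = {}"
      proof (rule ccontr)
        assume ne: "touch P (b4 n 0) \<inter> touch P (b4 n 2) \<noteq> {}"
        then have "touch P (b4 n 1) \<inter> touch P (b4 n 3) \<noteq> {}" using opposite_touch[OF bs P(1)] by blast
        then obtain C x2 y2 where C: "C \<in> P" "x2 \<in> C" "x2 \<in> b4 n 1" "y2 \<in> C" "y2 \<in> b4 n 3" by (auto simp: touch_def)
        obtain B x1 y1 where B: "B \<in> P" "x1 \<in> B" "x1 \<in> b4 n 0" "y1 \<in> B" "y1 \<in> b4 n 2" using ne by (auto simp: touch_def)
        have l: "x1 < x2" "x2 < y1" "y1 < y2" using B C by (auto simp: bl_def)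
        have "B = {x1, y1}" "C = {x2, y2}"
          using pairings_on_card[OF pr B(1)] pairings_on_card[OF pr C(1)] B C l by (auto simp: card_2_iff)
        then have "crosses B C" unfolding crosses_def using l by blast
        then show False using nc B C by blast
      qed
    qed auto
    have "(2 + q ^ (n^2)) * (qip q n f f)^2 + 1 * (L2norm (2*n-2*p) (contraction n n p f f))^2 \<le> Re (\<phi> (I n f ^ 4))"
      if f: "L2 n f" "psym n f" for f
    proof -
      have "q ^ (n^2 * Cr Q01) * (qip q n f f)^2 + q ^ (n^2 * Cr Q03) * (qip q n f f)^2 + q ^ Cr ?P0 * PI ?P0 4 (s4 n) (\<lambda>_. n) (\<lambda>_. f)
        \<le> (\<Sum>P\<in>bip {..<4} (b4 n). q ^ Cr P * PI P 4 (s4 n) (\<lambda>_. n) (\<lambda>_. f))"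
      proof (rule key[OF f _ _ Q_distinct(2) _ _ _ P0(1) _ _ _ P0(3)])
        show "0 \<le> q ^ Cr P * PI P 4 (s4 n) (\<lambda>_. n) (\<lambda>_. f)" if "P \<in> bip {..<4} (b4 n)" for P
          using cyc[OF that _ f] True by (cases "Cr P = 0") (auto simp: power_0_left)
      qed (auto simp: over_def)
      moreover have "PI ?P0 4 (s4 n) (\<lambda>_. n) (\<lambda>_. f) = (L2norm (2*n-2*p) (contraction n n p f f))^2"
        using cyc[OF P0(1,2) f] by (simp only: P0(3))
      moreover have "\<phi> (I n f ^ 4) = complex_of_real (DS 4 (s4 n) (\<lambda>_. n) (\<lambda>_. f))"
        unfolding power_Iprod by (rule diagram_formula[OF bs f(1)])
      ultimately show ?thesis using True n unfolding DS_def by (simp add: Cr_four P0(2) zero_power)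
    qed
    then show ?thesis by (intro exI[of _ 1]) auto
  next
    case False
    then have qpos: "0 < q" using q0 by simp
    let ?P0 = "inv_pairing {..<4*n} (h_cr n p)"
    note P0 = h_cr_bip[OF p(1) pn]
    \<comment> \<open>Here \<open>Q02\<close> and \<open>Q03\<close> contribute 1 + q^(n^2) times
      the squared norm term; the remaining unit of the constant comes from the mean in
      \<open>fourth_moment_tensor_bound\<close>.\<close>
    let ?S = "{P\<in>bip {..<4} (b4 n). touch P (b4 n 0) \<inter> touch P (b4 n 1) = {}}"
    have cyc: "PI P 4 (s4 n) (\<lambda>_. n) (\<lambda>_. f) = (L2norm (2*n-2*card (touch P (b4 n 0) \<inter> touch P (b4 n 3)))
        (contraction n n (card (touch P (b4 n 0) \<inter> touch P (b4 n 3))) f f))^2"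
      if P: "P \<in> ?S" and f: "L2 n f" "psym n f" for P f
      by (rule PI_four_cycle[OF bs _ f, where \<gamma> = 1 and \<delta> = 2]) (use P in auto)
    have ov: "over 4 (b4 n) Q \<subseteq> ?S" if Q: "Q \<in> pairings_on {..<4}" "{0, 1} \<notin> Q" for Q
    proof
      fix P assume P: "P \<in> over 4 (b4 n) Q"
      have "touch P (b4 n 0) \<inter> touch P (b4 n 1) = {}"
      proof (rule ccontr)
        assume "touch P (b4 n 0) \<inter> touch P (b4 n 1) \<noteq> {}"
        then obtain B where B: "B \<in> P" "0 \<in> oset 4 (b4 n) B" "1 \<in> oset 4 (b4 n) B" by (auto simp: touch_def oset_def)
        then have BQ: "oset 4 (b4 n) B \<in> Q" using P by (auto simp: over_def)
        have "card (oset 4 (b4 n) B) = 2" by (rule pairings_on_card[OF Q(1) BQ])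
        then have "oset 4 (b4 n) B = {0, 1}" using B by (auto simp: card_2_iff)
        then show False using BQ Q(2) by simp
      qed
      then show "P \<in> ?S" using P by (simp add: over_def)
    qed
    have n01: "{0, 1} \<notin> Q02" "{0, 1} \<notin> Q03" by (auto simp: Q02_def Q03_def doubleton_eq_iff)
    have "(2 + q ^ (n^2)) * (qip q n f f)^2 + q ^ Cr ?P0 * (L2norm (2*n-2*p) (contraction n n p f f))^2 \<le> Re (\<phi> (I n f ^ 4))"
      if f: "L2 n f" "psym n f" for f
    proof -
      have PS: "?P0 \<in> ?S" using P0(1,2) by simp
      have "q ^ (n^2 * Cr Q02) * (qip q n f f)^2 + q ^ (n^2 * Cr Q03) * (qip q n f f)^2 + q ^ Cr ?P0 * PI ?P0 4 (s4 n) (\<lambda>_. n) (\<lambda>_. f)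
        \<le> (\<Sum>P\<in>?S. q ^ Cr P * PI P 4 (s4 n) (\<lambda>_. n) (\<lambda>_. f))"
      proof (rule key[OF f _ _ Q_distinct(3) _ ov[OF Q_pairings(2) n01(1)] ov[OF Q_pairings(3) n01(2)] PS _ _ _ P0(3)])
        show "0 \<le> q ^ Cr P * PI P 4 (s4 n) (\<lambda>_. n) (\<lambda>_. f)" if "P \<in> ?S" for P
          unfolding cyc[OF that f] using q0 by simp
      qed auto
      moreover have "PI ?P0 4 (s4 n) (\<lambda>_. n) (\<lambda>_. f) = (L2norm (2*n-2*p) (contraction n n p f f))^2"
        using cyc[OF PS f] by (simp only: P0(3))
      moreover note fourth_moment_tensor_bound[OF n f]
      ultimately show ?thesis by (simp add: Cr_four algebra_simps)
    qed
    moreover have "0 < q ^ Cr ?P0" using qpos by simp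
    ultimately show ?thesis by blast
  qed
qed

end

subsection \<open>Symmetrization\<close>

text \<open>A cylinder over a null set is null.\<close>

lemma AE_PM_subset:
  assumes ST: "T \<subseteq> S" "finite S" and R: "AE x in PM T. R x"
  shows "AE y in PM S. R (restrict y T)"
proof -
  have fT: "finite T" "finite (S - T)" using ST finite_subset by auto
  interpret U: sigma_finite_measure "PM (S - T)" by (rule sigma_finite_PM[OF fT(2)])
  have d: "T \<inter> (S - T) = {}" "T \<union> (S - T) = S" using ST by auto
  from R obtain N where N: "{x\<in>space (PM T). \<not> R x} \<subseteq> N" "emeasure (PM T) N = 0" "N \<in> sets (PM T)"
    by (rule AE_E)
  have r: "(\<lambda>y. restrict y T) \<in> measurable (PM S) (PM T)"
    using measurable_PM_reindex[of "\<lambda>i. i" T S] ST by (auto simp: restrict_def)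
  have "emeasure (PM S) ((\<lambda>y. restrict y T) -` N \<inter> space (PM S)) =
      (\<integral>\<^sup>+y. indicator N (restrict y T) \<partial>PM S)"
    unfolding nn_integral_indicator[OF measurable_sets[OF r N(3)], symmetric]
    by (intro nn_integral_cong) (simp add: indicator_def)
  also have "\<dots> = (\<integral>\<^sup>+z. indicator N (restrict (merge T (S - T) z) T) \<partial>(PM T \<Otimes>\<^sub>M PM (S - T)))"
    using PM_nn_integral_pair[OF d(1) fT, of "\<lambda>y. indicator N (restrict y T)"] r N(3)
    unfolding d(2) by simp
  also have "\<dots> = (\<integral>\<^sup>+z. indicator N (fst z) \<partial>(PM T \<Otimes>\<^sub>M PM (S - T)))"
    by (intro nn_integral_cong) (auto simp: space_pair_measure space_PM restrict_merge PiE_restrict)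
  also have "\<dots> = emeasure (PM T \<Otimes>\<^sub>M PM (S - T)) (N \<times> space (PM (S - T)))"
    unfolding nn_integral_indicator[OF pair_measureI[OF N(3) sets.top], symmetric]
    by (intro nn_integral_cong) (auto simp: indicator_def space_pair_measure)
  also have "\<dots> = 0" using N by (simp add: U.emeasure_pair_measure_Times)
  finally have z: "emeasure (PM S) ((\<lambda>y. restrict y T) -` N \<inter> space (PM S)) = 0" .
  show ?thesis
  proof (rule AE_I[OF _ z measurable_sets[OF r N(3)]])
    show "{y\<in>space (PM S). \<not> R (restrict y T)} \<subseteq> (\<lambda>y. restrict y T) -` N \<inter> space (PM S)"
      using measurable_space[OF r] N(1) by auto
  qed
qed

lemma AE_PM_inj:
  assumes b: "inj_on b T" "b ` T \<subseteq> S" and fin: "finite T" "finite S" and R: "AE x in PM T. R x"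
  shows "AE y in PM S. R (restrict (\<lambda>i. y (b i)) T)"
proof -
  have "AE y in PM (b ` T). R (restrict (\<lambda>i. y (b i)) T)"
    by (rule AE_PM_reindex[OF inj_on_imp_bij_betw[OF b(1)] fin(1) R])
  from AE_PM_subset[OF b(2) fin(2) this] show ?thesis
    by (simp add: restrict_def cong: if_cong)
qed

text \<open>Each of the two factors reads its arguments from distinct coordinates of the free and
  contracted variables taken together, so null sets pull back to null sets. By Fubini the integrands
  agree for almost every choice of the free variables.\<close>

lemma contraction_cong_AE:
  assumes f: "f \<in> borel_measurable (PM {..<n})" and h: "h \<in> borel_measurable (PM {..<n})"
    and fh: "AE x in PM {..<n}. f x = h x" and p: "p \<le> n"
  shows "AE t in PM {..<2*n-2*p}. contraction n n p f f t = contraction n n p h h t"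
proof -
  define m where "m = n - p"
  have M: "2*n-2*p = 2*m" and nm: "n = m + p" using p by (auto simp: m_def)
  \<comment> \<open>The contracted variables get the indices after the \<open>2*m\<close> free ones,
    so that all of them live in one product space.\<close>
  let ?A = "{2*m..<2*m+p}" and ?eA = "\<lambda>i. 2*m+i"
  let ?b1 = "\<lambda>i. if i < m then i else ?eA (n - 1 - i)" and ?b2 = "\<lambda>i. if i < p then ?eA i else m + (i - p)"
  let ?R = "\<lambda>b t a. restrict (\<lambda>i. merge {..<2*m} ?A (t, a) (b i)) {..<n}"
  interpret pair_sigma_finite "PM {..<2*m} :: (nat \<Rightarrow> real) measure" "PM ?A :: (nat \<Rightarrow> real) measure"
    by (intro pair_sigma_finite.intro sigma_finite_PM) simp_all
  have U: "{..<2*m} \<inter> ?A = {}" by auto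
  have "AE t in PM {..<2*m}. AE a in PM ?A. f (?R b t a) = h (?R b t a)"
    if b: "inj_on b {..<n}" "b ` {..<n} \<subseteq> {..<2*m} \<union> ?A" for b
  proof -
    have "AE y in PM ({..<2*m} \<union> ?A). f (restrict (\<lambda>i. y (b i)) {..<n}) = h (restrict (\<lambda>i. y (b i)) {..<n})"
      by (rule AE_PM_inj[OF b _ _ fh]) auto
    then have "AE z in PM {..<2*m} \<Otimes>\<^sub>M PM ?A. f (restrict (\<lambda>i. merge {..<2*m} ?A z (b i)) {..<n}) =
        h (restrict (\<lambda>i. merge {..<2*m} ?A z (b i)) {..<n})"
      by (subst (asm) merge_PM_distr[OF U, symmetric]) (auto dest: AE_distrD[OF measurable_merge_PM])
    from AE_pair[OF this] show ?thesis by simp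
  qed
  note * = this
  have b1: "inj_on ?b1 {..<n}" "?b1 ` {..<n} \<subseteq> {..<2*m} \<union> ?A"
    using nm by (auto simp: inj_on_def)
  have b2: "inj_on ?b2 {..<n}" "?b2 ` {..<n} \<subseteq> {..<2*m} \<union> ?A"
    using nm by (auto simp: inj_on_def)
  have e: "contraction n n p g g t = (\<integral>a. g (?R ?b1 t a) * g (?R ?b2 t a) \<partial>PM ?A)"
    if g: "g \<in> borel_measurable (PM {..<n})" and t: "t \<in> space (PM {..<2*m})" for g t
  proof -
    have pos: "0 \<le> t i" if "i < 2*m" for i using t that by (auto simp: space_PM PiE_def Pi_def)
    have eA: "bij_betw ?eA {..<p} ?A"
      by (rule bij_betw_byWitness[where f' = "\<lambda>i. i - 2*m"]) auto
    have "contraction n n p g g t =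
      (\<integral>a. g (restrict (\<lambda>i. merge {..<m} ?A (t, a) (if i < n - p then i else ?eA (n - 1 - i))) {..<n}) *
         g (restrict (\<lambda>i. merge {m..<2*m} ?A (t, a) (if i < p then ?eA i else n - p + (i - p))) {..<n}) \<partial>PM ?A)"
      by (rule contraction_reindex[OF g p eA, where ?e1.0 = "\<lambda>i. i" and ?e2.0 = "\<lambda>i. i"])
        (use pos M in \<open>auto simp: m_def[symmetric] bij_betw_def\<close>)
    also have "\<dots> = (\<integral>a. g (?R ?b1 t a) * g (?R ?b2 t a) \<partial>PM ?A)"
      by (intro Bochner_Integration.integral_cong refl arg_cong2[where f = "(*)"] arg_cong[where f = g] restrict_ext)
        (use nm in \<open>auto simp: merge_def\<close>)
    finally show ?thesis .
  qed
  have "AE t in PM {..<2*m}. contraction n n p f f t = contraction n n p h h t"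
    using *[OF b1] *[OF b2] AE_space
  proof eventually_elim
    case (elim t)
    have m: "(\<lambda>a. g (?R b t a)) \<in> borel_measurable (PM ?A)"
      if g: "g \<in> borel_measurable (PM {..<n})" and b: "b ` {..<n} \<subseteq> {..<2*m} \<union> ?A" for b and g :: "(nat \<Rightarrow> real) \<Rightarrow> real"
    proof (rule measurable_compose[OF _ g])
      have "b \<in> {..<n} \<rightarrow> {..<2*m} \<union> ?A" using b by auto
      from measurable_compose[OF measurable_compose[OF measurable_Pair1'[OF elim(3)] measurable_merge_PM] measurable_PM_reindex[OF this]]
      show "(\<lambda>a. ?R b t a) \<in> measurable (PM ?A) (PM {..<n})" by simp
    qed
    show ?case unfolding e[OF f elim(3)] e[OF h elim(3)]
    proof (rule integral_cong_AE)
      show "(\<lambda>a. f (?R ?b1 t a) * f (?R ?b2 t a)) \<in> borel_measurable (PM ?A)"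
        by (intro borel_measurable_times m[OF f] b1 b2)
      show "(\<lambda>a. h (?R ?b1 t a) * h (?R ?b2 t a)) \<in> borel_measurable (PM ?A)"
        by (intro borel_measurable_times m[OF h] b1 b2)
      show "AE a in PM ?A. f (?R ?b1 t a) * f (?R ?b2 t a) = h (?R ?b1 t a) * h (?R ?b2 t a)"
        using elim(1,2) by eventually_elim simp
    qed
  qed
  then show ?thesis by (simp only: M)
qed

text \<open>Turns symmetry almost everywhere into symmetry at every point, at the cost of a change
  on a null set.\<close>

definition symz :: "nat \<Rightarrow> ((nat \<Rightarrow> real) \<Rightarrow> real) \<Rightarrow> (nat \<Rightarrow> real) \<Rightarrow> real" where
  "symz n f x = (\<Sum>\<sigma>\<in>{\<sigma>. \<sigma> permutes {..<n}}. f (permarg n \<sigma> x)) / fact n"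

lemma psym_symz: "psym n (symz n f)"
  unfolding psym_def
proof (intro allI impI)
  fix \<tau> x assume t: "\<tau> permutes {..<n}"
  have "permarg n \<sigma> (permarg n \<tau> x) = permarg n (\<tau> \<circ> \<sigma>) x" if "\<sigma> permutes {..<n}" for \<sigma>
    using permutes_in_image[OF that] by (auto simp: permarg_def fun_eq_iff)
  then have "(\<Sum>\<sigma>\<in>{\<sigma>. \<sigma> permutes {..<n}}. f (permarg n \<sigma> (permarg n \<tau> x))) =
      (\<Sum>\<sigma>\<in>{\<sigma>. \<sigma> permutes {..<n}}. f (permarg n (\<tau> \<circ> \<sigma>) x))" by simp
  also have "\<dots> = (\<Sum>\<sigma>\<in>{\<sigma>. \<sigma> permutes {..<n}}. f (permarg n \<sigma> x))"
    by (rule setum_permutations_compose_left[OF t, symmetric])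
  finally show "symz n f (permarg n \<tau> x) = symz n f x" by (simp add: symz_def)
qed

lemma L2_symz:
  assumes "L2 n f" shows "L2 n (symz n f)"
proof -
  have "sqint (PM {..<n}) (\<lambda>x. (1 / fact n) * (\<Sum>\<sigma>\<in>{\<sigma>. \<sigma> permutes {..<n}}. f (permarg n \<sigma> x)))"
    using L2_permarg(1)[OF _ assms] by (intro sqint_cmult sqint_sum) (auto simp: finite_permutations L2_sqint)
  then show ?thesis by (simp add: L2_sqint symz_def[abs_def])
qed

lemma symz_AE:
  assumes "symmetric_fun n f"
  shows "AE x in Mn n. symz n f x = f x"
proof -
  have "AE x in Mn n. \<forall>\<sigma>\<in>{\<sigma>. \<sigma> permutes {..<n}}. f (permarg n \<sigma> x) = f x"
    using assms by (subst AE_ball_countable) (auto simp: symmetric_fun_def finite_permutations intro: countable_finite)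
  then show ?thesis
    by eventually_elim (simp add: symz_def card_permutations)
qed

lemma L2norm_contraction_symz:
  assumes f: "L2 n f" "symmetric_fun n f" and p: "p \<le> n"
  shows "L2norm (2*n-2*p) (contraction n n p (symz n f) (symz n f)) = L2norm (2*n-2*p) (contraction n n p f f)"
proof -
  note fm = f(1)[unfolded L2_sqint, THEN sqint_measurable]
    and hm = L2_symz[OF f(1), unfolded L2_sqint, THEN sqint_measurable]
  have "AE t in PM {..<2*n-2*p}. contraction n n p (symz n f) (symz n f) t = contraction n n p f f t"
    by (rule contraction_cong_AE[OF hm fm symz_AE[OF f(2), unfolded Mn_eq_PM] p])
  then have "(\<integral>t. (contraction n n p (symz n f) (symz n f) t)^2 \<partial>PM {..<2*n-2*p}) =
      (\<integral>t. (contraction n n p f f t)^2 \<partial>PM {..<2*n-2*p})"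
    by (intro integral_cong_AE borel_measurable_power contraction_measurable fm hm p) (auto elim: eventually_mono)
  then show ?thesis by (simp only: L2norm_def Mn_eq_PM)
qed

context qBM
begin

text \<open>The setting prescribes \<open>I n\<close> on functions and not on their classes. That a
  null function is sent to 0 follows from the isometry and the faithfulness of the state.\<close>

lemma I_symz:
  assumes n: "n \<ge> 1" and f: "L2 n f" "symmetric_fun n f"
  shows "I n (symz n f) = I n f"
proof -
  let ?d = "\<lambda>x. symz n f x - f x"
  have d: "L2 n ?d" using sqint_diff L2_symz[OF f(1)] f(1) by (simp add: L2_sqint)
  have "(\<integral>x. (?d x)^2 \<partial>Mn n) = (\<integral>x. 0 \<partial>Mn n)"
    using d symz_AE[OF f(2)] by (intro integral_cong_AE) (auto simp: L2_def elim: eventually_mono)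
  then have "L2norm n ?d = 0" by (simp add: L2norm_def)
  then have "qip q n ?d ?d \<le> 0" using qip_self_bound[OF q0 _ d] q1 by simp
  then have "nrm2 (I n ?d) = 0" using nrm2_I[OF n d] nrm2_nonneg[of "I n ?d"] by simp
  then have "I n ?d = 0" by (intro \<phi>_faithful) (simp add: nrm2_complex)
  then show ?thesis using I_diff[OF n L2_symz[OF f(1)] f(1)] by simp
qed

lemma qip_symz:
  assumes n: "n \<ge> 1" and f: "L2 n f" "symmetric_fun n f" and g: "L2 n g" "symmetric_fun n g"
  shows "qip q n (symz n f) (symz n g) = qip q n f g"
  using I_isometry[OF n n f(1) g(1)] I_isometry[OF n n L2_symz[OF f(1)] L2_symz[OF g(1)]]
  by (simp add: I_symz[OF n f] I_symz[OF n g])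

end

section \<open>Moments of the q-Gaussian law\<close>

lemma qgauss_moment_card:
  "qgauss_moment q' t m = (\<Sum>P\<in>pairings m. q' ^ Cr P * t ^ card P)"
proof (cases "odd m")
  case True
  \<comment> \<open>An odd number of points has no pairing, so the uniform formula is an empty sum
    there.\<close>
  then have "P \<notin> pairings_on {..<m}" for P using card_pairing[of "{..<m}" P] by auto
  then have "pairings m = {}" by (auto simp: pairings_eq)
  then show ?thesis using True by (simp add: qgauss_moment_def)
next
  case False
  then have "t ^ (m div 2) * (\<Sum>P\<in>pairings m. q' ^ Cr P) = (\<Sum>P\<in>pairings m. q' ^ Cr P * t ^ card P)"
    unfolding sum_distrib_left
    using card_pairing[of "{..<m}"] by (intro sum.cong) (auto simp: pairings_eq)
  then show ?thesis using False by (simp add: qgauss_moment_def)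
qed

lemma pairings_zero: "pairings 0 = {{}}"
proof -
  have "P = {}" if "P \<in> pairings 0" for P
    using card_pairing[of "{..<0}" P] finite_pairing[of "{..<0}" P] that by (simp add: pairings_eq)
  then show ?thesis by (auto simp: pairings_def)
qed

text \<open>Of the three pairings of four points two have no crossing and one has a single crossing;
  this is the constant of assertion (i).\<close>

lemma qgauss_moment_four: "qgauss_moment q' t 4 = (2 + q') * t^2"
  unfolding qgauss_moment_def pairings_eq pairings_four
  using Q_distinct by (simp add: Cr_four algebra_simps)

lemma Cr2_self: "Cr2 P P = Cr P"
  unfolding Cr2_def Cr_def by (rule arg_cong[where f = card]) blast

text \<open>With a single colour the product over pairs of colours has one factor, and each crossing
  weighs \<open>q ^ (N^2)\<close>.\<close>

lemma qgauss_moment_col: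
  assumes r: "r \<ge> 1"
  shows "(\<Sum>P\<in>col_pairings r (\<lambda>_. N :: nat).
      (\<Prod>(a, b)\<in>{(a, b). a \<in> (\<lambda>_. N) ` {..<r} \<and> b \<in> (\<lambda>_. N) ` {..<r} \<and> a \<le> b}.
         q ^ (Cr2 {B\<in>P. \<forall>l\<in>B. N = a} {B\<in>P. \<forall>l\<in>B. N = b} * a * b)) * (\<Prod>B\<in>P. t)) =
    qgauss_moment (q ^ (N^2)) t r"
proof -
  have im: "(\<lambda>_. N) ` {..<r} = {N}" using r by (intro image_constant[of 0]) simp
  have D: "{(a, b). a \<in> {N} \<and> b \<in> {N} \<and> a \<le> b} = {(N, N)}" by auto
  have "col_pairings r (\<lambda>_. N) = pairings r" by (simp add: col_pairings_def)
  then show ?thesis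
    unfolding im D qgauss_moment_card
    by (simp add: Cr2_self power_mult[symmetric] power2_eq_square mult_ac)
qed

theorem theorem3p1:
  fixes q :: real and d :: nat and n :: "nat \<Rightarrow> nat"
    and f :: "nat \<Rightarrow> nat \<Rightarrow> ((nat \<Rightarrow> real) \<Rightarrow> real)"
    and c :: "nat \<Rightarrow> nat \<Rightarrow> real"
    and star :: "'a::{real_normed_algebra_1,banach} \<Rightarrow> 'a" and J :: 'a
    and \<phi> :: "'a \<Rightarrow> complex" and X :: "real \<Rightarrow> 'a"
    and I :: "nat \<Rightarrow> ((nat \<Rightarrow> real) \<Rightarrow> real) \<Rightarrow> 'a"
  assumes setting: "qBM_setting q star J \<phi> X I"
    and q: "0 \<le> q" "q < 1"
    and d: "d \<ge> 1"
    and n: "\<And>i. i < d \<Longrightarrow> n i \<ge> 1"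
    and fL2: "\<And>i k. i < d \<Longrightarrow> L2 (n i) (f i k)"
    and fsym: "\<And>i k. i < d \<Longrightarrow> symmetric_fun (n i) (f i k)"
    and lim: "\<And>i j. i < d \<Longrightarrow> j < d \<Longrightarrow> n i = n j \<Longrightarrow>
               (\<lambda>k. qip q (n i) (f i k) (f j k)) \<longlonglongrightarrow> c i j"
  shows
   "((\<forall>i<d. (\<lambda>k. \<phi> (I (n i) (f i k) ^ 4))
              \<longlonglongrightarrow> complex_of_real ((2 + q ^ (n i ^ 2)) * (c i i)^2))
     \<longleftrightarrow>
     (\<forall>i<d. \<forall>p. 1 \<le> p \<and> p \<le> n i - 1 \<longrightarrow>
        (\<lambda>k. L2norm (2 * n i - 2 * p) (contraction (n i) (n i) p (f i k) (f i k))) \<longlonglongrightarrow> 0))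
    \<and>
    ((\<forall>i<d. \<forall>p. 1 \<le> p \<and> p \<le> n i - 1 \<longrightarrow>
        (\<lambda>k. L2norm (2 * n i - 2 * p) (contraction (n i) (n i) p (f i k) (f i k))) \<longlonglongrightarrow> 0)
     \<longleftrightarrow>
     (\<forall>i<d. \<forall>m. (\<lambda>k. \<phi> (I (n i) (f i k) ^ m))
              \<longlonglongrightarrow> complex_of_real (qgauss_moment (q ^ (n i ^ 2)) (c i i) m)))
    \<and>
    ((\<forall>i<d. \<forall>m. (\<lambda>k. \<phi> (I (n i) (f i k) ^ m))
              \<longlonglongrightarrow> complex_of_real (qgauss_moment (q ^ (n i ^ 2)) (c i i) m))
     \<longleftrightarrow>
     (\<forall>r\<ge>1. \<forall>idx :: nat \<Rightarrow> nat. (\<forall>l<r. idx l < d) \<longrightarrow>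
        (\<lambda>k. \<phi> (prod_list (map (\<lambda>l. I (n (idx l)) (f (idx l) k)) [0..<r])))
        \<longlonglongrightarrow> complex_of_real
             (\<Sum>P\<in>col_pairings r (\<lambda>l. n (idx l)).
                (\<Prod>(a, b)\<in>{(a, b). a \<in> (\<lambda>l. n (idx l)) ` {..<r} \<and> b \<in> (\<lambda>l. n (idx l)) ` {..<r} \<and> a \<le> b}.
                   q ^ (Cr2 {B\<in>P. \<forall>l\<in>B. n (idx l) = a} {B\<in>P. \<forall>l\<in>B. n (idx l) = b} * a * b))
                * (\<Prod>B\<in>P. c (idx (Min B)) (idx (Max B))))))"
proof -
  interpret qBM q star J \<phi> X I
    by unfold_locales (use setting q in auto)
  \<comment> \<open>All four assertions and the hypothesis on the inner products are transferred to
    these everywhere symmetric representatives.\<close>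
  define g where "g i k = symz (n i) (f i k)" for i k
  have gL: "L2 (n i) (g i k)" and gs: "psym (n i) (g i k)" and gI: "I (n i) (f i k) = I (n i) (g i k)"
    and gc: "\<And>p. p \<le> n i \<Longrightarrow> L2norm (2 * n i - 2 * p) (contraction (n i) (n i) p (f i k) (f i k)) =
        L2norm (2 * n i - 2 * p) (contraction (n i) (n i) p (g i k) (g i k))" if "i < d" for i k
    using that L2_symz psym_symz I_symz[OF n fL2 fsym] L2norm_contraction_symz[OF fL2 fsym] fL2
    by (simp_all add: g_def)
  have glim: "(\<lambda>k. qip q (n i) (g i k) (g j k)) \<longlonglongrightarrow> c i j" if "i < d" "j < d" "n i = n j" for i j
  proof -
    have "qip q (n i) (g i k) (g j k) = qip q (n i) (f i k) (f j k)" for k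
      using qip_symz[OF n[OF that(1)] fL2[OF that(1)] fsym[OF that(1)], of "f j k"]
        fL2[OF that(2)] fsym[OF that(2)] that(3) by (simp add: g_def)
    then show ?thesis using lim[OF that] by simp
  qed
  let ?i = "\<forall>i<d. (\<lambda>k. \<phi> (I (n i) (f i k) ^ 4)) \<longlonglongrightarrow> complex_of_real ((2 + q ^ (n i ^ 2)) * (c i i)^2)"
  let ?ii = "\<forall>i<d. \<forall>p. 1 \<le> p \<and> p \<le> n i - 1 \<longrightarrow>
        (\<lambda>k. L2norm (2 * n i - 2 * p) (contraction (n i) (n i) p (f i k) (f i k))) \<longlonglongrightarrow> 0"
  let ?iii = "\<forall>i<d. \<forall>m. (\<lambda>k. \<phi> (I (n i) (f i k) ^ m))
              \<longlonglongrightarrow> complex_of_real (qgauss_moment (q ^ (n i ^ 2)) (c i i) m)"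
  let ?S = "\<lambda>r idx. \<Sum>P\<in>col_pairings r (\<lambda>l. n (idx l)).
                (\<Prod>(a, b)\<in>{(a, b). a \<in> (\<lambda>l. n (idx l)) ` {..<r} \<and> b \<in> (\<lambda>l. n (idx l)) ` {..<r} \<and> a \<le> b}.
                   q ^ (Cr2 {B\<in>P. \<forall>l\<in>B. n (idx l) = a} {B\<in>P. \<forall>l\<in>B. n (idx l) = b} * a * b))
                * (\<Prod>B\<in>P. c (idx (Min B)) (idx (Max B)))"
  let ?iv = "\<forall>r\<ge>1. \<forall>idx :: nat \<Rightarrow> nat. (\<forall>l<r. idx l < d) \<longrightarrow>
        (\<lambda>k. \<phi> (prod_list (map (\<lambda>l. I (n (idx l)) (f (idx l) k)) [0..<r]))) \<longlonglongrightarrow> complex_of_real (?S r idx)"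
  have 12: ?ii if h: ?i
  proof (intro allI impI)
    fix i p assume i: "i < d" and p: "1 \<le> p \<and> p \<le> n i - 1"
    let ?x = "\<lambda>k. L2norm (2 * n i - 2 * p) (contraction (n i) (n i) p (f i k) (f i k))"
    obtain w where w: "w > 0" and b: "\<And>u. L2 (n i) u \<Longrightarrow> psym (n i) u \<Longrightarrow>
       (2 + q ^ (n i^2)) * (qip q (n i) u u)^2 + w * (L2norm (2*n i-2*p) (contraction (n i) (n i) p u u))^2
         \<le> Re (\<phi> (I (n i) u ^ 4))"
      using fourth_moment_lower_bound[OF n[OF i], of p] p by blast
    \<comment> \<open>The excess of the fourth moment over its lower bound, divided by the weight;
      it dominates the squared contraction norm and tends to 0 under (i).\<close>
    let ?y = "\<lambda>k. (Re (\<phi> (I (n i) (g i k) ^ 4)) - (2 + q ^ (n i^2)) * (qip q (n i) (g i k) (g i k))^2) / w"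
    have "(\<lambda>k. \<phi> (I (n i) (g i k) ^ 4)) \<longlonglongrightarrow> complex_of_real ((2 + q ^ (n i ^ 2)) * (c i i)^2)"
      using h[rule_format, OF i] by (simp only: gI[OF i])
    then have "(\<lambda>k. Re (\<phi> (I (n i) (g i k) ^ 4))) \<longlonglongrightarrow> (2 + q ^ (n i ^ 2)) * (c i i)^2"
      using tendsto_Re by fastforce
    then have "?y \<longlonglongrightarrow> ((2 + q ^ (n i ^ 2)) * (c i i)^2 - (2 + q ^ (n i ^ 2)) * (c i i)^2) / w"
      by (intro tendsto_intros glim[OF i i refl]) (use w in auto)
    then have y: "?y \<longlonglongrightarrow> 0" by simp
    have pn: "p \<le> n i" using p by linarith
    have "(?x k)^2 \<le> ?y k" for k
      using b[OF gL[OF i] gs[OF i], of k] w unfolding gc[OF i pn] by (simp add: field_simps)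
    then have "(\<lambda>k. (?x k)^2) \<longlonglongrightarrow> 0"
      by (intro tendsto_sandwich[OF _ _ tendsto_const y] always_eventually allI) simp_all
    then have "(\<lambda>k. sqrt ((?x k)^2)) \<longlonglongrightarrow> sqrt 0" by (rule tendsto_real_sqrt)
    then show "?x \<longlonglongrightarrow> 0" by (simp add: L2norm_nonneg)
  qed
  have 24: ?iv if h: ?ii
  proof (intro allI impI)
    fix r :: nat and idx :: "nat \<Rightarrow> nat" assume idx: "\<forall>l<r. idx l < d"
    have "(\<lambda>k. \<phi> (Iprod r (\<lambda>l. n (idx l)) (\<lambda>l. g (idx l) k))) \<longlonglongrightarrow> complex_of_real (?S r idx)"
    proof (rule mixed_moment_tendsto[where n = "\<lambda>l. n (idx l)" and f = "\<lambda>l k. g (idx l) k" and c = "\<lambda>l m. c (idx l) (idx m)"])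
      fix l p assume l: "l < r" and p: "1 \<le> p" "p \<le> n (idx l) - 1"
      have "p \<le> n (idx l)" using p by simp
      then show "(\<lambda>k. L2norm (2 * n (idx l) - 2 * p) (contraction (n (idx l)) (n (idx l)) p (g (idx l) k) (g (idx l) k))) \<longlonglongrightarrow> 0"
        using h idx l p by (simp add: gc[symmetric])
    qed (use idx n gL gs glim in auto)
    moreover have "Iprod r (\<lambda>l. n (idx l)) (\<lambda>l. g (idx l) k) = prod_list (map (\<lambda>l. I (n (idx l)) (f (idx l) k)) [0..<r])" for k
      unfolding Iprod_def using idx gI by (intro arg_cong[where f = prod_list] map_cong) auto
    ultimately show "(\<lambda>k. \<phi> (prod_list (map (\<lambda>l. I (n (idx l)) (f (idx l) k)) [0..<r]))) \<longlonglongrightarrow> complex_of_real (?S r idx)"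
      by simp
  qed
  have 43: ?iii if h: ?iv
  proof (intro allI impI)
    fix i m assume i: "i < d"
    show "(\<lambda>k. \<phi> (I (n i) (f i k) ^ m)) \<longlonglongrightarrow> complex_of_real (qgauss_moment (q ^ (n i ^ 2)) (c i i) m)"
    \<comment> \<open>Mixed moments start at length 1, so the moment of order 0 is checked apart;
      the empty pairing gives the value 1.\<close>
    proof (cases "m = 0")
      case True
      then show ?thesis by (simp add: qgauss_moment_def pairings_zero Cr_def)
    next
      case False
      then have m: "m \<ge> 1" by simp
      have "(\<lambda>k. \<phi> (prod_list (map (\<lambda>l. I (n i) (f i k)) [0..<m]))) \<longlonglongrightarrow> complex_of_real (?S m (\<lambda>_. i))"
        using h[rule_format, OF m, of "\<lambda>_. i"] i by simp
      then show ?thesis unfolding qgauss_moment_col[OF m] by (simp only: power_Iprod Iprod_def)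
    qed
  qed
  have 31: ?i if h: ?iii
  proof (intro allI impI)
    fix i assume "i < d"
    then show "(\<lambda>k. \<phi> (I (n i) (f i k) ^ 4)) \<longlonglongrightarrow> complex_of_real ((2 + q ^ (n i ^ 2)) * (c i i)^2)"
      using h[rule_format, of i 4] by (simp only: qgauss_moment_four)
  qed
  show ?thesis using 12 24 43 31 by blast
qed

end
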